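(* Let $\Omega\subset\mathbb{R}^d$ be an open, bounded, convex domain. Let $\mathcal{A}$ be a (nonempty) compact metric space, let $a\in C(\overline{\Omega}\times\mathcal{A};\mathbb{R}^{d\times d}_{\mathrm{sym},+})$ be such that there exist constants $\overline{\nu}\geq\underline{\nu}>0$ and $\varepsilon\in(0,1]$ with $a(x,\alpha)\in\mathcal{C}(\underline{\nu},\overline{\nu},\varepsilon)$ for all $x\in\overline{\Omega}$ and $\alpha\in\mathcal{A}$, and let $f\in C(\overline{\Omega}\times\mathcal{A})$. Let $F\colon L^2(\Omega)\to L^2(\Omega)$ be completely continuous. Let $G\in V^*$ be nonnegative in the sense of distributions. Let $\{G_n\}_{n\in\mathbb{N}}$ be a sequence in $V^*$ that is weak-$*$ converging to $G$ in $V^*$. For each $n\in\mathbb{N}$, let $(u_n,m_n)\in V\times L^2_+(\Omega)$ be a solution of the VI problem with datum $G_n$: $$H[u_n]=F[m_n]\ \text{ in }\Omega,\qquad \langle G_n,v-u_n\rangle_{V^*\times V}\leq(m_n,H[v]-H[u_n])_\Omega\quad\forall v\in V.$$ Then there exist a solution $(u,m)\in V\times L^2_+(\Omega)$ of the VI problem with datum $G$, i.e. $$H[u]=F[m]\ \text{ in }\Omega,\qquad \langle G,v-u\rangle_{V^*\times V}\leq(m,H[v]-H[u])_\Omega\quad\forall v\in V,$$ and a subsequence $\{(u_{n_j},m_{n_j})\}_{j\in\mathbb{N}}$ such that $u_{n_j}\to u$ strongly in $V$ and $m_{n_j}\rightharpoonup m$ weakly in $L^2(\Omega)$ as $j\t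o\infty$.
   Context: Notation: $\mathbb{R}^{d\times d}_{\mathrm{sym}}$ is the space of real symmetric $d\times d$ matrices, $\mathbb{R}^{d\times d}_{\mathrm{sym},+}$ its subset of positive semidefinite matrices; $A:B=\sum_{i,j}A_{ij}B_{ij}$; $|\cdot|$ is the Frobenius norm. $(\cdot,\cdot)_\Omega$ is the inner product of $L^2(\Omega)$ and $L^2_+(\Omega)$ is the set of functions in $L^2(\Omega)$ that are nonnegative a.e. in $\Omega$. $V:=H^2(\Omega)\cap H^1_0(\Omega)$ with the norm and inner product of $H^2(\Omega)$; $V^*$ is its dual, with duality pairing $\langle\cdot,\cdot\rangle_{V^*\times V}$. $G\in V^*$ is nonnegative in the sense of distributions if $\langle G,v\rangle_{V^*\times V}\geq 0$ for all $v\in V$ with $v\ge 0$ a.e. in $\Omega$. A (possibly nonlinear) operator $F\colon L^2(\Omega)\to L^2(\Omega)$ is completely continuous if $m_j\rightharpoonup m$ weakly in $L^2(\Omega)$ implies $F[m_j]\to F[m]$ strongly in $L^2(\Omega)$. Cordes class: for $\overline{\nu}\geq\underline{\nu}>0$ and $\varepsilon\in(0,1]$, $\mathcal{C}(\underline{\nu},\overline{\nu},\varepsilon)$ is the set of all $\overline{a}\in\mathbb{R}^{d\times d}_{\mathrm{sym},+}$ such that $\underline{\nu}|\xi|^2\leq\xi^T\overline{a}\xi\leq\overline{\nu}|\xi|^2$ for all $\xi\in\mathbb{R}^d$ and $\frac{|\overline{a}|}{\mathrm{Tr}\,\overline{a}}\leq\frac{1}{\sqrt{d-1+\varepsilon}}$.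 Hamiltonian: $H(x,M):=\sup_{\alpha\in\mathcal{A}}\{-a(x,\alpha):M-f(x,\alpha)\}$ for $(x,M)\in\overline{\Omega}\times\mathbb{R}^{d\times d}_{\mathrm{sym}}$. For $v\in V$, $H[v]\in L^2(\Omega)$ is given by $H[v](x):=H(x,D^2v(x))$ for a.e. $x\in\Omega$. Equations $H[u]=F[m]$ in $\Omega$ are understood pointwise a.e. in $\Omega$. *)

theory Defs
  imports "HOL-Analysis.Analysis"
begin

(* Elements of L^2, H^1, H^2 and V are represented by functions on real^'n that are
   identified when they agree almost everywhere on Omega; values outside Omega are
   irrelevant.  The norms below are accordingly seminorms on representatives. *)

subsection \<open>Square-integrable functions\<close>

definition L2 :: "(real^'n) set \<Rightarrow> (real^'n \<Rightarrow> real) set" where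
  "L2 \<Omega> = {f \<in> borel_measurable (lebesgue_on \<Omega>). integrable (lebesgue_on \<Omega>) (\<lambda>x. (f x)\<^sup>2)}"

definition L2_plus :: "(real^'n) set \<Rightarrow> (real^'n \<Rightarrow> real) set" where
  "L2_plus \<Omega> = {f \<in> L2 \<Omega>. AE x in lebesgue_on \<Omega>. 0 \<le> f x}"

definition L2_inner :: "(real^'n) set \<Rightarrow> (real^'n \<Rightarrow> real) \<Rightarrow> (real^'n \<Rightarrow> real) \<Rightarrow> real" where
  "L2_inner \<Omega> f g = (LINT x|lebesgue_on \<Omega>. f x * g x)"

definition L2_norm :: "(real^'n) set \<Rightarrow> (real^'n \<Rightarrow> real) \<Rightarrow> real" where
  "L2_norm \<Omega> f = sqrt (L2_inner \<Omega> f f)"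

subsection \<open>Dual spaces and convergence\<close>

(* The bound makes a functional in the dual invariant under changing representatives. *)
definition dual_space ::
    "('x \<Rightarrow> real) set \<Rightarrow> (('x \<Rightarrow> real) \<Rightarrow> real) \<Rightarrow> (('x \<Rightarrow> real) \<Rightarrow> real) set" where
  "dual_space S nrm = {\<Phi>.
     (\<forall>u\<in>S. \<forall>v\<in>S. \<Phi> (\<lambda>x. u x + v x) = \<Phi> u + \<Phi> v) \<and>
     (\<forall>c. \<forall>v\<in>S. \<Phi> (\<lambda>x. c * v x) = c * \<Phi> v) \<and>
     (\<exists>C. \<forall>v\<in>S. \<bar>\<Phi> v\<bar> \<le> C * nrm v)}"

definition strong_conv ::
    "(('x \<Rightarrow> real) \<Rightarrow> real) \<Rightarrow> (nat \<Rightarrow> 'x \<Rightarrow> real) \<Rightarrow> ('x \<Rightarrow> real) \<Rightarrow> bool" where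
  "strong_conv nrm w l \<longleftrightarrow> (\<lambda>j. nrm (\<lambda>x. w j x - l x)) \<longlonglongrightarrow> 0"

definition weak_conv ::
    "('x \<Rightarrow> real) set \<Rightarrow> (('x \<Rightarrow> real) \<Rightarrow> real) \<Rightarrow> (nat \<Rightarrow> 'x \<Rightarrow> real) \<Rightarrow> ('x \<Rightarrow> real) \<Rightarrow> bool" where
  "weak_conv S nrm w l \<longleftrightarrow> (\<forall>\<Phi>\<in>dual_space S nrm. (\<lambda>j. \<Phi> (w j)) \<longlonglongrightarrow> \<Phi> l)"

definition weak_star_conv ::
    "('x \<Rightarrow> real) set \<Rightarrow> (nat \<Rightarrow> ('x \<Rightarrow> real) \<Rightarrow> real) \<Rightarrow> (('x \<Rightarrow> real) \<Rightarrow> real) \<Rightarrow> bool" where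
  "weak_star_conv S \<Phi>s \<Phi> \<longleftrightarrow> (\<forall>v\<in>S. (\<lambda>j. \<Phi>s j v) \<longlonglongrightarrow> \<Phi> v)"

(* The second conjunct says that F is well defined on almost-everywhere classes. *)
definition L2_operator ::
    "(real^'n) set \<Rightarrow> ((real^'n \<Rightarrow> real) \<Rightarrow> (real^'n \<Rightarrow> real)) \<Rightarrow> bool" where
  "L2_operator \<Omega> F \<longleftrightarrow> F \<in> L2 \<Omega> \<rightarrow> L2 \<Omega> \<and>
     (\<forall>m\<in>L2 \<Omega>. \<forall>m'\<in>L2 \<Omega>. (AE x in lebesgue_on \<Omega>. m x = m' x) \<longrightarrow>
        (AE x in lebesgue_on \<Omega>. F m x = F m' x))"

definition completely_continuous ::
    "(real^'n) set \<Rightarrow> ((real^'n \<Rightarrow> real) \<Rightarrow> (real^'n \<Rightarrow> real)) \<Rightarrow> bool" where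
  "completely_continuous \<Omega> F \<longleftrightarrow>
     (\<forall>w l. (\<forall>j. w j \<in> L2 \<Omega>) \<and> l \<in> L2 \<Omega> \<and> weak_conv (L2 \<Omega>) (L2_norm \<Omega>) w l \<longrightarrow>
        strong_conv (L2_norm \<Omega>) (\<lambda>j. F (w j)) (F l))"

subsection \<open>Test functions and weak derivatives\<close>

definition partial :: "'n \<Rightarrow> (real^'n \<Rightarrow> real) \<Rightarrow> real^'n \<Rightarrow> real" where
  "partial i \<phi> x = frechet_derivative \<phi> (at x) (axis i 1)"

primrec iter_partial :: "'n list \<Rightarrow> (real^'n \<Rightarrow> real) \<Rightarrow> real^'n \<Rightarrow> real" where
  "iter_partial [] \<phi> = \<phi>"
| "iter_partial (i # js) \<phi> = partial i (iter_partial js \<phi>)"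

(* If all iterated partial derivatives are differentiable, they are in particular
   continuous, so this is membership in C^infinity. *)
definition smooth :: "(real^'n \<Rightarrow> real) \<Rightarrow> bool" where
  "smooth \<phi> \<longleftrightarrow> (\<forall>js x. iter_partial js \<phi> differentiable (at x))"

definition test_functions :: "(real^'n) set \<Rightarrow> (real^'n \<Rightarrow> real) set" where
  "test_functions \<Omega> = {\<phi>. smooth \<phi> \<and> compact (closure {x. \<phi> x \<noteq> 0}) \<and> closure {x. \<phi> x \<noteq> 0} \<subseteq> \<Omega>}"

definition is_weak_partial ::
    "(real^'n) set \<Rightarrow> 'n \<Rightarrow> (real^'n \<Rightarrow> real) \<Rightarrow> (real^'n \<Rightarrow> real) \<Rightarrow> bool" where
  "is_weak_partial \<Omega> i v g \<longleftrightarrow>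
     (\<forall>\<phi>\<in>test_functions \<Omega>. L2_inner \<Omega> v (partial i \<phi>) = - L2_inner \<Omega> g \<phi>)"

(* A representative of the weak derivative; meaningful when one exists in L^2. *)
definition weak_partial :: "(real^'n) set \<Rightarrow> 'n \<Rightarrow> (real^'n \<Rightarrow> real) \<Rightarrow> real^'n \<Rightarrow> real" where
  "weak_partial \<Omega> i v = (SOME g. g \<in> L2 \<Omega> \<and> is_weak_partial \<Omega> i v g)"

definition weak_hessian :: "(real^'n) set \<Rightarrow> (real^'n \<Rightarrow> real) \<Rightarrow> real^'n \<Rightarrow> real^'n^'n" where
  "weak_hessian \<Omega> v x = (\<chi> i j. weak_partial \<Omega> i (weak_partial \<Omega> j v) x)"

subsection \<open>Sobolev spaces\<close>

definition H1 :: "(real^'n) set \<Rightarrow> (real^'n \<Rightarrow> real) set" where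
  "H1 \<Omega> = {v \<in> L2 \<Omega>. \<forall>i. \<exists>g\<in>L2 \<Omega>. is_weak_partial \<Omega> i v g}"

definition H1_norm :: "(real^'n) set \<Rightarrow> (real^'n \<Rightarrow> real) \<Rightarrow> real" where
  "H1_norm \<Omega> v = sqrt ((L2_norm \<Omega> v)\<^sup>2 + (\<Sum>i\<in>UNIV. (L2_norm \<Omega> (weak_partial \<Omega> i v))\<^sup>2))"

definition H10 :: "(real^'n) set \<Rightarrow> (real^'n \<Rightarrow> real) set" where
  "H10 \<Omega> = {v \<in> H1 \<Omega>. \<exists>\<phi>. (\<forall>k. \<phi> k \<in> test_functions \<Omega>) \<and> strong_conv (H1_norm \<Omega>) \<phi> v}"

definition H2 :: "(real^'n) set \<Rightarrow> (real^'n \<Rightarrow> real) set" where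
  "H2 \<Omega> = {v \<in> H1 \<Omega>. \<forall>i. weak_partial \<Omega> i v \<in> H1 \<Omega>}"

definition H2_norm :: "(real^'n) set \<Rightarrow> (real^'n \<Rightarrow> real) \<Rightarrow> real" where
  "H2_norm \<Omega> v = sqrt ((L2_norm \<Omega> v)\<^sup>2 + (\<Sum>i\<in>UNIV. (L2_norm \<Omega> (weak_partial \<Omega> i v))\<^sup>2)
     + (\<Sum>i\<in>UNIV. \<Sum>j\<in>UNIV. (L2_norm \<Omega> (weak_partial \<Omega> i (weak_partial \<Omega> j v)))\<^sup>2))"

definition V :: "(real^'n) set \<Rightarrow> (real^'n \<Rightarrow> real) set" where
  "V \<Omega> = H2 \<Omega> \<inter> H10 \<Omega>"

definition V_dual :: "(real^'n) set \<Rightarrow> ((real^'n \<Rightarrow> real) \<Rightarrow> real) set" where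
  "V_dual \<Omega> = dual_space (V \<Omega>) (H2_norm \<Omega>)"

definition nonneg_distr :: "(real^'n) set \<Rightarrow> ((real^'n \<Rightarrow> real) \<Rightarrow> real) \<Rightarrow> bool" where
  "nonneg_distr \<Omega> G \<longleftrightarrow> (\<forall>v\<in>V \<Omega>. (AE x in lebesgue_on \<Omega>. 0 \<le> v x) \<longrightarrow> 0 \<le> G v)"

subsection \<open>The Hamiltonian and the variational inequality\<close>

definition sym_psd :: "(real^'n^'n) set" where
  "sym_psd = {M. transpose M = M \<and> (\<forall>\<xi>. 0 \<le> \<xi> \<bullet> (M *v \<xi>))}"

(* On real^'n^'n the library's norm is the Frobenius norm and its inner product is A : B. *)
definition cordes_class :: "real \<Rightarrow> real \<Rightarrow> real \<Rightarrow> (real^'n^'n) set" where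
  "cordes_class \<nu>l \<nu>u \<epsilon> = {M \<in> sym_psd.
     (\<forall>\<xi>. \<nu>l * (norm \<xi>)\<^sup>2 \<le> \<xi> \<bullet> (M *v \<xi>) \<and> \<xi> \<bullet> (M *v \<xi>) \<le> \<nu>u * (norm \<xi>)\<^sup>2) \<and>
     norm M / trace M \<le> 1 / sqrt (real CARD('n) - 1 + \<epsilon>)}"

definition hamiltonian ::
    "'a set \<Rightarrow> (real^'n \<Rightarrow> 'a \<Rightarrow> real^'n^'n) \<Rightarrow> (real^'n \<Rightarrow> 'a \<Rightarrow> real)
       \<Rightarrow> real^'n \<Rightarrow> real^'n^'n \<Rightarrow> real" where
  "hamiltonian A a f x M = (SUP \<alpha>\<in>A. - (a x \<alpha> \<bullet> M) - f x \<alpha>)"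

definition HJB ::
    "(real^'n) set \<Rightarrow> 'a set \<Rightarrow> (real^'n \<Rightarrow> 'a \<Rightarrow> real^'n^'n) \<Rightarrow> (real^'n \<Rightarrow> 'a \<Rightarrow> real)
       \<Rightarrow> (real^'n \<Rightarrow> real) \<Rightarrow> real^'n \<Rightarrow> real" where
  "HJB \<Omega> A a f v x = hamiltonian A a f x (weak_hessian \<Omega> v x)"

definition VI_solution ::
    "(real^'n) set \<Rightarrow> 'a set \<Rightarrow> (real^'n \<Rightarrow> 'a \<Rightarrow> real^'n^'n) \<Rightarrow> (real^'n \<Rightarrow> 'a \<Rightarrow> real)
       \<Rightarrow> ((real^'n \<Rightarrow> real) \<Rightarrow> (real^'n \<Rightarrow> real)) \<Rightarrow> ((real^'n \<Rightarrow> real) \<Rightarrow> real)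
       \<Rightarrow> (real^'n \<Rightarrow> real) \<Rightarrow> (real^'n \<Rightarrow> real) \<Rightarrow> bool" where
  "VI_solution \<Omega> A a f F G u m \<longleftrightarrow>
     u \<in> V \<Omega> \<and> m \<in> L2_plus \<Omega> \<and>
     (AE x in lebesgue_on \<Omega>. HJB \<Omega> A a f u x = F m x) \<and>
     (\<forall>v\<in>V \<Omega>. G (\<lambda>x. v x - u x) \<le> L2_inner \<Omega> m (\<lambda>x. HJB \<Omega> A a f v x - HJB \<Omega> A a f u x))"

end

theory Submission
  imports Defs "HOL-Library.Diagonal_Subsequence"
begin

text \<open>On a convex domain the Laplacian dominates the Hessian in \<open>L\<^sup>2\<close>, and every \<open>g\<close> in \<open>L\<^sup>2\<close> is of the
  form \<open>\<nu> u - \<Delta>u\<close> with \<open>u\<close> in \<open>V\<close>. To avoid boundary regularity, both facts are obtained from the whole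
  space: a convex weight \<open>exp \<phi>\<close> that is 1 on a compact convex part of the domain and is very large
  outside the domain makes approximate solutions small there, while by convexity of \<open>\<phi>\<close> the Bochner
  identity has a good sign, uniformly in the size of the weight.

  Under the Cordes condition the renormalised operators are then perturbations of the Laplacian by a
  factor less than one, hence the norm of \<open>u - v\<close> in \<open>H\<^sup>2\<close> is controlled by \<open>H[u] - H[v]\<close> in \<open>L\<^sup>2\<close>. For
  the densities, take \<open>w\<close> in \<open>V\<close> with \<open>a(\<cdot>, \<alpha>) : D\<^sup>2w \<ge> m\<^sub>n\<close> for all \<open>\<alpha>\<close>, up to a small error: testing the
  inequality with \<open>v = u\<^sub>n + w\<close> gives a bound on \<open>m\<^sub>n\<close> by the norm of \<open>G\<^sub>n\<close>. A weak limit \<open>m\<close> of a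
  subsequence then has \<open>F[m\<^sub>n] \<rightarrow> F[m]\<close>, which makes \<open>u\<^sub>n\<close> a Cauchy sequence, and the inequality passes to
  the limit.\<close>

section \<open>Hilbert space arguments for seminormed spaces of functions\<close>

text \<open>Functions stand for their classes, so only seminorms are available; the Hilbert space
  facts are proved once for sets of functions with a semidefinite form and used for
  \<open>L2\<close>, for finite families in \<open>L2\<close>, and for \<open>V\<close>. One tool,
  closure membership from biorthogonality, gives the Riesz theorem, weak compactness, Mazur's lemma
  for subspaces and the density of ranges of differential operators. What shapes the regularity part
  is the constant one between Hessian and Laplacian: the Cordes factor \<open>\<kappa>\<close> is
  only known to be below one, so a lossy estimate could not be absorbed. Conjugation by
  \<open>exp (\<phi> x / 2)\<close> carries the weighted operator to
  \<open>\<nu> + W - \<Delta>\<close> with a smooth bounded potential \<open>W \<ge> 0\<close>.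
  Density of its range follows by perturbation from constant potentials, and those are handled by
  comparing the Laplacian with averages over neighbouring points, without Fourier analysis. The
  shift \<nu> > 0 controls \<open>u\<close> itself; it tends to zero in the Miranda-Talenti
  inequality and is absorbed by the Poincare inequality in the construction of
  \<open>w\<close>.\<close>

locale semi_inner =
  fixes S :: "('x \<Rightarrow> real) set" and ip :: "('x \<Rightarrow> real) \<Rightarrow> ('x \<Rightarrow> real) \<Rightarrow> real"
  assumes zero_mem: "(\<lambda>x. 0) \<in> S"
    and add_mem: "u \<in> S \<Longrightarrow> v \<in> S \<Longrightarrow> (\<lambda>x. u x + v x) \<in> S"
    and scale_mem: "u \<in> S \<Longrightarrow> (\<lambda>x. c * u x) \<in> S"
    and ip_commute: "u \<in> S \<Longrightarrow> v \<in> S \<Longrightarrow> ip u v = ip v u"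
    and ip_add_left: "u \<in> S \<Longrightarrow> v \<in> S \<Longrightarrow> w \<in> S \<Longrightarrow> ip (\<lambda>x. u x + v x) w = ip u w + ip v w"
    and ip_scale_left: "u \<in> S \<Longrightarrow> w \<in> S \<Longrightarrow> ip (\<lambda>x. c * u x) w = c * ip u w"
    and ip_nonneg: "u \<in> S \<Longrightarrow> 0 \<le> ip u u"
begin

definition nrm :: "('x \<Rightarrow> real) \<Rightarrow> real" where "nrm u = sqrt (ip u u)"

lemma diff_mem: "u \<in> S \<Longrightarrow> v \<in> S \<Longrightarrow> (\<lambda>x. u x - v x) \<in> S"
  using add_mem[of u "\<lambda>x. (-1) * v x"] scale_mem[of v "-1"] by simp

lemma ip_diff_left:
  assumes "u \<in> S" "v \<in> S" "w \<in> S" shows "ip (\<lambda>x. u x - v x) w = ip u w - ip v w"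
  using ip_add_left[of u "\<lambda>x. (-1) * v x" w] ip_scale_left[of v w "-1"] scale_mem[of v "-1"] assms
  by simp

lemma ip_add_right:
  "u \<in> S \<Longrightarrow> v \<in> S \<Longrightarrow> w \<in> S \<Longrightarrow> ip w (\<lambda>x. u x + v x) = ip w u + ip w v"
  using ip_commute[of w "\<lambda>x. u x + v x"] ip_commute[of w u] ip_commute[of w v]
  by (simp add: add_mem ip_add_left)

lemma ip_diff_right:
  "u \<in> S \<Longrightarrow> v \<in> S \<Longrightarrow> w \<in> S \<Longrightarrow> ip w (\<lambda>x. u x - v x) = ip w u - ip w v"
  using ip_commute[of w "\<lambda>x. u x - v x"] ip_commute[of w u] ip_commute[of w v]
  by (simp add: diff_mem ip_diff_left)

lemma ip_scale_right: "u \<in> S \<Longrightarrow> w \<in> S \<Longrightarrow> ip w (\<lambda>x. c * u x) = c * ip w u"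
  using ip_commute[of w "\<lambda>x. c * u x"] ip_commute[of w u]
  by (simp add: scale_mem ip_scale_left)

lemmas mem_intros = zero_mem add_mem diff_mem scale_mem
lemmas ip_simps = ip_add_left ip_diff_left ip_scale_left ip_add_right ip_diff_right ip_scale_right
  mem_intros

lemma nrm_nonneg: "u \<in> S \<Longrightarrow> 0 \<le> nrm u"
  by (simp add: nrm_def ip_nonneg)

lemma nrm_square: "u \<in> S \<Longrightarrow> (nrm u)\<^sup>2 = ip u u"
  by (simp add: nrm_def ip_nonneg)

lemma nrm_scale: "u \<in> S \<Longrightarrow> nrm (\<lambda>x. c * u x) = \<bar>c\<bar> * nrm u"
  by (simp add: nrm_def ip_simps real_sqrt_mult mult.assoc[symmetric])

lemma nrm_minus_commute:
  assumes "u \<in> S" "v \<in> S" shows "nrm (\<lambda>x. u x - v x) = nrm (\<lambda>x. v x - u x)"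
  using nrm_scale[of "\<lambda>x. v x - u x" "-1"] assms by (simp add: mem_intros)

lemma square_add: "u \<in> S \<Longrightarrow> v \<in> S \<Longrightarrow> (nrm (\<lambda>x. u x + v x))\<^sup>2 = (nrm u)\<^sup>2 + 2 * ip u v + (nrm v)\<^sup>2"
  by (simp add: nrm_square ip_simps ip_commute[of v u])

lemma square_diff: "u \<in> S \<Longrightarrow> v \<in> S \<Longrightarrow> (nrm (\<lambda>x. u x - v x))\<^sup>2 = (nrm u)\<^sup>2 - 2 * ip u v + (nrm v)\<^sup>2"
  by (simp add: nrm_square ip_simps ip_commute[of v u])

lemma Cauchy_Schwarz:
  assumes u: "u \<in> S" and v: "v \<in> S" shows "\<bar>ip u v\<bar> \<le> nrm u * nrm v"
proof -
  define a b c where "a = ip u u" and "b = ip u v" and "c = ip v v"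
  have pos: "0 \<le> a - 2 * t * b + t\<^sup>2 * c" for t
  proof -
    have "0 \<le> ip (\<lambda>x. u x - t * v x) (\<lambda>x. u x - t * v x)"
      by (intro ip_nonneg mem_intros u v)
    also have "\<dots> = a - 2 * t * b + t\<^sup>2 * c"
      using u v by (simp add: ip_simps ip_commute[of v u] a_def b_def c_def power2_eq_square algebra_simps)
    finally show ?thesis .
  qed
  have a0: "a \<ge> 0" and c0: "c \<ge> 0" using ip_nonneg u v by (auto simp: a_def c_def)
  have "b\<^sup>2 \<le> a * c"
  \<comment> \<open>\<open>c = 0\<close> does not make \<open>v\<close> the zero function here. The
    quadratic in \<open>t\<close> is then affine, and a nonzero slope would make it negative at
    \<open>(a + 1) / (2 * b)\<close>; otherwise its minimiser \<open>b / c\<close> is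
    inserted.\<close>
  proof (cases "c = 0")
    case True
    have "b = 0"
    proof (rule ccontr)
      assume "b \<noteq> 0"
      with pos[of "(a + 1) / (2 * b)"] True show False by (simp add: field_simps)
    qed
    then show ?thesis using True by simp
  next
    case False
    with c0 have "c > 0" by simp
    with pos[of "b / c"] show ?thesis
      by (simp add: field_simps power2_eq_square)
  qed
  then have "sqrt (b\<^sup>2) \<le> sqrt (a * c)" by (rule real_sqrt_le_mono)
  then show ?thesis by (simp add: nrm_def a_def b_def c_def real_sqrt_mult)
qed

lemma nrm_triangle:
  assumes u: "u \<in> S" and v: "v \<in> S" shows "nrm (\<lambda>x. u x + v x) \<le> nrm u + nrm v"
proof (rule power2_le_imp_le)
  show "(nrm (\<lambda>x. u x + v x))\<^sup>2 \<le> (nrm u + nrm v)\<^sup>2"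
    using Cauchy_Schwarz[OF u v] by (simp add: square_add u v power2_sum)
  show "0 \<le> nrm u + nrm v" using nrm_nonneg u v by simp
qed

lemma nrm_triangle_diff:
  assumes "u \<in> S" "v \<in> S" "w \<in> S"
  shows "nrm (\<lambda>x. u x - w x) \<le> nrm (\<lambda>x. u x - v x) + nrm (\<lambda>x. v x - w x)"
  using nrm_triangle[of "\<lambda>x. u x - v x" "\<lambda>x. v x - w x"] assms by (simp add: mem_intros)

lemma nrm_diff_ge:
  assumes "u \<in> S" "v \<in> S" shows "\<bar>nrm u - nrm v\<bar> \<le> nrm (\<lambda>x. u x - v x)"
proof -
  have "nrm u \<le> nrm (\<lambda>x. u x - v x) + nrm v"
    using nrm_triangle[of "\<lambda>x. u x - v x" v] assms by (simp add: mem_intros)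
  moreover have "nrm v \<le> nrm (\<lambda>x. v x - u x) + nrm u"
    using nrm_triangle[of "\<lambda>x. v x - u x" u] assms by (simp add: mem_intros)
  ultimately show ?thesis using nrm_minus_commute[OF assms] by (simp add: abs_le_iff)
qed

lemma strong_conv_ip:
  assumes X: "\<And>n. X n \<in> S" and l: "l \<in> S" and lim: "strong_conv nrm X l" and y: "y \<in> S"
  shows "(\<lambda>n. ip (X n) y) \<longlonglongrightarrow> ip l y"
proof (rule Lim_transform_bound[where g = "\<lambda>n. nrm (\<lambda>x. X n x - l x) * nrm y", THEN LIM_zero_cancel])
  show "\<forall>\<^sub>F n in sequentially. norm (ip (X n) y - ip l y) \<le> norm (nrm (\<lambda>x. X n x - l x) * nrm y)"
    using Cauchy_Schwarz[of "\<lambda>x. X _ x - l x" y] X l y by (auto simp: ip_simps abs_mult nrm_nonneg)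
  show "(\<lambda>n. nrm (\<lambda>x. X n x - l x) * nrm y) \<longlonglongrightarrow> 0"
    using lim unfolding strong_conv_def by (rule tendsto_mult_left_zero)
qed

lemma strong_conv_nrm:
  assumes X: "\<And>n. X n \<in> S" and l: "l \<in> S" and lim: "strong_conv nrm X l"
  shows "(\<lambda>n. nrm (X n)) \<longlonglongrightarrow> nrm l"
proof (rule Lim_transform_bound[where g = "\<lambda>n. nrm (\<lambda>x. X n x - l x)", THEN LIM_zero_cancel])
  show "\<forall>\<^sub>F n in sequentially. norm (nrm (X n) - nrm l) \<le> norm (nrm (\<lambda>x. X n x - l x))"
    using nrm_diff_ge[OF X l] by (auto simp: intro!: always_eventually order_trans[OF _ abs_ge_self])
  show "(\<lambda>n. nrm (\<lambda>x. X n x - l x)) \<longlonglongrightarrow> 0" using lim by (simp add: strong_conv_def)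
qed

text \<open>The error \<open>ip (X n) (\<lambda>x. Y n x - y x)\<close> is controlled by
  Cauchy-Schwarz, for which the weakly convergent factor must be bounded. The bound is a hypothesis
  because the densities come with one.\<close>

lemma weak_strong_ip:
  assumes X: "\<And>n. X n \<in> S" and x: "x \<in> S" and Y: "\<And>n. Y n \<in> S" and y: "y \<in> S"
    and weak: "\<And>z. z \<in> S \<Longrightarrow> (\<lambda>n. ip (X n) z) \<longlonglongrightarrow> ip x z"
    and strong: "strong_conv nrm Y y" and bdd: "\<And>n. nrm (X n) \<le> C"
  shows "(\<lambda>n. ip (X n) (Y n)) \<longlonglongrightarrow> ip x y"
proof -
  have "(\<lambda>n. ip (X n) (\<lambda>x. Y n x - y x)) \<longlonglongrightarrow> 0"
  proof (rule Lim_transform_bound)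
    show "\<forall>\<^sub>F n in sequentially. norm (ip (X n) (\<lambda>x. Y n x - y x)) \<le> norm (C * nrm (\<lambda>x. Y n x - y x))"
    proof (intro always_eventually allI)
      fix n
      have "\<bar>ip (X n) (\<lambda>x. Y n x - y x)\<bar> \<le> nrm (X n) * nrm (\<lambda>x. Y n x - y x)"
        by (intro Cauchy_Schwarz X mem_intros Y y)
      also have "\<dots> \<le> C * nrm (\<lambda>x. Y n x - y x)"
        by (intro mult_right_mono bdd nrm_nonneg mem_intros Y y)
      finally show "norm (ip (X n) (\<lambda>x. Y n x - y x)) \<le> norm (C * nrm (\<lambda>x. Y n x - y x))" by simp
    qed
    show "(\<lambda>n. C * nrm (\<lambda>x. Y n x - y x)) \<longlonglongrightarrow> 0"
      using strong unfolding strong_conv_def by (rule tendsto_mult_right_zero)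
  qed
  from tendsto_add[OF this weak[OF y]] show ?thesis
    by (simp add: ip_simps X Y y)
qed

text \<open>Lower semicontinuity of the norm: the weak limit is tested against itself. The bounds
  \<open>c n\<close> may vary, so that errors tending to zero disappear in the limit.\<close>

lemma weak_limit_nrm_le:
  assumes X: "\<And>n. X n \<in> S" and x: "x \<in> S"
    and weak: "(\<lambda>n. ip (X n) x) \<longlonglongrightarrow> ip x x" and bdd: "\<And>n. nrm (X n) \<le> c n" and c: "c \<longlonglongrightarrow> C"
  shows "nrm x \<le> C"
proof -
  have "ip x x \<le> C * nrm x"
  proof (rule LIMSEQ_le[OF weak])
    show "(\<lambda>n. c n * nrm x) \<longlonglongrightarrow> C * nrm x" by (intro tendsto_intros c)
    show "\<exists>N. \<forall>n\<ge>N. ip (X n) x \<le> c n * nrm x"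
    proof (intro exI allI impI)
      fix n
      have "ip (X n) x \<le> nrm (X n) * nrm x" using Cauchy_Schwarz[OF X x, of n] by simp
      also have "\<dots> \<le> c n * nrm x" by (intro mult_right_mono bdd nrm_nonneg x)
      finally show "ip (X n) x \<le> c n * nrm x" .
    qed
  qed
  then have *: "nrm x * nrm x \<le> C * nrm x" using nrm_square[OF x] by (simp add: power2_eq_square)
  have "0 \<le> C"
  proof (rule LIMSEQ_le_const[OF c])
    show "\<exists>N. \<forall>n\<ge>N. 0 \<le> c n" using bdd nrm_nonneg[OF X] by (meson order_trans)
  qed
  show ?thesis
  proof (cases "nrm x = 0")
    case True then show ?thesis using \<open>0 \<le> C\<close> by simp
  next
    case False
    then have "nrm x > 0" using nrm_nonneg[OF x] by simp
    then show ?thesis using * by (simp add: mult_le_cancel_right)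
  qed
qed

end

section \<open>Complete spaces: projection, Riesz representation, weak compactness, uniform
  boundedness\<close>

locale semi_hilbert = semi_inner +
  assumes complete: "(\<And>n. X n \<in> S) \<Longrightarrow>
      (\<And>e. 0 < e \<Longrightarrow> \<exists>N. \<forall>m\<ge>N. \<forall>n\<ge>N. nrm (\<lambda>x. X m x - X n x) < e) \<Longrightarrow>
      \<exists>l\<in>S. strong_conv nrm X l"
begin

text \<open>The orthogonal projection onto the closure of \<open>M\<close> differs from \<open>z\<close> by a vector orthogonal
  to \<open>M\<close>, which the hypothesis forces to vanish.\<close>
lemma in_closure_if_biorthogonal:
  assumes M: "M \<subseteq> S" "(\<lambda>x. 0) \<in> M"
    and M_add: "\<And>u v. u \<in> M \<Longrightarrow> v \<in> M \<Longrightarrow> (\<lambda>x. u x + v x) \<in> M"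
    and M_scale: "\<And>c u. u \<in> M \<Longrightarrow> (\<lambda>x. c * u x) \<in> M"
    and z: "z \<in> S" and perp: "\<And>y. y \<in> S \<Longrightarrow> (\<And>m. m \<in> M \<Longrightarrow> ip m y = 0) \<Longrightarrow> ip z y = 0"
  obtains X where "\<And>n. X n \<in> M" "strong_conv nrm X z"
proof -
  define D where "D = (\<lambda>m. (nrm (\<lambda>x. z x - m x))\<^sup>2) ` M"
  define d where "d = Inf D"
  have bdd: "bdd_below D" unfolding D_def by (intro bdd_belowI2[of _ 0]) simp
  have ne: "D \<noteq> {}" using M by (auto simp: D_def)
  have d_le: "d \<le> (nrm (\<lambda>x. z x - m x))\<^sup>2" if "m \<in> M" for m
    unfolding d_def using that bdd by (intro cInf_lower) (auto simp: D_def)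
  have d0: "0 \<le> d" unfolding d_def using ne by (intro cInf_greatest) (auto simp: D_def)
  have "\<exists>m\<in>M. (nrm (\<lambda>x. z x - m x))\<^sup>2 < d + inverse (real (Suc n))" for n
    using cInf_lessD[OF ne, of "d + inverse (real (Suc n))"] by (auto simp: d_def D_def)
  then obtain X where XM: "\<And>n. X n \<in> M"
    and X: "\<And>n. (nrm (\<lambda>x. z x - X n x))\<^sup>2 < d + inverse (real (Suc n))" by metis
  have XS: "X n \<in> S" for n using XM M by auto
  \<comment> \<open>Parallelogram law: the midpoint of \<open>X m\<close> and \<open>X n\<close>
    lies in \<open>M\<close>, so its distance to \<open>z\<close> has square at least
    \<open>d\<close>. Hence a minimising sequence is Cauchy.\<close>
  have par: "(nrm (\<lambda>x. X m x - X n x))\<^sup>2 \<le> 2 * inverse (real (Suc m)) + 2 * inverse (real (Suc n))" for m n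
  proof -
    have "(\<lambda>x. (1/2) * (X m x + X n x)) \<in> M" by (intro M_scale M_add XM)
    from d_le[OF this] have "d \<le> (nrm (\<lambda>x. z x - (1/2) * (X m x + X n x)))\<^sup>2" .
    moreover have "(nrm (\<lambda>x. X m x - X n x))\<^sup>2 = 2 * (nrm (\<lambda>x. z x - X m x))\<^sup>2 + 2 * (nrm (\<lambda>x. z x - X n x))\<^sup>2
       - 4 * (nrm (\<lambda>x. z x - (1/2) * (X m x + X n x)))\<^sup>2"
      using XS[of m] XS[of n] z ip_commute[OF XS XS, of m n] ip_commute[OF z XS, of m]
        ip_commute[OF z XS, of n]
      by (simp only: nrm_square ip_simps) (simp add: algebra_simps)
    ultimately show ?thesis using X[of m] X[of n] by linarith
  qed
  have "\<exists>l\<in>S. strong_conv nrm X l"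
  proof (rule complete[OF XS])
    fix e :: real assume "0 < e"
    then obtain N where N: "inverse (real (Suc N)) < e\<^sup>2 / 4"
      using reals_Archimedean[of "e\<^sup>2 / 4"] by auto
    show "\<exists>N. \<forall>m\<ge>N. \<forall>n\<ge>N. nrm (\<lambda>x. X m x - X n x) < e"
    proof (intro exI allI impI)
      fix m n assume "N \<le> m" "N \<le> n"
      then have "inverse (real (Suc m)) \<le> inverse (real (Suc N))"
        "inverse (real (Suc n)) \<le> inverse (real (Suc N))" by (auto simp: field_simps)
      with par[of m n] N have "(nrm (\<lambda>x. X m x - X n x))\<^sup>2 < e\<^sup>2" by linarith
      then show "nrm (\<lambda>x. X m x - X n x) < e" using \<open>0 < e\<close> by (simp add: power2_less_imp_less)
    qed
  qed
  then obtain l where l: "l \<in> S" "strong_conv nrm X l" by blast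
  define p where "p = (\<lambda>x. z x - l x)"
  have p: "p \<in> S" unfolding p_def by (intro mem_intros z l)
  have Xz: "(\<lambda>n. (nrm (\<lambda>x. z x - X n x))\<^sup>2) \<longlonglongrightarrow> d"
  proof (rule tendsto_sandwich[of "\<lambda>n. d" _ _ "\<lambda>n. d + inverse (real (Suc n))"])
    show "(\<lambda>n. d + inverse (real (Suc n))) \<longlonglongrightarrow> d"
      using tendsto_add[OF tendsto_const LIMSEQ_inverse_real_of_nat] by simp
    show "\<forall>\<^sub>F n in sequentially. (nrm (\<lambda>x. z x - X n x))\<^sup>2 \<le> d + inverse (real (Suc n))"
      using X by (intro always_eventually allI less_imp_le)
  qed (use d_le[OF XM] in auto)
  have Xl: "(\<lambda>n. nrm (\<lambda>x. X n x - l x)) \<longlonglongrightarrow> 0" using l by (simp add: strong_conv_def)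
  have lim_p: "(\<lambda>n. (nrm (\<lambda>x. (z x - X n x) - w x))\<^sup>2) \<longlonglongrightarrow> (nrm (\<lambda>x. p x - w x))\<^sup>2" if w: "w \<in> S" for w
  proof -
    have "strong_conv nrm (\<lambda>n x. (z x - X n x) - w x) (\<lambda>x. p x - w x)"
      using Xl nrm_minus_commute[OF XS l(1)] by (simp add: strong_conv_def p_def)
    then have "(\<lambda>n. nrm (\<lambda>x. (z x - X n x) - w x)) \<longlonglongrightarrow> nrm (\<lambda>x. p x - w x)"
      by (intro strong_conv_nrm mem_intros z XS w p)
    then show ?thesis by (intro tendsto_power)
  qed
  have pd: "(nrm p)\<^sup>2 = d"
    using lim_p[OF zero_mem] Xz by (simp add: LIMSEQ_unique)
  have "ip m p = 0" if m: "m \<in> M" for m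
  proof -
    have mS: "m \<in> S" using m M by auto
    \<comment> \<open>First variation of the squared distance along \<open>m\<close>. The limit
      \<open>l\<close> need not lie in \<open>M\<close>, so minimality is used for
      \<open>X n\<close> and passed to the limit.\<close>
    have *: "0 \<le> - (2 * t * ip m p) + t\<^sup>2 * (nrm m)\<^sup>2" for t
    proof -
      have "d \<le> (nrm (\<lambda>x. p x - t * m x))\<^sup>2"
      proof (rule LIMSEQ_le_const[OF lim_p])
        show "(\<lambda>x. t * m x) \<in> S" by (intro mem_intros mS)
        have "d \<le> (nrm (\<lambda>x. z x - X n x - t * m x))\<^sup>2" for n
          using d_le[of "\<lambda>x. X n x + t * m x"] by (simp add: M_add M_scale m XM diff_diff_eq)
        then show "\<exists>N. \<forall>n\<ge>N. d \<le> (nrm (\<lambda>x. z x - X n x - t * m x))\<^sup>2" by blast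
      qed
      also have "\<dots> = (nrm p)\<^sup>2 - 2 * t * ip m p + t\<^sup>2 * (nrm m)\<^sup>2"
        using square_diff[OF p scale_mem[OF mS], of t]
        by (simp only: nrm_scale[OF mS] ip_scale_right[OF mS p] ip_commute[OF p mS] power_mult_distrib power2_abs)
      finally show ?thesis using pd by simp
    qed
    show ?thesis
    proof (rule ccontr)
      assume ne: "ip m p \<noteq> 0"
      \<comment> \<open>The minimiser of the quadratic in \<open>t\<close>, with 1 added to the
        denominator because \<open>nrm m\<close> may vanish.\<close>
      define s where "s = ip m p / ((nrm m)\<^sup>2 + 1)"
      have "s * ((nrm m)\<^sup>2 + 1) = ip m p" by (simp add: s_def add_nonneg_eq_0_iff)
      then have "- (2 * s * ip m p) + s\<^sup>2 * (nrm m)\<^sup>2 = - s\<^sup>2 * ((nrm m)\<^sup>2 + 2)"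
        by (simp add: algebra_simps power2_eq_square flip: \<open>s * ((nrm m)\<^sup>2 + 1) = ip m p\<close>)
      moreover have "s\<^sup>2 * ((nrm m)\<^sup>2 + 2) > 0"
      proof (rule mult_pos_pos)
        show "0 < s\<^sup>2" using ne by (simp add: s_def add_nonneg_eq_0_iff)
        show "0 < (nrm m)\<^sup>2 + 2" using zero_le_power2[of "nrm m"] by linarith
      qed
      ultimately show False using *[of s] by simp
    qed
  qed
  \<comment> \<open>The hypothesis is applied to \<open>p\<close>, the difference between
    \<open>z\<close> and the limit \<open>l\<close>: both \<open>z\<close> and \<open>l\<close> are
    orthogonal to \<open>p\<close>, so \<open>p\<close> has norm zero.\<close>
  then have zp: "ip z p = 0" and Xp: "\<And>n. ip (X n) p = 0" using perp[OF p] XM by auto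
  have "(\<lambda>n. ip (X n) p) \<longlonglongrightarrow> ip l p" by (rule strong_conv_ip[OF XS l p])
  then have "ip l p = 0" using Xp by (simp add: LIMSEQ_const_iff)
  with zp have "ip p p = 0" using ip_diff_left[OF z l(1) p] by (simp add: p_def)
  then have p0: "nrm p = 0" by (simp add: nrm_def)
  have "strong_conv nrm X z" unfolding strong_conv_def
  proof (rule tendsto_sandwich[OF _ _ tendsto_const Xl])
    show "\<forall>\<^sub>F n in sequentially. nrm (\<lambda>x. X n x - z x) \<le> nrm (\<lambda>x. X n x - l x)"
      using nrm_triangle_diff[OF XS l(1) z] nrm_minus_commute[OF z l(1)] p0 by (simp add: p_def)
  qed (simp add: nrm_nonneg mem_intros XS z)
  then show ?thesis using XM that by blast
qed

text \<open>A vector orthogonal to the kernel but not to \<open>z\<close> must exist: otherwise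
  biorthogonality would put \<open>z\<close> into the closure of the kernel, and boundedness would
  force \<open>\<Phi> z = 0\<close>. Rescaling that vector represents the functional.\<close>

lemma Riesz:
  assumes \<Phi>: "\<Phi> \<in> dual_space S nrm"
  obtains y where "y \<in> S" "\<And>v. v \<in> S \<Longrightarrow> \<Phi> v = ip v y"
proof (cases "\<forall>v\<in>S. \<Phi> v = 0")
  case True
  then show ?thesis using that[of "\<lambda>x. 0"] zero_mem ip_scale_right[of "\<lambda>x. 0" _ 0] by auto
next
  case False
  have add: "\<And>u v. u \<in> S \<Longrightarrow> v \<in> S \<Longrightarrow> \<Phi> (\<lambda>x. u x + v x) = \<Phi> u + \<Phi> v"
    and scale: "\<And>c v. v \<in> S \<Longrightarrow> \<Phi> (\<lambda>x. c * v x) = c * \<Phi> v"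
    using \<Phi> by (auto simp: dual_space_def)
  obtain C where C: "\<And>v. v \<in> S \<Longrightarrow> \<bar>\<Phi> v\<bar> \<le> C * nrm v" using \<Phi> unfolding dual_space_def by blast
  have diff: "\<Phi> (\<lambda>x. u x - c * v x) = \<Phi> u - c * \<Phi> v" if "u \<in> S" "v \<in> S" for u v c
    using add[of u "\<lambda>x. (- c) * v x"] scale[of v "- c"] scale_mem[of v "-c"] that by simp
  obtain z where z: "z \<in> S" "\<Phi> z \<noteq> 0" using False by blast
  define M where "M = {m \<in> S. \<Phi> m = 0}"
  have "\<exists>y\<in>S. (\<forall>m\<in>M. ip m y = 0) \<and> ip z y \<noteq> 0"
  proof (rule ccontr)
    assume "\<not> ?thesis"
    then have perp: "ip z y = 0" if "y \<in> S" "\<And>m. m \<in> M \<Longrightarrow> ip m y = 0" for y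
      using that by blast
    obtain X where X: "\<And>n. X n \<in> M" "strong_conv nrm X z"
    proof (rule in_closure_if_biorthogonal[of M z])
      show "(\<lambda>x. 0) \<in> M" using scale[of "\<lambda>x. 0" 0] by (simp add: M_def zero_mem)
    qed (use z perp in \<open>auto simp: M_def add scale mem_intros\<close>)
    have XS: "X n \<in> S" and X0: "\<Phi> (X n) = 0" for n using X by (auto simp: M_def)
    have "\<bar>\<Phi> z\<bar> \<le> 0"
    proof (rule LIMSEQ_le_const)
      show "(\<lambda>n. C * nrm (\<lambda>x. X n x - z x)) \<longlonglongrightarrow> 0"
        using X(2) unfolding strong_conv_def by (rule tendsto_mult_right_zero)
      have "\<bar>\<Phi> z\<bar> \<le> C * nrm (\<lambda>x. X n x - z x)" for n
        using C[of "\<lambda>x. X n x - z x"] diff[of "X n" z 1] XS X0 z by (simp add: mem_intros)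
      then show "\<exists>N. \<forall>n\<ge>N. \<bar>\<Phi> z\<bar> \<le> C * nrm (\<lambda>x. X n x - z x)" by blast
    qed
    then show False using z by simp
  qed
  then obtain y where y: "y \<in> S" "\<And>m. m \<in> M \<Longrightarrow> ip m y = 0" "ip z y \<noteq> 0" by blast
  have "\<Phi> v = ip v (\<lambda>x. (\<Phi> z / ip z y) * y x)" if v: "v \<in> S" for v
  proof -
    have "(\<lambda>x. v x - (\<Phi> v / \<Phi> z) * z x) \<in> M"
      using diff[OF v z(1), of "\<Phi> v / \<Phi> z"] diff_mem[OF v scale_mem[OF z(1), of "\<Phi> v / \<Phi> z"]] z
      by (simp add: M_def)
    from y(2)[OF this] have "ip v y = (\<Phi> v / \<Phi> z) * ip z y"
      using ip_diff_left[OF v scale_mem[OF z(1)] y(1), of "\<Phi> v / \<Phi> z"]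
        ip_scale_left[OF z(1) y(1), of "\<Phi> v / \<Phi> z"] by simp
    then show ?thesis
      using z y(3) ip_scale_right[OF y(1) v, of "\<Phi> z / ip z y"] by (simp add: field_simps)
  qed
  then show ?thesis using that[of "\<lambda>x. (\<Phi> z / ip z y) * y x"] y mem_intros by blast
qed

text \<open>The diagonal argument makes only the inner products with the members of the sequence
  converge. The set \<open>M\<close> of vectors with convergent inner products contains these
  members, and a vector orthogonal to \<open>M\<close> is orthogonal to all of them, so it lies in
  \<open>M\<close> itself and has norm zero. Thus \<open>M\<close> is dense, an approximation
  argument gives \<open>S \<subseteq> M\<close>, and the limit functional is represented by
  Riesz.\<close>

lemma weak_compactness:
  fixes X :: "nat \<Rightarrow> 'a \<Rightarrow> real"
  assumes X: "\<And>n. X n \<in> S" and bdd: "\<And>n. nrm (X n) \<le> C"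
  obtains r l where "strict_mono r" "l \<in> S" "\<And>y. y \<in> S \<Longrightarrow> (\<lambda>n. ip (X (r n)) y) \<longlonglongrightarrow> ip l y"
proof -
  have C0: "0 \<le> C" using bdd[of 0] nrm_nonneg[OF X, of 0] by simp
  have bound: "\<bar>ip y (X n)\<bar> \<le> C * nrm y" if "y \<in> S" for y n
  proof -
    have "\<bar>ip y (X n)\<bar> \<le> nrm y * nrm (X n)" by (intro Cauchy_Schwarz that X)
    also have "\<dots> \<le> nrm y * C" by (intro mult_left_mono bdd nrm_nonneg that)
    finally show ?thesis by (simp add: mult.commute)
  qed
  interpret sub: subseqs "\<lambda>k s. convergent (\<lambda>n. ip (X k) (X (s n)))"
  proof (unfold_locales, goal_cases)
    case (1 k s)
    have "bounded (range (\<lambda>n. ip (X k) (X (s n))))"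
      unfolding bounded_iff using bound[OF X] by auto
    then obtain l r' where "strict_mono r'" "((\<lambda>n. ip (X k) (X (s n))) \<circ> r') \<longlonglongrightarrow> l"
      using bounded_imp_convergent_subsequence by blast
    then show ?case by (auto simp: o_def convergent_def intro!: exI[of _ r'])
  qed
  define r where "r = sub.diagseq"
  have r: "strict_mono r" unfolding r_def by (rule sub.subseq_diagseq)
  have conv: "convergent (\<lambda>n. ip (X k) (X (r n)))" for k
  proof -
    \<comment> \<open>The diagonal sequence is a subsequence of the \<open>k\<close>-th one only
      from index \<open>Suc k\<close> on; the shift is removed by
      \<open>LIMSEQ_offset\<close>.\<close>
    have "convergent (\<lambda>n. ip (X k) (X ((sub.diagseq \<circ> ((+) (Suc k))) n)))"
    proof (rule sub.diagseq_holds)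
      fix s r :: "nat \<Rightarrow> nat" and i
      assume "strict_mono r" "convergent (\<lambda>n. ip (X i) (X (s n)))"
      then show "convergent (\<lambda>n. ip (X i) (X ((s \<circ> r) n)))"
        using convergent_subseq_convergent[of "\<lambda>n. ip (X i) (X (s n))" r] by (simp add: o_def)
    qed
    then obtain L where "(\<lambda>n. ip (X k) (X (r (n + Suc k)))) \<longlonglongrightarrow> L"
      by (auto simp: convergent_def r_def add.commute)
    then have "(\<lambda>n. ip (X k) (X (r n))) \<longlonglongrightarrow> L" by (rule LIMSEQ_offset)
    then show ?thesis by (auto simp: convergent_def)
  qed
  define M where "M = {y \<in> S. convergent (\<lambda>n. ip y (X (r n)))}"
  have M0: "(\<lambda>x. 0) \<in> M" using ip_scale_left[OF X X, of 0]
      ip_scale_left[of "\<lambda>x. 0" _ 0] by (simp add: M_def zero_mem X convergent_const)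
  have all: "S \<subseteq> M"
  proof
    fix z assume z: "z \<in> S"
    obtain Y where Y: "\<And>n. Y n \<in> M" "strong_conv nrm Y z"
    proof (rule in_closure_if_biorthogonal[of M z])
      show "M \<subseteq> S" by (auto simp: M_def)
      show "(\<lambda>x. 0) \<in> M" by (rule M0)
      show "(\<lambda>x. u x + v x) \<in> M" if "u \<in> M" "v \<in> M" for u v
        using that by (auto simp: M_def ip_simps X intro: convergent_add)
      show "(\<lambda>x. c * u x) \<in> M" if "u \<in> M" for c u
        using that by (auto simp: M_def ip_simps X intro: convergent_mult convergent_const)
      show "ip z y = 0" if y: "y \<in> S" and perp: "\<And>m. m \<in> M \<Longrightarrow> ip m y = 0" for y
      proof -
        have "ip (X k) y = 0" for k by (rule perp) (simp add: M_def X conv)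
        then have "y \<in> M" using y by (simp add: M_def ip_commute[OF y X] convergent_const)
        then have "ip y y = 0" by (rule perp)
        then show ?thesis using Cauchy_Schwarz[OF z y] by (simp add: nrm_def)
      qed
    qed (use z in blast)+
    have YS: "Y n \<in> S" for n using Y by (auto simp: M_def)
    have "Cauchy (\<lambda>n. ip z (X (r n)))"
    proof (rule metric_CauchyI)
      fix e :: real assume e: "0 < e"
      \<comment> \<open>A third of \<open>e\<close> for each of the two replacements of
        \<open>z\<close> by \<open>Y k\<close>, the last third for the Cauchy property of
        \<open>Y k\<close>. The added 1 guards against \<open>C = 0\<close>.\<close>
      have "eventually (\<lambda>k. nrm (\<lambda>x. Y k x - z x) < e / (3 * (C + 1))) sequentially"
        using Y(2) e C0 unfolding strong_conv_def by (intro order_tendstoD) auto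
      then obtain k where k: "nrm (\<lambda>x. Y k x - z x) < e / (3 * (C + 1))"
        by (auto simp: eventually_sequentially)
      have near: "\<bar>ip (Y k) (X n) - ip z (X n)\<bar> < e / 3" for n
      proof -
        have "\<bar>ip (Y k) (X n) - ip z (X n)\<bar> \<le> C * nrm (\<lambda>x. Y k x - z x)"
          using bound[of "\<lambda>x. Y k x - z x" n] by (simp add: ip_simps X YS z)
        also have "\<dots> \<le> (C + 1) * nrm (\<lambda>x. Y k x - z x)"
          by (intro mult_right_mono nrm_nonneg mem_intros YS z) simp
        also have "\<dots> < (C + 1) * (e / (3 * (C + 1)))" using k C0 by (intro mult_strict_left_mono) auto
        also have "(C + 1) * (e / (3 * (C + 1))) = e / 3" using C0 by (simp add: divide_simps)
        finally show ?thesis .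
      qed
      have "Cauchy (\<lambda>n. ip (Y k) (X (r n)))" using Y(1)[of k] by (auto simp: M_def convergent_Cauchy)
      then obtain N where N: "\<And>m n. m \<ge> N \<Longrightarrow> n \<ge> N \<Longrightarrow> \<bar>ip (Y k) (X (r m)) - ip (Y k) (X (r n))\<bar> < e / 3"
        using e unfolding Cauchy_def dist_real_def by (meson divide_pos_pos zero_less_numeral)
      show "\<exists>N. \<forall>m\<ge>N. \<forall>n\<ge>N. dist (ip z (X (r m))) (ip z (X (r n))) < e"
      proof (intro exI[of _ N] allI impI)
        fix m n assume "N \<le> m" "N \<le> n"
        from N[OF this] near[of "r m"] near[of "r n"] show "dist (ip z (X (r m))) (ip z (X (r n))) < e"
          unfolding dist_real_def by arith
      qed
    qed
    then show "z \<in> M" using z by (simp add: M_def Cauchy_convergent)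
  qed
  define \<Phi> where "\<Phi> y = lim (\<lambda>n. ip y (X (r n)))" for y
  have \<Phi>: "(\<lambda>n. ip y (X (r n))) \<longlonglongrightarrow> \<Phi> y" if "y \<in> S" for y
    using all that by (auto simp: M_def \<Phi>_def convergent_LIMSEQ_iff)
  have "\<Phi> \<in> dual_space S nrm"
    unfolding dual_space_def
  proof (intro CollectI conjI ballI allI exI[of _ C])
    show "\<Phi> (\<lambda>x. u x + v x) = \<Phi> u + \<Phi> v" if "u \<in> S" "v \<in> S" for u v
      using \<Phi>[OF add_mem[OF that]] tendsto_add[OF \<Phi>[OF that(1)] \<Phi>[OF that(2)]] that
      by (simp add: ip_simps X LIMSEQ_unique)
    show "\<Phi> (\<lambda>x. c * v x) = c * \<Phi> v" if "v \<in> S" for c v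
      using \<Phi>[OF scale_mem[OF that, of c]] tendsto_mult_left[OF \<Phi>[OF that], of c] that
      by (simp add: ip_simps X LIMSEQ_unique)
    show "\<bar>\<Phi> v\<bar> \<le> C * nrm v" if "v \<in> S" for v
      using bound[OF that] by (intro LIMSEQ_le_const2[OF tendsto_rabs[OF \<Phi>[OF that]]]) auto
  qed
  then obtain l where l: "l \<in> S" "\<And>v. v \<in> S \<Longrightarrow> \<Phi> v = ip v l" by (rule Riesz) blast
  show ?thesis
  proof (rule that[OF r l(1)])
    fix y assume y: "y \<in> S"
    show "(\<lambda>n. ip (X (r n)) y) \<longlonglongrightarrow> ip l y"
      using \<Phi>[OF y] l(2)[OF y] ip_commute[OF y X] ip_commute[OF y l(1)] by simp
  qed
qed

text \<open>A gliding hump argument in place of the Baire category theorem. Steps of length at most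
  \<open>(1/3)^k\<close> are taken so that a functional becomes large, up to a fixed factor as large
  as its norm permits; all later steps together have at most half that length and can undo at most
  three quarters of its value. On the limit \<open>l\<close> the functionals would therefore grow
  like \<open>(4/3)^k\<close>.\<close>

lemma uniform_boundedness:
  assumes \<Phi>: "\<And>n::nat. \<Phi> n \<in> dual_space S nrm" and bdd: "\<And>v. v \<in> S \<Longrightarrow> bdd_above (range (\<lambda>n. \<bar>\<Phi> n v\<bar>))"
  obtains C where "0 < C" "\<And>n v. v \<in> S \<Longrightarrow> \<bar>\<Phi> n v\<bar> \<le> C * nrm v"
proof (rule ccontr)
  assume "\<not> thesis"
  with that have unb: "\<And>C. 0 < C \<Longrightarrow> \<exists>n. \<exists>v\<in>S. C * nrm v < \<bar>\<Phi> n v\<bar>" by (meson not_le)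
  have add: "\<And>n u v. u \<in> S \<Longrightarrow> v \<in> S \<Longrightarrow> \<Phi> n (\<lambda>x. u x + v x) = \<Phi> n u + \<Phi> n v"
    and scale: "\<And>n c v. v \<in> S \<Longrightarrow> \<Phi> n (\<lambda>x. c * v x) = c * \<Phi> n v"
    using \<Phi> by (auto simp: dual_space_def)
  have diff: "\<Phi> n (\<lambda>x. u x - v x) = \<Phi> n u - \<Phi> n v" if "u \<in> S" "v \<in> S" for u v n
    using add[of u "\<lambda>x. (- 1) * v x"] scale[of v n "- 1"] scale_mem[of v "-1"] that by simp
  have step: "\<exists>w n. w \<in> S \<and> nrm (\<lambda>x. w x - v x) \<le> r \<and> K * r < \<bar>\<Phi> n w\<bar> \<and>
      (\<forall>u\<in>S. r * \<bar>\<Phi> n u\<bar> \<le> 3/2 * \<bar>\<Phi> n w\<bar> * nrm u)" if v: "v \<in> S" and "0 < r" "0 < K" for v r K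
  proof -
    obtain n y0 where y0: "y0 \<in> S" "K * nrm y0 < \<bar>\<Phi> n y0\<bar>" using unb[OF \<open>0 < K\<close>] by blast
    obtain C where C: "\<And>v. v \<in> S \<Longrightarrow> \<bar>\<Phi> n v\<bar> \<le> C * nrm v"
      using \<Phi>[of n] unfolding dual_space_def by blast
    \<comment> \<open>The norm of the functional is located up to the factor 3/2 by searching
      through powers of 3/2, so that no supremum over \<open>S\<close> has to be formed.\<close>
    define P where "P m \<longleftrightarrow> (\<forall>u\<in>S. \<bar>\<Phi> n u\<bar> \<le> K * (3/2)^m * nrm u)" for m
    obtain m where m: "C / K < (3/2)^m" using real_arch_pow[of "3/2" "C / K"] by auto
    have "P m" unfolding P_def
    proof
      fix u assume u: "u \<in> S"
      have "\<bar>\<Phi> n u\<bar> \<le> C * nrm u" using C[OF u] .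
      also have "\<dots> \<le> K * (3/2)^m * nrm u"
        using m \<open>0 < K\<close> by (intro mult_right_mono nrm_nonneg u) (simp add: field_simps)
      finally show "\<bar>\<Phi> n u\<bar> \<le> K * (3/2)^m * nrm u" .
    qed
    moreover have "\<not> P 0" using y0 by (auto simp: P_def not_le)
    ultimately obtain i where i: "\<not> P i" "P (Suc i)" using ex_least_nat_less[of P m] by auto
    define C' where "C' = K * (3/2)^i"
    have C': "K \<le> C'" using \<open>0 < K\<close> by (simp add: C'_def)
    obtain y where y: "y \<in> S" "C' * nrm y < \<bar>\<Phi> n y\<bar>" using i(1) by (auto simp: P_def C'_def not_le)
    have \<Phi>_le: "\<bar>\<Phi> n u\<bar> \<le> 3/2 * C' * nrm u" if "u \<in> S" for u
      using i(2) that by (auto simp: P_def C'_def mult.commute mult.left_commute)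
    have ny: "nrm y > 0" using y C[OF y(1)] nrm_nonneg[OF y(1)] by (cases "nrm y = 0") auto
    define e where "e = r / nrm y"
    have e0: "e > 0" using \<open>0 < r\<close> ny by (simp add: e_def)
    have er: "e * nrm y = r" using ny by (simp add: e_def)
    have eK: "C' * r < e * \<bar>\<Phi> n y\<bar>" using y ny \<open>0 < r\<close> by (simp add: e_def field_simps)
    define w1 w2 where "w1 = (\<lambda>x. v x + e * y x)" and "w2 = (\<lambda>x. v x - e * y x)"
    have w: "w1 \<in> S" "w2 \<in> S" unfolding w1_def w2_def by (intro mem_intros v y)+
    have w': "nrm (\<lambda>x. w1 x - v x) \<le> r" "nrm (\<lambda>x. w2 x - v x) \<le> r"
      using nrm_scale[OF y(1), of e] nrm_scale[OF y(1), of "-e"] er e0 by (auto simp: w1_def w2_def)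
    \<comment> \<open>Whatever the value at \<open>v\<close> is, one of the two opposite steps
      yields at least the size of the increment \<open>e * \<Phi> n y\<close>.\<close>
    have "\<Phi> n w1 - \<Phi> n w2 = 2 * (e * \<Phi> n y)"
      unfolding w1_def w2_def using v y by (simp add: add diff scale mem_intros)
    moreover have "C' * r < \<bar>e * \<Phi> n y\<bar>" using eK e0 by (simp add: abs_mult)
    ultimately have "C' * r < \<bar>\<Phi> n w1\<bar> \<or> C' * r < \<bar>\<Phi> n w2\<bar>" by arith
    with w w' obtain w where w: "w \<in> S" "nrm (\<lambda>x. w x - v x) \<le> r" "C' * r < \<bar>\<Phi> n w\<bar>" by blast
    have "K * r \<le> C' * r" using C' \<open>0 < r\<close> by simp
    moreover have "r * \<bar>\<Phi> n u\<bar> \<le> 3/2 * \<bar>\<Phi> n w\<bar> * nrm u" if u: "u \<in> S" for u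
    proof -
      have "r * \<bar>\<Phi> n u\<bar> \<le> r * (3/2 * C' * nrm u)" using \<Phi>_le[OF u] \<open>0 < r\<close> by simp
      also have "\<dots> = 3/2 * (C' * r) * nrm u" by simp
      also have "\<dots> \<le> 3/2 * \<bar>\<Phi> n w\<bar> * nrm u" using w nrm_nonneg[OF u] by (intro mult_right_mono) auto
      finally show ?thesis .
    qed
    ultimately show ?thesis using w by (meson le_less_trans)
  qed
  \<comment> \<open>Radius \<open>(1/3)^k\<close> and level \<open>4^k\<close>, so the value reached
    exceeds \<open>(4/3)^k\<close>. The last clause records near-optimality of the functional on the
    scale of the step.\<close>
  define Q where "Q k v = (\<lambda>(w, n). w \<in> S \<and> nrm (\<lambda>x. w x - v x) \<le> (1/3)^k \<and> 4^k * (1/3)^k < \<bar>\<Phi> n w\<bar> \<and>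
      (\<forall>u\<in>S. (1/3)^k * \<bar>\<Phi> n u\<bar> \<le> 3/2 * \<bar>\<Phi> n w\<bar> * nrm u))" for k :: nat and v
  have exQ: "\<exists>p. Q k v p" if "v \<in> S" for k v
    using step[OF that, of "(1/3)^k" "4^k"] by (auto simp: Q_def)
  define p where "p = rec_nat (\<lambda>x. 0, 0::nat) (\<lambda>k p. SOME p'. Q (Suc k) (fst p) p')"
  define w n where "w k = fst (p k)" and "n k = snd (p k)" for k
  have wS: "w k \<in> S" for k
  proof (induction k)
    case 0 show ?case by (simp add: w_def p_def zero_mem)
  next
    case (Suc k)
    have "Q (Suc k) (w k) (p (Suc k))"
      using someI_ex[OF exQ[OF Suc]] by (simp add: p_def w_def)
    then show ?case by (auto simp: Q_def w_def split: prod.splits)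
  qed
  have "Q (Suc k) (w k) (w (Suc k), n (Suc k))" for k
    using someI_ex[OF exQ[OF wS]] by (simp add: p_def w_def n_def)
  then have w_step: "nrm (\<lambda>x. w (Suc k) x - w k x) \<le> (1/3)^(Suc k)"
    and w_big: "4^(Suc k) * (1/3)^(Suc k) < \<bar>\<Phi> (n (Suc k)) (w (Suc k))\<bar>"
    and w_opt: "u \<in> S \<Longrightarrow> (1/3)^(Suc k) * \<bar>\<Phi> (n (Suc k)) u\<bar> \<le> 3/2 * \<bar>\<Phi> (n (Suc k)) (w (Suc k))\<bar> * nrm u" for k u
    unfolding Q_def by auto
  \<comment> \<open>The geometric tail of ratio 1/3 after step \<open>k\<close> sums to half of
    \<open>(1/3)^k\<close>.\<close>
  have far: "nrm (\<lambda>x. w (k + j) x - w k x) \<le> (1/2) * (1/3)^k" for k j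
  proof -
    have "nrm (\<lambda>x. w (k + j) x - w k x) \<le> (1/2) * ((1/3)^k - (1/3)^(k+j))"
    proof (induction j)
      case 0 show ?case by (simp add: nrm_def ip_scale_left[OF zero_mem zero_mem, of 0, simplified])
    next
      case (Suc j)
      have "nrm (\<lambda>x. w (k + Suc j) x - w k x) \<le> (1/3)^(Suc (k+j)) + (1/2) * ((1/3)^k - (1/3)^(k+j))"
        using nrm_triangle_diff[OF wS[of "Suc (k + j)"] wS[of "k + j"] wS[of k]] w_step[of "k+j"] Suc
        by (simp only: add_Suc_right)
      also have "\<dots> = (1/2) * ((1/3)^k - (1/3)^(k + Suc j))" by (simp add: field_simps)
      finally show ?case .
    qed
    also have "\<dots> \<le> (1/2) * (1/3)^k" by simp
    finally show ?thesis .
  qed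
  have "\<exists>l\<in>S. strong_conv nrm w l"
  proof (rule complete[OF wS])
    fix e :: real assume "0 < e"
    then obtain N where N: "(1/3::real)^N < e" using real_arch_pow_inv[of e "1/3"] by auto
    show "\<exists>N. \<forall>i\<ge>N. \<forall>j\<ge>N. nrm (\<lambda>x. w i x - w j x) < e"
    proof (intro exI allI impI)
      fix i j assume ij: "N \<le> i" "N \<le> j"
      have "nrm (\<lambda>x. w i x - w N x) \<le> (1/2) * (1/3)^N" "nrm (\<lambda>x. w N x - w j x) \<le> (1/2) * (1/3)^N"
        using far[of N "i - N"] far[of N "j - N"] ij nrm_minus_commute[OF wS wS, of N j] by simp_all
      then show "nrm (\<lambda>x. w i x - w j x) < e"
        using nrm_triangle_diff[OF wS[of i] wS[of N] wS[of j]] N by linarith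
    qed
  qed
  then obtain l where l: "l \<in> S" "(\<lambda>k. nrm (\<lambda>x. w k x - l x)) \<longlonglongrightarrow> 0" by (auto simp: strong_conv_def)
  have wl: "nrm (\<lambda>x. w k x - l x) \<le> (1/2) * (1/3)^k" for k
  proof -
    have "(\<lambda>j. (1/2) * (1/3)^k + nrm (\<lambda>x. w (j + k) x - l x)) \<longlonglongrightarrow> (1/2) * (1/3)^k + 0"
      by (intro tendsto_add tendsto_const LIMSEQ_ignore_initial_segment l)
    moreover have "nrm (\<lambda>x. w k x - l x) \<le> (1/2) * (1/3)^k + nrm (\<lambda>x. w (j + k) x - l x)" for j
      using nrm_triangle_diff[OF wS wS l(1), of k "j + k"] far[of k j] nrm_minus_commute[OF wS wS, of k "j + k"]
      by (simp add: add.commute)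
    ultimately show ?thesis by (intro LIMSEQ_le_const) auto
  qed
  obtain B where B: "\<And>m. \<bar>\<Phi> m l\<bar> \<le> B" using bdd[OF l(1)] by (auto simp: bdd_above_def)
  have "(4/3)^(Suc k) \<le> 4 * B" for k
  proof -
    let ?\<Phi> = "\<Phi> (n (Suc k))" and ?w = "w (Suc k)"
    have "(1/3)^(Suc k) * \<bar>?\<Phi> (\<lambda>x. ?w x - l x)\<bar> \<le> 3/2 * \<bar>?\<Phi> ?w\<bar> * nrm (\<lambda>x. ?w x - l x)"
      by (intro w_opt mem_intros wS l)
    also have "\<dots> \<le> 3/2 * \<bar>?\<Phi> ?w\<bar> * ((1/2) * (1/3)^(Suc k))" by (intro mult_left_mono wl) simp
    also have "\<dots> = (1/3)^(Suc k) * (3/4 * \<bar>?\<Phi> ?w\<bar>)" by simp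
    finally have "\<bar>?\<Phi> (\<lambda>x. ?w x - l x)\<bar> \<le> 3/4 * \<bar>?\<Phi> ?w\<bar>"
      by (subst (asm) mult_le_cancel_left_pos) simp_all
    then have "\<bar>?\<Phi> ?w\<bar> \<le> 4 * \<bar>?\<Phi> l\<bar>" using diff[OF wS l(1), of "n (Suc k)" "Suc k"] by linarith
    also have "\<dots> \<le> 4 * B" using B by simp
    finally have "\<bar>?\<Phi> ?w\<bar> \<le> 4 * B" .
    moreover have "(4/3::real)^(Suc k) = 4^(Suc k) * (1/3)^(Suc k)" by (simp only: power_mult_distrib[symmetric]) simp
    ultimately show ?thesis using w_big[of k] by linarith
  qed
  moreover obtain k where "4 * B < (4/3)^k" using real_arch_pow[of "4/3" "4 * B"] by auto
  moreover have "(4/3::real)^k \<le> (4/3)^(Suc k)" by simp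
  ultimately show False by (meson le_less_trans less_irrefl order_trans)
qed

end

section \<open>The space of square-integrable functions\<close>

lemma L2_measurable: "f \<in> L2 S \<Longrightarrow> f \<in> borel_measurable (lebesgue_on S)"
  by (simp add: L2_def)

lemma L2_square_integrable: "f \<in> L2 S \<Longrightarrow> integrable (lebesgue_on S) (\<lambda>x. (f x)\<^sup>2)"
  by (simp add: L2_def)

lemma L2_mult_integrable:
  assumes "f \<in> L2 S" "g \<in> L2 S" shows "integrable (lebesgue_on S) (\<lambda>x. f x * g x)"
proof (rule Bochner_Integration.integrable_bound)
  show "integrable (lebesgue_on S) (\<lambda>x. (f x)\<^sup>2 + (g x)\<^sup>2)"
    using assms by (intro Bochner_Integration.integrable_add L2_square_integrable)
  show "(\<lambda>x. f x * g x) \<in> borel_measurable (lebesgue_on S)"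
    using assms L2_measurable by measurable
  have "\<bar>a * b\<bar> \<le> a\<^sup>2 + b\<^sup>2" for a b :: real
  proof -
    have "2 * (\<bar>a\<bar> * \<bar>b\<bar>) \<le> \<bar>a\<bar>\<^sup>2 + \<bar>b\<bar>\<^sup>2" using sum_squares_bound[of "\<bar>a\<bar>" "\<bar>b\<bar>"] by simp
    moreover have "0 \<le> \<bar>a\<bar> * \<bar>b\<bar>" by simp
    ultimately show ?thesis by (simp only: abs_mult power2_abs)
  qed
  then show "AE x in lebesgue_on S. norm (f x * g x) \<le> norm ((f x)\<^sup>2 + (g x)\<^sup>2)"
    by (auto simp: abs_of_nonneg)
qed

lemma L2_bound:
  assumes "f \<in> borel_measurable (lebesgue_on S)" "g \<in> L2 S" "AE x in lebesgue_on S. \<bar>f x\<bar> \<le> \<bar>g x\<bar>"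
  shows "f \<in> L2 S"
proof -
  have "integrable (lebesgue_on S) (\<lambda>x. (f x)\<^sup>2)"
  proof (rule Bochner_Integration.integrable_bound[OF L2_square_integrable[OF assms(2)]])
    show "AE x in lebesgue_on S. norm ((f x)\<^sup>2) \<le> norm ((g x)\<^sup>2)"
      using assms(3) by eventually_elim (simp add: abs_le_square_iff)
  qed (use assms(1) in measurable)
  then show ?thesis using assms(1) by (simp add: L2_def)
qed

lemma L2_zero: "(\<lambda>x. 0) \<in> L2 S"
  by (simp add: L2_def)

lemma L2_scale: "f \<in> L2 S \<Longrightarrow> (\<lambda>x. c * f x) \<in> L2 S"
  by (auto simp: L2_def power_mult_distrib)

lemma L2_add:
  assumes "f \<in> L2 S" "g \<in> L2 S" shows "(\<lambda>x. f x + g x) \<in> L2 S"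
proof -
  have "integrable (lebesgue_on S) (\<lambda>x. (f x)\<^sup>2 + 2 * (f x * g x) + (g x)\<^sup>2)"
    using assms by (intro Bochner_Integration.integrable_add integrable_mult_right
        L2_square_integrable L2_mult_integrable)
  then have "integrable (lebesgue_on S) (\<lambda>x. (f x + g x)\<^sup>2)"
    by (simp add: power2_sum algebra_simps)
  then show ?thesis using assms by (auto simp: L2_def)
qed

lemma semi_inner_L2: "semi_inner (L2 (S :: (real^'n) set)) (L2_inner S)"
proof
  fix u v w :: "real^'n \<Rightarrow> real" and c :: real
  assume u: "u \<in> L2 S"
  { assume "v \<in> L2 S" "w \<in> L2 S"
    then show "L2_inner S (\<lambda>x. u x + v x) w = L2_inner S u w + L2_inner S v w"
      using u by (simp add: L2_inner_def distrib_right L2_mult_integrable) }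
  show "L2_inner S (\<lambda>x. c * u x) w = c * L2_inner S u w"
    by (simp add: L2_inner_def mult.assoc)
  show "0 \<le> L2_inner S u u" by (simp add: L2_inner_def)
  show "L2_inner S u v = L2_inner S v u" by (simp add: L2_inner_def mult.commute)
qed (simp_all add: L2_zero L2_scale L2_add)

lemma semi_inner_nrm_L2: "semi_inner.nrm (L2_inner S) = L2_norm S"
  by (rule ext) (simp add: semi_inner.nrm_def[OF semi_inner_L2] L2_norm_def)

lemma nn_integral_square:
  "f \<in> L2 S \<Longrightarrow> (\<integral>\<^sup>+x. ennreal ((f x)\<^sup>2) \<partial>lebesgue_on S) = ennreal ((L2_norm S f)\<^sup>2)"
  using L2_square_integrable[of f S]
  by (simp add: nn_integral_eq_integral L2_norm_def L2_inner_def power2_eq_square)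

text \<open>Riesz-Fischer. Along a subsequence the increments \<open>D j\<close> have norm at most
  \<open>(1/4)^j\<close>; the weights \<open>4^j\<close> keep the sum of the squares integrable and,
  where it is finite, force \<open>D j x\<close> below a multiple of \<open>(1/2)^j\<close>. So the
  telescoping series converges almost everywhere, and Fatou's lemma carries the Cauchy estimate of
  the whole sequence over to the limit.\<close>

lemma L2_complete:
  fixes X :: "nat \<Rightarrow> real^'n \<Rightarrow> real"
  assumes X: "\<And>n. X n \<in> L2 S"
    and cauchy: "\<And>e. 0 < e \<Longrightarrow> \<exists>N. \<forall>m\<ge>N. \<forall>n\<ge>N. L2_norm S (\<lambda>x. X m x - X n x) < e"
  shows "\<exists>l\<in>L2 S. strong_conv (L2_norm S) X l"
proof -
  interpret L: semi_inner "L2 S" "L2_inner S" rewrites "semi_inner.nrm (L2_inner S) = L2_norm S"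
    by (rule semi_inner_L2, rule semi_inner_nrm_L2)
  let ?M = "lebesgue_on S"
  have meas[measurable]: "X n \<in> borel_measurable ?M" for n using X by (rule L2_measurable)
  have "\<exists>k. \<forall>j. (\<forall>m\<ge>k j. \<forall>n\<ge>k j. L2_norm S (\<lambda>x. X m x - X n x) < (1/4)^j) \<and> k j < k (Suc j)"
  proof (intro dependent_nat_choice)
    show "\<exists>k. \<forall>m\<ge>k. \<forall>n\<ge>k. L2_norm S (\<lambda>x. X m x - X n x) < (1 / 4) ^ 0" using cauchy[of 1] by simp
    fix k j
    obtain N where "\<forall>m\<ge>N. \<forall>n\<ge>N. L2_norm S (\<lambda>x. X m x - X n x) < (1 / 4) ^ Suc j"
      using cauchy[of "(1/4)^Suc j"] by auto
    then show "\<exists>y. (\<forall>m\<ge>y. \<forall>n\<ge>y. L2_norm S (\<lambda>x. X m x - X n x) < (1 / 4) ^ Suc j) \<and> k < y"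
      by (intro exI[of _ "max N (Suc k)"]) auto
  qed
  then obtain k where k: "\<And>j m n. m \<ge> k j \<Longrightarrow> n \<ge> k j \<Longrightarrow> L2_norm S (\<lambda>x. X m x - X n x) < (1/4)^j"
    and k_mono: "\<And>j. k j < k (Suc j)" by blast
  have sm: "strict_mono k" using k_mono by (simp add: strict_mono_Suc_iff)
  define D where "D j x = X (k (Suc j)) x - X (k j) x" for j x
  have D: "D j \<in> L2 S" for j unfolding D_def by (intro L.mem_intros X)
  have D_le: "L2_norm S (D j) \<le> (1/4)^j" for j
    using k[of j "k (Suc j)" "k j"] k_mono[of j] unfolding D_def by simp
  have [measurable]: "D j \<in> borel_measurable ?M" for j using D by (rule L2_measurable)
  have "(\<integral>\<^sup>+x. (\<Sum>j. ennreal (4^j * (D j x)\<^sup>2)) \<partial>?M) = (\<Sum>j. \<integral>\<^sup>+x. ennreal (4^j * (D j x)\<^sup>2) \<partial>?M)"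
    by (rule nn_integral_suminf) measurable
  also have "\<dots> \<le> (\<Sum>j. ennreal ((1/4)^j))"
  proof (intro suminf_le summableI)
    fix j
    have "(\<integral>\<^sup>+x. ennreal (4^j * (D j x)\<^sup>2) \<partial>?M) = ennreal (4^j) * (\<integral>\<^sup>+x. ennreal ((D j x)\<^sup>2) \<partial>?M)"
      by (simp add: ennreal_mult nn_integral_cmult)
    also have "\<dots> = ennreal (4^j * (L2_norm S (D j))\<^sup>2)"
      by (simp add: nn_integral_square D ennreal_mult)
    also have "\<dots> \<le> ennreal (4^j * ((1/4)^j)\<^sup>2)"
      by (intro ennreal_leI mult_left_mono power_mono D_le L.nrm_nonneg D) simp
    also have "4^j * ((1/4)^j)\<^sup>2 = (1/4::real)^j"
      by (simp add: power2_eq_square flip: power_mult_distrib)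
    finally show "(\<integral>\<^sup>+x. ennreal (4^j * (D j x)\<^sup>2) \<partial>?M) \<le> ennreal ((1/4)^j)" .
  qed
  also have "\<dots> < \<infinity>"
    by (subst suminf_ennreal2) auto
  finally have fin: "(\<integral>\<^sup>+x. (\<Sum>j. ennreal (4^j * (D j x)\<^sup>2)) \<partial>?M) \<noteq> \<infinity>" by simp
  have "AE x in ?M. (\<Sum>j. ennreal (4^j * (D j x)\<^sup>2)) \<noteq> \<infinity>"
    by (rule nn_integral_PInf_AE[OF _ fin]) measurable
  then have conv: "AE x in ?M. convergent (\<lambda>j. X (k j) x)"
  proof eventually_elim
    fix x assume "(\<Sum>j. ennreal (4^j * (D j x)\<^sup>2)) \<noteq> \<infinity>"
    then have "(\<Sum>j. ennreal (4^j * (D j x)\<^sup>2)) = ennreal (enn2real (\<Sum>j. ennreal (4^j * (D j x)\<^sup>2)))"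
      by (simp only: ennreal_enn2real_if infinity_ennreal_def if_False)
    then obtain C where C: "0 \<le> C" "(\<Sum>j. ennreal (4^j * (D j x)\<^sup>2)) = ennreal C"
      using enn2real_nonneg by blast
    have "norm (D j x) \<le> sqrt C * (1/2)^j" for j
    proof -
      have "ennreal (4^j * (D j x)\<^sup>2) \<le> ennreal C"
        using sum_le_suminf[OF summableI, of "{j}" "\<lambda>j. ennreal (4^j * (D j x)\<^sup>2)"]
        unfolding C(2) by simp
      then have "4^j * (D j x)\<^sup>2 \<le> C" using C(1) by simp
      moreover have "((2::real)^j)\<^sup>2 = 4^j"
        by (simp add: power2_eq_square flip: power_mult_distrib)
      ultimately have "(2^j * \<bar>D j x\<bar>)\<^sup>2 \<le> C" by (simp only: power_mult_distrib power2_abs)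
      then have "2^j * \<bar>D j x\<bar> \<le> sqrt C" by (rule real_le_rsqrt)
      then show ?thesis by (simp add: field_simps)
    qed
    then have "summable (\<lambda>j. D j x)"
      by (intro summable_comparison_test'[OF summable_mult[OF summable_geometric[of "1/2"]]]) auto
    then have "convergent (\<lambda>n. \<Sum>j<n. D j x)" by (simp add: summable_iff_convergent)
    moreover have "(\<Sum>j<n. D j x) = X (k n) x - X (k 0) x" for n
      unfolding D_def by (rule sum_lessThan_telescope)
    ultimately have "convergent (\<lambda>n. X (k n) x - X (k 0) x)" by simp
    then show "convergent (\<lambda>j. X (k j) x)" by (simp add: convergent_diff_const_right_iff)
  qed
  define l where "l x = lim (\<lambda>j. X (k j) x)" for x
  have l_meas[measurable]: "l \<in> borel_measurable ?M"
    unfolding l_def by (rule borel_measurable_lim_metric) measurable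
  have lim: "AE x in ?M. (\<lambda>j. X (k j) x) \<longlonglongrightarrow> l x"
    using conv by eventually_elim (simp add: convergent_LIMSEQ_iff l_def)
  have fatou: "(\<integral>\<^sup>+x. ennreal ((X n x - l x)\<^sup>2) \<partial>?M) \<le> ennreal (e\<^sup>2)"
    if e: "0 < e" and N: "\<And>m n. m \<ge> N \<Longrightarrow> n \<ge> N \<Longrightarrow> L2_norm S (\<lambda>x. X m x - X n x) < e" and n: "n \<ge> N" for n N e
  proof -
    have "(\<integral>\<^sup>+x. ennreal ((X n x - l x)\<^sup>2) \<partial>?M) = (\<integral>\<^sup>+x. liminf (\<lambda>j. ennreal ((X n x - X (k j) x)\<^sup>2)) \<partial>?M)"
    proof (rule nn_integral_cong_AE)
      show "AE x in ?M. ennreal ((X n x - l x)\<^sup>2) = liminf (\<lambda>j. ennreal ((X n x - X (k j) x)\<^sup>2))"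
        using lim
      proof eventually_elim
        fix x assume *: "(\<lambda>j. X (k j) x) \<longlonglongrightarrow> l x"
        have "(\<lambda>j. ennreal ((X n x - X (k j) x)\<^sup>2)) \<longlonglongrightarrow> ennreal ((X n x - l x)\<^sup>2)"
          by (intro tendsto_intros *)
        then show "ennreal ((X n x - l x)\<^sup>2) = liminf (\<lambda>j. ennreal ((X n x - X (k j) x)\<^sup>2))"
          by (intro lim_imp_Liminf[symmetric]) auto
      qed
    qed
    also have "\<dots> \<le> liminf (\<lambda>j. \<integral>\<^sup>+x. ennreal ((X n x - X (k j) x)\<^sup>2) \<partial>?M)"
      by (rule nn_integral_liminf) measurable
    also have "\<dots> \<le> ennreal (e\<^sup>2)"
    proof (rule Liminf_le)
      show "\<forall>\<^sub>F j in sequentially. (\<integral>\<^sup>+x. ennreal ((X n x - X (k j) x)\<^sup>2) \<partial>?M) \<le> ennreal (e\<^sup>2)"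
      proof (rule eventually_sequentiallyI[of N])
        fix j assume "N \<le> j"
        then have "N \<le> k j" using strict_mono_imp_increasing[OF sm, of j] by simp
        then show "(\<integral>\<^sup>+x. ennreal ((X n x - X (k j) x)\<^sup>2) \<partial>?M) \<le> ennreal (e\<^sup>2)"
          using N[OF n, of "k j"] L.nrm_nonneg[of "\<lambda>x. X n x - X (k j) x"] e
          by (subst nn_integral_square) (auto intro!: ennreal_leI power_mono L.mem_intros X)
      qed
    qed simp
    finally show ?thesis .
  qed
  have diff: "(\<lambda>x. X n x - l x) \<in> L2 S \<and> L2_norm S (\<lambda>x. X n x - l x) \<le> e"
    if e: "0 < e" and N: "\<And>m n. m \<ge> N \<Longrightarrow> n \<ge> N \<Longrightarrow> L2_norm S (\<lambda>x. X m x - X n x) < e" and n: "n \<ge> N" for n N e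
  proof
    have F: "(\<integral>\<^sup>+x. ennreal ((X n x - l x)\<^sup>2) \<partial>?M) \<le> ennreal (e\<^sup>2)"
      by (rule fatou[where N = N]) (use e N n in auto)
    have "(\<integral>\<^sup>+x. ennreal ((X n x - l x)\<^sup>2) \<partial>?M) < \<infinity>"
      by (rule le_less_trans[OF F]) simp
    then show in_L2: "(\<lambda>x. X n x - l x) \<in> L2 S"
      by (auto simp: L2_def integrable_iff_bounded)
    have "ennreal ((L2_norm S (\<lambda>x. X n x - l x))\<^sup>2) \<le> ennreal (e\<^sup>2)"
      using F nn_integral_square[OF in_L2] by simp
    then have "(L2_norm S (\<lambda>x. X n x - l x))\<^sup>2 \<le> e\<^sup>2" by simp
    then show "L2_norm S (\<lambda>x. X n x - l x) \<le> e"
      by (rule power2_le_imp_le) (use e in simp)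
  qed
  obtain N where N: "\<And>m n. m \<ge> N \<Longrightarrow> n \<ge> N \<Longrightarrow> L2_norm S (\<lambda>x. X m x - X n x) < 1"
    using cauchy[of 1] by auto
  have "(\<lambda>x. X N x - (X N x - l x)) \<in> L2 S"
    using diff[of 1 N N] N by (intro L.diff_mem[OF X, of "\<lambda>x. X N x - l x"]) simp
  then have l: "l \<in> L2 S" by simp
  have "strong_conv (L2_norm S) X l" unfolding strong_conv_def
  proof (rule LIMSEQ_I)
    fix r :: real assume r: "0 < r"
    then obtain N where N: "\<And>m n. m \<ge> N \<Longrightarrow> n \<ge> N \<Longrightarrow> L2_norm S (\<lambda>x. X m x - X n x) < r/2"
      using cauchy[of "r/2"] by auto
    show "\<exists>no. \<forall>n\<ge>no. norm (L2_norm S (\<lambda>x. X n x - l x) - 0) < r"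
    proof (intro exI[of _ N] allI impI)
      fix n assume "N \<le> n"
      then have "L2_norm S (\<lambda>x. X n x - l x) \<le> r/2" using diff[of "r/2" N n] N r by simp
      then show "norm (L2_norm S (\<lambda>x. X n x - l x) - 0) < r"
        using L.nrm_nonneg[of "\<lambda>x. X n x - l x"] r X l by (simp add: L.mem_intros)
    qed
  qed
  with l show ?thesis by blast
qed

lemma semi_hilbert_L2: "semi_hilbert (L2 S) (L2_inner S)"
  by (intro semi_hilbert.intro semi_hilbert_axioms.intro semi_inner_L2, unfold semi_inner_nrm_L2)
     (rule L2_complete)

text \<open>The rewrite makes the abstract lemmas speak of \<open>L2_norm\<close> instead of the
  norm built by the locale.\<close>

interpretation L2: semi_hilbert "L2 S" "L2_inner S"
  rewrites "semi_inner.nrm (L2_inner S) = L2_norm S" for S :: "(real^'n) set"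
  by (rule semi_hilbert_L2, rule semi_inner_nrm_L2)

lemma L2_inner_cong_AE:
  assumes "f \<in> L2 S" "f' \<in> L2 S" "g \<in> L2 S" "g' \<in> L2 S"
    and "AE x in lebesgue_on S. f x = f' x" "AE x in lebesgue_on S. g x = g' x"
  shows "L2_inner S f g = L2_inner S f' g'"
  unfolding L2_inner_def
proof (rule integral_cong_AE)
  show "AE x in lebesgue_on S. f x * g x = f' x * g' x" using assms(5,6) by eventually_elim simp
qed (use assms L2_measurable in measurable)

lemma L2_norm_cong_AE:
  assumes "f \<in> L2 S" "f' \<in> L2 S" "AE x in lebesgue_on S. f x = f' x"
  shows "L2_norm S f = L2_norm S f'"
  unfolding L2_norm_def using assms by (simp add: L2_inner_cong_AE[of f S f' f f'])

lemma L2_norm_mono_AE: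
  assumes "f \<in> L2 S" "g \<in> L2 S" "AE x in lebesgue_on S. \<bar>f x\<bar> \<le> \<bar>g x\<bar>"
  shows "L2_norm S f \<le> L2_norm S g"
  unfolding L2_norm_def L2_inner_def
proof (intro real_sqrt_le_mono integral_mono_AE L2_mult_integrable assms)
  show "AE x in lebesgue_on S. f x * f x \<le> g x * g x"
    using assms(3) by eventually_elim (metis abs_le_square_iff power2_eq_square)
qed

lemma L2_norm_eq_0_iff:
  assumes "f \<in> L2 S" shows "L2_norm S f = 0 \<longleftrightarrow> (AE x in lebesgue_on S. f x = 0)"
proof -
  have "L2_norm S f = 0 \<longleftrightarrow> (LINT x|lebesgue_on S. (f x)\<^sup>2) = 0"
    by (simp add: L2_norm_def L2_inner_def power2_eq_square)
  also have "\<dots> \<longleftrightarrow> (AE x in lebesgue_on S. (f x)\<^sup>2 = 0)"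
    using assms by (intro integral_nonneg_eq_0_iff_AE L2_square_integrable) auto
  finally show ?thesis by simp
qed

lemma L2_strong_limit_unique:
  assumes "\<And>n. X n \<in> L2 S" "f \<in> L2 S" "g \<in> L2 S" "strong_conv (L2_norm S) X f" "strong_conv (L2_norm S) X g"
  shows "AE x in lebesgue_on S. f x = g x"
proof -
  have "L2_norm S (\<lambda>x. f x - g x) \<le> 0"
  proof (rule LIMSEQ_le_const)
    show "(\<lambda>n. L2_norm S (\<lambda>x. X n x - f x) + L2_norm S (\<lambda>x. X n x - g x)) \<longlonglongrightarrow> 0"
      using tendsto_add[OF assms(4,5)[unfolded strong_conv_def]] by simp
    show "\<exists>N. \<forall>n\<ge>N. L2_norm S (\<lambda>x. f x - g x) \<le> L2_norm S (\<lambda>x. X n x - f x) + L2_norm S (\<lambda>x. X n x - g x)"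
      using L2.nrm_triangle_diff[OF assms(2) assms(1) assms(3)] L2.nrm_minus_commute[OF assms(2) assms(1)]
      by auto
  qed
  then have "L2_norm S (\<lambda>x. f x - g x) = 0"
    using L2.nrm_nonneg[OF L2.diff_mem[OF assms(2,3)]] by simp
  then have "AE x in lebesgue_on S. f x - g x = 0"
    using L2_norm_eq_0_iff[OF L2.diff_mem[OF assms(2,3)]] by blast
  then show ?thesis by eventually_elim simp
qed

lemma L2_abs: "f \<in> L2 S \<Longrightarrow> (\<lambda>x. \<bar>f x\<bar>) \<in> L2 S"
  by (auto simp: L2_def)

lemma L2_norm_abs: "L2_norm S (\<lambda>x. \<bar>f x\<bar>) = L2_norm S f"
  by (simp add: L2_norm_def L2_inner_def)

lemma L2_sum: "finite I \<Longrightarrow> (\<And>i. i \<in> I \<Longrightarrow> f i \<in> L2 S) \<Longrightarrow> (\<lambda>x. \<Sum>i\<in>I. f i x) \<in> L2 S"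
  by (induction I rule: finite_induct) (auto simp: L2_zero L2_add)

lemma L2_inner_sum_left:
  "finite I \<Longrightarrow> (\<And>i. i \<in> I \<Longrightarrow> f i \<in> L2 S) \<Longrightarrow> g \<in> L2 S \<Longrightarrow>
    L2_inner S (\<lambda>x. \<Sum>i\<in>I. f i x) g = (\<Sum>i\<in>I. L2_inner S (f i) g)"
  by (induction I rule: finite_induct)
     (auto simp: L2.ip_add_left L2_sum L2.ip_scale_left[OF L2_zero, of _ _ 0, simplified])

lemma L2_norm_sum:
  "finite I \<Longrightarrow> (\<And>i. i \<in> I \<Longrightarrow> f i \<in> L2 S) \<Longrightarrow> L2_norm S (\<lambda>x. \<Sum>i\<in>I. f i x) \<le> (\<Sum>i\<in>I. L2_norm S (f i))"
proof (induction I rule: finite_induct)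
  case empty then show ?case by (simp add: L2_norm_def L2_inner_def)
next
  case (insert i I)
  then show ?case using L2.nrm_triangle[of "f i" S "\<lambda>x. \<Sum>i\<in>I. f i x"] by (simp add: L2_sum)
qed

text \<open>By Riesz every functional in the abstract dual is an inner product, so testing against
  \<open>L2\<close> suffices.\<close>

lemma L2_weak_convI:
  assumes "\<And>n. X n \<in> L2 S" "l \<in> L2 S" "\<And>y. y \<in> L2 S \<Longrightarrow> (\<lambda>n. L2_inner S (X n) y) \<longlonglongrightarrow> L2_inner S l y"
  shows "weak_conv (L2 S) (L2_norm S) X l"
  unfolding weak_conv_def
proof
  fix \<Phi> assume "\<Phi> \<in> dual_space (L2 S) (L2_norm S)"
  then obtain y where "y \<in> L2 S" "\<And>v. v \<in> L2 S \<Longrightarrow> \<Phi> v = L2_inner S v y" by (rule L2.Riesz) blast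
  then show "(\<lambda>j. \<Phi> (X j)) \<longlonglongrightarrow> \<Phi> l" using assms by simp
qed

subsection \<open>Finite families\<close>

text \<open>A family \<open>(f\<^sub>i)\<close> is encoded as one function of the pair \<open>(i, x)\<close>, so that the Hilbert space
  lemmas apply to it.\<close>
definition L2_family :: "(real^'n) set \<Rightarrow> ('i::finite \<times> (real^'n) \<Rightarrow> real) set" where
  "L2_family S = {f. \<forall>i. (\<lambda>x. f (i, x)) \<in> L2 S}"

definition L2_family_inner ::
    "(real^'n) set \<Rightarrow> ('i::finite \<times> (real^'n) \<Rightarrow> real) \<Rightarrow> ('i \<times> (real^'n) \<Rightarrow> real) \<Rightarrow> real" where
  "L2_family_inner S f g = (\<Sum>i\<in>UNIV. L2_inner S (\<lambda>x. f (i, x)) (\<lambda>x. g (i, x)))"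

lemma semi_inner_L2_family: "semi_inner (L2_family S) (L2_family_inner S)"
  by unfold_locales
     (auto simp: L2_family_def L2_family_inner_def L2.mem_intros L2.ip_simps L2.ip_commute
        L2.ip_nonneg sum.distrib sum_distrib_left intro!: sum.cong sum_nonneg)

lemma L2_family_nrm_square:
  assumes "f \<in> L2_family S"
  shows "(semi_inner.nrm (L2_family_inner S) f)\<^sup>2 = (\<Sum>i\<in>UNIV. (L2_norm S (\<lambda>x. f (i, x)))\<^sup>2)"
  using assms unfolding semi_inner.nrm_square[OF semi_inner_L2_family assms]
  by (auto simp: L2_family_inner_def L2_family_def L2.nrm_square intro!: sum.cong)

lemma L2_family_component_le:
  assumes "f \<in> L2_family S"
  shows "L2_norm S (\<lambda>x. f (i, x)) \<le> semi_inner.nrm (L2_family_inner S) f"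
proof (rule power2_le_imp_le)
  show "(L2_norm S (\<lambda>x. f (i, x)))\<^sup>2 \<le> (semi_inner.nrm (L2_family_inner S) f)\<^sup>2"
    unfolding L2_family_nrm_square[OF assms] by (rule member_le_sum) auto
  show "0 \<le> semi_inner.nrm (L2_family_inner S) f"
    using semi_inner.nrm_nonneg[OF semi_inner_L2_family assms] .
qed

lemma L2_family_strong_conv_iff:
  assumes "\<And>n. X n \<in> L2_family S" "l \<in> L2_family S"
  shows "strong_conv (semi_inner.nrm (L2_family_inner S)) X l \<longleftrightarrow>
    (\<forall>i. strong_conv (L2_norm S) (\<lambda>n x. X n (i, x)) (\<lambda>x. l (i, x)))"
proof
  have D: "(\<lambda>p. X n p - l p) \<in> L2_family S" for n
    using assms by (simp add: semi_inner.diff_mem[OF semi_inner_L2_family])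
  { assume *: "strong_conv (semi_inner.nrm (L2_family_inner S)) X l"
    show "\<forall>i. strong_conv (L2_norm S) (\<lambda>n x. X n (i, x)) (\<lambda>x. l (i, x))"
    proof
      fix i
      show "strong_conv (L2_norm S) (\<lambda>n x. X n (i, x)) (\<lambda>x. l (i, x))"
        unfolding strong_conv_def
      proof (rule tendsto_sandwich[OF _ _ tendsto_const *[unfolded strong_conv_def]])
        show "\<forall>\<^sub>F n in sequentially. 0 \<le> L2_norm S (\<lambda>x. X n (i, x) - l (i, x))"
          using D by (intro always_eventually allI L2.nrm_nonneg) (auto simp: L2_family_def)
        show "\<forall>\<^sub>F n in sequentially. L2_norm S (\<lambda>x. X n (i, x) - l (i, x))
            \<le> semi_inner.nrm (L2_family_inner S) (\<lambda>x. X n x - l x)"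
          using L2_family_component_le[OF D] by simp
      qed
    qed }
  { assume *: "\<forall>i. strong_conv (L2_norm S) (\<lambda>n x. X n (i, x)) (\<lambda>x. l (i, x))"
    have lim: "(\<lambda>n. (L2_norm S (\<lambda>x. X n (i, x) - l (i, x)))\<^sup>2) \<longlonglongrightarrow> 0\<^sup>2" for i
      using * by (intro tendsto_power) (simp add: strong_conv_def)
    have "(\<lambda>n. (semi_inner.nrm (L2_family_inner S) (\<lambda>p. X n p - l p))\<^sup>2) \<longlonglongrightarrow> 0"
      using tendsto_sum[where I = UNIV, OF lim] by (simp add: L2_family_nrm_square[OF D])
    then have "(\<lambda>n. sqrt ((semi_inner.nrm (L2_family_inner S) (\<lambda>p. X n p - l p))\<^sup>2)) \<longlonglongrightarrow> sqrt 0"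
      by (intro tendsto_real_sqrt) simp
    then show "strong_conv (semi_inner.nrm (L2_family_inner S)) X l"
      unfolding strong_conv_def by (simp add: semi_inner.nrm_nonneg[OF semi_inner_L2_family D]) }
qed

lemma semi_hilbert_L2_family:
  "semi_hilbert (L2_family (S :: (real^'n) set)) (L2_family_inner S :: ('i::finite \<times> (real^'n) \<Rightarrow> real) \<Rightarrow> _)"
proof (intro semi_hilbert.intro semi_hilbert_axioms.intro semi_inner_L2_family)
  fix X :: "nat \<Rightarrow> ('i \<times> (real^'n) \<Rightarrow> real)"
  assume X: "\<And>n. X n \<in> L2_family S"
    and cauchy: "\<And>e. 0 < e \<Longrightarrow> \<exists>N. \<forall>m\<ge>N. \<forall>n\<ge>N. semi_inner.nrm (L2_family_inner S) (\<lambda>x. X m x - X n x) < e"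
  have D: "(\<lambda>p. X m p - X n p) \<in> L2_family S" for m n
    using X by (simp add: semi_inner.diff_mem[OF semi_inner_L2_family])
  have "\<exists>l\<in>L2 S. strong_conv (L2_norm S) (\<lambda>n x. X n (i, x)) l" for i
  proof (rule L2_complete)
    show "(\<lambda>x. X n (i, x)) \<in> L2 S" for n using X by (simp add: L2_family_def)
    fix e :: real assume "0 < e"
    from cauchy[OF this] show "\<exists>N. \<forall>m\<ge>N. \<forall>n\<ge>N. L2_norm S (\<lambda>x. X m (i, x) - X n (i, x)) < e"
      using L2_family_component_le[OF D] by (meson le_less_trans)
  qed
  then obtain l where l: "\<And>i. l i \<in> L2 S" "\<And>i. strong_conv (L2_norm S) (\<lambda>n x. X n (i, x)) (l i)" by metis
  have "(\<lambda>(i, x). l i x) \<in> L2_family S" using l by (simp add: L2_family_def)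
  moreover from this have "strong_conv (semi_inner.nrm (L2_family_inner S)) X (\<lambda>(i, x). l i x)"
    using l X by (subst L2_family_strong_conv_iff) auto
  ultimately show "\<exists>l\<in>L2_family S. strong_conv (semi_inner.nrm (L2_family_inner S)) X l" by blast
qed

text \<open>Compactness is applied to the family as one vector, so that a single subsequence serves
  all components.\<close>

lemma L2_family_weak_compactness:
  fixes X :: "nat \<Rightarrow> 'i::finite \<Rightarrow> real^'n \<Rightarrow> real"
  assumes X: "\<And>n i. X n i \<in> L2 S" and bdd: "\<And>n i. L2_norm S (X n i) \<le> C"
  obtains r l where "strict_mono r" "\<And>i. l i \<in> L2 S"
    "\<And>i y. y \<in> L2 S \<Longrightarrow> (\<lambda>n. L2_inner S (X (r n) i) y) \<longlonglongrightarrow> L2_inner S (l i) y"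
proof -
  interpret semi_hilbert "L2_family S :: ('i \<times> (real^'n) \<Rightarrow> real) set" "L2_family_inner S"
    by (rule semi_hilbert_L2_family)
  have XF: "(\<lambda>(i, x). X n i x) \<in> L2_family S" for n using X by (simp add: L2_family_def)
  have C0: "0 \<le> C" using bdd[of 0 undefined] L2.nrm_nonneg[OF X, of 0 undefined] by simp
  have "nrm (\<lambda>(i, x). X n i x) \<le> sqrt (\<Sum>i\<in>(UNIV::'i set). C\<^sup>2)" for n
  proof (rule real_le_rsqrt)
    show "(nrm (\<lambda>(i, x). X n i x))\<^sup>2 \<le> (\<Sum>i\<in>(UNIV::'i set). C\<^sup>2)"
      unfolding L2_family_nrm_square[OF XF]
      using bdd X by (intro sum_mono power_mono) (auto intro: L2.nrm_nonneg)
  qed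
  with XF obtain r l where r: "strict_mono r" "l \<in> L2_family S"
    and w: "\<And>y. y \<in> L2_family S \<Longrightarrow>
      (\<lambda>n. L2_family_inner S (\<lambda>(i, x). X (r n) i x) y) \<longlonglongrightarrow> L2_family_inner S l y"
    using weak_compactness[of "\<lambda>n (i, x). X n i x"] by metis
  show ?thesis
  proof (rule that[OF r(1)])
    show "(\<lambda>x. l (i, x)) \<in> L2 S" for i using r by (simp add: L2_family_def)
    fix i :: 'i and y :: "real^'n \<Rightarrow> real" assume y: "y \<in> L2 S"
    \<comment> \<open>A family supported in one component extracts the weak convergence of that
      component.\<close>
    define y' where "y' = (\<lambda>(j, x). if j = i then y x else 0)"
    have "(\<lambda>x. y' (j, x)) \<in> L2 S" for j by (cases "j = i") (simp_all add: y'_def y L2_zero)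
    then have "y' \<in> L2_family S" by (simp add: L2_family_def)
    moreover have "L2_family_inner S f y' = L2_inner S (\<lambda>x. f (i, x)) y" for f
    proof -
      have "L2_family_inner S f y' = (\<Sum>j\<in>UNIV. if j = i then L2_inner S (\<lambda>x. f (i, x)) y else 0)"
        unfolding L2_family_inner_def y'_def by (intro sum.cong) (auto simp: L2_inner_def)
      then show ?thesis by simp
    qed
    ultimately show "(\<lambda>n. L2_inner S (X (r n) i) y) \<longlonglongrightarrow> L2_inner S (\<lambda>x. l (i, x)) y"
      using w[of y'] by simp
  qed
qed

text \<open>A vector orthogonal to \<open>M\<close> is orthogonal to every \<open>X n\<close> and
  hence to their weak limit. As \<open>M\<close> is a subspace, this puts the weak limit into the
  strong closure of \<open>M\<close>; the approximants are members of \<open>M\<close>, not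
  necessarily convex combinations of the \<open>X n\<close>.\<close>

lemma L2_family_Mazur:
  fixes M :: "('i::finite \<Rightarrow> real^'n \<Rightarrow> real) set"
  assumes M: "\<And>f i. f \<in> M \<Longrightarrow> f i \<in> L2 S"
    and M_zero: "(\<lambda>i x. 0) \<in> M"
    and M_add: "\<And>f g. f \<in> M \<Longrightarrow> g \<in> M \<Longrightarrow> (\<lambda>i x. f i x + g i x) \<in> M"
    and M_scale: "\<And>c f. f \<in> M \<Longrightarrow> (\<lambda>i x. c * f i x) \<in> M"
    and X: "\<And>n. X n \<in> M" and l: "\<And>i. l i \<in> L2 S"
    and weak: "\<And>i y. y \<in> L2 S \<Longrightarrow> (\<lambda>n. L2_inner S (X n i) y) \<longlonglongrightarrow> L2_inner S (l i) y"
  obtains Y where "\<And>n. Y n \<in> M" "\<And>i. strong_conv (L2_norm S) (\<lambda>n. Y n i) (l i)"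
proof -
  interpret semi_hilbert "L2_family S :: ('i \<times> (real^'n) \<Rightarrow> real) set" "L2_family_inner S"
    by (rule semi_hilbert_L2_family)
  define M' where "M' = (\<lambda>f (i, x). f i x) ` M"
  obtain Z where Z: "\<And>n. Z n \<in> M'" "strong_conv nrm Z (\<lambda>(i, x). l i x)"
  proof (rule in_closure_if_biorthogonal[of M' "\<lambda>(i, x). l i x"])
    show "M' \<subseteq> L2_family S" using M by (auto simp: M'_def L2_family_def)
    show "(\<lambda>x. 0) \<in> M'" using M_zero by (auto simp: M'_def intro!: image_eqI)
    show "(\<lambda>x. u x + v x) \<in> M'" if "u \<in> M'" "v \<in> M'" for u v
      using that M_add by (auto simp: M'_def intro!: image_eqI)
    show "(\<lambda>x. c * u x) \<in> M'" if "u \<in> M'" for c u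
      using that M_scale by (auto simp: M'_def intro!: image_eqI)
    show "(\<lambda>(i, x). l i x) \<in> L2_family S" using l by (simp add: L2_family_def)
    fix y assume y: "y \<in> L2_family S" and perp: "\<And>m. m \<in> M' \<Longrightarrow> L2_family_inner S m y = 0"
    have "(\<lambda>n. L2_family_inner S (\<lambda>(i, x). X n i x) y) \<longlonglongrightarrow> L2_family_inner S (\<lambda>(i, x). l i x) y"
      unfolding L2_family_inner_def using y weak by (intro tendsto_sum) (simp add: L2_family_def)
    moreover have "L2_family_inner S (\<lambda>(i, x). X n i x) y = 0" for n
      by (rule perp) (use X in \<open>auto simp: M'_def\<close>)
    ultimately show "L2_family_inner S (\<lambda>(i, x). l i x) y = 0" by (simp add: LIMSEQ_const_iff)
  qed blast
  have "\<exists>f. f \<in> M \<and> Z n = (\<lambda>(i, x). f i x)" for n using Z(1)[of n] by (auto simp: M'_def)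
  then obtain Y where Y: "\<And>n. Y n \<in> M" "\<And>n. Z n = (\<lambda>(i, x). Y n i x)" by metis
  have ZF: "Z n \<in> L2_family S" for n using Y M by (simp add: L2_family_def)
  have lF: "(\<lambda>(i, x). l i x) \<in> L2_family S" using l by (simp add: L2_family_def)
  have "strong_conv (L2_norm S) (\<lambda>n. Y n i) (l i)" for i
    using Z(2) L2_family_strong_conv_iff[OF ZF lF] Y(2) by simp
  with Y(1) show ?thesis using that by blast
qed

section \<open>Smooth functions\<close>

lemma partial_eq:
  assumes "(u has_derivative D) (at x)" shows "partial i u x = D (axis i 1)"
  using frechet_derivative_at[OF assms] by (simp add: partial_def)

lemma has_derivative_imp_differentiable: "(u has_derivative D) (at x) \<Longrightarrow> u differentiable (at x)"
  by (auto simp: differentiable_def)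

lemma partial_add:
  assumes "u differentiable (at x)" "v differentiable (at x)"
  shows "partial i (\<lambda>x. u x + v x) x = partial i u x + partial i v x"
proof -
  obtain D E where D: "(u has_derivative D) (at x)" and E: "(v has_derivative E) (at x)"
    using assms by (auto simp: differentiable_def)
  show ?thesis by (simp add: partial_eq[OF has_derivative_add[OF D E]] partial_eq[OF D] partial_eq[OF E])
qed

lemma partial_diff:
  assumes "u differentiable (at x)" "v differentiable (at x)"
  shows "partial i (\<lambda>x. u x - v x) x = partial i u x - partial i v x"
proof -
  obtain D E where D: "(u has_derivative D) (at x)" and E: "(v has_derivative E) (at x)"
    using assms by (auto simp: differentiable_def)
  show ?thesis by (simp add: partial_eq[OF has_derivative_diff[OF D E]] partial_eq[OF D] partial_eq[OF E])
qed

lemma partial_mult: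
  fixes u v :: "real^'n \<Rightarrow> real"
  assumes "u differentiable (at x)" "v differentiable (at x)"
  shows "partial i (\<lambda>x. u x * v x) x = partial i u x * v x + u x * partial i v x"
proof -
  obtain D E where D: "(u has_derivative D) (at x)" and E: "(v has_derivative E) (at x)"
    using assms by (auto simp: differentiable_def)
  show ?thesis by (simp add: partial_eq[OF has_derivative_mult[OF D E]] partial_eq[OF D] partial_eq[OF E])
qed

lemma partial_const: "partial i (\<lambda>x. c) x = 0"
  by (simp add: partial_eq[OF has_derivative_const])

lemma partial_scale:
  assumes "u differentiable (at x)" shows "partial i (\<lambda>x. c * u x) x = c * partial i u x"
  using partial_mult[OF _ assms, of "\<lambda>x. c"] by (simp add: partial_const)

lemma has_derivative_affine: "((\<lambda>x. b \<bullet> x - c) has_derivative (\<lambda>h. b \<bullet> h)) (at x)"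
  by (auto intro!: derivative_eq_intros)

lemma partial_affine: "partial i (\<lambda>x. b \<bullet> x - c) x = b $ i"
  by (simp add: partial_eq[OF has_derivative_affine] inner_axis)

lemma has_derivative_comp_real:
  assumes "(f has_real_derivative d) (at (u x))" "(u has_derivative D) (at x)"
  shows "((\<lambda>x. f (u x)) has_derivative (\<lambda>h. d * D h)) (at x)"
  using has_derivative_compose[OF assms(2)] assms(1) by (simp add: has_field_derivative_def)

lemma partial_comp:
  assumes "(f has_real_derivative d) (at (u x))" "u differentiable (at x)"
  shows "partial i (\<lambda>x. f (u x)) x = d * partial i u x"
proof -
  obtain D where "(u has_derivative D) (at x)" using assms by (auto simp: differentiable_def)
  with has_derivative_comp_real[OF assms(1) this] show ?thesis by (simp add: partial_eq)
qed

lemma differentiable_comp_real: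
  assumes "(f has_real_derivative d) (at (u x))" "u differentiable (at x)"
  shows "(\<lambda>x. f (u x)) differentiable (at x)"
  using assms has_derivative_comp_real unfolding differentiable_def by blast

lemma partial_translate:
  assumes "u differentiable (at (x + h))"
  shows "partial i (\<lambda>x. u (x + h)) x = partial i u (x + h)"
    "(\<lambda>x. u (x + h)) differentiable (at x)"
proof -
  obtain D where D: "(u has_derivative D) (at (x + h))" using assms by (auto simp: differentiable_def)
  have "((\<lambda>x. x + h) has_derivative (\<lambda>x. x)) (at x)" by (auto intro!: derivative_eq_intros)
  from has_derivative_compose[OF this, of u D] D
  have "((\<lambda>x. u (x + h)) has_derivative D) (at x)" by simp
  then show "partial i (\<lambda>x. u (x + h)) x = partial i u (x + h)"
    "(\<lambda>x. u (x + h)) differentiable (at x)"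
    using D by (auto simp: partial_eq differentiable_def)
qed

lemma axis_has_derivative:
  assumes "u differentiable (at (x + t *\<^sub>R axis i 1))"
  shows "((\<lambda>t. u (x + t *\<^sub>R axis i 1)) has_real_derivative partial i u (x + t *\<^sub>R axis i 1)) (at t)"
proof -
  obtain D where D: "(u has_derivative D) (at (x + t *\<^sub>R axis i 1))"
    using assms by (auto simp: differentiable_def)
  have "((\<lambda>t. x + t *\<^sub>R axis i 1) has_derivative (\<lambda>h. h *\<^sub>R axis i 1)) (at t)"
    by (auto intro!: derivative_eq_intros)
  from has_derivative_compose[OF this D]
  have "((\<lambda>t. u (x + t *\<^sub>R axis i 1)) has_derivative (\<lambda>h. D (h *\<^sub>R axis i 1))) (at t)" .
  moreover have "D (h *\<^sub>R axis i 1) = D (axis i 1) * h" for h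
    using linear_scale[OF has_derivative_linear[OF D]] by simp
  ultimately show ?thesis by (simp add: has_field_derivative_def partial_eq[OF D])
qed

text \<open>Differentiability up to order \<open>k\<close>, set up for induction on
  \<open>k\<close>: partial derivatives of products and composites are sums of products of lower
  order, a shape that the list-indexed \<open>smooth\<close> does not follow.\<close>

primrec Ck :: "nat \<Rightarrow> (real^'n \<Rightarrow> real) \<Rightarrow> bool" where
  "Ck 0 u \<longleftrightarrow> True"
| "Ck (Suc k) u \<longleftrightarrow> (\<forall>x. u differentiable (at x)) \<and> (\<forall>i. Ck k (partial i u))"

lemma iter_partial_append: "iter_partial (js @ ks) u = iter_partial js (iter_partial ks u)"
  by (induction js) simp_all

text \<open>\<open>Ck\<close> removes the innermost derivative first, while
  \<open>iter_partial\<close> adds the outermost one, hence the reverse induction on the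
  list.\<close>

lemma smooth_iff_Ck: "smooth u \<longleftrightarrow> (\<forall>k. Ck k u)"
proof
  assume "smooth u"
  show "\<forall>k. Ck k u"
  proof
    fix k show "Ck k u" using \<open>smooth u\<close>
    proof (induction k arbitrary: u)
      case (Suc k)
      have "u differentiable (at x)" for x
        using Suc.prems unfolding smooth_def by (metis iter_partial.simps(1))
      moreover have "smooth (partial i u)" for i
        using Suc.prems iter_partial_append[of _ "[i]" u] unfolding smooth_def by (metis iter_partial.simps)
      ultimately show ?case using Suc.IH by simp
    qed simp
  qed
next
  have "Ck (Suc (length js)) u \<Longrightarrow> iter_partial js u differentiable (at x)" for js x
  proof (induction js arbitrary: u rule: rev_induct)
    case (snoc j js)
    then show ?case by (simp add: iter_partial_append)
  qed simp
  then show "\<forall>k. Ck k u \<Longrightarrow> smooth u" unfolding smooth_def by blast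
qed

lemma Ck_mono: "Ck (Suc k) u \<Longrightarrow> Ck k u"
  by (induction k arbitrary: u) simp_all

lemma Ck_const: "Ck k (\<lambda>x::real^'n. c)"
proof (induction k arbitrary: c)
  case (Suc k)
  have "partial i (\<lambda>x::real^'n. c) = (\<lambda>x. 0)" for i by (simp add: fun_eq_iff partial_const)
  then show ?case using Suc by simp
qed simp

lemma Ck_affine: "Ck k (\<lambda>x. b \<bullet> x - c)"
proof (cases k)
  case (Suc k')
  have "partial i (\<lambda>x. b \<bullet> x - c) = (\<lambda>x. b $ i)" for i by (simp add: fun_eq_iff partial_affine)
  then show ?thesis using Suc has_derivative_imp_differentiable[OF has_derivative_affine] by (simp add: Ck_const)
qed simp

lemma Ck_add: "Ck k u \<Longrightarrow> Ck k v \<Longrightarrow> Ck k (\<lambda>x. u x + v x)"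
proof (induction k arbitrary: u v)
  case (Suc k)
  then have "partial i (\<lambda>x. u x + v x) = (\<lambda>x. partial i u x + partial i v x)" for i
    by (simp add: fun_eq_iff partial_add)
  then show ?case using Suc by simp
qed simp

lemma Ck_mult: "Ck k u \<Longrightarrow> Ck k v \<Longrightarrow> Ck k (\<lambda>x. u x * v x)"
proof (induction k arbitrary: u v)
  case (Suc k)
  then have "partial i (\<lambda>x. u x * v x) = (\<lambda>x. partial i u x * v x + u x * partial i v x)" for i
    by (simp add: fun_eq_iff partial_mult)
  then show ?case using Suc Ck_mono[OF Suc.prems(1)] Ck_mono[OF Suc.prems(2)] by (simp add: Ck_add)
qed simp

text \<open>The whole tower of derivatives \<open>F n\<close> is carried along, because the chain
  rule for \<open>F n\<close> involves \<open>F (Suc n)\<close>; the order \<open>n\<close> is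
  general in the induction.\<close>

lemma Ck_comp:
  assumes F: "\<And>n t. (F n has_real_derivative F (Suc n) t) (at t)"
  shows "Ck k u \<Longrightarrow> Ck k (\<lambda>x. F n (u x))"
proof (induction k arbitrary: n)
  case (Suc k)
  then have "partial i (\<lambda>x. F n (u x)) = (\<lambda>x. F (Suc n) (u x) * partial i u x)" for i
    by (auto simp: fun_eq_iff intro!: partial_comp F)
  moreover have "(\<lambda>x. F n (u x)) differentiable (at x)" for x
    using Suc.prems by (auto intro!: differentiable_comp_real[OF F])
  ultimately show ?case using Suc Ck_mono[OF Suc.prems] by (simp add: Ck_mult)
qed simp

lemma smooth_differentiable: "smooth u \<Longrightarrow> u differentiable (at x)"
  unfolding smooth_iff_Ck by (metis Ck.simps(2))

lemma smooth_partial: "smooth u \<Longrightarrow> smooth (partial i u)"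
  unfolding smooth_iff_Ck by (metis Ck.simps(2))

lemma smooth_const: "smooth (\<lambda>x. c)" by (simp add: smooth_iff_Ck Ck_const)
lemma smooth_affine: "smooth (\<lambda>x. b \<bullet> x - c)" by (simp add: smooth_iff_Ck Ck_affine)
lemma smooth_add: "smooth u \<Longrightarrow> smooth v \<Longrightarrow> smooth (\<lambda>x. u x + v x)" by (simp add: smooth_iff_Ck Ck_add)
lemma smooth_mult: "smooth u \<Longrightarrow> smooth v \<Longrightarrow> smooth (\<lambda>x. u x * v x)" by (simp add: smooth_iff_Ck Ck_mult)
lemma smooth_scale: "smooth u \<Longrightarrow> smooth (\<lambda>x. c * u x)" by (intro smooth_mult smooth_const)
lemma smooth_diff: "smooth u \<Longrightarrow> smooth v \<Longrightarrow> smooth (\<lambda>x. u x - v x)"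
  using smooth_add[of u "\<lambda>x. (-1) * v x"] smooth_scale[of v "-1"] by simp

lemma smooth_sum: "finite I \<Longrightarrow> (\<And>i. i \<in> I \<Longrightarrow> smooth (u i)) \<Longrightarrow> smooth (\<lambda>x. \<Sum>i\<in>I. u i x)"
  by (induction I rule: finite_induct) (auto simp: smooth_const smooth_add)

lemma smooth_prod: "finite I \<Longrightarrow> (\<And>i. i \<in> I \<Longrightarrow> smooth (u i)) \<Longrightarrow> smooth (\<lambda>x. \<Prod>i\<in>I. u i x)"
  by (induction I rule: finite_induct) (auto simp: smooth_const smooth_mult)

definition smooth_real :: "(real \<Rightarrow> real) \<Rightarrow> bool" where
  "smooth_real f \<longleftrightarrow> (\<exists>F. F 0 = f \<and> (\<forall>n t. (F n has_real_derivative F (Suc n) t) (at t)))"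

lemma smooth_comp:
  assumes "smooth_real f" "smooth u" shows "smooth (\<lambda>x. f (u x))"
proof -
  obtain F where "F 0 = f" "\<And>n t. (F n has_real_derivative F (Suc n) t) (at t)"
    using assms unfolding smooth_real_def by blast
  then show ?thesis using Ck_comp[of F _ u 0] assms(2) by (simp add: smooth_iff_Ck)
qed

lemma smooth_real_exp: "smooth_real exp"
  unfolding smooth_real_def by (rule exI[of _ "\<lambda>n. exp"]) (auto intro: DERIV_exp)

lemma smooth_translate: "smooth u \<Longrightarrow> smooth (\<lambda>x. u (x + h))"
proof -
  have "Ck k u \<Longrightarrow> Ck k (\<lambda>x. u (x + h))" for k
  proof (induction k arbitrary: u)
    case (Suc k)
    then have "partial i (\<lambda>x. u (x + h)) = (\<lambda>x. partial i u (x + h))" for i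
      by (simp add: fun_eq_iff partial_translate)
    then show ?case using Suc by (simp add: partial_translate)
  qed simp
  then show "smooth u \<Longrightarrow> smooth (\<lambda>x. u (x + h))" by (simp add: smooth_iff_Ck)
qed

lemma smooth_continuous: "smooth u \<Longrightarrow> continuous_on S u"
  using smooth_differentiable differentiable_imp_continuous_within continuous_at_imp_continuous_on by blast

lemma smooth_borel: "smooth u \<Longrightarrow> u \<in> borel_measurable borel"
  by (intro borel_measurable_continuous_onI smooth_continuous)

lemma partial_sum:
  "finite I \<Longrightarrow> (\<And>j. j \<in> I \<Longrightarrow> smooth (u j)) \<Longrightarrow>
    partial i (\<lambda>x. \<Sum>j\<in>I. u j x) x = (\<Sum>j\<in>I. partial i (u j) x)"
  by (induction I rule: finite_induct)
     (auto simp: partial_const partial_add smooth_differentiable smooth_sum)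

lemma smooth_partial_rules:
  assumes "smooth u" "smooth v"
  shows "partial i (\<lambda>x. u x + v x) = (\<lambda>x. partial i u x + partial i v x)"
    "partial i (\<lambda>x. u x - v x) = (\<lambda>x. partial i u x - partial i v x)"
    "partial i (\<lambda>x. c * u x) = (\<lambda>x. c * partial i u x)"
    "partial i (\<lambda>x. u x * v x) = (\<lambda>x. partial i u x * v x + u x * partial i v x)"
  using assms
  by (simp_all add: fun_eq_iff partial_add partial_diff partial_scale partial_mult smooth_differentiable)

subsection \<open>The functions \<open>p (1/t) exp (-1/t)\<close>\<close>

definition flat :: "real poly \<Rightarrow> real \<Rightarrow> real" where
  "flat p t = (if 0 < t then poly p (1/t) * exp (- (1/t)) else 0)"

lemma poly_exp_tendsto_0: "((\<lambda>s::real. poly p s * exp (- s)) \<longlongrightarrow> 0) at_top"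
proof -
  have "((\<lambda>s::real. \<Sum>i\<le>degree p. coeff p i * (s ^ i / exp s)) \<longlongrightarrow> (\<Sum>i\<le>degree p. coeff p i * 0)) at_top"
    by (intro tendsto_intros tendsto_power_div_exp_0)
  then show ?thesis by (simp add: poly_altdef sum_distrib_right sum_divide_distrib exp_minus field_simps)
qed

text \<open>In the variable \<open>s = 1/t\<close> differentiation sends \<open>p\<close> to
  \<open>s^2 (p - p')\<close>. Since the family is closed under differentiation, this one
  computation makes all its members smooth.\<close>

lemma flat_has_derivative:
  "(flat p has_real_derivative flat ([:0, 0, 1:] * (p - pderiv p)) t) (at t)"
proof (cases "t = 0")
  case False
  show ?thesis
  proof (cases "0 < t")
    case True
    have "((\<lambda>t. poly p (1/t) * exp (- (1/t))) has_real_derivative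
        flat ([:0, 0, 1:] * (p - pderiv p)) t) (at t)"
      using True by (auto intro!: derivative_eq_intros poly_DERIV[THEN DERIV_chain2]
          simp: flat_def field_simps power2_eq_square)
    then show ?thesis
      by (rule has_field_derivative_transform_within_open[where S = "{0<..}"])
         (use True in \<open>auto simp: flat_def\<close>)
  next
    case *: False
    have "((\<lambda>t. 0) has_real_derivative flat ([:0, 0, 1:] * (p - pderiv p)) t) (at t)"
      using * by (simp add: flat_def)
    then show ?thesis
      by (rule has_field_derivative_transform_within_open[where S = "{..<0}"])
         (use * False in \<open>auto simp: flat_def\<close>)
  qed
next
  case True
  have right: "((\<lambda>h. flat p h / h) \<longlongrightarrow> 0) (at_right 0)"
  proof -
    \<comment> \<open>At the origin from the right: with \<open>s = 1/h\<close> the difference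
      quotient is \<open>s * poly p s * exp (- s)\<close>, and the factor \<open>s\<close> is taken
      into the polynomial as \<open>pCons 0 p\<close>.\<close>
    have "((\<lambda>h::real. poly (pCons 0 p) (inverse h) * exp (- inverse h)) \<longlongrightarrow> 0) (at_right 0)"
      by (rule filterlim_compose[OF poly_exp_tendsto_0 filterlim_inverse_at_top_right])
    then show ?thesis
    proof (rule Lim_transform_eventually)
      show "\<forall>\<^sub>F h in at_right 0. poly (pCons 0 p) (inverse h) * exp (- inverse h) = flat p h / h"
        using eventually_at_right_less by eventually_elim (simp add: flat_def field_simps)
    qed
  qed
  have left: "((\<lambda>h. flat p h / h) \<longlongrightarrow> 0) (at_left 0)"
  proof (rule Lim_transform_eventually[OF tendsto_const])
    show "\<forall>\<^sub>F h in at_left 0. 0 = flat p h / h"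
      by (auto simp: eventually_at_left_field flat_def intro: exI[of _ "-1"])
  qed
  show ?thesis unfolding True has_field_derivative_iff
    using filterlim_split_at[OF left right] by (simp add: flat_def)
qed

lemma smooth_real_flat: "smooth_real (flat p)"
proof -
  define P where "P n = ((\<lambda>p. [:0, 0, 1:] * (p - pderiv p)) ^^ n) p" for n
  show ?thesis unfolding smooth_real_def
  proof (intro exI[of _ "\<lambda>n. flat (P n)"] conjI allI)
    show "flat (P 0) = flat p" by (simp add: P_def)
    show "(flat (P n) has_real_derivative flat (P (Suc n)) t) (at t)" for n t
      using flat_has_derivative[of "P n" t] by (simp add: P_def)
  qed
qed

definition bump :: "real \<Rightarrow> real" where "bump = flat 1"

lemma bump_eq: "bump t = (if 0 < t then exp (- (1/t)) else 0)"
  by (simp add: bump_def flat_def)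

lemma smooth_bump: "smooth u \<Longrightarrow> smooth (\<lambda>x. bump (u x))"
  unfolding bump_def by (rule smooth_comp[OF smooth_real_flat])

lemma bump_bounds: "0 \<le> bump t" "bump t \<le> 1" "t \<le> 0 \<Longrightarrow> bump t = 0" "0 < t \<Longrightarrow> 0 < bump t"
  by (auto simp: bump_eq)

lemma bump_mono: "s \<le> t \<Longrightarrow> bump s \<le> bump t"
  by (auto simp: bump_eq frac_le)

text \<open>A smooth substitute for the positive part, whose convexity gives the sign in the Bochner
  inequality.\<close>
definition cvx :: "real \<Rightarrow> real" where "cvx t = t * bump t"

text \<open>With \<open>s = 1/t\<close> the profile is \<open>exp (- s) / s\<close>; its first two
  derivatives are \<open>(1 + s) * exp (- s)\<close> and \<open>s^3 * exp (- s)\<close>. Both are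
  nonnegative and bounded, as the convexity of the weight and the boundedness of the potential
  require.\<close>

lemma cvx_has_derivative: "(cvx has_real_derivative flat [:1, 1:] t) (at t)"
proof -
  have "(cvx has_real_derivative 1 * bump t + flat ([:0, 0, 1:] * (1 - pderiv 1)) t * t) (at t)"
    unfolding cvx_def[abs_def] bump_def
    by (intro DERIV_mult DERIV_ident flat_has_derivative)
  moreover have "1 * bump t + flat ([:0, 0, 1:] * (1 - pderiv 1)) t * t = flat [:1, 1:] t"
    by (simp add: bump_def flat_def field_simps)
  ultimately show ?thesis by simp
qed

lemma cvx'_has_derivative: "(flat [:1, 1:] has_real_derivative flat [:0, 0, 0, 1:] t) (at t)"
  using flat_has_derivative[of "[:1, 1:]" t] by (simp add: pderiv_pCons)

lemma smooth_cvx: "smooth u \<Longrightarrow> smooth (\<lambda>x. cvx (u x))"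
  unfolding cvx_def by (intro smooth_mult smooth_bump)

lemma cvx_bounds: "0 \<le> cvx t" "t \<le> 0 \<Longrightarrow> cvx t = 0" "1/2 \<le> t \<Longrightarrow> exp (- 2) / 2 \<le> cvx t"
proof -
  show "0 \<le> cvx t" "t \<le> 0 \<Longrightarrow> cvx t = 0" by (auto simp: cvx_def bump_eq)
  assume t: "1/2 \<le> t"
  have "(1/2) * bump (1/2) \<le> t * bump t" using t by (intro mult_mono bump_mono bump_bounds) auto
  then show "exp (- 2) / 2 \<le> cvx t" by (simp add: bump_eq cvx_def)
qed

lemma cvx'_bounds: "0 \<le> flat [:1, 1:] t" "flat [:1, 1:] t \<le> 1"
proof -
  show "0 \<le> flat [:1, 1:] t" by (simp add: flat_def)
  have "(1 + s) * exp (- s) \<le> 1" for s :: real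
    using exp_ge_add_one_self[of s] by (simp add: exp_minus field_simps)
  from this[of "1/t"] show "flat [:1, 1:] t \<le> 1" by (simp add: flat_def)
qed

lemma cvx''_bounds: "0 \<le> flat [:0, 0, 0, 1:] t" "flat [:0, 0, 0, 1:] t \<le> 27"
proof -
  show "0 \<le> flat [:0, 0, 0, 1:] t" by (simp add: flat_def)
  \<comment> \<open>Cubing \<open>s / 3 \<le> exp (s / 3)\<close> gives the constant 27.\<close>
  have "s ^ 3 * exp (- s) \<le> 27" if "0 \<le> s" for s :: real
  proof -
    have "(s / 3) ^ 3 \<le> exp (s / 3) ^ 3"
      using that exp_ge_add_one_self[of "s / 3"] by (intro power_mono) linarith+
    also have "\<dots> = exp s" using exp_of_nat_mult[of 3 "s / 3"] by simp
    finally show ?thesis by (simp add: exp_minus field_simps power3_eq_cube)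
  qed
  from this[of "1/t"] show "flat [:0, 0, 0, 1:] t \<le> 27"
    by (simp add: flat_def power3_eq_cube mult.assoc)
qed

section \<open>Test functions\<close>

lemma test_functionsD: "\<phi> \<in> test_functions S \<Longrightarrow> smooth \<phi>"
  by (simp add: test_functions_def)

lemma test_functionsI:
  assumes "smooth \<phi>" "compact K" "K \<subseteq> S" "\<And>x. x \<notin> K \<Longrightarrow> \<phi> x = 0"
  shows "\<phi> \<in> test_functions S"
proof -
  have "closure {x. \<phi> x \<noteq> 0} \<subseteq> K"
    using assms by (intro closure_minimal compact_imp_closed) auto
  then show ?thesis
    using assms compact_Int_closed[of K "closure {x. \<phi> x \<noteq> 0}"] 
    by (auto simp: test_functions_def Int_absorb1)
qed

lemma test_functionsE:
  assumes "\<phi> \<in> test_functions S"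
  obtains K where "compact K" "K \<subseteq> S" "\<And>x. x \<notin> K \<Longrightarrow> \<phi> x = 0"
  using assms closure_subset[of "{x. \<phi> x \<noteq> 0}"] unfolding test_functions_def by blast

lemma test_functions_mono: "S \<subseteq> T \<Longrightarrow> test_functions S \<subseteq> test_functions T"
  by (auto simp: test_functions_def)

lemma partial_zero_outside:
  assumes "closed K" "\<And>x. x \<notin> K \<Longrightarrow> \<phi> x = 0" "x \<notin> K"
  shows "partial i \<phi> x = 0"
proof -
  have "(\<phi> has_derivative (\<lambda>h. 0)) (at x)"
    by (rule has_derivative_transform_within_open[of "\<lambda>x. 0" _ x _ "- K"])
       (use assms in \<open>auto simp: open_closed\<close>)
  then show ?thesis by (simp add: partial_eq)
qed

lemma test_mult_smooth:
  assumes "smooth u" "\<phi> \<in> test_functions S" shows "(\<lambda>x. u x * \<phi> x) \<in> test_functions S"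
proof -
  obtain K where "compact K" "K \<subseteq> S" "\<And>x. x \<notin> K \<Longrightarrow> \<phi> x = 0" using assms(2) by (rule test_functionsE) blast
  then show ?thesis using assms by (intro test_functionsI[of _ K] smooth_mult) (auto dest: test_functionsD)
qed

lemma test_scale: "\<phi> \<in> test_functions S \<Longrightarrow> (\<lambda>x. c * \<phi> x) \<in> test_functions S"
  by (rule test_mult_smooth[OF smooth_const])

lemma test_zero: "(\<lambda>x. 0) \<in> test_functions S"
  by (rule test_functionsI[of _ "{}"]) (auto simp: smooth_const)

lemma test_add:
  assumes "\<phi> \<in> test_functions S" "\<psi> \<in> test_functions S" shows "(\<lambda>x. \<phi> x + \<psi> x) \<in> test_functions S"
proof -
  obtain K where K: "compact K" "K \<subseteq> S" "\<And>x. x \<notin> K \<Longrightarrow> \<phi> x = 0" using assms(1) by (rule test_functionsE) blast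
  obtain L where L: "compact L" "L \<subseteq> S" "\<And>x. x \<notin> L \<Longrightarrow> \<psi> x = 0" using assms(2) by (rule test_functionsE) blast
  show ?thesis
    by (rule test_functionsI[of _ "K \<union> L"]) (use K L assms in \<open>auto simp: compact_Un intro: smooth_add test_functionsD\<close>)
qed

lemma test_diff:
  assumes "\<phi> \<in> test_functions S" "\<psi> \<in> test_functions S" shows "(\<lambda>x. \<phi> x - \<psi> x) \<in> test_functions S"
  using test_add[OF assms(1) test_scale[OF assms(2), of "-1"]] by simp

lemma test_sum:
  "finite I \<Longrightarrow> (\<And>i. i \<in> I \<Longrightarrow> \<phi> i \<in> test_functions S) \<Longrightarrow> (\<lambda>x. \<Sum>i\<in>I. \<phi> i x) \<in> test_functions S"
  by (induction I rule: finite_induct) (auto simp: test_zero test_add)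

lemma test_partial:
  assumes "\<phi> \<in> test_functions S" shows "partial i \<phi> \<in> test_functions S"
proof -
  obtain K where K: "compact K" "K \<subseteq> S" "\<And>x. x \<notin> K \<Longrightarrow> \<phi> x = 0" using assms by (rule test_functionsE) blast
  then show ?thesis
    using assms partial_zero_outside[OF compact_imp_closed[OF K(1)] K(3)]
    by (intro test_functionsI[of _ K] smooth_partial) (auto dest: test_functionsD)
qed

lemma test_translate:
  assumes "\<phi> \<in> test_functions UNIV" shows "(\<lambda>x. \<phi> (x + h)) \<in> test_functions UNIV"
proof -
  obtain K where K: "compact K" "\<And>x. x \<notin> K \<Longrightarrow> \<phi> x = 0" using assms by (rule test_functionsE) blast
  show ?thesis
  proof (rule test_functionsI[of _ "(\<lambda>x. x - h) ` K"])
    show "compact ((\<lambda>x. x - h) ` K)" by (intro compact_continuous_image continuous_intros K)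
    show "\<phi> (x + h) = 0" if "x \<notin> (\<lambda>x. x - h) ` K" for x
      using K(2)[of "x + h"] that by (metis add_diff_cancel image_eqI)
  qed (use assms in \<open>auto intro: smooth_translate dest: test_functionsD\<close>)
qed

lemma test_bounded:
  assumes "\<phi> \<in> test_functions S" obtains B where "\<And>x. \<bar>\<phi> x\<bar> \<le> B" "0 \<le> B"
proof -
  obtain K where K: "compact K" "K \<subseteq> S" "\<And>x. x \<notin> K \<Longrightarrow> \<phi> x = 0" using assms by (rule test_functionsE) blast
  have "compact (\<phi> ` K)"
    using assms by (intro compact_continuous_image smooth_continuous K test_functionsD)
  then obtain B where B: "\<And>x. x \<in> K \<Longrightarrow> norm (\<phi> x) \<le> B"
    using compact_imp_bounded[of "\<phi> ` K"] unfolding bounded_iff by auto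
  have "\<bar>\<phi> x\<bar> \<le> max B 0" for x using B[of x] K(3)[of x] by (cases "x \<in> K") auto
  then show ?thesis using that[of "max B 0"] by simp
qed

lemma smooth_measurable: "smooth u \<Longrightarrow> u \<in> borel_measurable (lebesgue_on S)"
  by (intro measurable_restrict_space1 measurable_completion) (simp add: smooth_borel)

lemma bounded_compact_support_integrable:
  fixes f :: "real^'n \<Rightarrow> real"
  assumes S: "S \<in> sets lebesgue" and f: "f \<in> borel_measurable (lebesgue_on S)"
    and B: "\<And>x. x \<in> S \<Longrightarrow> \<bar>f x\<bar> \<le> B" and K: "compact K" "\<And>x. x \<in> S \<Longrightarrow> x \<notin> K \<Longrightarrow> f x = 0"
  shows "integrable (lebesgue_on S) f"
proof (rule Bochner_Integration.integrable_bound)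
  have KS: "K \<inter> S \<in> lmeasurable"
    using lmeasurable_compact[OF K(1)] S by (simp add: fmeasurable_Int_fmeasurable)
  have "integrable (lebesgue_on S) (indicat_real K)"
    using KS S
    by (subst integrable_restrict_space)
       (auto simp: indicator_inter_arith[symmetric] Int_commute fmeasurable_def less_top[symmetric])
  then show "integrable (lebesgue_on S) (\<lambda>x. B * indicat_real K x)" by simp
  show "AE x in lebesgue_on S. norm (f x) \<le> norm (B * indicat_real K x)"
  proof (rule AE_I2)
    fix x assume "x \<in> space (lebesgue_on S)"
    then have "x \<in> S" by (simp add: space_restrict_space)
    then show "norm (f x) \<le> norm (B * indicat_real K x)"
      using B[of x] K(2)[of x] by (cases "x \<in> K") auto
  qed
qed (rule f)

lemma test_integrable:
  assumes "\<phi> \<in> test_functions T" "S \<in> sets lebesgue" shows "integrable (lebesgue_on S) \<phi>"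
proof -
  obtain K where K: "compact K" "\<And>x. x \<notin> K \<Longrightarrow> \<phi> x = 0" using assms by (auto elim: test_functionsE)
  obtain B where "\<And>x. \<bar>\<phi> x\<bar> \<le> B" using assms(1) by (rule test_bounded) blast
  then show ?thesis
    using assms K by (intro bounded_compact_support_integrable[of S \<phi> B K] smooth_measurable) (auto dest: test_functionsD)
qed

lemma test_L2:
  assumes "\<phi> \<in> test_functions T" "S \<in> sets lebesgue" shows "\<phi> \<in> L2 S"
  using test_integrable[OF test_mult_smooth[OF test_functionsD[OF assms(1)] assms(1)] assms(2)]
    smooth_measurable[OF test_functionsD[OF assms(1)]]
  by (simp add: L2_def power2_eq_square)

lemma integral_lebesgue_on:
  assumes "S \<in> sets lebesgue" "\<And>x. x \<notin> S \<Longrightarrow> f x = 0"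
  shows "(LINT x|lebesgue_on S. f x) = (LINT x|lebesgue. f x :: real)"
  using assms by (subst integral_restrict_space) (auto intro!: Bochner_Integration.integral_cong simp: indicator_def)

lemma integrable_lebesgue_on:
  assumes "S \<in> sets lebesgue" "\<And>x. x \<notin> S \<Longrightarrow> f x = 0"
  shows "integrable (lebesgue_on S) f \<longleftrightarrow> integrable lebesgue (f :: _ \<Rightarrow> real)"
  using assms by (subst integrable_restrict_space) (auto intro!: Bochner_Integration.integrable_cong simp: indicator_def)

lemma integral_translate:
  fixes f :: "real^'n \<Rightarrow> real"
  assumes "f \<in> borel_measurable borel"
  shows "(LINT x|lebesgue. f (x + h)) = (LINT x|lebesgue. f x)"
proof -
  have "(LINT x|lborel. f x) = (LINT x|distr lborel borel ((+) h). f x)" by (simp add: lborel_distr_plus)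
  also have "\<dots> = (LINT x|lborel. f (h + x))" using assms by (intro integral_distr) auto
  finally show ?thesis using assms by (simp add: integral_completion add.commute)
qed

lemma axis_mvt:
  assumes "smooth \<phi>" "0 < t"
  shows "\<exists>s. 0 < s \<and> s < t \<and> \<phi> (x + t *\<^sub>R axis i 1) - \<phi> x = t * partial i \<phi> (x + s *\<^sub>R axis i 1)"
  using MVT2[of 0 t "\<lambda>t. \<phi> (x + t *\<^sub>R axis i 1)" "\<lambda>t. partial i \<phi> (x + t *\<^sub>R axis i 1)"]
    axis_has_derivative[OF smooth_differentiable[OF assms(1)]] assms(2) by auto

text \<open>Difference quotients have integral zero by translation invariance. They are dominated by
  the mean value bound on a ball of radius \<open>R + 1\<close>, the steps \<open>t n\<close> being
  at most 1, and converge to the partial derivative.\<close>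

lemma integral_partial_eq_0:
  fixes \<phi> :: "real^'n \<Rightarrow> real"
  assumes \<phi>: "\<phi> \<in> test_functions UNIV"
  shows "(LINT x|lebesgue. partial i \<phi> x) = 0"
proof -
  have sm: "smooth \<phi>" using \<phi> by (rule test_functionsD)
  obtain K where K: "compact K" "\<And>x. x \<notin> K \<Longrightarrow> \<phi> x = 0" using \<phi> by (rule test_functionsE) blast
  obtain B where B: "\<And>x. \<bar>partial i \<phi> x\<bar> \<le> B" "0 \<le> B" using test_partial[OF \<phi>] by (rule test_bounded) blast
  obtain R where R: "\<And>x. x \<in> K \<Longrightarrow> norm x \<le> R" using compact_imp_bounded[OF K(1)] by (auto simp: bounded_iff)
  define t where "t n = inverse (real (Suc n))" for n
  have t: "0 < t n" "t n \<le> 1" for n by (auto simp: t_def field_simps)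
  define g where "g n x = (\<phi> (x + t n *\<^sub>R axis i 1) - \<phi> x) / t n" for n x
  have g_bound: "norm (g n x) \<le> B * indicator (cball 0 (R + 1)) x" for n x
  proof (cases "x \<in> cball 0 (R + 1)")
    case True
    obtain s where "\<phi> (x + t n *\<^sub>R axis i 1) - \<phi> x = t n * partial i \<phi> (x + s *\<^sub>R axis i 1)"
      using axis_mvt[OF sm t(1)] by blast
    then show ?thesis using True t(1)[of n] B by (simp add: g_def)
  next
    case False
    then have "x \<notin> K" using R[of x] by auto
    moreover have "x + t n *\<^sub>R axis i 1 \<notin> K"
    proof
      assume "x + t n *\<^sub>R axis i 1 \<in> K"
      then have "norm (x + t n *\<^sub>R axis i 1) \<le> R" by (rule R)
      moreover have "norm (t n *\<^sub>R axis i 1 :: real^'n) \<le> 1" using t[of n] by simp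
      ultimately have "norm x \<le> R + 1"
        using norm_triangle_ineq4[of "x + t n *\<^sub>R axis i 1" "t n *\<^sub>R axis i 1"] by simp
      with False show False by simp
    qed
    ultimately show ?thesis using False K(2) by (simp add: g_def)
  qed
  have "(\<lambda>n. LINT x|lebesgue. g n x) \<longlonglongrightarrow> (LINT x|lebesgue. partial i \<phi> x)"
  proof (rule integral_dominated_convergence[where w = "\<lambda>x. B * indicator (cball 0 (R + 1)) x"])
    show "partial i \<phi> \<in> borel_measurable lebesgue"
      using smooth_measurable[OF smooth_partial[OF sm], where S = UNIV] by (simp add: lebesgue_on_UNIV_eq)
    show "g n \<in> borel_measurable lebesgue" for n
    proof -
      have "(\<lambda>x. (1 / t n) * (\<phi> (x + t n *\<^sub>R axis i 1) - \<phi> x)) \<in> borel_measurable (lebesgue_on UNIV)"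
        by (intro smooth_measurable smooth_scale smooth_diff smooth_translate sm)
      then show ?thesis by (simp add: g_def[abs_def] lebesgue_on_UNIV_eq)
    qed
    have "integrable lebesgue (indicat_real (cball (0::real^'n) (R + 1)))"
      using lmeasurable_cball[of "0::real^'n" "R + 1"] by (auto simp: fmeasurable_def)
    then show "integrable lebesgue (\<lambda>x. B * indicat_real (cball (0::real^'n) (R + 1)) x)" by simp
    show "AE x in lebesgue. (\<lambda>n. g n x) \<longlonglongrightarrow> partial i \<phi> x"
    proof (rule AE_I2)
      fix x
      have "((\<lambda>h. (\<phi> (x + h *\<^sub>R axis i 1) - \<phi> x) / h) \<longlongrightarrow> partial i \<phi> x) (at 0)"
        using axis_has_derivative[OF smooth_differentiable[OF sm], where x = x and t = 0 and i = i]
        by (simp add: has_field_derivative_iff)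
      moreover have "filterlim t (at 0) sequentially"
        using LIMSEQ_inverse_real_of_nat t unfolding t_def[abs_def] filterlim_at
        by (auto simp del: of_nat_Suc)
      ultimately show "(\<lambda>n. g n x) \<longlonglongrightarrow> partial i \<phi> x"
        unfolding g_def by (rule filterlim_compose)
    qed
    show "AE x in lebesgue. norm (g n x) \<le> B * indicator (cball 0 (R + 1)) x" for n using g_bound by simp
  qed
  moreover have "(LINT x|lebesgue. g n x) = 0" for n
  proof -
    have int: "integrable lebesgue \<phi>" "integrable lebesgue (\<lambda>x. \<phi> (x + t n *\<^sub>R axis i 1))"
      using test_integrable[OF \<phi>, of UNIV] test_integrable[OF test_translate[OF \<phi>], of UNIV]
      by (auto simp: lebesgue_on_UNIV_eq)
    show ?thesis unfolding g_def using int integral_translate[OF smooth_borel[OF sm]] by simp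
  qed
  ultimately show ?thesis by (simp add: LIMSEQ_const_iff)
qed

text \<open>Only the product with \<open>\<phi>\<close> has to be a test function, so
  \<open>u\<close> may be any smooth function and the boundary of \<open>S\<close> never
  enters.\<close>

lemma integration_by_parts:
  fixes S :: "(real^'n) set"
  assumes S: "S \<in> sets lebesgue" and u: "smooth u" and \<phi>: "\<phi> \<in> test_functions S"
  shows "L2_inner S (partial i u) \<phi> = - L2_inner S u (partial i \<phi>)"
proof -
  have sm: "smooth \<phi>" using \<phi> by (rule test_functionsD)
  have t1: "(\<lambda>x. partial i u x * \<phi> x) \<in> test_functions S"
    by (intro test_mult_smooth smooth_partial u \<phi>)
  have t2: "(\<lambda>x. u x * partial i \<phi> x) \<in> test_functions S"
    by (intro test_mult_smooth u test_partial \<phi>)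
  have zero: "f x = 0" if "f \<in> test_functions S" "x \<notin> S" for f x
    using that by (auto elim!: test_functionsE)
  have "L2_inner S (partial i u) \<phi> + L2_inner S u (partial i \<phi>) =
      (LINT x|lebesgue. partial i u x * \<phi> x + u x * partial i \<phi> x)"
    unfolding L2_inner_def
    using test_integrable[OF t1 S] test_integrable[OF t2 S] zero[OF t1] zero[OF t2]
    by (simp add: integral_lebesgue_on[OF S] integrable_lebesgue_on[OF S])
  also have "\<dots> = (LINT x|lebesgue. partial i (\<lambda>x. u x * \<phi> x) x)"
    using u sm by (simp add: smooth_partial_rules)
  also have "\<dots> = 0"
    using test_mult_smooth[OF u \<phi>] test_functions_mono[of S UNIV] by (intro integral_partial_eq_0) auto
  finally show ?thesis by simp
qed

subsection \<open>The fundamental lemma of the calculus of variations\<close>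

text \<open>Each factor is a bump of the distance to a face, magnified by \<open>Suc k\<close>. It
  vanishes outside the open box, and tends to 1 inside since \<open>bump\<close> tends to 1 at
  infinity.\<close>

lemma box_indicator_limit:
  fixes a b :: "real^'n"
  defines "\<phi> \<equiv> \<lambda>k x. \<Prod>i\<in>UNIV. bump ((real (Suc k) *\<^sub>R axis i 1) \<bullet> x - real (Suc k) * a$i) *
      bump (((- real (Suc k)) *\<^sub>R axis i 1) \<bullet> x - (- real (Suc k)) * b$i)"
  shows "cbox a b \<subseteq> S \<Longrightarrow> \<phi> k \<in> test_functions S" "\<bar>\<phi> k x\<bar> \<le> indicator (cbox a b) x"
    "(\<lambda>k. \<phi> k x) \<longlonglongrightarrow> indicator (box a b) x"
proof -
  define f where "f k i x = bump (real (Suc k) * (x$i - a$i)) * bump (real (Suc k) * (b$i - x$i))"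
    for k and i :: 'n and x :: "real^'n"
  have \<phi>_eq: "\<phi> k x = (\<Prod>i\<in>UNIV. f k i x)" for k x
    by (simp add: \<phi>_def f_def inner_axis' algebra_simps)
  have f01: "0 \<le> f k i x" "f k i x \<le> 1" for k i x
    by (auto simp: f_def bump_bounds intro: mult_le_one)
  have f0: "f k i x = 0" if "\<not> (a$i < x$i \<and> x$i < b$i)" for k i x
    using that by (auto simp: f_def bump_bounds(3) mult_le_0_iff not_less)
  have \<phi>0: "\<phi> k x = 0" if "x \<notin> box a b" for k x
    using that f0 unfolding \<phi>_eq by (auto simp: mem_box_cart intro!: prod_zero)
  show "\<bar>\<phi> k x\<bar> \<le> indicator (cbox a b) x"
  proof (cases "x \<in> box a b")
    case True
    then have "x \<in> cbox a b" using box_subset_cbox by blast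
    then show ?thesis using f01 by (simp add: \<phi>_eq abs_prod prod_le_1)
  qed (simp add: \<phi>0)
  show "\<phi> k \<in> test_functions S" if "cbox a b \<subseteq> S"
  proof (rule test_functionsI[of _ "cbox a b"])
    show "smooth (\<phi> k)" unfolding \<phi>_def
      by (intro smooth_prod smooth_mult smooth_bump smooth_affine) simp
    show "\<phi> k x = 0" if "x \<notin> cbox a b" for x using that box_subset_cbox by (intro \<phi>0) blast
  qed (use that in auto)
  show "(\<lambda>k. \<phi> k x) \<longlonglongrightarrow> indicator (box a b) x"
  proof (cases "x \<in> box a b")
    case True
    have lim: "(\<lambda>k. bump (real (Suc k) * c)) \<longlonglongrightarrow> 1" if "0 < c" for c
    proof -
      have "(\<lambda>k. exp (- (inverse (real (Suc k)) * (1 / c)))) \<longlonglongrightarrow> exp (- (0 * (1/c)))"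
        by (intro tendsto_intros LIMSEQ_inverse_real_of_nat)
      moreover have "bump (real (Suc k) * c) = exp (- (inverse (real (Suc k)) * (1 / c)))" for k
        using that by (simp add: bump_eq inverse_eq_divide)
      ultimately show ?thesis by simp
    qed
    have "(\<lambda>k. f k i x) \<longlonglongrightarrow> 1" for i
      using tendsto_mult[OF lim[of "x$i - a$i"] lim[of "b$i - x$i"]] True
      by (simp add: f_def mem_box_cart)
    then have "(\<lambda>k. \<Prod>i\<in>UNIV. f k i x) \<longlonglongrightarrow> (\<Prod>i\<in>(UNIV::'n set). 1)" by (intro tendsto_prod)
    then show ?thesis using True by (simp add: \<phi>_eq)
  qed (simp add: \<phi>0)
qed

text \<open>Open boxes generate the Borel sets and are closed under intersection; the total integral
  is what the complement step of the induction uses. The conclusion comes from the sets where a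
  Borel version \<open>g\<close> of \<open>f\<close> is positive or negative, since the induction
  reaches Borel sets.\<close>

lemma AE_0_if_box_integrals_0:
  fixes f :: "real^'n \<Rightarrow> real"
  assumes f: "integrable lebesgue f" and total: "integral\<^sup>L lebesgue f = 0"
    and boxes: "\<And>c d. (LINT x|lebesgue. indicator (box c d) x * f x) = 0"
  shows "AE x in lebesgue. f x = 0"
proof -
  let ?G = "range (\<lambda>(a, b). box a b :: (real^'n) set)"
  have borel: "sets borel = sigma_sets UNIV ?G"
    by (subst borel_eq_box) (simp add: sets_measure_of_conv)
  have int_ind: "integrable lebesgue (\<lambda>x. indicator A x * f x)" if "A \<in> sets borel" for A
    using integrable_mult_indicator[of A lebesgue f] that f by simp
  have zero: "(LINT x|lebesgue. indicator A x * f x) = 0" if "A \<in> sets borel" for A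
  proof -
    have "Int_stable ?G"
    proof (rule Int_stableI)
      fix A B assume "A \<in> ?G" "B \<in> ?G"
      moreover have "\<exists>p q. box a b \<inter> box c d = box p q" for a b c d :: "real^'n"
        unfolding box_Int_box by blast
      ultimately show "A \<inter> B \<in> ?G" by (auto simp: image_iff)
    qed
    moreover have "?G \<subseteq> Pow UNIV" by simp
    moreover have "A \<in> sigma_sets UNIV ?G" using that borel by simp
    ultimately show ?thesis
    proof (induction rule: sigma_sets_induct_disjoint)
      case (basic A)
      then show ?case using boxes by auto
    next
      case empty then show ?case by simp
    next
      case (compl A)
      then have A: "A \<in> sets borel" using borel by simp
      have "(LINT x|lebesgue. indicator (UNIV - A) x * f x) = (LINT x|lebesgue. f x - indicator A x * f x)"
        by (intro Bochner_Integration.integral_cong) (auto simp: indicator_def)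
      also have "\<dots> = 0" using compl f int_ind[OF A] total by simp
      finally show ?case .
    next
      case (union A)
      have A: "A i \<in> sets lebesgue" for i using union(2) borel by (auto simp: image_subset_iff)
      have "(LINT x:(\<Union>i. A i)|lebesgue. f x) = (\<Sum>i. (LINT x:(A i)|lebesgue. f x))"
      proof (rule lebesgue_integral_countable_add[OF A])
        show "A i \<inter> A j = {}" if "i \<noteq> j" for i j using union(1) that by (auto simp: disjoint_family_on_def)
        show "set_integrable lebesgue (\<Union>i. A i) f"
          unfolding set_integrable_def using A f by (intro integrable_mult_indicator) auto
      qed
      then show ?case using union(3) by (simp add: set_lebesgue_integral_def)
    qed
  qed
  obtain g where g: "g \<in> borel_measurable lborel" "AE x in lborel. f x = g x"
    using completion_ex_borel_measurable_real[of f lborel] f by auto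
  have fg: "AE x in lebesgue. f x = g x" using g(2) by (rule AE_completion)
  have half: "AE x in lebesgue. indicator {x. 0 < c * g x} x * (c * f x) = 0" if "c = 1 \<or> c = -1" for c
  proof -
    let ?A = "{x. 0 < c * g x}"
    have A: "?A \<in> sets borel" using g(1) by measurable
    have nn: "AE x in lebesgue. 0 \<le> indicator ?A x * (c * f x)"
      using fg by eventually_elim (auto simp: indicator_def)
    have "integrable lebesgue (\<lambda>x. indicator ?A x * (c * f x))"
      using integrable_mult_right[OF int_ind[OF A], of c] by (simp add: mult.left_commute)
    moreover have "(LINT x|lebesgue. indicator ?A x * (c * f x)) = 0"
      using zero[OF A] by (simp add: mult.left_commute[of _ c])
    ultimately show ?thesis using nn integral_nonneg_eq_0_iff_AE by blast
  qed
  have "AE x in lebesgue. indicator {x. 0 < 1 * g x} x * (1 * f x) = 0"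
    "AE x in lebesgue. indicator {x. 0 < -1 * g x} x * (-1 * f x) = 0"
    by (rule half, simp)+
  with fg show ?thesis by eventually_elim (auto simp: indicator_def split: if_splits)
qed

text \<open>The work is local, on closed boxes inside \<open>S\<close>: there square integrability
  makes \<open>h\<close> integrable, and the smooth approximations of indicators of sub-boxes are
  admissible test functions. Countably many closed boxes cover \<open>S\<close>.\<close>

lemma fundamental_lemma:
  fixes h :: "real^'n \<Rightarrow> real"
  assumes S: "open S" and h: "h \<in> L2 S" and zero: "\<And>\<phi>. \<phi> \<in> test_functions S \<Longrightarrow> L2_inner S h \<phi> = 0"
  shows "AE x in lebesgue_on S. h x = 0"
proof -
  have Sl: "S \<in> sets lebesgue" using S by simp
  have local: "AE x in lebesgue. x \<in> cbox a b \<longrightarrow> h x = 0" if ab: "cbox a b \<subseteq> S" for a b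
  proof -
    define f where "f x = indicator (cbox a b) x * h x" for x
    have "(\<lambda>x. indicator (cbox a b) x * 1) \<in> L2 S"
    proof -
      have m: "indicat_real (cbox a b) \<in> borel_measurable (lebesgue_on S)"
        by (intro measurable_restrict_space1 borel_measurable_indicator) simp
      then have "integrable (lebesgue_on S) (indicat_real (cbox a b))"
        by (intro bounded_compact_support_integrable[of S _ 1 "cbox a b"] Sl) (auto simp: indicator_def)
      with m show ?thesis by (simp add: L2_def power2_eq_square indicator_inter_arith[symmetric])
    qed
    from L2_mult_integrable[OF this h] have "integrable (lebesgue_on S) f" by (simp add: f_def[abs_def])
    moreover have f0: "f x = 0" if "x \<notin> S" for x using that ab by (auto simp: f_def indicator_def)
    ultimately have f: "integrable lebesgue f" by (simp add: integrable_lebesgue_on[OF Sl])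
    have box0: "(LINT x|lebesgue. indicator (box c d) x * h x) = 0" if cd: "cbox c d \<subseteq> cbox a b" for c d
    proof -
      obtain \<phi> where \<phi>: "\<And>k. \<phi> k \<in> test_functions S" "\<And>k x. \<bar>\<phi> k x\<bar> \<le> indicator (cbox c d) x"
        "\<And>x. (\<lambda>k. \<phi> k x) \<longlonglongrightarrow> indicator (box c d) x"
        by (rule that[OF box_indicator_limit(1)[OF order_trans[OF cd ab]] box_indicator_limit(2) box_indicator_limit(3)])
      have meas: "\<phi> k \<in> borel_measurable lebesgue" for k
        using smooth_measurable[OF test_functionsD[OF \<phi>(1)], where S = UNIV] by (simp add: lebesgue_on_UNIV_eq)
      have zero_out: "\<phi> k x = 0" if "x \<notin> cbox a b" for k x
      proof -
        have "x \<notin> cbox c d" using that cd by blast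
        then show ?thesis using \<phi>(2)[of k x] by simp
      qed
      have eq: "\<phi> k x * h x = \<phi> k x * f x" for k x using zero_out[of x k] by (auto simp: f_def indicator_def)
      have "(\<lambda>k. LINT x|lebesgue. \<phi> k x * f x) \<longlonglongrightarrow> (LINT x|lebesgue. indicator (box c d) x * f x)"
      proof (rule integral_dominated_convergence[where w = "\<lambda>x. \<bar>f x\<bar>"])
        show "integrable lebesgue (\<lambda>x. \<bar>f x\<bar>)" using f by simp
        show "AE x in lebesgue. (\<lambda>k. \<phi> k x * f x) \<longlonglongrightarrow> indicator (box c d) x * f x"
          using \<phi>(3) by (intro AE_I2 tendsto_mult tendsto_const)
        show "AE x in lebesgue. norm (\<phi> k x * f x) \<le> \<bar>f x\<bar>" for k
        proof (rule AE_I2)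
          fix x show "norm (\<phi> k x * f x) \<le> \<bar>f x\<bar>"
            using mult_right_mono[OF order_trans[OF \<phi>(2)[of k x] indicator_le_1], of "\<bar>f x\<bar>"]
            by (simp add: abs_mult)
        qed
      qed (use f meas in \<open>auto intro!: borel_measurable_times borel_measurable_indicator\<close>)
      moreover have "(LINT x|lebesgue. \<phi> k x * f x) = 0" for k
      proof -
        have "(LINT x|lebesgue. \<phi> k x * f x) = (LINT x|lebesgue_on S. \<phi> k x * f x)"
          using f0 by (intro integral_lebesgue_on[symmetric] Sl) simp
        also have "\<dots> = L2_inner S h (\<phi> k)" by (simp only: L2_inner_def mult.commute[of "h _"] eq)
        finally show ?thesis using zero[OF \<phi>(1)] by simp
      qed
      moreover have "indicator (box c d) x * f x = indicator (box c d) x * h x" for x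
        using cd by (auto simp: f_def indicator_def dest: subsetD[OF box_subset_cbox])
      ultimately show ?thesis by (simp add: LIMSEQ_const_iff)
    qed
    have ae: "AE x in lebesgue. x \<notin> cbox a b - box a b"
      using negligible_frontier_interval[of a b]
      by (intro AE_not_in) (simp add: negligible_iff_null_sets)
    \<comment> \<open>The boundary of the box is negligible, so \<open>f\<close> may be integrated
      over the open box. This reduces an arbitrary box to a sub-box of \<open>box a b\<close>, whose
      closure stays inside \<open>S\<close>.\<close>
    have fbox: "(LINT x|lebesgue. indicator A x * f x) = (LINT x|lebesgue. indicator (A \<inter> box a b) x * h x)"
      if "A \<in> sets lebesgue" for A
    proof (rule integral_cong_AE)
      show "(\<lambda>x. indicator A x * f x) \<in> borel_measurable lebesgue"
        by (intro borel_measurable_times borel_measurable_indicator that borel_measurable_integrable[OF f])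
      have eq: "(\<lambda>x. indicator (A \<inter> box a b) x * h x) = (\<lambda>x. indicator (A \<inter> box a b) x * f x)"
        by (auto simp: f_def indicator_def fun_eq_iff dest: subsetD[OF box_subset_cbox])
      show "(\<lambda>x. indicator (A \<inter> box a b) x * h x) \<in> borel_measurable lebesgue"
        unfolding eq using that
        by (intro borel_measurable_times borel_measurable_indicator borel_measurable_integrable[OF f]) auto
      show "AE x in lebesgue. indicator A x * f x = indicator (A \<inter> box a b) x * h x"
        using ae by eventually_elim (auto simp: f_def indicator_def dest: subsetD[OF box_subset_cbox])
    qed
    have sub: "(LINT x|lebesgue. indicator (box c d \<inter> box a b) x * h x) = 0" for c d
    proof -
      obtain c' d' where cd: "box c d \<inter> box a b = box c' d'" by (auto simp: box_Int_box)
      show ?thesis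
      proof (cases "box c' d' = {}")
        case False
        then have "cbox c' d' = closure (box c' d')" by simp
        also have "\<dots> \<subseteq> closure (box a b)" using cd by (intro closure_mono) auto
        also have "\<dots> \<subseteq> cbox a b" by (intro closure_minimal box_subset_cbox closed_cbox)
        finally show ?thesis using box0[of c' d'] cd by simp
      qed (simp add: cd)
    qed
    have "AE x in lebesgue. f x = 0"
    proof (rule AE_0_if_box_integrals_0[OF f])
      show "integral\<^sup>L lebesgue f = 0"
        using fbox[of UNIV] box0[of a b] by simp
      show "(LINT x|lebesgue. indicator (box c d) x * f x) = 0" for c d
        using fbox[of "box c d"] sub by simp
    qed
    then show ?thesis by eventually_elim (auto simp: f_def indicator_def)
  qed
  obtain \<D> where \<D>: "countable \<D>" "\<And>X. X \<in> \<D> \<Longrightarrow> X \<subseteq> S" "\<And>X. X \<in> \<D> \<Longrightarrow> \<exists>a b. X = cbox a b" "\<Union>\<D> = S"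
    by (rule open_countable_Union_open_cbox[OF S]) blast
  have "AE x in lebesgue. \<forall>X\<in>\<D>. x \<in> X \<longrightarrow> h x = 0"
  proof (subst AE_ball_countable[OF \<D>(1)], rule ballI)
    fix X assume X: "X \<in> \<D>"
    obtain a b where "X = cbox a b" using \<D>(3)[OF X] by blast
    then show "AE x in lebesgue. x \<in> X \<longrightarrow> h x = 0" using local[of a b] \<D>(2)[OF X] by simp
  qed
  then have "AE x in lebesgue. x \<in> S \<longrightarrow> h x = 0"
    by eventually_elim (use \<D> in auto)
  then show ?thesis using Sl by (simp add: AE_restrict_space_iff)
qed

section \<open>Approximate solvability of Schroedinger equations on the whole space\<close>

definition laplacian :: "(real^'n \<Rightarrow> real) \<Rightarrow> real^'n \<Rightarrow> real" where
  "laplacian u x = (\<Sum>i\<in>UNIV. partial i (partial i u) x)"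

lemma test_L2_UNIV: "\<phi> \<in> test_functions S \<Longrightarrow> \<phi> \<in> L2 UNIV"
  using test_L2[of \<phi> S UNIV] sets.top[of lebesgue] by simp

lemma test_laplacian: "\<phi> \<in> test_functions S \<Longrightarrow> laplacian \<phi> \<in> test_functions S"
  unfolding laplacian_def[abs_def] by (intro test_sum test_partial) simp_all

lemma laplacian_add:
  "smooth u \<Longrightarrow> smooth v \<Longrightarrow> laplacian (\<lambda>x. u x + v x) x = laplacian u x + laplacian v x"
  by (simp add: laplacian_def smooth_partial_rules smooth_partial sum.distrib)

lemma laplacian_scale: "smooth u \<Longrightarrow> laplacian (\<lambda>x. c * u x) x = c * laplacian u x"
  by (simp add: laplacian_def smooth_partial_rules(3) smooth_partial sum_distrib_left)

lemma inner_laplacian: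
  assumes "\<phi> \<in> test_functions UNIV"
  shows "L2_inner UNIV (laplacian \<phi>) \<phi> = - (\<Sum>i\<in>UNIV. (L2_norm UNIV (partial i \<phi>))\<^sup>2)"
proof -
  have "L2_inner UNIV (laplacian \<phi>) \<phi> = (\<Sum>i\<in>UNIV. L2_inner UNIV (partial i (partial i \<phi>)) \<phi>)"
    unfolding laplacian_def[abs_def]
    using assms by (intro L2_inner_sum_left test_L2_UNIV) (auto intro: test_partial test_L2_UNIV)
  also have "\<dots> = (\<Sum>i\<in>UNIV. - (L2_norm UNIV (partial i \<phi>))\<^sup>2)"
  proof (rule sum.cong[OF refl])
    fix i
    have "L2_inner UNIV (partial i (partial i \<phi>)) \<phi> = - L2_inner UNIV (partial i \<phi>) (partial i \<phi>)"
      using sets.top[of lebesgue]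
      by (intro integration_by_parts smooth_partial test_functionsD[OF assms] assms) simp
    then show "L2_inner UNIV (partial i (partial i \<phi>)) \<phi> = - (L2_norm UNIV (partial i \<phi>))\<^sup>2"
      using L2.nrm_square[OF test_L2_UNIV[OF test_partial[OF assms]]] by simp
  qed
  finally show ?thesis by (simp add: sum_negf)
qed

text \<open>Pairing the operator with \<open>\<phi>\<close> gives \<open>\<mu>\<close> times the
  squared norm of \<open>\<phi>\<close> plus the gradient energy, which is nonnegative.\<close>

lemma resolvent_bound:
  assumes \<phi>: "\<phi> \<in> test_functions UNIV" and "0 < \<mu>"
  shows "\<mu> * L2_norm UNIV \<phi> \<le> L2_norm UNIV (\<lambda>x. \<mu> * \<phi> x - laplacian \<phi> x)"
proof (cases "L2_norm UNIV \<phi> = 0")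
  case True
  have "(\<lambda>x. \<mu> * \<phi> x - laplacian \<phi> x) \<in> L2 UNIV"
    by (intro L2.mem_intros test_L2_UNIV[OF \<phi>] test_L2_UNIV[OF test_laplacian[OF \<phi>]])
  from L2.nrm_nonneg[OF this] show ?thesis using True by simp
next
  case False
  have L: "\<phi> \<in> L2 UNIV" "laplacian \<phi> \<in> L2 UNIV"
    using \<phi> test_laplacian[OF \<phi>] by (auto intro: test_L2_UNIV)
  have pos: "0 < L2_norm UNIV \<phi>" using False L2.nrm_nonneg[OF L(1)] by simp
  have "L2_inner UNIV (\<lambda>x. \<mu> * \<phi> x - laplacian \<phi> x) \<phi> =
      \<mu> * (L2_norm UNIV \<phi>)\<^sup>2 + (\<Sum>i\<in>UNIV. (L2_norm UNIV (partial i \<phi>))\<^sup>2)"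
    using L by (simp add: L2.ip_simps inner_laplacian[OF \<phi>] L2.nrm_square)
  moreover have "0 \<le> (\<Sum>i\<in>UNIV. (L2_norm UNIV (partial i \<phi>))\<^sup>2)" by (intro sum_nonneg) simp
  moreover have "L2_inner UNIV (\<lambda>x. \<mu> * \<phi> x - laplacian \<phi> x) \<phi> \<le>
      L2_norm UNIV (\<lambda>x. \<mu> * \<phi> x - laplacian \<phi> x) * L2_norm UNIV \<phi>"
    by (rule order_trans[OF abs_ge_self L2.Cauchy_Schwarz]) (intro L2.mem_intros L)+
  ultimately have "(\<mu> * L2_norm UNIV \<phi>) * L2_norm UNIV \<phi> \<le>
      L2_norm UNIV (\<lambda>x. \<mu> * \<phi> x - laplacian \<phi> x) * L2_norm UNIV \<phi>"
    by (simp add: power2_eq_square)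
  then show ?thesis using pos by (simp only: mult_le_cancel_right_pos)
qed

text \<open>One step of the symmetric random walk of length \<open>h\<close>. It is an
  \<open>L2\<close> contraction on test functions and commutes with derivatives, and
  \<open>2 * CARD('n) / h^2\<close> times its difference to the identity is the discrete
  Laplacian.\<close>

definition avg :: "real \<Rightarrow> (real^'n \<Rightarrow> real) \<Rightarrow> real^'n \<Rightarrow> real" where
  "avg h g x = (1 / (2 * real CARD('n))) * (\<Sum>i\<in>UNIV. g (x + h *\<^sub>R axis i 1) + g (x + (-h) *\<^sub>R axis i 1))"

definition lap_err :: "real \<Rightarrow> (real^'n \<Rightarrow> real) \<Rightarrow> real^'n \<Rightarrow> real" where
  "lap_err h g x = laplacian g x - (2 * real CARD('n) / h\<^sup>2) * (avg h g x - g x)"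

lemma test_avg: "g \<in> test_functions UNIV \<Longrightarrow> avg h g \<in> test_functions UNIV"
  unfolding avg_def[abs_def] by (intro test_scale test_sum test_add test_translate) simp_all

lemma test_lap_err: "g \<in> test_functions UNIV \<Longrightarrow> lap_err h g \<in> test_functions UNIV"
  unfolding lap_err_def[abs_def] by (intro test_diff test_scale test_avg test_laplacian)

lemma norm_translate:
  assumes "g \<in> test_functions UNIV" shows "L2_norm UNIV (\<lambda>x. g (x + h)) = L2_norm UNIV g"
proof -
  have "(\<lambda>x. g x * g x) \<in> borel_measurable borel"
    using smooth_borel[OF smooth_mult[OF test_functionsD[OF assms] test_functionsD[OF assms]]] .
  from integral_translate[OF this] show ?thesis
    by (simp add: L2_norm_def L2_inner_def lebesgue_on_UNIV_eq)
qed

lemma norm_avg_le: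
  fixes g :: "real^'n \<Rightarrow> real"
  assumes g: "g \<in> test_functions UNIV" shows "L2_norm UNIV (avg h g) \<le> L2_norm UNIV g"
proof -
  have mem: "(\<lambda>x. g (x + k)) \<in> L2 UNIV" for k
    by (rule test_L2_UNIV[OF test_translate[OF g]])
  have "L2_norm UNIV (\<lambda>x. \<Sum>i\<in>UNIV. g (x + h *\<^sub>R axis i 1) + g (x + (-h) *\<^sub>R axis i 1))
      \<le> (\<Sum>i\<in>(UNIV::'n set). L2_norm UNIV (\<lambda>x. g (x + h *\<^sub>R axis i 1) + g (x + (-h) *\<^sub>R axis i 1)))"
    by (intro L2_norm_sum L2.mem_intros mem) simp
  also have "\<dots> \<le> (\<Sum>i\<in>(UNIV::'n set). 2 * L2_norm UNIV g)"
    by (intro sum_mono order_trans[OF L2.nrm_triangle[OF mem mem]]) (simp only: norm_translate[OF g])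
  finally have *: "L2_norm UNIV (\<lambda>x. \<Sum>i\<in>UNIV. g (x + h *\<^sub>R axis i 1) + g (x + (-h) *\<^sub>R axis i 1))
      \<le> real CARD('n) * (2 * L2_norm UNIV g)" by simp
  have mem': "(\<lambda>x. \<Sum>i\<in>UNIV. g (x + h *\<^sub>R axis i 1) + g (x + (-h) *\<^sub>R axis i 1)) \<in> L2 UNIV"
    by (intro L2_sum L2.mem_intros mem) simp
  have "L2_norm UNIV (avg h g) = 1 / (2 * real CARD('n)) *
      L2_norm UNIV (\<lambda>x. \<Sum>i\<in>UNIV. g (x + h *\<^sub>R axis i 1) + g (x + (-h) *\<^sub>R axis i 1))"
    unfolding avg_def[abs_def] by (subst L2.nrm_scale[OF mem']) simp
  also have "\<dots> \<le> 1 / (2 * real CARD('n)) * (real CARD('n) * (2 * L2_norm UNIV g))"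
    by (intro mult_left_mono *) simp
  finally show ?thesis by simp
qed

lemma partial_avg:
  fixes g :: "real^'n \<Rightarrow> real"
  assumes g: "smooth g" shows "partial j (avg h g) = avg h (partial j g)"
proof
  fix x :: "real^'n"
  have t: "smooth (\<lambda>x. g (x + k))" "partial j (\<lambda>x. g (x + k)) x = partial j g (x + k)" for k
    using g by (auto intro: smooth_translate partial_translate smooth_differentiable)
  have sm: "smooth (\<lambda>x. g (x + h *\<^sub>R axis i 1) + g (x + (-h) *\<^sub>R axis i 1))" for i
    by (intro smooth_add t)
  have "partial j (avg h g) x = (1 / (2 * real CARD('n))) *
      (\<Sum>i\<in>UNIV. partial j (\<lambda>x. g (x + h *\<^sub>R axis i 1) + g (x + (-h) *\<^sub>R axis i 1)) x)"
    unfolding avg_def[abs_def]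
    by (simp only: partial_scale[OF smooth_differentiable[OF smooth_sum[OF finite sm]]] partial_sum[OF finite sm])
  also have "\<dots> = avg h (partial j g) x"
    unfolding avg_def by (simp only: partial_add[OF smooth_differentiable[OF t(1)] smooth_differentiable[OF t(1)]] t(2))
  finally show "partial j (avg h g) x = avg h (partial j g) x" .
qed

lemma laplacian_avg:
  assumes "smooth g" shows "laplacian (avg h g) = avg h (laplacian g)"
  using assms
  by (simp add: laplacian_def[abs_def] partial_avg smooth_partial)
     (simp add: avg_def fun_eq_iff sum_distrib_left sum.distrib flip: sum.distrib, subst sum.swap, simp)

text \<open>Averaging commutes with translations and derivatives, so the consistency error of an
  iterated average is an iterated average of the error of \<open>g\<close> and does not
  grow.\<close>

lemma lap_err_avg:
  fixes g :: "real^'n \<Rightarrow> real"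
  assumes "smooth g" shows "lap_err h (avg h g) = avg h (lap_err h g)"
proof
  fix x :: "real^'n"
  have lin: "avg h (\<lambda>x. u x - c * (v x - w x)) x = avg h u x - c * (avg h v x - avg h w x)" for u v w :: "real^'n \<Rightarrow> real" and c
    by (simp add: avg_def sum.distrib sum_subtractf sum_distrib_left algebra_simps)
  show "lap_err h (avg h g) x = avg h (lap_err h g) x"
    unfolding lap_err_def[abs_def] lin laplacian_avg[OF assms] by simp
qed

text \<open>Maclaurin's formula for \<open>g (x + t e) + g (x - t e)\<close>: being even in
  \<open>t\<close>, it has no first-order term. The second derivatives in the remainder are compared
  with the one at \<open>x\<close> through the third derivative; the rate \<open>h\<close> is enough
  for what follows.\<close>

lemma second_difference_error:
  fixes g :: "real^'n \<Rightarrow> real"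
  assumes g: "smooth g" and B: "\<And>x. \<bar>partial i (partial i (partial i g)) x\<bar> \<le> B" and h: "0 < h"
  shows "\<bar>partial i (partial i g) x - (g (x + h *\<^sub>R axis i 1) + g (x + (-h) *\<^sub>R axis i 1) - 2 * g x) / h\<^sup>2\<bar> \<le> B * h"
proof -
  let ?e = "axis i (1::real)"
  let ?d = "\<lambda>(m::nat) t. if m = 0 then g (x + t *\<^sub>R ?e) + g (x + (-t) *\<^sub>R ?e)
     else if m = 1 then partial i g (x + t *\<^sub>R ?e) - partial i g (x + (-t) *\<^sub>R ?e)
     else partial i (partial i g) (x + t *\<^sub>R ?e) + partial i (partial i g) (x + (-t) *\<^sub>R ?e)"
  have plus: "((\<lambda>t. u (x + t *\<^sub>R ?e)) has_real_derivative partial i u (x + t *\<^sub>R ?e)) (at t)"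
    if "smooth u" for u t
    by (intro axis_has_derivative smooth_differentiable that)
  have minus: "((\<lambda>t. u (x + (-t) *\<^sub>R ?e)) has_real_derivative - partial i u (x + (-t) *\<^sub>R ?e)) (at t)"
    if "smooth u" for u t
    using DERIV_chain2[OF axis_has_derivative[OF smooth_differentiable[OF that], where t = "- t" and x = x and i = i]
        DERIV_minus[OF DERIV_ident, of t UNIV]] by simp
  have "\<exists>t. 0 < t \<and> t < h \<and> ?d 0 h = (\<Sum>m<2. ?d m 0 / fact m * h ^ m) + ?d 2 t / fact 2 * h ^ 2"
  proof (rule Maclaurin)
    show "\<forall>m t. m < 2 \<and> 0 \<le> t \<and> t \<le> h \<longrightarrow> ((\<lambda>t. ?d m t) has_real_derivative ?d (Suc m) t) (at t)"
    proof (intro allI impI)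
      fix m :: nat and t assume "m < 2 \<and> 0 \<le> t \<and> t \<le> h"
      then consider "m = 0" | "m = 1" by linarith
      then show "((\<lambda>t. ?d m t) has_real_derivative ?d (Suc m) t) (at t)"
      proof cases
        case 1
        then show ?thesis using DERIV_add[OF plus[OF g] minus[OF g]] by simp
      next
        case 2
        then show ?thesis
          using DERIV_diff[OF plus[OF smooth_partial[OF g]] minus[OF smooth_partial[OF g]]] by simp
      qed
    qed
  qed (use h in auto)
  then obtain t where t: "0 < t" "t < h" and "?d 0 h = (\<Sum>m<2. ?d m 0 / fact m * h ^ m) + ?d 2 t / fact 2 * h ^ 2"
    by blast
  then have eq: "(g (x + h *\<^sub>R ?e) + g (x + (-h) *\<^sub>R ?e) - 2 * g x) / h\<^sup>2 =
      (partial i (partial i g) (x + t *\<^sub>R ?e) + partial i (partial i g) (x + (-t) *\<^sub>R ?e)) / 2"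
    using h by (simp add: numeral_2_eq_2 field_simps)
  have sm: "smooth (partial i (partial i g))" by (intro smooth_partial g)
  have lip: "\<bar>partial i (partial i g) (y + t *\<^sub>R ?e) - partial i (partial i g) y\<bar> \<le> B * h" for y
  proof -
    obtain s where "partial i (partial i g) (y + t *\<^sub>R ?e) - partial i (partial i g) y =
        t * partial i (partial i (partial i g)) (y + s *\<^sub>R ?e)"
      using axis_mvt[OF sm t(1), of y i] by blast
    moreover have "\<bar>t * partial i (partial i (partial i g)) (y + s *\<^sub>R ?e)\<bar> \<le> h * B"
      unfolding abs_mult using t B by (intro mult_mono) auto
    ultimately show ?thesis by (simp add: mult.commute)
  qed
  define p q r where "p = partial i (partial i g) (x + t *\<^sub>R ?e)" and "q = partial i (partial i g) x"
    and "r = partial i (partial i g) (x + (-t) *\<^sub>R ?e)"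
  have "\<bar>p - q\<bar> \<le> B * h" "\<bar>q - r\<bar> \<le> B * h"
    using lip[of x] lip[of "x + (-t) *\<^sub>R ?e"] by (simp_all add: p_def q_def r_def)
  then have "\<bar>q - (p + r) / 2\<bar> \<le> B * h" by argo
  then show ?thesis unfolding eq by (simp add: p_def q_def r_def)
qed

text \<open>For \<open>h \<le> 1\<close> the error lives in one fixed ball, so the pointwise bound
  of order \<open>h\<close> becomes an \<open>L2\<close> bound of order \<open>h\<close>.\<close>

lemma lap_err_bound:
  fixes g :: "real^'n \<Rightarrow> real"
  assumes g: "g \<in> test_functions UNIV"
  obtains C where "0 \<le> C" "\<And>h. 0 < h \<Longrightarrow> h \<le> 1 \<Longrightarrow> L2_norm UNIV (lap_err h g) \<le> C * h"
proof -
  have sm: "smooth g" using g by (rule test_functionsD)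
  obtain K where K: "compact K" "\<And>x. x \<notin> K \<Longrightarrow> g x = 0" using g by (rule test_functionsE) blast
  obtain R where R: "\<And>x. x \<in> K \<Longrightarrow> norm x \<le> R" using compact_imp_bounded[OF K(1)] by (auto simp: bounded_iff)
  have "\<exists>B. \<forall>x. \<bar>partial i (partial i (partial i g)) x\<bar> \<le> B" for i
  proof -
    obtain B where "\<And>x. \<bar>partial i (partial i (partial i g)) x\<bar> \<le> B"
      using test_partial[OF test_partial[OF test_partial[OF g]]] by (rule test_bounded) blast
    then show ?thesis by blast
  qed
  then obtain B where B: "\<And>i x. \<bar>partial i (partial i (partial i g)) x\<bar> \<le> B i" by metis
  define I where "I = indicat_real (cball (0::real^'n) (R + 1))"
  have I_int: "integrable lebesgue I"
    unfolding I_def using lmeasurable_cball[of "0::real^'n" "R + 1"] by (auto simp: fmeasurable_def)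
  moreover have "(I x)\<^sup>2 = I x" for x by (simp add: I_def indicator_def)
  ultimately have I: "I \<in> L2 UNIV" by (auto simp: L2_def lebesgue_on_UNIV_eq)
  define B' where "B' = (\<Sum>i\<in>UNIV. B i)"
  have "0 \<le> B i" for i using B[of i 0] by linarith
  then have B'0: "0 \<le> B'" by (simp add: B'_def sum_nonneg)
  have "L2_norm UNIV (lap_err h g) \<le> B' * L2_norm UNIV I * h" if h: "0 < h" "h \<le> 1" for h
  proof -
    have eq: "lap_err h g x = (\<Sum>i\<in>UNIV. partial i (partial i g) x -
        (g (x + h *\<^sub>R axis i 1) + g (x + (-h) *\<^sub>R axis i 1) - 2 * g x) / h\<^sup>2)" for x
    proof -
      have "(2 * real CARD('n) / h\<^sup>2) * (avg h g x - g x) =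
          (\<Sum>i\<in>UNIV. (g (x + h *\<^sub>R axis i 1) + g (x + (-h) *\<^sub>R axis i 1) - 2 * g x) / h\<^sup>2)"
      proof -
        have *: "(2 * C / h\<^sup>2) * ((1 / (2 * C)) * S - gx) = (S - C * (2 * gx)) / h\<^sup>2" if "C \<noteq> 0" for C S gx
          using that h by (simp add: field_simps)
        show ?thesis unfolding avg_def sum_divide_distrib[symmetric] sum_subtractf
          by (subst *) simp_all
      qed
      then show ?thesis by (simp add: lap_err_def laplacian_def sum_subtractf)
    qed
    have "\<bar>lap_err h g x\<bar> \<le> \<bar>(B' * h) * I x\<bar>" for x
    proof (cases "x \<in> cball 0 (R + 1)")
      case True
      have "\<bar>lap_err h g x\<bar> \<le> (\<Sum>i\<in>UNIV. B i * h)"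
        unfolding eq by (intro order_trans[OF sum_abs] sum_mono second_difference_error sm B h)
      then show ?thesis using True B'0 h by (simp add: I_def B'_def sum_distrib_right)
    next
      case False
      then have x: "norm x > R + 1" by simp
      have far: "g y = 0" if "norm (x - y) \<le> 1" for y
      proof (rule K(2))
        show "y \<notin> K"
        proof
          assume "y \<in> K"
          then have "norm y \<le> R" by (rule R)
          with x that norm_triangle_sub[of x y] show False by simp
        qed
      qed
      have "g (x + h *\<^sub>R axis i 1) = 0" "g (x + (-h) *\<^sub>R axis i 1) = 0" for i
        using h by (auto intro!: far)
      moreover have "x \<notin> K" using R[of x] x by auto
      then have "partial i (partial i g) x = 0" for i
        by (intro partial_zero_outside[OF compact_imp_closed[OF K(1)]] K(2))
      ultimately have "lap_err h g x = 0" unfolding eq using far[of x] by simp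
      then show ?thesis by simp
    qed
    then have "L2_norm UNIV (lap_err h g) \<le> L2_norm UNIV (\<lambda>x. (B' * h) * I x)"
      by (intro L2_norm_mono_AE L2.mem_intros I test_L2_UNIV[OF test_lap_err[OF g]] AE_I2)
    also have "\<dots> = B' * L2_norm UNIV I * h" using B'0 h by (simp add: L2.nrm_scale[OF I])
    finally show ?thesis .
  qed
  then show ?thesis using that[of "B' * L2_norm UNIV I"] B'0 L2.nrm_nonneg[OF I] by simp
qed

text \<open>Testing with iterated averages of \<open>g\<close> gives a sequence \<open>b\<^sub>n\<close> that would grow geometrically
  if \<open>b\<^sub>0\<close> exceeded the consistency error of the discrete Laplacian; but it is bounded.\<close>
lemma orthogonal_resolvent_range:
  fixes y :: "real^'n \<Rightarrow> real"
  assumes y: "y \<in> L2 UNIV" and \<mu>: "0 < \<mu>"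
    and perp: "\<And>\<psi>. \<psi> \<in> test_functions UNIV \<Longrightarrow> L2_inner UNIV (\<lambda>x. \<mu> * \<psi> x - laplacian \<psi> x) y = 0"
    and g: "g \<in> test_functions UNIV"
  shows "L2_inner UNIV g y = 0"
proof -
  obtain C where C: "0 \<le> C" "\<And>h. 0 < h \<Longrightarrow> h \<le> 1 \<Longrightarrow> L2_norm UNIV (lap_err h g) \<le> C * h"
    using lap_err_bound[OF g] by blast
  define Y where "Y = L2_norm UNIV y"
  have Y0: "0 \<le> Y" using L2.nrm_nonneg[OF y] by (simp add: Y_def)
  \<comment> \<open>\<open>C * Y / \<mu> * h\<close> is the level at which the gain from
    \<open>\<mu>\<close> balances the consistency error in the recursion below; it tends to zero
    with \<open>h\<close>.\<close>
  have small: "\<bar>L2_inner UNIV g y\<bar> \<le> C * Y / \<mu> * h" if h: "0 < h" "h \<le> 1" for h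
  proof (rule ccontr)
    assume contra: "\<not> ?thesis"
    define G where "G n = (avg h ^^ n) g" for n
    have G: "G n \<in> test_functions UNIV" for n
      by (induction n) (simp_all add: G_def g test_avg)
    have G_norm: "L2_norm UNIV (G n) \<le> L2_norm UNIV g" for n
    proof (induction n)
      case (Suc n)
      have "L2_norm UNIV (G (Suc n)) \<le> L2_norm UNIV (G n)" using norm_avg_le[OF G] by (simp add: G_def)
      with Suc show ?case by simp
    qed (simp add: G_def)
    have err_norm: "L2_norm UNIV (lap_err h (G n)) \<le> C * h" for n
    proof (induction n)
      case 0 show ?case using C(2)[OF h] by (simp add: G_def)
    next
      case (Suc n)
      have "lap_err h (G (Suc n)) = avg h (lap_err h (G n))"
        using lap_err_avg[OF test_functionsD[OF G]] by (simp add: G_def)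
      then show ?case using norm_avg_le[OF test_lap_err[OF G], of h h n] Suc by simp
    qed
    define b where "b n = L2_inner UNIV (G n) y" for n
    \<comment> \<open>Reciprocal of the factor in the discrete Laplacian: up to the consistency
      error, \<open>avg h\<close> is an explicit Euler step of length \<open>s\<close> for the heat
      equation.\<close>
    define s where "s = h\<^sup>2 / (2 * real CARD('n))"
    have s0: "0 < s" using h by (simp add: s_def)
    define e where "e n = L2_inner UNIV (lap_err h (G n)) y" for n
    have e_bound: "\<bar>e n\<bar> \<le> C * h * Y" for n
    proof -
      have "\<bar>e n\<bar> \<le> L2_norm UNIV (lap_err h (G n)) * Y"
        unfolding e_def Y_def by (intro L2.Cauchy_Schwarz y test_L2_UNIV[OF test_lap_err[OF G]])
      also have "\<dots> \<le> C * h * Y" by (intro mult_right_mono err_norm Y0)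
      finally show ?thesis .
    qed
    \<comment> \<open>Orthogonality to the range turns the Laplacian of \<open>G n\<close>, once
      paired with \<open>y\<close>, into multiplication by \<open>\<mu>\<close>.\<close>
    have rec: "b (Suc n) = (1 + s * \<mu>) * b n - s * e n" for n
    proof -
      have L: "G n \<in> L2 UNIV" "laplacian (G n) \<in> L2 UNIV" "G (Suc n) \<in> L2 UNIV"
        using G test_laplacian[OF G] by (auto intro: test_L2_UNIV)
      have GS: "avg h (G n) = G (Suc n)" by (simp add: G_def)
      have eq: "lap_err h (G n) = (\<lambda>x. laplacian (G n) x - (1/s) * (G (Suc n) x - G n x))"
        by (simp add: lap_err_def[abs_def] s_def GS)
      have "e n = L2_inner UNIV (laplacian (G n)) y - (1/s) * (b (Suc n) - b n)"
        unfolding e_def b_def eq using L y by (simp only: L2.ip_diff_left L2.ip_scale_left L2.mem_intros)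
      moreover have "L2_inner UNIV (laplacian (G n)) y = \<mu> * b n"
        using perp[OF G, of n] L y by (simp add: L2.ip_simps b_def)
      ultimately show ?thesis using s0 by (simp add: field_simps)
    qed
    define q where "q = C * Y / \<mu> * h"
    define a where "a = \<bar>b 0\<bar> - q"
    have a0: "0 < a" using contra by (simp add: a_def q_def b_def G_def)
    have grow: "(1 + s * \<mu>) ^ n * a \<le> \<bar>b n\<bar> - q" for n
    proof (induction n)
      case 0 show ?case by (simp add: a_def)
    next
      case (Suc n)
      have "s * \<bar>e n\<bar> \<le> s * \<mu> * q"
        using e_bound[of n] s0 \<mu> by (simp add: q_def mult.commute mult.left_commute)
      moreover have "(1 + s * \<mu>) * \<bar>b n\<bar> - s * \<bar>e n\<bar> \<le> \<bar>b (Suc n)\<bar>"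
      proof -
        have "(1 + s * \<mu>) * \<bar>b n\<bar> - s * \<bar>e n\<bar> = \<bar>(1 + s * \<mu>) * b n\<bar> - \<bar>s * e n\<bar>"
          using s0 \<mu> by (simp add: abs_mult add_pos_pos)
        also have "\<dots> \<le> \<bar>b (Suc n)\<bar>" unfolding rec by arith
        finally show ?thesis .
      qed
      moreover have "(1 + s * \<mu>) * ((1 + s * \<mu>) ^ n * a) \<le> (1 + s * \<mu>) * (\<bar>b n\<bar> - q)"
        using Suc s0 \<mu> by (intro mult_left_mono) (auto simp: add_pos_pos less_imp_le)
      ultimately show ?case by (simp add: algebra_simps)
    qed
    have b_bound: "\<bar>b n\<bar> \<le> L2_norm UNIV g * Y" for n
    proof -
      have "\<bar>b n\<bar> \<le> L2_norm UNIV (G n) * Y"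
        unfolding b_def Y_def by (intro L2.Cauchy_Schwarz y test_L2_UNIV[OF G])
      also have "\<dots> \<le> L2_norm UNIV g * Y" by (intro mult_right_mono G_norm Y0)
      finally show ?thesis .
    qed
    have "0 \<le> q" using C(1) Y0 \<mu> h by (simp add: q_def)
    obtain n where "L2_norm UNIV g * Y / a < (1 + s * \<mu>) ^ n"
      using real_arch_pow[of "1 + s * \<mu>"] s0 \<mu> by auto
    then have "L2_norm UNIV g * Y < (1 + s * \<mu>) ^ n * a" using a0 by (simp add: field_simps)
    with grow[of n] b_bound[of n] \<open>0 \<le> q\<close> show False by linarith
  qed
  have "\<bar>L2_inner UNIV g y\<bar> \<le> 0"
  proof (rule LIMSEQ_le_const)
    show "(\<lambda>n. C * Y / \<mu> * inverse (real (Suc n))) \<longlonglongrightarrow> 0"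
      by (rule tendsto_mult_right_zero[OF LIMSEQ_inverse_real_of_nat])
    show "\<exists>N. \<forall>n\<ge>N. \<bar>L2_inner UNIV g y\<bar> \<le> C * Y / \<mu> * inverse (real (Suc n))"
      by (intro exI allI impI small) (simp_all add: field_simps)
  qed
  then show ?thesis by simp
qed

text \<open>A vector orthogonal to the range is orthogonal to all test functions by
  \<open>orthogonal_resolvent_range\<close>, hence vanishes by the fundamental lemma.\<close>

lemma resolvent_range_dense:
  fixes z :: "real^'n \<Rightarrow> real"
  assumes z: "z \<in> L2 UNIV" and \<mu>: "0 < \<mu>"
  obtains \<psi> where "\<And>n::nat. \<psi> n \<in> test_functions UNIV"
    "strong_conv (L2_norm UNIV) (\<lambda>n x. \<mu> * \<psi> n x - laplacian (\<psi> n) x) z"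
proof -
  define M where "M = (\<lambda>\<psi> x. \<mu> * \<psi> x - laplacian \<psi> x) ` test_functions (UNIV :: (real^'n) set)"
  have memL2: "(\<lambda>x. \<mu> * \<psi> x - laplacian \<psi> x) \<in> L2 UNIV" if "\<psi> \<in> test_functions UNIV" for \<psi> :: "real^'n \<Rightarrow> real"
    by (intro L2.mem_intros test_L2_UNIV[OF that] test_L2_UNIV[OF test_laplacian[OF that]])
  obtain X where X: "\<And>n. X n \<in> M" "strong_conv (L2_norm UNIV) X z"
  proof (rule L2.in_closure_if_biorthogonal[of M UNIV z])
    show "M \<subseteq> L2 UNIV" using memL2 by (auto simp: M_def)
    show "(\<lambda>x. 0) \<in> M" unfolding M_def
      by (rule image_eqI[OF _ test_zero]) (simp add: laplacian_def smooth_partial_rules partial_const fun_eq_iff partial_const[abs_def])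
    show "(\<lambda>x. u x + v x) \<in> M" if uv: "u \<in> M" "v \<in> M" for u v
    proof -
      obtain \<phi> \<psi> where "\<phi> \<in> test_functions UNIV" "\<psi> \<in> test_functions UNIV"
        "u = (\<lambda>x. \<mu> * \<phi> x - laplacian \<phi> x)" "v = (\<lambda>x. \<mu> * \<psi> x - laplacian \<psi> x)"
        using uv by (auto simp: M_def)
      then show ?thesis unfolding M_def
        by (intro image_eqI[of _ _ "\<lambda>x. \<phi> x + \<psi> x"] test_add)
           (auto simp: laplacian_add test_functionsD algebra_simps)
    qed
    show "(\<lambda>x. c * u x) \<in> M" if u: "u \<in> M" for c u
    proof -
      obtain \<phi> where "\<phi> \<in> test_functions UNIV" "u = (\<lambda>x. \<mu> * \<phi> x - laplacian \<phi> x)"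
        using u by (auto simp: M_def)
      then show ?thesis unfolding M_def
        by (intro image_eqI[of _ _ "\<lambda>x. c * \<phi> x"] test_scale)
           (auto simp: laplacian_scale test_functionsD algebra_simps)
    qed
    fix y assume y: "y \<in> L2 UNIV" and perp: "\<And>m. m \<in> M \<Longrightarrow> L2_inner UNIV m y = 0"
    have "AE x in lebesgue_on UNIV. y x = 0"
    proof (rule fundamental_lemma[OF open_UNIV y])
      fix \<phi> :: "real^'n \<Rightarrow> real" assume \<phi>: "\<phi> \<in> test_functions UNIV"
      have "L2_inner UNIV \<phi> y = 0"
        by (rule orthogonal_resolvent_range[OF y \<mu> _ \<phi>]) (rule perp, simp add: M_def)
      then show "L2_inner UNIV y \<phi> = 0" using L2.ip_commute[OF y test_L2_UNIV[OF \<phi>]] by simp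
    qed
    then have "L2_norm UNIV y = 0" using L2_norm_eq_0_iff[OF y] by simp
    then show "L2_inner UNIV z y = 0" using L2.Cauchy_Schwarz[OF z y] by simp
  qed (use z in auto)
  have "\<exists>\<psi>. \<psi> \<in> test_functions UNIV \<and> X n = (\<lambda>x. \<mu> * \<psi> x - laplacian \<psi> x)" for n
    using X(1)[of n] by (auto simp: M_def)
  then obtain \<psi> where "\<And>n. \<psi> n \<in> test_functions UNIV" "\<And>n. X n = (\<lambda>x. \<mu> * \<psi> n x - laplacian (\<psi> n) x)"
    by metis
  moreover from this(2) have "X = (\<lambda>n x. \<mu> * \<psi> n x - laplacian (\<psi> n) x)" by (rule ext)
  ultimately show ?thesis using that[of \<psi>] X(2) by simp
qed

text \<open>Perturbation of the constant potential \<open>m\<close>. For \<open>y\<close> orthogonal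
  to the range, the operator is written as \<open>\<mu> - \<Delta>\<close> minus multiplication by
  \<open>m - W\<close>, whose values lie between 0 and \<open>m\<close>, and approximate solutions
  of the equation with \<open>\<mu> = \<nu> + m\<close> and right-hand side \<open>y\<close> are
  inserted. With \<open>resolvent_bound\<close> this bounds the squared norm of \<open>y\<close> by
  \<open>m / \<mu> < 1\<close> times itself.\<close>

lemma schroedinger_range_dense:
  fixes z :: "real^'n \<Rightarrow> real"
  assumes z: "z \<in> L2 UNIV" and \<nu>: "0 < \<nu>"
    and W: "smooth W" and W_bounds: "\<And>x. 0 \<le> W x" "\<And>x. W x \<le> m" and "0 < \<delta>"
  obtains \<psi> where "\<psi> \<in> test_functions UNIV"
    "L2_norm UNIV (\<lambda>x. (\<nu> * \<psi> x + W x * \<psi> x - laplacian \<psi> x) - z x) < \<delta>"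
proof -
  define T where "T \<psi> x = \<nu> * \<psi> x + W x * \<psi> x - laplacian \<psi> x" for \<psi> and x :: "real^'n"
  have TL2: "T \<psi> \<in> L2 UNIV" if "\<psi> \<in> test_functions UNIV" for \<psi>
    unfolding T_def[abs_def]
    by (intro test_L2_UNIV[of _ UNIV] test_diff test_add test_scale test_mult_smooth[OF W] test_laplacian that)
  define M where "M = T ` test_functions (UNIV :: (real^'n) set)"
  have m0: "0 \<le> m" using W_bounds[of 0] by linarith
  obtain X where X: "\<And>n. X n \<in> M" "strong_conv (L2_norm UNIV) X z"
  proof (rule L2.in_closure_if_biorthogonal[of M UNIV z])
    show "M \<subseteq> L2 UNIV" using TL2 by (auto simp: M_def)
    show "(\<lambda>x. 0) \<in> M" unfolding M_def
      by (rule image_eqI[OF _ test_zero]) (simp add: T_def laplacian_def fun_eq_iff partial_const[abs_def])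
    show "(\<lambda>x. u x + v x) \<in> M" if uv: "u \<in> M" "v \<in> M" for u v
    proof -
      obtain \<phi> \<psi> where "\<phi> \<in> test_functions UNIV" "\<psi> \<in> test_functions UNIV" "u = T \<phi>" "v = T \<psi>"
        using uv by (auto simp: M_def)
      then show ?thesis unfolding M_def
        by (intro image_eqI[of _ _ "\<lambda>x. \<phi> x + \<psi> x"] test_add)
           (auto simp: T_def laplacian_add test_functionsD algebra_simps)
    qed
    show "(\<lambda>x. c * u x) \<in> M" if u: "u \<in> M" for c u
    proof -
      obtain \<phi> where "\<phi> \<in> test_functions UNIV" "u = T \<phi>" using u by (auto simp: M_def)
      then show ?thesis unfolding M_def
        by (intro image_eqI[of _ _ "\<lambda>x. c * \<phi> x"] test_scale)
           (auto simp: T_def laplacian_scale test_functionsD algebra_simps)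
    qed
    fix y assume y: "y \<in> L2 UNIV" and perp: "\<And>v. v \<in> M \<Longrightarrow> L2_inner UNIV v y = 0"
    define \<mu> where "\<mu> = \<nu> + m"
    have \<mu>: "0 < \<mu>" using \<nu> m0 by (simp add: \<mu>_def)
    obtain \<psi> where \<psi>: "\<And>n::nat. \<psi> n \<in> test_functions UNIV"
      and lim: "strong_conv (L2_norm UNIV) (\<lambda>n x. \<mu> * \<psi> n x - laplacian (\<psi> n) x) y"
      using resolvent_range_dense[OF y \<mu>] by blast
    define R where "R n x = \<mu> * \<psi> n x - laplacian (\<psi> n) x" for n x
    have R: "R n \<in> L2 UNIV" for n unfolding R_def[abs_def]
      by (intro L2.mem_intros test_L2_UNIV[OF \<psi>] test_L2_UNIV[OF test_laplacian[OF \<psi>]])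
    have limR: "strong_conv (L2_norm UNIV) R y" using lim by (simp add: R_def[abs_def])
    have "L2_inner UNIV (R n) y \<le> m / \<mu> * L2_norm UNIV (R n) * L2_norm UNIV y" for n
    proof -
      define P where "P x = (m - W x) * \<psi> n x" for x
      have P: "P \<in> L2 UNIV" unfolding P_def[abs_def]
        by (intro test_L2_UNIV[of _ UNIV] test_mult_smooth smooth_diff smooth_const W \<psi>)
      have "R n = (\<lambda>x. P x + T (\<psi> n) x)" by (simp add: fun_eq_iff R_def P_def T_def \<mu>_def algebra_simps)
      moreover have "L2_inner UNIV (T (\<psi> n)) y = 0" using \<psi> by (intro perp) (simp add: M_def)
      ultimately have "L2_inner UNIV (R n) y = L2_inner UNIV P y"
        using L2.ip_add_left[OF P TL2[OF \<psi>] y] by simp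
      also have "\<dots> \<le> L2_norm UNIV P * L2_norm UNIV y"
        using L2.Cauchy_Schwarz[OF P y] by linarith
      also have "\<dots> \<le> m / \<mu> * L2_norm UNIV (R n) * L2_norm UNIV y"
      proof (rule mult_right_mono[OF _ L2.nrm_nonneg[OF y]])
        have "L2_norm UNIV P \<le> L2_norm UNIV (\<lambda>x. m * \<psi> n x)"
        proof (intro L2_norm_mono_AE P L2.mem_intros test_L2_UNIV[OF \<psi>] AE_I2)
          show "\<bar>P x\<bar> \<le> \<bar>m * \<psi> n x\<bar>" for x
            unfolding P_def abs_mult using W_bounds[of x] by (intro mult_right_mono) auto
        qed
        also have "\<dots> = m * L2_norm UNIV (\<psi> n)" using m0 by (simp add: L2.nrm_scale[OF test_L2_UNIV[OF \<psi>]])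
        also have "\<dots> \<le> m * (L2_norm UNIV (R n) / \<mu>)"
          using resolvent_bound[OF \<psi> \<mu>, of n] \<mu> m0
          by (intro mult_left_mono) (auto simp: R_def[abs_def] field_simps)
        finally show "L2_norm UNIV P \<le> m / \<mu> * L2_norm UNIV (R n)" by simp
      qed
      finally show ?thesis .
    qed
    then have "L2_inner UNIV y y \<le> m / \<mu> * L2_norm UNIV y * L2_norm UNIV y"
      by (intro LIMSEQ_le[OF L2.strong_conv_ip[OF R y limR y]
            tendsto_mult_right[OF tendsto_mult_left[OF L2.strong_conv_nrm[OF R y limR]]]]) auto
    then have "(1 - m / \<mu>) * (L2_norm UNIV y)\<^sup>2 \<le> 0"
      using L2.nrm_square[OF y] by (simp add: power2_eq_square algebra_simps)
    moreover have "0 < 1 - m / \<mu>" using \<nu> m0 by (simp add: \<mu>_def)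
    ultimately have "L2_norm UNIV y = 0" by (simp add: mult_le_0_iff)
    then show "L2_inner UNIV z y = 0" using L2.Cauchy_Schwarz[OF z y] by simp
  qed (use z in auto)
  have "eventually (\<lambda>n. L2_norm UNIV (\<lambda>x. X n x - z x) < \<delta>) sequentially"
    using X(2) \<open>0 < \<delta>\<close> unfolding strong_conv_def by (intro order_tendstoD)
  then obtain n where n: "L2_norm UNIV (\<lambda>x. X n x - z x) < \<delta>" by (auto simp: eventually_sequentially)
  obtain \<psi> where "\<psi> \<in> test_functions UNIV" "X n = T \<psi>" using X(1)[of n] by (auto simp: M_def)
  with n that show ?thesis by (simp add: T_def[abs_def])
qed

section \<open>A weighted Bochner inequality\<close>

text \<open>The second difference is symmetric in the two directions. Applying the mean value
  theorem in either order represents it by either mixed derivative at nearby points, and continuity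
  identifies the limits.\<close>

lemma partial_commute:
  fixes f :: "real^'n \<Rightarrow> real"
  assumes f: "smooth f" shows "partial i (partial j f) x = partial j (partial i f) x"
proof -
  have mixed: "\<exists>s' t'. 0 < s' \<and> s' < s \<and> 0 < t' \<and> t' < s \<and>
      f (x + s *\<^sub>R axis i 1 + s *\<^sub>R axis j 1) - f (x + s *\<^sub>R axis i 1) - f (x + s *\<^sub>R axis j 1) + f x =
      s * s * partial j (partial i f) (x + s' *\<^sub>R axis i 1 + t' *\<^sub>R axis j 1)" if s_pos: "0 < s" for s i j
  proof -
    define g where "g y = f (y + s *\<^sub>R axis j 1) - f y" for y
    have g: "smooth g" unfolding g_def[abs_def] by (intro smooth_diff smooth_translate f)
    have pg: "partial i g y = partial i f (y + s *\<^sub>R axis j 1) - partial i f y" for y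
      unfolding g_def[abs_def]
      by (simp add: partial_diff partial_translate smooth_differentiable smooth_translate f)
    obtain s' where s': "0 < s'" "s' < s" "g (x + s *\<^sub>R axis i 1) - g x = s * partial i g (x + s' *\<^sub>R axis i 1)"
      using axis_mvt[OF g s_pos, of x i] by blast
    obtain t' where t': "0 < t'" "t' < s" "partial i f ((x + s' *\<^sub>R axis i 1) + s *\<^sub>R axis j 1) - partial i f (x + s' *\<^sub>R axis i 1)
        = s * partial j (partial i f) ((x + s' *\<^sub>R axis i 1) + t' *\<^sub>R axis j 1)"
      using axis_mvt[OF smooth_partial[OF f] s_pos] by blast
    show ?thesis
      by (rule exI[of _ s'], rule exI[of _ t']) (use s' t' in \<open>simp add: pg g_def algebra_simps\<close>)
  qed
  define s where "s n = inverse (real (Suc n))" for n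
  have s: "0 < s n" for n by (simp add: s_def)
  have s0: "s \<longlonglongrightarrow> 0" unfolding s_def[abs_def] by (rule LIMSEQ_inverse_real_of_nat)
  have lim: "(\<lambda>n. partial b (partial a f) (x + p n *\<^sub>R axis a 1 + q n *\<^sub>R axis b 1)) \<longlonglongrightarrow> partial b (partial a f) x"
    if "\<And>n. 0 < p n \<and> p n < s n" "\<And>n. 0 < q n \<and> q n < s n" for p q a b
  proof -
    have "p \<longlonglongrightarrow> 0" "q \<longlonglongrightarrow> 0"
      by (rule tendsto_sandwich[OF _ _ tendsto_const s0]; use that in \<open>simp add: less_imp_le\<close>)+
    then have l: "(\<lambda>n. x + p n *\<^sub>R axis a 1 + q n *\<^sub>R axis b 1) \<longlonglongrightarrow> x + 0 *\<^sub>R axis a 1 + 0 *\<^sub>R axis b 1"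
      by (intro tendsto_intros)
    have "continuous_on UNIV (partial b (partial a f))" by (intro smooth_continuous smooth_partial f)
    then have "isCont (partial b (partial a f)) (x + 0 *\<^sub>R axis a 1 + 0 *\<^sub>R axis b 1)"
      by (simp add: continuous_on_eq_continuous_at)
    from isCont_tendsto_compose[OF this l] show ?thesis by simp
  qed
  define Q where "Q i j r p q \<longleftrightarrow> 0 < p \<and> p < r \<and> 0 < q \<and> q < r \<and>
      f (x + r *\<^sub>R axis i 1 + r *\<^sub>R axis j 1) - f (x + r *\<^sub>R axis i 1) - f (x + r *\<^sub>R axis j 1) + f x =
      r * r * partial j (partial i f) (x + p *\<^sub>R axis i 1 + q *\<^sub>R axis j 1)" for i j r p q
  have "\<exists>p q. Q i j (s n) p q" for i j n unfolding Q_def by (rule mixed[OF s])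
  then obtain P R where PR: "\<And>i j n. Q i j (s n) (P i j n) (R i j n)" by metis
  define p q p' q' where "p = P i j" and "q = R i j" and "p' = P j i" and "q' = R j i"
  have pq: "Q i j (s n) (p n) (q n)" and pq': "Q j i (s n) (p' n) (q' n)" for n
    using PR by (simp_all add: p_def q_def p'_def q'_def)
  have "partial j (partial i f) (x + p n *\<^sub>R axis i 1 + q n *\<^sub>R axis j 1) =
      partial i (partial j f) (x + p' n *\<^sub>R axis j 1 + q' n *\<^sub>R axis i 1)" for n
  proof -
    have "s n * s n * partial j (partial i f) (x + p n *\<^sub>R axis i 1 + q n *\<^sub>R axis j 1) =
      s n * s n * partial i (partial j f) (x + p' n *\<^sub>R axis j 1 + q' n *\<^sub>R axis i 1)"
      using pq[of n] pq'[of n] unfolding Q_def by (simp add: algebra_simps)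
    then show ?thesis using s[of n] by simp
  qed
  moreover have "(\<lambda>n. partial j (partial i f) (x + p n *\<^sub>R axis i 1 + q n *\<^sub>R axis j 1)) \<longlonglongrightarrow> partial j (partial i f) x"
    using pq by (intro lim) (auto simp: Q_def)
  moreover have "(\<lambda>n. partial i (partial j f) (x + p' n *\<^sub>R axis j 1 + q' n *\<^sub>R axis i 1)) \<longlonglongrightarrow> partial i (partial j f) x"
    using pq' by (intro lim) (auto simp: Q_def)
  ultimately show ?thesis by (simp add: LIMSEQ_unique)
qed

section \<open>Integration by parts with the weight \<open>exp (\<phi> x)\<close>\<close>

locale smooth_weight =
  fixes \<phi> :: "real^'n \<Rightarrow> real"
  assumes smooth_weight: "smooth \<phi>"
begin

text \<open>\<open>T i\<close> is minus the adjoint of \<open>partial i\<close> for the weighted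
  inner product: \<open>exp (\<phi> x) * T i w x\<close> is the \<open>i\<close>-th derivative of
  the product of \<open>w\<close> with the weight.\<close>

definition T :: "'n \<Rightarrow> (real^'n \<Rightarrow> real) \<Rightarrow> real^'n \<Rightarrow> real" where
  "T i w x = partial i w x + partial i \<phi> x * w x"

definition ipw :: "(real^'n \<Rightarrow> real) \<Rightarrow> (real^'n \<Rightarrow> real) \<Rightarrow> real" where
  "ipw u v = L2_inner UNIV (\<lambda>x. exp (\<phi> x) * u x) v"

lemma smooth_exp_weight: "smooth (\<lambda>x. exp (c * \<phi> x))"
  by (intro smooth_comp[OF smooth_real_exp] smooth_scale smooth_weight)

lemma smooth_exp: "smooth (\<lambda>x. exp (\<phi> x))"
  using smooth_exp_weight[of 1] by simp

lemma partial_exp_mult: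
  assumes "smooth w"
  shows "partial i (\<lambda>x. exp (c * \<phi> x) * w x) x = exp (c * \<phi> x) * (partial i w x + c * partial i \<phi> x * w x)"
proof -
  have "partial i (\<lambda>x. exp (c * \<phi> x)) x = exp (c * \<phi> x) * (c * partial i \<phi> x)"
    using partial_comp[where f = exp and u = "\<lambda>x. c * \<phi> x" and x = x and i = i, OF DERIV_exp]
    by (simp add: partial_scale smooth_differentiable smooth_weight smooth_scale)
  then show ?thesis
    using assms smooth_exp_weight[of c]
    by (simp add: partial_mult smooth_differentiable algebra_simps)
qed

lemma test_T: "w \<in> test_functions S \<Longrightarrow> T i w \<in> test_functions S"
  unfolding T_def[abs_def] by (intro test_add test_partial test_mult_smooth smooth_partial smooth_weight)

lemma ipw_integrable:
  "u \<in> test_functions UNIV \<Longrightarrow> v \<in> test_functions UNIV \<Longrightarrow>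
    (\<lambda>x. exp (\<phi> x) * u x) \<in> L2 UNIV \<and> v \<in> L2 UNIV"
  using test_L2_UNIV[OF test_mult_smooth[OF smooth_exp]] test_L2_UNIV by blast

lemma ipw_commute: "ipw u v = ipw v u"
  unfolding ipw_def L2_inner_def by (simp add: mult.commute mult.left_commute)

lemma ipw_sum_left:
  assumes "finite I" "\<And>i. i \<in> I \<Longrightarrow> u i \<in> test_functions UNIV" "v \<in> test_functions UNIV"
  shows "ipw (\<lambda>x. \<Sum>i\<in>I. u i x) v = (\<Sum>i\<in>I. ipw (u i) v)"
  unfolding ipw_def sum_distrib_left
  using assms ipw_integrable by (intro L2_inner_sum_left) auto

lemma ipw_sum_right:
  assumes "finite I" "\<And>i. i \<in> I \<Longrightarrow> u i \<in> test_functions UNIV" "v \<in> test_functions UNIV"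
  shows "ipw v (\<lambda>x. \<Sum>i\<in>I. u i x) = (\<Sum>i\<in>I. ipw v (u i))"
  using ipw_sum_left[OF assms] by (simp add: ipw_commute[of v])

lemma ipw_scale: "ipw (\<lambda>x. c * u x) v = c * ipw u v"
  unfolding ipw_def L2_inner_def by (simp add: mult.assoc mult.left_commute)

lemma ipw_scale_right: "ipw v (\<lambda>x. c * u x) = c * ipw v u"
  using ipw_scale[of c u v] by (simp add: ipw_commute[of v])

lemma ipw_diff:
  assumes "u \<in> test_functions UNIV" "v \<in> test_functions UNIV" "w \<in> test_functions UNIV"
  shows "ipw (\<lambda>x. u x - v x) w = ipw u w - ipw v w"
  unfolding ipw_def right_diff_distrib using assms ipw_integrable by (intro L2.ip_diff_left) auto

lemma ipw_diff_right:
  assumes "u \<in> test_functions UNIV" "v \<in> test_functions UNIV" "w \<in> test_functions UNIV"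
  shows "ipw w (\<lambda>x. u x - v x) = ipw w u - ipw w v"
  using ipw_diff[OF assms] by (simp add: ipw_commute[of w])

lemma ipw_add_right:
  assumes "u \<in> test_functions UNIV" "v \<in> test_functions UNIV" "w \<in> test_functions UNIV"
  shows "ipw w (\<lambda>x. u x + v x) = ipw w u + ipw w v"
  unfolding ipw_def using assms ipw_integrable by (intro L2.ip_add_right) auto

lemma ipw_eq_norm:
  "ipw u u = (L2_norm UNIV (\<lambda>x. exp (1/2 * \<phi> x) * u x))\<^sup>2"
proof -
  have "exp (1/2 * \<phi> x) * exp (1/2 * \<phi> x) = exp (\<phi> x)" for x by (simp flip: exp_add)
  then have "exp (1/2 * \<phi> x) * u x * (exp (1/2 * \<phi> x) * u x) = exp (\<phi> x) * u x * u x" for x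
    by (metis (no_types, opaque_lifting) mult.assoc mult.commute)
  then have "ipw u u = L2_inner UNIV (\<lambda>x. exp (1/2 * \<phi> x) * u x) (\<lambda>x. exp (1/2 * \<phi> x) * u x)"
    unfolding ipw_def L2_inner_def by (simp only:)
  moreover have "0 \<le> L2_inner UNIV (\<lambda>x. exp (1/2 * \<phi> x) * u x) (\<lambda>x. exp (1/2 * \<phi> x) * u x)"
    unfolding L2_inner_def by simp
  ultimately show ?thesis by (simp add: L2_norm_def)
qed

lemma ipw_nonneg: "0 \<le> ipw u u"
  by (simp add: ipw_eq_norm)

lemma T_adjoint:
  assumes w: "w \<in> test_functions UNIV" and z: "z \<in> test_functions UNIV"
  shows "ipw (T i w) z = - ipw w (partial i z)"
proof -
  have "(\<lambda>x. exp (\<phi> x) * T i w x) = partial i (\<lambda>x. exp (\<phi> x) * w x)"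
    using partial_exp_mult[OF test_functionsD[OF w], of i 1] by (simp add: T_def fun_eq_iff)
  then show ?thesis unfolding ipw_def using sets.top[of lebesgue]
    by (simp add: integration_by_parts[OF _ smooth_mult[OF smooth_exp test_functionsD[OF w]] z])
qed

text \<open>The commutator of \<open>partial i\<close> with \<open>T j\<close> is multiplication by
  a second derivative of \<open>\<phi>\<close>; each of the two operators is moved to the other side
  once.\<close>

lemma weighted_commutation:
  assumes w: "w \<in> test_functions UNIV" and z: "z \<in> test_functions UNIV"
  shows "ipw (T i w) (T j z) =
    ipw (partial j w) (partial i z) - ipw w (\<lambda>x. partial i (partial j \<phi>) x * z x)"
proof -
  have z': "smooth z" using z by (rule test_functionsD)
  have comm: "partial i (T j z) = (\<lambda>x. T j (partial i z) x + partial i (partial j \<phi>) x * z x)"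
    using z' smooth_weight unfolding T_def[abs_def]
    by (simp add: smooth_partial_rules smooth_partial smooth_mult partial_commute[OF z', of i j] fun_eq_iff algebra_simps)
  have t: "(\<lambda>x. partial i (partial j \<phi>) x * z x) \<in> test_functions UNIV"
    by (intro test_mult_smooth smooth_partial smooth_weight z)
  have "ipw (T i w) (T j z) = - ipw w (partial i (T j z))"
    by (rule T_adjoint[OF w test_T[OF z]])
  also have "\<dots> = - ipw (T j (partial i z)) w - ipw w (\<lambda>x. partial i (partial j \<phi>) x * z x)"
    unfolding comm ipw_add_right[OF test_T[OF test_partial[OF z]] t w] by (simp add: ipw_commute)
  also have "- ipw (T j (partial i z)) w = ipw (partial j w) (partial i z)"
    using T_adjoint[OF test_partial[OF z] w, of j] by (simp add: ipw_commute)
  finally show ?thesis .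
qed

text \<open>With \<open>P\<close> the sum of \<open>T i (partial i u)\<close>, commutation expresses
  the square of \<open>P\<close> by plain second derivatives minus the Hessian of
  \<open>\<phi>\<close> applied to the gradient, and the sum over \<open>T j (partial i u)\<close>
  by the same second derivatives minus the Laplacian of \<open>\<phi>\<close> times the squared
  gradient. The hypothesis \<open>curvature\<close> compares the two corrections, so no constant
  depends on the size of \<open>\<phi>\<close>.\<close>

lemma Bochner_inequality:
  assumes u: "u \<in> test_functions UNIV" and \<nu>: "0 < \<nu>"
    and curvature: "\<And>x \<xi>. (\<Sum>i\<in>UNIV. \<Sum>j\<in>UNIV. partial i (partial j \<phi>) x * \<xi> i * \<xi> j) \<le>
      (\<Sum>i\<in>UNIV. \<Sum>j\<in>UNIV. partial j (partial j \<phi>) x * \<xi> i * \<xi> i)"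
  defines "g \<equiv> \<lambda>x. \<nu> * u x - (\<Sum>i\<in>UNIV. T i (partial i u) x)"
  shows "(\<Sum>i\<in>UNIV. \<Sum>j\<in>UNIV. ipw (T j (partial i u)) (T j (partial i u))) + \<nu>\<^sup>2 * ipw u u +
    2 * \<nu> * (\<Sum>i\<in>UNIV. ipw (partial i u) (partial i u)) \<le> ipw g g"
proof -
  define P where "P = (\<lambda>x. \<Sum>i\<in>UNIV. T i (partial i u) x)"
  have ui: "partial i u \<in> test_functions UNIV" for i by (intro test_partial u)
  have Ti: "T i (partial i' u) \<in> test_functions UNIV" for i i' by (intro test_T ui)
  have P: "P \<in> test_functions UNIV" unfolding P_def by (intro test_sum Ti) simp
  have h: "(\<lambda>x. partial i (partial j \<phi>) x * partial k u x) \<in> test_functions UNIV" for i j k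
    by (intro test_mult_smooth smooth_partial smooth_weight ui)
  have uiuj: "partial i (partial j u) = partial j (partial i u)" for i j
    using partial_commute[OF test_functionsD[OF u]] by (simp add: fun_eq_iff)
  have "ipw P P = (\<Sum>i\<in>UNIV. \<Sum>j\<in>UNIV. ipw (T i (partial i u)) (T j (partial j u)))"
    unfolding P_def by (subst ipw_sum_left; (intro Ti test_sum)?; simp?) (subst ipw_sum_right; simp add: Ti)
  also have "\<dots> = (\<Sum>i\<in>UNIV. \<Sum>j\<in>UNIV. ipw (partial j (partial i u)) (partial j (partial i u)) -
      ipw (partial i u) (\<lambda>x. partial i (partial j \<phi>) x * partial j u x))"
    using uiuj by (simp add: weighted_commutation ui)
  finally have PP: "ipw P P = (\<Sum>i\<in>UNIV. \<Sum>j\<in>UNIV. ipw (partial j (partial i u)) (partial j (partial i u))) -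
      (\<Sum>i\<in>UNIV. \<Sum>j\<in>UNIV. ipw (partial i u) (\<lambda>x. partial i (partial j \<phi>) x * partial j u x))"
    by (simp add: sum_subtractf)
  have TT: "(\<Sum>i\<in>UNIV. \<Sum>j\<in>UNIV. ipw (T j (partial i u)) (T j (partial i u))) =
      (\<Sum>i\<in>UNIV. \<Sum>j\<in>UNIV. ipw (partial j (partial i u)) (partial j (partial i u))) -
      (\<Sum>i\<in>UNIV. \<Sum>j\<in>UNIV. ipw (partial i u) (\<lambda>x. partial j (partial j \<phi>) x * partial i u x))"
    by (simp add: weighted_commutation ui sum_subtractf)
  have curv: "(\<Sum>i\<in>UNIV. \<Sum>j\<in>UNIV. ipw (partial i u) (\<lambda>x. partial i (partial j \<phi>) x * partial j u x)) \<le>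
      (\<Sum>i\<in>UNIV. \<Sum>j\<in>UNIV. ipw (partial i u) (\<lambda>x. partial j (partial j \<phi>) x * partial i u x))"
  proof -
    \<comment> \<open>Four indices, so that both curvature sums are built from one family of
      integrands and the pointwise comparison can be integrated.\<close>
    define F where "F a b i j x = exp (\<phi> x) * partial i u x * (partial a (partial b \<phi>) x * partial j u x)" for a b i j x
    have F_int: "integrable (lebesgue_on UNIV) (F a b i j)" for a b i j
      unfolding F_def[abs_def] using ipw_integrable[OF ui h] by (intro L2_mult_integrable) auto
    have ipF: "ipw (partial i u) (\<lambda>x. partial a (partial b \<phi>) x * partial j u x) = (LINT x|lebesgue_on UNIV. F a b i j x)" for a b i j
      by (simp add: ipw_def L2_inner_def F_def)
    have "(\<Sum>i\<in>UNIV. \<Sum>j\<in>UNIV. ipw (partial i u) (\<lambda>x. partial i (partial j \<phi>) x * partial j u x)) =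
        (LINT x|lebesgue_on UNIV. (\<Sum>i\<in>UNIV. \<Sum>j\<in>UNIV. F i j i j x))"
      using F_int by (simp add: ipF)
    also have "\<dots> \<le> (LINT x|lebesgue_on UNIV. (\<Sum>i\<in>UNIV. \<Sum>j\<in>UNIV. F j j i i x))"
    proof (intro integral_mono_AE AE_I2 Bochner_Integration.integrable_sum F_int)
      fix x
      have "(\<Sum>i\<in>UNIV. \<Sum>j\<in>UNIV. F i j i j x) = exp (\<phi> x) *
          (\<Sum>i\<in>UNIV. \<Sum>j\<in>UNIV. partial i (partial j \<phi>) x * partial i u x * partial j u x)"
        by (simp add: F_def sum_distrib_left mult_ac)
      also have "\<dots> \<le> exp (\<phi> x) * (\<Sum>i\<in>UNIV. \<Sum>j\<in>UNIV. partial j (partial j \<phi>) x * partial i u x * partial i u x)"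
        by (intro mult_left_mono curvature) simp
      also have "\<dots> = (\<Sum>i\<in>UNIV. \<Sum>j\<in>UNIV. F j j i i x)"
        by (simp add: F_def sum_distrib_left mult_ac)
      finally show "(\<Sum>i\<in>UNIV. \<Sum>j\<in>UNIV. F i j i j x) \<le> (\<Sum>i\<in>UNIV. \<Sum>j\<in>UNIV. F j j i i x)" .
    qed
    also have "\<dots> = (\<Sum>i\<in>UNIV. \<Sum>j\<in>UNIV. ipw (partial i u) (\<lambda>x. partial j (partial j \<phi>) x * partial i u x))"
      using F_int by (simp add: ipF)
    finally show ?thesis .
  qed
  \<comment> \<open>The cross term with \<open>\<nu> * u\<close> is the gradient energy, which gives
    the third summand of the bound.\<close>
  have Pu: "ipw P u = - (\<Sum>i\<in>UNIV. ipw (partial i u) (partial i u))"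
    unfolding P_def by (subst ipw_sum_left) (simp_all add: Ti u T_adjoint ui sum_negf)
  have "ipw g g = \<nu>\<^sup>2 * ipw u u - 2 * \<nu> * ipw P u + ipw P P"
  proof -
    have g_eq: "g = (\<lambda>x. \<nu> * u x - P x)" by (simp add: g_def P_def)
    have \<nu>u: "(\<lambda>x. \<nu> * u x) \<in> test_functions UNIV" by (intro test_scale u)
    show ?thesis unfolding g_eq
      using ipw_diff[OF \<nu>u P test_diff[OF \<nu>u P]] ipw_diff_right[OF \<nu>u P \<nu>u] ipw_diff_right[OF \<nu>u P P]
      by (simp add: ipw_scale ipw_scale_right ipw_commute[of u P] power2_eq_square algebra_simps)
  qed
  with PP TT curv Pu show ?thesis by simp
qed

text \<open>Splitting the weight evenly makes the operator symmetric, hence a Schroedinger operator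
  on the unweighted space. The factor in front is there because the unweighted norm of the left-hand
  side is then the \<open>ipw\<close> norm occurring in the Bochner inequality.\<close>

lemma conjugation:
  assumes v: "smooth v"
  defines "u \<equiv> \<lambda>x. exp (-1/2 * \<phi> x) * v x"
  shows "exp (1/2 * \<phi> x) * (\<nu> * u x - (\<Sum>i\<in>UNIV. T i (partial i u) x)) =
    \<nu> * v x + (1/2 * laplacian \<phi> x + 1/4 * (\<Sum>i\<in>UNIV. (partial i \<phi> x)\<^sup>2)) * v x - laplacian v x"
proof -
  have u1: "partial i u = (\<lambda>x. exp (-1/2 * \<phi> x) * (partial i v x - 1/2 * (partial i \<phi> x * v x)))" for i
    unfolding u_def using partial_exp_mult[OF v, of i "-1/2"] by (simp add: fun_eq_iff)
  have inner: "smooth (\<lambda>x. partial i v x - 1/2 * (partial i \<phi> x * v x))" for i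
    by (intro smooth_diff smooth_scale smooth_mult smooth_partial v smooth_weight)
  have T1: "T i (partial i u) x = exp (-1/2 * \<phi> x) *
      (partial i (partial i v) x - (1/2 * partial i (partial i \<phi>) x + 1/4 * (partial i \<phi> x)\<^sup>2) * v x)" for i
  proof -
    have d: "partial i (\<lambda>x. partial i v x - 1/2 * (partial i \<phi> x * v x)) x =
        partial i (partial i v) x - 1/2 * (partial i (partial i \<phi>) x * v x + partial i \<phi> x * partial i v x)"
      using v smooth_weight by (simp add: smooth_partial_rules(2,3,4) smooth_partial smooth_mult smooth_scale del: mult_divide_mult_cancel_left times_divide_eq_left divide_const_simps)
    show ?thesis
      unfolding T_def u1 partial_exp_mult[OF inner] d by (simp add: algebra_simps power2_eq_square)
  qed
  have e: "exp (1/2 * \<phi> x) * (exp (-1/2 * \<phi> x) * y) = y" for y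
    by (simp add: mult.assoc[symmetric] flip: exp_add)
  have "exp (1/2 * \<phi> x) * (\<nu> * u x - (\<Sum>i\<in>UNIV. T i (partial i u) x)) =
      \<nu> * (exp (1/2 * \<phi> x) * (exp (-1/2 * \<phi> x) * v x)) -
      exp (1/2 * \<phi> x) * (exp (-1/2 * \<phi> x) * (\<Sum>i\<in>UNIV. partial i (partial i v) x - (1/2 * partial i (partial i \<phi>) x + 1/4 * (partial i \<phi> x)\<^sup>2) * v x))"
    unfolding T1 sum_distrib_left[symmetric] by (simp add: u_def right_diff_distrib mult.left_commute)
  also have "\<dots> = \<nu> * v x - (\<Sum>i\<in>UNIV. partial i (partial i v) x - (1/2 * partial i (partial i \<phi>) x + 1/4 * (partial i \<phi> x)\<^sup>2) * v x)"
    unfolding e ..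
  also have "\<dots> = \<nu> * v x + (1/2 * laplacian \<phi> x + 1/4 * (\<Sum>i\<in>UNIV. (partial i \<phi> x)\<^sup>2)) * v x - laplacian v x"
    by (simp add: laplacian_def sum_subtractf sum.distrib sum_distrib_left sum_distrib_right algebra_simps)
  finally show ?thesis .
qed

end

section \<open>Approximate solutions on a convex domain\<close>

text \<open>Separation and compactness. The affine functions are at most 0 on \<open>C\<close>, and
  outside \<Omega> one of them exceeds 1; the levels in between are the room in which the weight
  grows and the cutoff falls.\<close>

lemma halfspaces_between:
  fixes \<Omega> C :: "(real^'n) set"
  assumes \<Omega>: "open \<Omega>" "bounded \<Omega>" and C: "compact C" "convex C" "C \<subseteq> \<Omega>"
  obtains H where "finite H" "\<And>p x. p \<in> H \<Longrightarrow> x \<in> C \<Longrightarrow> fst p \<bullet> x - snd p \<le> (0::real)"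
    "{x. \<forall>p\<in>H. fst p \<bullet> x - snd p \<le> 1} \<subseteq> \<Omega>"
proof -
  obtain R where R: "\<And>x. x \<in> \<Omega> \<Longrightarrow> norm x \<le> R" using \<Omega>(2) by (auto simp: bounded_iff)
  \<comment> \<open>Coordinate half-spaces confine the polyhedron to the box \<open>B\<close>, which
    leaves only the compact set \<open>B - \<Omega>\<close> to be covered.\<close>
  define H0 where "H0 = (\<lambda>i::'n. (axis i (1::real), R)) ` UNIV \<union> (\<lambda>i. (- axis i 1, R)) ` UNIV"
  define B where "B = cbox (\<chi> i. - R - 1) (\<chi> i. R + 1 :: real^'n)"
  define Y where "Y = B - \<Omega>"
  have Y: "compact Y" unfolding Y_def B_def by (intro compact_diff compact_cbox \<Omega>)
  have "\<exists>p. (\<forall>x\<in>C. fst p \<bullet> x - snd p \<le> 0) \<and> 1 < fst p \<bullet> y - snd p" if "y \<in> Y" for y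
  proof -
    have "y \<notin> C" using that C by (auto simp: Y_def)
    then obtain a b where ab: "a \<bullet> y < b" "\<And>x. x \<in> C \<Longrightarrow> b < a \<bullet> x"
      using separating_hyperplane_closed_point[OF C(2) compact_imp_closed[OF C(1)]] by blast
    \<comment> \<open>Scaled so that the affine function equals 2 at \<open>y\<close> while staying
      nonpositive on \<open>C\<close>.\<close>
    define s where "s = 2 / (b - a \<bullet> y)"
    have ne: "b - a \<bullet> y \<noteq> 0" using ab by simp
    have s: "0 < s" "s * (b - a \<bullet> y) = 2"
      using ab nonzero_eq_divide_eq[OF ne, of s 2] by (simp_all add: s_def)
    have le: "s * (b - a \<bullet> x) \<le> 0" if "x \<in> C" for x
      using ab(2)[OF that] s(1) by (simp add: mult_le_0_iff)
    have eq: "fst (- (s *\<^sub>R a), - (s * b)) \<bullet> x - snd (- (s *\<^sub>R a), - (s * b)) = s * (b - a \<bullet> x)" for x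
      by (simp add: algebra_simps)
    show ?thesis
      by (rule exI[of _ "(- (s *\<^sub>R a), - (s * b))"], unfold eq) (use le s in simp)
  qed
  then obtain p where p: "\<And>y x. y \<in> Y \<Longrightarrow> x \<in> C \<Longrightarrow> fst (p y) \<bullet> x - snd (p y) \<le> 0"
    "\<And>y. y \<in> Y \<Longrightarrow> 1 < fst (p y) \<bullet> y - snd (p y)" by metis
  obtain Y' where Y': "Y' \<subseteq> Y" "finite Y'" "Y \<subseteq> (\<Union>y\<in>Y'. {x. 1 < fst (p y) \<bullet> x - snd (p y)})"
  proof (rule compactE_image[OF Y])
    show "open {x. 1 < fst (p y) \<bullet> x - snd (p y)}" for y
      by (intro open_Collect_less continuous_intros)
    show "Y \<subseteq> (\<Union>y\<in>Y. {x. 1 < fst (p y) \<bullet> x - snd (p y)})" using p(2) by blast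
  qed blast
  define H where "H = H0 \<union> p ` Y'"
  show ?thesis
  proof (rule that[of H])
    show "finite H" using Y' by (simp add: H_def H0_def)
    show "fst q \<bullet> x - snd q \<le> 0" if "q \<in> H" "x \<in> C" for q x
    proof -
      have "\<bar>x $ i\<bar> \<le> R" for i
        using R[of x] C(3) that(2) component_le_norm_cart[of x i] by force
      then have "x $ i \<le> R" "- x $ i \<le> R" for i by (auto simp: abs_le_iff)
      then show ?thesis using that p(1) Y'(1) by (auto simp: H_def H0_def inner_axis')
    qed
    show "{x. \<forall>q\<in>H. fst q \<bullet> x - snd q \<le> 1} \<subseteq> \<Omega>"
    proof
      fix x assume "x \<in> {x. \<forall>q\<in>H. fst q \<bullet> x - snd q \<le> 1}"
      then have x: "fst q \<bullet> x - snd q \<le> 1" if "q \<in> H" for q using that by simp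
      have "x \<in> B"
      proof -
        have "- R - 1 \<le> x $ i" "x $ i \<le> R + 1" for i
          using x[of "(axis i 1, R)"] x[of "(- axis i 1, R)"] by (auto simp: H_def H0_def inner_axis')
        then show ?thesis by (simp add: B_def mem_box_cart)
      qed
      moreover have "x \<notin> Y"
      proof
        assume "x \<in> Y"
        then obtain y where "y \<in> Y'" "1 < fst (p y) \<bullet> x - snd (p y)" using Y'(3) by blast
        with x[of "p y"] show False by (simp add: H_def)
      qed
      ultimately show "x \<in> \<Omega>" by (simp add: Y_def)
    qed
  qed
qed

lemma smooth_cutoff:
  fixes \<Omega> :: "(real^'n) set" and H :: "((real^'n) \<times> real) set"
  assumes "bounded \<Omega>" "finite H" "{x. \<forall>p\<in>H. fst p \<bullet> x - snd p \<le> 1} \<subseteq> \<Omega>"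
  obtains \<eta> where "\<eta> \<in> test_functions \<Omega>" "\<And>x. 0 \<le> \<eta> x" "\<And>x. \<eta> x \<le> 1"
    "\<And>x. (\<And>p. p \<in> H \<Longrightarrow> fst p \<bullet> x - snd p < 1/2) \<Longrightarrow> \<eta> x = 1"
proof -
  \<comment> \<open>Normalised so that \<open>c * bump (t - 1/2)\<close> reaches 1 at
    \<open>t = 1\<close>: then \<open>s\<close> is 1 below level 1/2 and vanishes above level
    1.\<close>
  define c where "c = inverse (bump (1/2))"
  define s where "s t = inverse (bump 1) * bump (1 - c * bump (t - 1/2))" for t
  have b: "0 < bump (1/2)" "0 < bump 1" by (auto intro: bump_bounds)
  have s0: "0 \<le> s t" for t using b by (simp add: s_def bump_bounds)
  have s1: "s t \<le> 1" for t
  proof -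
    have "bump (1 - c * bump (t - 1/2)) \<le> bump 1"
      using b by (intro bump_mono) (simp add: c_def bump_bounds)
    then show ?thesis using b by (simp add: s_def field_simps)
  qed
  have s_one: "s t = 1" if "t < 1/2" for t
    using that b bump_bounds(3)[of "t - 1/2"] by (simp add: s_def)
  have s_zero: "s t = 0" if "1 < t" for t
  proof -
    have "1 \<le> c * bump (t - 1/2)"
      using bump_mono[of "1/2" "t - 1/2"] that b by (simp add: c_def field_simps)
    then show ?thesis by (simp add: s_def bump_bounds(3))
  qed
  define \<eta> where "\<eta> x = (\<Prod>p\<in>H. s (fst p \<bullet> x - snd p))" for x
  show ?thesis
  proof (rule that[of \<eta>])
    show "\<eta> \<in> test_functions \<Omega>"
    proof (rule test_functionsI[of _ "{x. \<forall>p\<in>H. fst p \<bullet> x - snd p \<le> 1}"])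
      have "smooth (\<lambda>x. s (fst p \<bullet> x - snd p))" for p :: "(real^'n) \<times> real"
        unfolding s_def by (intro smooth_scale smooth_bump smooth_diff smooth_const smooth_affine)
      then show "smooth \<eta>" unfolding \<eta>_def[abs_def] using assms(2) by (intro smooth_prod)
      have "{x. \<forall>p\<in>H. fst p \<bullet> x - snd p \<le> 1} = (\<Inter>p\<in>H. {x. fst p \<bullet> x - snd p \<le> 1})" by auto
      moreover have "closed (\<Inter>p\<in>H. {x. fst p \<bullet> x - snd p \<le> 1})"
        by (intro closed_INT ballI closed_Collect_le continuous_intros)
      ultimately have "closed {x. \<forall>p\<in>H. fst p \<bullet> x - snd p \<le> 1}" by simp
      then show "compact {x. \<forall>p\<in>H. fst p \<bullet> x - snd p \<le> 1}"
        using bounded_subset[OF assms(1,3)] by (simp add: compact_eq_bounded_closed)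
      show "\<eta> x = 0" if "x \<notin> {x. \<forall>p\<in>H. fst p \<bullet> x - snd p \<le> 1}" for x
        using that s_zero assms(2) unfolding \<eta>_def by (auto simp: not_le intro!: prod_zero)
    qed (rule assms(3))
    show "0 \<le> \<eta> x" for x unfolding \<eta>_def by (intro prod_nonneg s0)
    show "\<eta> x \<le> 1" for x unfolding \<eta>_def by (intro prod_le_1) (simp add: s0 s1)
    show "\<eta> x = 1" if "\<And>p. p \<in> H \<Longrightarrow> fst p \<bullet> x - snd p < 1/2" for x
      unfolding \<eta>_def using that by (intro prod.neutral) (auto intro: s_one)
  qed
qed

text \<open>For \<open>K \<ge> 0\<close> a convex function that vanishes where all affine functions
  are nonpositive, and is at least \<open>K * (exp (-2) / 2)\<close> where one of them reaches 1/2,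
  the level at which the cutoff starts to fall.\<close>

definition polyhedral_weight :: "real \<Rightarrow> ((real^'n) \<times> real) set \<Rightarrow> real^'n \<Rightarrow> real" where
  "polyhedral_weight K H x = (\<Sum>p\<in>H. K * cvx (fst p \<bullet> x - snd p))"

context
  fixes K :: real and H :: "((real^'n) \<times> real) set"
  assumes H: "finite H" and K: "0 \<le> K"
begin

lemma smooth_polyhedral_weight: "smooth (polyhedral_weight K H)"
  unfolding polyhedral_weight_def[abs_def] by (intro smooth_sum H smooth_scale smooth_cvx smooth_affine)

lemma partial_polyhedral_weight:
  "partial i (polyhedral_weight K H) x = (\<Sum>p\<in>H. (K * fst p $ i) * flat [:1, 1:] (fst p \<bullet> x - snd p))"
proof -
  have "partial i (\<lambda>x. K * cvx (fst p \<bullet> x - snd p)) x = (K * fst p $ i) * flat [:1, 1:] (fst p \<bullet> x - snd p)" for p :: "(real^'n) \<times> real"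
    using partial_comp[where f = cvx and u = "\<lambda>x. fst p \<bullet> x - snd p" and x = x and i = i, OF cvx_has_derivative]
    by (simp add: partial_scale smooth_differentiable smooth_cvx smooth_affine partial_affine)
  moreover have "smooth (\<lambda>x. K * cvx (fst p \<bullet> x - snd p))" for p :: "(real^'n) \<times> real"
    by (intro smooth_scale smooth_cvx smooth_affine)
  ultimately show ?thesis
    unfolding polyhedral_weight_def[abs_def] by (subst partial_sum[OF H]) simp_all
qed

lemma second_partial_polyhedral_weight:
  "partial i (partial j (polyhedral_weight K H)) x =
    (\<Sum>p\<in>H. K * fst p $ j * fst p $ i * flat [:0, 0, 0, 1:] (fst p \<bullet> x - snd p))"
proof -
  have sm: "smooth (\<lambda>x. flat [:1, 1:] (fst p \<bullet> x - snd p))" for p :: "(real^'n) \<times> real"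
    by (intro smooth_comp[OF smooth_real_flat] smooth_affine)
  have "partial i (\<lambda>x. (K * fst p $ j) * flat [:1, 1:] (fst p \<bullet> x - snd p)) x =
      K * fst p $ j * fst p $ i * flat [:0, 0, 0, 1:] (fst p \<bullet> x - snd p)" for p :: "(real^'n) \<times> real"
    using partial_comp[where f = "flat [:1, 1:]" and u = "\<lambda>x. fst p \<bullet> x - snd p" and x = x and i = i, OF cvx'_has_derivative]
    by (simp only: partial_scale[OF smooth_differentiable[OF sm]] smooth_differentiable[OF smooth_affine] partial_affine)
       (simp add: mult_ac)
  then show ?thesis
    unfolding partial_polyhedral_weight[abs_def] by (subst partial_sum[OF H]) (simp_all add: smooth_scale sm)
qed

text \<open>Each summand has a rank-one Hessian with nonnegative factor, and Cauchy-Schwarz bounds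
  its quadratic form by its trace times the squared length of \<open>\<xi>\<close>.\<close>

lemma polyhedral_weight_curvature:
  "(\<Sum>i\<in>UNIV. \<Sum>j\<in>UNIV. partial i (partial j (polyhedral_weight K H)) x * \<xi> i * \<xi> j) \<le>
   (\<Sum>i\<in>UNIV. \<Sum>j\<in>UNIV. partial j (partial j (polyhedral_weight K H)) x * \<xi> i * \<xi> i)"
proof -
  let ?q = "\<lambda>p. K * flat [:0, 0, 0, 1:] (fst p \<bullet> x - snd p)"
  have "(\<Sum>i\<in>UNIV. \<Sum>j\<in>UNIV. partial i (partial j (polyhedral_weight K H)) x * \<xi> i * \<xi> j) =
      (\<Sum>p\<in>H. ?q p * (\<Sum>i\<in>UNIV. fst p $ i * \<xi> i)\<^sup>2)"
    unfolding second_partial_polyhedral_weight power2_eq_square sum_product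
    by (simp add: sum_distrib_left sum_distrib_right mult_ac)
       (subst sum.swap[of _ H], simp add: sum.swap[of _ H])
  also have "\<dots> \<le> (\<Sum>p\<in>H. ?q p * ((\<Sum>i\<in>UNIV. (fst p $ i)\<^sup>2) * (\<Sum>i\<in>UNIV. (\<xi> i)\<^sup>2)))"
    using K by (intro sum_mono mult_left_mono Cauchy_Schwarz_ineq_sum mult_nonneg_nonneg cvx''_bounds)
  also have "\<dots> = (\<Sum>i\<in>UNIV. \<Sum>j\<in>UNIV. partial j (partial j (polyhedral_weight K H)) x * \<xi> i * \<xi> i)"
    unfolding second_partial_polyhedral_weight power2_eq_square sum_product
    by (simp add: sum_distrib_left sum_distrib_right mult_ac)
       (subst sum.swap[of _ H], simp add: sum.swap[of _ H], subst sum.swap, simp)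
  finally show ?thesis .
qed

lemma polyhedral_weight_bounds:
  "0 \<le> polyhedral_weight K H x"
  "(\<And>p. p \<in> H \<Longrightarrow> fst p \<bullet> x - snd p \<le> 0) \<Longrightarrow> polyhedral_weight K H x = 0"
  "(\<And>p. p \<in> H \<Longrightarrow> fst p \<bullet> x - snd p \<le> 0) \<Longrightarrow> partial i (polyhedral_weight K H) x = 0"
  "p \<in> H \<Longrightarrow> 1/2 \<le> fst p \<bullet> x - snd p \<Longrightarrow> K * (exp (-2) / 2) \<le> polyhedral_weight K H x"
proof -
  show "0 \<le> polyhedral_weight K H x"
    unfolding polyhedral_weight_def using K by (intro sum_nonneg mult_nonneg_nonneg cvx_bounds)
  show "(\<And>p. p \<in> H \<Longrightarrow> fst p \<bullet> x - snd p \<le> 0) \<Longrightarrow> polyhedral_weight K H x = 0"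
    unfolding polyhedral_weight_def by (intro sum.neutral) (simp add: cvx_bounds)
  show "partial i (polyhedral_weight K H) x = 0" if "\<And>p. p \<in> H \<Longrightarrow> fst p \<bullet> x - snd p \<le> 0"
  proof -
    have "flat [:1, 1:] (fst p \<bullet> x - snd p) = 0" if "p \<in> H" for p
      using \<open>\<And>p. p \<in> H \<Longrightarrow> fst p \<bullet> x - snd p \<le> 0\<close>[OF that] by (simp add: flat_def)
    then show ?thesis unfolding partial_polyhedral_weight by (intro sum.neutral) simp
  qed
  assume p: "p \<in> H" "1/2 \<le> fst p \<bullet> x - snd p"
  have "K * (exp (-2) / 2) \<le> K * cvx (fst p \<bullet> x - snd p)"
    using K p by (intro mult_left_mono cvx_bounds)
  also have "\<dots> \<le> polyhedral_weight K H x"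
    unfolding polyhedral_weight_def using p H K
    by (intro member_le_sum) (auto intro!: mult_nonneg_nonneg cvx_bounds)
  finally show "K * (exp (-2) / 2) \<le> polyhedral_weight K H x" .
qed

text \<open>This is the potential that the conjugation produces. It is nonnegative because the
  weight is convex, and bounded because the first two derivatives of \<open>cvx\<close> are; the
  bound may depend on \<open>K\<close>.\<close>

lemma polyhedral_potential:
  defines "W \<equiv> \<lambda>x. 1/2 * laplacian (polyhedral_weight K H) x + 1/4 * (\<Sum>i\<in>UNIV. (partial i (polyhedral_weight K H) x)\<^sup>2)"
  shows "smooth W" "0 \<le> W x" "\<exists>m. \<forall>x. W x \<le> m"
proof -
  have "smooth (\<lambda>x. 1/2 * (\<Sum>i\<in>UNIV. partial i (partial i (polyhedral_weight K H)) x) +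
      1/4 * (\<Sum>i\<in>UNIV. partial i (polyhedral_weight K H) x * partial i (polyhedral_weight K H) x))"
    by (intro smooth_add smooth_scale smooth_sum smooth_mult smooth_partial smooth_polyhedral_weight) simp_all
  then show "smooth W" by (simp add: W_def laplacian_def power2_eq_square)
  have nn: "0 \<le> partial i (partial i (polyhedral_weight K H)) x" for i x
    unfolding second_partial_polyhedral_weight mult.assoc
    using K by (intro sum_nonneg mult_nonneg_nonneg[OF K]) (simp add: mult.assoc[symmetric] cvx''_bounds)
  then show "0 \<le> W x" for x unfolding W_def laplacian_def by (intro add_nonneg_nonneg mult_nonneg_nonneg sum_nonneg) auto
  define a where "a = (\<Sum>i\<in>UNIV. \<Sum>p\<in>H. K * (fst p $ i)\<^sup>2 * 27)"
  define b where "b = (\<Sum>i\<in>UNIV. (\<Sum>p\<in>H. \<bar>K * fst p $ i\<bar>)\<^sup>2)"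
  have "W x \<le> 1/2 * a + 1/4 * b" for x
  proof -
    have "laplacian (polyhedral_weight K H) x \<le> a"
      unfolding laplacian_def a_def second_partial_polyhedral_weight
    proof (intro sum_mono)
      fix i p
      have "K * (fst p $ i)\<^sup>2 * flat [:0, 0, 0, 1:] (fst p \<bullet> x - snd p) \<le> K * (fst p $ i)\<^sup>2 * 27"
        using K by (intro mult_left_mono cvx''_bounds) simp
      then show "K * fst p $ i * fst p $ i * flat [:0, 0, 0, 1:] (fst p \<bullet> x - snd p) \<le> K * (fst p $ i)\<^sup>2 * 27"
        by (simp add: power2_eq_square mult.assoc)
    qed
    moreover have "(\<Sum>i\<in>UNIV. (partial i (polyhedral_weight K H) x)\<^sup>2) \<le> b"
      unfolding b_def
    proof (intro sum_mono)
      fix i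
      have "\<bar>partial i (polyhedral_weight K H) x\<bar> \<le> (\<Sum>p\<in>H. \<bar>K * fst p $ i\<bar>)"
        unfolding partial_polyhedral_weight
      proof (intro order_trans[OF sum_abs] sum_mono)
        fix p
        show "\<bar>K * fst p $ i * flat [:1, 1:] (fst p \<bullet> x - snd p)\<bar> \<le> \<bar>K * fst p $ i\<bar>"
          unfolding abs_mult[of "K * fst p $ i"] using cvx'_bounds[of "fst p \<bullet> x - snd p"]
          by (intro mult_left_le) auto
      qed
      from power_mono[OF this, of 2] show "(partial i (polyhedral_weight K H) x)\<^sup>2 \<le> (\<Sum>p\<in>H. \<bar>K * fst p $ i\<bar>)\<^sup>2"
        by simp
    qed
    ultimately show ?thesis unfolding W_def by simp
  qed
  then show "\<exists>m. \<forall>x. W x \<le> m" by blast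
qed

end

subsection \<open>Restriction of the domain of integration\<close>

lemma L2_restrict:
  fixes f :: "real^'n \<Rightarrow> real"
  assumes "f \<in> L2 UNIV" "S \<in> sets lebesgue"
  shows "f \<in> L2 S" "L2_norm S f \<le> L2_norm UNIV f"
proof -
  have f: "f \<in> borel_measurable lebesgue" "integrable lebesgue (\<lambda>x. (f x)\<^sup>2)"
    using assms(1) by (auto simp: L2_def lebesgue_on_UNIV_eq)
  have i: "integrable lebesgue (\<lambda>x. indicator S x * (f x)\<^sup>2)"
    using integrable_mult_indicator[OF assms(2) f(2)] by simp
  then show "f \<in> L2 S"
    using f assms(2) by (auto simp: L2_def integrable_restrict_space intro: measurable_restrict_space1)
  have "(LINT x|lebesgue. indicator S x * (f x)\<^sup>2) \<le> (LINT x|lebesgue. (f x)\<^sup>2)"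
    by (intro integral_mono i f) (auto simp: indicator_def)
  then show "L2_norm S f \<le> L2_norm UNIV f"
    using assms(2) by (simp add: L2_norm_def L2_inner_def power2_eq_square integral_restrict_space lebesgue_on_UNIV_eq)
qed

lemma L2_extend:
  fixes f :: "real^'n \<Rightarrow> real"
  assumes "f \<in> L2 S" "S \<in> sets lebesgue" "\<And>x. x \<notin> S \<Longrightarrow> f x = 0"
  shows "f \<in> L2 UNIV" "L2_norm UNIV f = L2_norm S f"
proof -
  have "f \<in> borel_measurable (lebesgue_on S)" using assms(1) by (rule L2_measurable)
  then have "(\<lambda>x. indicator S x *\<^sub>R f x) \<in> borel_measurable lebesgue"
    using assms(2) by (simp add: borel_measurable_restrict_space_iff)
  moreover have "(\<lambda>x. indicator S x *\<^sub>R f x) = f" using assms(3) by (auto simp: indicator_def fun_eq_iff)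
  ultimately have "f \<in> borel_measurable lebesgue" by simp
  moreover have "integrable lebesgue (\<lambda>x. (f x)\<^sup>2)"
    using L2_square_integrable[OF assms(1)] assms(3) by (simp add: integrable_lebesgue_on[OF assms(2)])
  ultimately show "f \<in> L2 UNIV" by (simp add: L2_def lebesgue_on_UNIV_eq)
  show "L2_norm UNIV f = L2_norm S f"
    using assms(3) by (simp add: L2_norm_def L2_inner_def integral_lebesgue_on[OF assms(2)] lebesgue_on_UNIV_eq)
qed

lemma L2_indicator:
  fixes f :: "real^'n \<Rightarrow> real"
  assumes "f \<in> L2 S" "A \<in> sets lebesgue"
  shows "(\<lambda>x. indicator A x * f x) \<in> L2 S" "L2_norm S (\<lambda>x. indicator A x * f x) \<le> L2_norm S f"
proof -
  have "indicat_real A \<in> borel_measurable (lebesgue_on S)"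
    by (intro measurable_restrict_space1 borel_measurable_indicator assms)
  then have "(\<lambda>x. indicator A x * f x) \<in> borel_measurable (lebesgue_on S)"
    using L2_measurable[OF assms(1)] by (intro borel_measurable_times)
  moreover have ae: "AE x in lebesgue_on S. \<bar>indicator A x * f x\<bar> \<le> \<bar>f x\<bar>"
    by (intro AE_I2) (auto simp: indicator_def)
  ultimately show "(\<lambda>x. indicator A x * f x) \<in> L2 S" by (rule L2_bound[OF _ assms(1)])
  then show "L2_norm S (\<lambda>x. indicator A x * f x) \<le> L2_norm S f" by (rule L2_norm_mono_AE[OF _ assms(1) ae])
qed

lemma partial_cong_open:
  assumes "open U" "x \<in> U" "\<And>y. y \<in> U \<Longrightarrow> f y = g y" "g differentiable (at x)"
  shows "partial i f x = partial i g x"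
proof -
  obtain D where D: "(g has_derivative D) (at x)" using assms(4) by (auto simp: differentiable_def)
  have "(f has_derivative D) (at x)"
    by (rule has_derivative_transform_within_open[OF D assms(1,2)]) (simp add: assms(3))
  with D show ?thesis by (simp add: partial_eq)
qed

subsection \<open>The approximate resolvent\<close>

text \<open>Cut \<open>g\<close> off to \<open>C\<close>, solve the Schroedinger equation
  approximately, undo the conjugation to get \<open>u\<close>, and multiply by the cutoff. On
  \<open>C\<close> the weight is 1 with vanishing gradient, so the Bochner inequality controls the
  plain Hessian there. Where the cutoff is not constant the weight is at least
  \<open>exp (K * c0)\<close>, which makes the extra gradient term small.\<close>

lemma approximate_solution:
  fixes \<Omega> C :: "(real^'n) set"
  assumes \<Omega>: "open \<Omega>" "bounded \<Omega>" and C: "compact C" "convex C" "C \<subseteq> \<Omega>"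
    and g: "g \<in> L2 \<Omega>" and \<nu>: "0 < \<nu>" and \<delta>: "0 < \<delta>"
  obtains w where "w \<in> test_functions \<Omega>"
    "(\<Sum>i\<in>UNIV. \<Sum>j\<in>UNIV. (L2_norm \<Omega> (\<lambda>x. indicator C x * partial j (partial i w) x))\<^sup>2) \<le> (L2_norm \<Omega> g + \<delta>)\<^sup>2"
    "L2_norm \<Omega> w \<le> (L2_norm \<Omega> g + \<delta>) / \<nu>"
    "\<And>i. (L2_norm \<Omega> (partial i w))\<^sup>2 \<le> (L2_norm \<Omega> g + \<delta>)\<^sup>2 / \<nu> + \<delta>"
    "L2_norm \<Omega> (\<lambda>x. indicator C x * (\<nu> * w x - laplacian w x - g x)) \<le> \<delta>"
proof -
  have \<Omega>_leb: "\<Omega> \<in> sets lebesgue" using \<Omega> by simp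
  have C_leb: "C \<in> sets lebesgue" using C(1) compact_imp_closed[of C] by simp
  obtain H where H: "finite H" and H_C: "\<And>p x. p \<in> H \<Longrightarrow> x \<in> C \<Longrightarrow> fst p \<bullet> x - snd p \<le> (0::real)"
    and H_\<Omega>: "{x. \<forall>p\<in>H. fst p \<bullet> x - snd p \<le> 1} \<subseteq> \<Omega>"
    using halfspaces_between[OF \<Omega> C] by blast
  obtain \<eta> where \<eta>: "\<eta> \<in> test_functions \<Omega>" "\<And>x. 0 \<le> \<eta> x" "\<And>x. \<eta> x \<le> 1"
    and \<eta>_one: "\<And>x. (\<And>p. p \<in> H \<Longrightarrow> fst p \<bullet> x - snd p < 1/2) \<Longrightarrow> \<eta> x = 1"
    using smooth_cutoff[OF \<Omega>(2) H H_\<Omega>] by blast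
  \<comment> \<open>An open set on which the cutoff is identically 1. It contains \<open>C\<close>,
    and outside it the exponent of the weight is at least \<open>K * c0\<close>.\<close>
  define U where "U = {x::real^'n. \<forall>p\<in>H. fst p \<bullet> x - snd p < 1/2}"
  have "U = (\<Inter>p\<in>H. {x. fst p \<bullet> x - snd p < 1/2})" by (auto simp: U_def)
  then have U: "open U" using H by (auto intro!: open_INT open_Collect_less continuous_intros)
  have CU: "C \<subseteq> U" using H_C by (fastforce simp: U_def)
  have "\<exists>B. \<forall>x. \<bar>partial i \<eta> x\<bar> \<le> B" for i
    using test_bounded[OF test_partial[OF \<eta>(1), of i]] by blast
  then obtain Bi where Bi: "\<And>i x. \<bar>partial i \<eta> x\<bar> \<le> Bi i" by metis
  define B where "B = (\<Sum>i\<in>UNIV. Bi i)"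
  have Bi0: "0 \<le> Bi i" for i using Bi[of i 0] by linarith
  have B: "\<bar>partial i \<eta> x\<bar> \<le> B" for i x
    using Bi[of i x] member_le_sum[of i UNIV Bi] Bi0 by (simp add: B_def)
  define N where "N = L2_norm \<Omega> g + \<delta>"
  \<comment> \<open>\<open>A\<close> bounds twice the squared norm of the extra gradient term
    \<open>p\<close> below, before the exponential gain; \<open>K\<close> makes the product of both
    at most \<open>\<delta>\<close>, by \<open>t \<le> exp t\<close> at
    \<open>t = A / \<delta>\<close>.\<close>
  define A where "A = 2 * B\<^sup>2 * N\<^sup>2 / \<nu>\<^sup>2"
  have A0: "0 \<le> A" by (simp add: A_def)
  define c0 where "c0 = exp (-2) / (2::real)"
  have c0: "0 < c0" by (simp add: c0_def)
  define K where "K = A / (\<delta> * c0)"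
  have K: "0 \<le> K" using A0 \<delta> c0 by (simp add: K_def)
  have KA: "A * exp (- (K * c0)) \<le> \<delta>"
  proof -
    have "K * c0 = A / \<delta>" using c0 by (simp add: K_def)
    then have "A / \<delta> \<le> exp (K * c0)" using exp_ge_add_one_self[of "K * c0"] by linarith
    then show ?thesis using \<delta> by (simp add: exp_minus field_simps)
  qed
  define \<phi> where "\<phi> = polyhedral_weight K H"
  interpret smooth_weight \<phi>
    by unfold_locales (simp add: \<phi>_def smooth_polyhedral_weight[OF H K])
  have \<phi>0: "0 \<le> \<phi> x" for x unfolding \<phi>_def by (rule polyhedral_weight_bounds[OF H K])
  have \<phi>C: "\<phi> x = 0" "partial i \<phi> x = 0" if "x \<in> C" for x i
    unfolding \<phi>_def using that H_C by (auto intro!: polyhedral_weight_bounds[OF H K])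
  have \<phi>Z: "K * c0 \<le> \<phi> x" if "x \<notin> U" for x
    using that polyhedral_weight_bounds(4)[OF H K] by (auto simp: U_def \<phi>_def c0_def not_less)
  define W where "W x = 1/2 * laplacian \<phi> x + 1/4 * (\<Sum>i\<in>UNIV. (partial i \<phi> x)\<^sup>2)" for x
  have W: "smooth W" "\<And>x. 0 \<le> W x" "\<exists>m. \<forall>x. W x \<le> m"
    using polyhedral_potential[OF H K] unfolding W_def[abs_def] \<phi>_def by auto
  then obtain m where m: "\<And>x. W x \<le> m" by blast
  define z where "z x = indicator C x * g x" for x
  have z\<Omega>: "z \<in> L2 \<Omega>" "L2_norm \<Omega> z \<le> L2_norm \<Omega> g" unfolding z_def[abs_def] by (rule L2_indicator[OF g C_leb])+
  have "z x = 0" if "x \<notin> \<Omega>" for x using that C(3) by (auto simp: z_def indicator_def)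
  note z = L2_extend[OF z\<Omega>(1) \<Omega>_leb this]
  obtain v where v: "v \<in> test_functions UNIV"
    and v_approx: "L2_norm UNIV (\<lambda>x. (\<nu> * v x + W x * v x - laplacian v x) - z x) < \<delta>"
    using schroedinger_range_dense[OF z(1) \<nu> W(1,2) m \<delta>] by blast
  define u where "u x = exp (-1/2 * \<phi> x) * v x" for x
  have u: "u \<in> test_functions UNIV" unfolding u_def[abs_def] by (intro test_mult_smooth smooth_exp_weight v)
  have ui: "partial i u \<in> test_functions UNIV" for i by (intro test_partial u)
  define G where "G x = \<nu> * u x - (\<Sum>i\<in>UNIV. T i (partial i u) x)" for x
  have G: "G \<in> test_functions UNIV" unfolding G_def[abs_def] by (intro test_diff test_scale test_sum test_T ui u) simp
  have eG: "exp (1/2 * \<phi> x) * G x = \<nu> * v x + W x * v x - laplacian v x" for x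
    using conjugation[OF test_functionsD[OF v], where \<nu> = \<nu> and x = x] by (simp add: G_def u_def[abs_def] W_def)
  have eG_L2: "(\<lambda>x. exp (1/2 * \<phi> x) * G x) \<in> L2 UNIV"
    by (intro test_L2_UNIV[of _ UNIV] test_mult_smooth smooth_exp_weight G)
  have approx: "L2_norm UNIV (\<lambda>x. exp (1/2 * \<phi> x) * G x - z x) < \<delta>" using v_approx unfolding eG .
  have "L2_norm UNIV (\<lambda>x. exp (1/2 * \<phi> x) * G x) \<le> N"
  proof -
    have "L2_norm UNIV (\<lambda>x. (exp (1/2 * \<phi> x) * G x - z x) + z x) \<le> L2_norm UNIV (\<lambda>x. exp (1/2 * \<phi> x) * G x - z x) + L2_norm UNIV z"
      by (intro L2.nrm_triangle L2.diff_mem eG_L2 z)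
    then show ?thesis using approx z z\<Omega> by (simp add: N_def)
  qed
  moreover have "0 \<le> L2_norm UNIV (\<lambda>x. exp (1/2 * \<phi> x) * G x)" by (rule L2.nrm_nonneg[OF eG_L2])
  ultimately have GN: "ipw G G \<le> N\<^sup>2" and N0: "0 \<le> N" unfolding ipw_eq_norm by (auto intro: power_mono)
  have "(\<Sum>i\<in>UNIV. \<Sum>j\<in>UNIV. ipw (T j (partial i u)) (T j (partial i u))) + \<nu>\<^sup>2 * ipw u u +
    2 * \<nu> * (\<Sum>i\<in>UNIV. ipw (partial i u) (partial i u)) \<le> ipw G G"
    unfolding G_def[abs_def]
    by (rule Bochner_inequality[OF u \<nu>]) (unfold \<phi>_def, rule polyhedral_weight_curvature[OF H K])
  moreover have "0 \<le> (\<Sum>i\<in>UNIV. \<Sum>j\<in>UNIV. ipw (T j (partial i u)) (T j (partial i u)))"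
    "0 \<le> \<nu>\<^sup>2 * ipw u u" "0 \<le> 2 * \<nu> * (\<Sum>i\<in>UNIV. ipw (partial i u) (partial i u))"
    using \<nu> by (auto intro!: sum_nonneg mult_nonneg_nonneg ipw_nonneg)
  ultimately have hess: "(\<Sum>i\<in>UNIV. \<Sum>j\<in>UNIV. ipw (T j (partial i u)) (T j (partial i u))) \<le> N\<^sup>2"
    and mass: "\<nu>\<^sup>2 * ipw u u \<le> N\<^sup>2" and energy: "2 * \<nu> * (\<Sum>i\<in>UNIV. ipw (partial i u) (partial i u)) \<le> N\<^sup>2"
    using GN by linarith+
  \<comment> \<open>The form in which the weighted estimates are used: pointwise domination
    including the factor \<open>exp (1/2 * \<phi> x)\<close>, which can be spent where the weight is
    large.\<close>
  have below: "(L2_norm \<Omega> f)\<^sup>2 \<le> ipw h h" if f: "f \<in> L2 UNIV" and h: "h \<in> test_functions UNIV" and le: "\<And>x. \<bar>f x\<bar> \<le> exp (1/2 * \<phi> x) * \<bar>h x\<bar>" for f h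
  proof -
    have hL2: "(\<lambda>x. exp (1/2 * \<phi> x) * h x) \<in> L2 UNIV"
      by (intro test_L2_UNIV[of _ UNIV] test_mult_smooth smooth_exp_weight h)
    have "L2_norm \<Omega> f \<le> L2_norm UNIV f" by (rule L2_restrict[OF f \<Omega>_leb])
    also have "\<dots> \<le> L2_norm UNIV (\<lambda>x. exp (1/2 * \<phi> x) * h x)"
      by (rule L2_norm_mono_AE[OF f hL2]) (use le in \<open>simp add: abs_mult\<close>)
    finally show ?thesis
      unfolding ipw_eq_norm using L2.nrm_nonneg[OF L2_restrict(1)[OF f \<Omega>_leb]] by (rule power_mono)
  qed
  have e1: "1 \<le> exp (1/2 * \<phi> x)" for x using \<phi>0[of x] by simp
  define w where "w x = \<eta> x * u x" for x
  have w: "w \<in> test_functions \<Omega>"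
    using test_mult_smooth[OF test_functionsD[OF u] \<eta>(1)] by (simp add: w_def[abs_def] mult.commute)
  have wU: "w x = u x" if "x \<in> U" for x using \<eta>_one[of x] that by (simp add: w_def U_def)
  have w1: "partial i w x = partial i u x" if "x \<in> U" for i x
    by (rule partial_cong_open[OF U that wU smooth_differentiable[OF test_functionsD[OF u]]])
  have w2: "partial j (partial i w) x = partial j (partial i u) x" if "x \<in> U" for i j x
    by (rule partial_cong_open[OF U that w1 smooth_differentiable[OF test_functionsD[OF ui]]])
  have TC: "T j (partial i u) x = partial j (partial i w) x" if "x \<in> C" for i j x
    using that CU w2[of x] \<phi>C(2) by (auto simp: T_def)
  have wi: "partial i w \<in> L2 UNIV" and wij: "partial j (partial i w) \<in> L2 UNIV" for i j
    using test_L2_UNIV[OF test_partial[OF w]] test_L2_UNIV[OF test_partial[OF test_partial[OF w]]] by auto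
  show ?thesis
  proof (rule that[OF w])
    have "(\<Sum>i\<in>UNIV. \<Sum>j\<in>UNIV. (L2_norm \<Omega> (\<lambda>x. indicator C x * partial j (partial i w) x))\<^sup>2) \<le>
        (\<Sum>i\<in>UNIV. \<Sum>j\<in>UNIV. ipw (T j (partial i u)) (T j (partial i u)))"
    proof (intro sum_mono below L2_indicator wij C_leb test_T ui)
      fix i j x
      show "\<bar>indicator C x * partial j (partial i w) x\<bar> \<le> exp (1/2 * \<phi> x) * \<bar>T j (partial i u) x\<bar>"
        using TC[of x j i] \<phi>C(1)[of x] by (cases "x \<in> C") simp_all
    qed
    with hess show "(\<Sum>i\<in>UNIV. \<Sum>j\<in>UNIV. (L2_norm \<Omega> (\<lambda>x. indicator C x * partial j (partial i w) x))\<^sup>2) \<le> (L2_norm \<Omega> g + \<delta>)\<^sup>2"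
      by (simp add: N_def)
    have "(L2_norm \<Omega> w)\<^sup>2 \<le> ipw u u"
    proof (rule below[OF test_L2_UNIV[OF w] u])
      fix x
      have "\<bar>w x\<bar> \<le> 1 * \<bar>u x\<bar>" unfolding w_def abs_mult using \<eta>(2,3)[of x] by (intro mult_right_mono) auto
      also have "\<dots> \<le> exp (1/2 * \<phi> x) * \<bar>u x\<bar>" by (intro mult_right_mono e1) simp
      finally show "\<bar>w x\<bar> \<le> exp (1/2 * \<phi> x) * \<bar>u x\<bar>" .
    qed
    then have "(\<nu> * L2_norm \<Omega> w)\<^sup>2 \<le> N\<^sup>2"
      using mass mult_left_mono[of "(L2_norm \<Omega> w)\<^sup>2" "ipw u u" "\<nu>\<^sup>2"] by (simp add: power_mult_distrib)
    then have "\<nu> * L2_norm \<Omega> w \<le> N" using N0 by (rule power2_le_imp_le)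
    then show "L2_norm \<Omega> w \<le> (L2_norm \<Omega> g + \<delta>) / \<nu>" using \<nu> by (simp add: N_def field_simps)
    show "(L2_norm \<Omega> (partial i w))\<^sup>2 \<le> (L2_norm \<Omega> g + \<delta>)\<^sup>2 / \<nu> + \<delta>" for i
    proof -
      define p where "p x = partial i \<eta> x * u x" for x
      define q where "q x = \<eta> x * partial i u x" for x
      have pi: "partial i w = (\<lambda>x. p x + q x)"
        unfolding p_def q_def w_def[abs_def]
        using smooth_partial_rules(4)[OF test_functionsD[OF \<eta>(1)] test_functionsD[OF u]] by simp
      have p: "p \<in> test_functions UNIV" and q: "q \<in> test_functions UNIV"
        unfolding p_def[abs_def] q_def[abs_def]
        by (intro test_mult_smooth smooth_partial test_functionsD[OF \<eta>(1)] u ui)+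
      have pq: "p \<in> L2 \<Omega>" "q \<in> L2 \<Omega>" using p q by (auto intro: test_L2 \<Omega>_leb)
      have "(L2_norm \<Omega> q)\<^sup>2 \<le> ipw (partial i u) (partial i u)"
      proof (rule below[OF test_L2_UNIV[OF q] ui])
        fix x
        have "\<bar>q x\<bar> \<le> 1 * \<bar>partial i u x\<bar>" unfolding q_def abs_mult using \<eta>(2,3)[of x] by (intro mult_right_mono) auto
        also have "\<dots> \<le> exp (1/2 * \<phi> x) * \<bar>partial i u x\<bar>" by (intro mult_right_mono e1) simp
        finally show "\<bar>q x\<bar> \<le> exp (1/2 * \<phi> x) * \<bar>partial i u x\<bar>" .
      qed
      also have "\<dots> \<le> (\<Sum>i\<in>UNIV. ipw (partial i u) (partial i u))" by (rule member_le_sum) (auto intro: ipw_nonneg)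
      also have "\<dots> \<le> N\<^sup>2 / (2 * \<nu>)" using energy \<nu> by (simp add: field_simps)
      finally have q_bound: "(L2_norm \<Omega> q)\<^sup>2 \<le> N\<^sup>2 / (2 * \<nu>)" .
      \<comment> \<open>Outside \<open>U\<close> a factor \<open>exp (K * c0 / 2)\<close> of the
        weight is available; \<open>b\<close> is the bound on the cutoff gradient divided by
        it.\<close>
      define b where "b = B * exp (- (K * c0 / 2))"
      have "(L2_norm \<Omega> p)\<^sup>2 \<le> ipw (\<lambda>x. b * u x) (\<lambda>x. b * u x)"
      proof (rule below[OF test_L2_UNIV[OF p] test_scale[OF u]])
        fix x
        show "\<bar>p x\<bar> \<le> exp (1/2 * \<phi> x) * \<bar>b * u x\<bar>"
        proof (cases "x \<in> U")
          case True
          have "partial i \<eta> x = partial i (\<lambda>x. 1) x"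
            by (rule partial_cong_open[OF U True]) (auto simp: U_def \<eta>_one)
          then show ?thesis by (simp add: p_def partial_const)
        next
          case False
          have "\<bar>p x\<bar> \<le> B * \<bar>u x\<bar>" unfolding p_def abs_mult by (intro mult_right_mono B) simp
          also have "B * \<bar>u x\<bar> = exp (K * c0 / 2) * (b * \<bar>u x\<bar>)"
            by (simp add: b_def mult.assoc[symmetric] mult.commute[of _ B] flip: exp_add)
          also have "\<dots> \<le> exp (1/2 * \<phi> x) * (b * \<bar>u x\<bar>)"
            using \<phi>Z[OF False] B[of i x] by (intro mult_right_mono) (auto simp: b_def)
          finally show ?thesis using B[of i x] by (simp add: abs_mult b_def)
        qed
      qed
      also have "\<dots> = b\<^sup>2 * ipw u u" by (simp add: ipw_scale ipw_scale_right power2_eq_square)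
      also have "\<dots> \<le> b\<^sup>2 * (N\<^sup>2 / \<nu>\<^sup>2)" using mass \<nu> by (intro mult_left_mono) (auto simp: field_simps)
      also have "b\<^sup>2 = B\<^sup>2 * exp (- (K * c0))" by (simp add: b_def power_mult_distrib flip: exp_double)
      finally have p_bound: "2 * (L2_norm \<Omega> p)\<^sup>2 \<le> \<delta>" using KA by (simp add: A_def field_simps)
      have "(L2_norm \<Omega> (partial i w))\<^sup>2 \<le> (L2_norm \<Omega> p + L2_norm \<Omega> q)\<^sup>2"
        unfolding pi by (intro power_mono L2.nrm_triangle L2.nrm_nonneg L2.add_mem pq)
      also have "\<dots> \<le> 2 * (L2_norm \<Omega> p)\<^sup>2 + 2 * (L2_norm \<Omega> q)\<^sup>2"
        using sum_squares_bound[of "L2_norm \<Omega> p" "L2_norm \<Omega> q"] by (simp add: power2_sum)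
      also have "\<dots> \<le> \<delta> + 2 * (N\<^sup>2 / (2 * \<nu>))" using p_bound q_bound by linarith
      finally show ?thesis using \<nu> by (simp add: N_def)
    qed
    have "L2_norm \<Omega> (\<lambda>x. indicator C x * (\<nu> * w x - laplacian w x - g x)) \<le>
        L2_norm UNIV (\<lambda>x. exp (1/2 * \<phi> x) * G x - z x)"
    proof -
      have L: "(\<lambda>x. exp (1/2 * \<phi> x) * G x - z x) \<in> L2 UNIV" by (intro L2.diff_mem eG_L2 z)
      \<comment> \<open>On \<open>C\<close> both \<open>\<phi>\<close> and its gradient vanish and
        \<open>w\<close> agrees with \<open>u\<close> nearby, so the weighted equation is the plain
        one.\<close>
      have eq: "indicator C x * (\<nu> * w x - laplacian w x - g x) = indicator C x * (exp (1/2 * \<phi> x) * G x - z x)" for x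
      proof (cases "x \<in> C")
        case True
        then have "G x = \<nu> * w x - laplacian w x"
          using CU wU by (auto simp: G_def laplacian_def TC)
        then show ?thesis using True \<phi>C(1)[OF True] by (simp add: z_def)
      qed simp
      show ?thesis unfolding eq
        using L2_indicator(2)[OF L2_restrict(1)[OF L \<Omega>_leb] C_leb] L2_restrict(2)[OF L \<Omega>_leb] by simp
    qed
    with approx show "L2_norm \<Omega> (\<lambda>x. indicator C x * (\<nu> * w x - laplacian w x - g x)) \<le> \<delta>" by simp
  qed
qed

section \<open>Sobolev spaces\<close>

lemma L2_strong_convI_le:
  assumes "\<And>n. L2_norm S (\<lambda>x. X n x - l x) \<le> e n" "e \<longlonglongrightarrow> 0" "\<And>n. X n \<in> L2 S" "l \<in> L2 S"
  shows "strong_conv (L2_norm S) X l"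
  unfolding strong_conv_def
proof (rule tendsto_sandwich[OF _ _ tendsto_const assms(2)])
  show "\<forall>\<^sub>F n in sequentially. 0 \<le> L2_norm S (\<lambda>x. X n x - l x)"
    by (intro always_eventually allI L2.nrm_nonneg L2.diff_mem assms)
qed (use assms(1) in simp)

locale open_domain =
  fixes \<Omega> :: "(real^'n) set"
  assumes open_domain: "open \<Omega>"
begin

lemma domain_lebesgue: "\<Omega> \<in> sets lebesgue"
  using open_domain by simp

abbreviation ip where "ip \<equiv> L2_inner \<Omega>"
abbreviation nm where "nm \<equiv> L2_norm \<Omega>"
abbreviation D where "D i v \<equiv> weak_partial \<Omega> i v"

lemma test_in_L2: "\<phi> \<in> test_functions T \<Longrightarrow> \<phi> \<in> L2 \<Omega>"
  by (rule test_L2[OF _ domain_lebesgue])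

lemma is_weak_partial_unique:
  assumes "g \<in> L2 \<Omega>" "h \<in> L2 \<Omega>" "is_weak_partial \<Omega> i v g" "is_weak_partial \<Omega> i v h"
  shows "AE x in lebesgue_on \<Omega>. g x = h x"
proof -
  have "AE x in lebesgue_on \<Omega>. g x - h x = 0"
    using assms by (intro fundamental_lemma[OF open_domain] L2.diff_mem)
      (simp_all add: L2.ip_diff_left test_in_L2 is_weak_partial_def)
  then show ?thesis by eventually_elim simp
qed

text \<open>\<open>SOME\<close> selects an unspecified representative, so later identities between
  values of \<open>D\<close> hold almost everywhere only.\<close>

lemma weak_partial:
  assumes "g \<in> L2 \<Omega>" "is_weak_partial \<Omega> i v g"
  shows "D i v \<in> L2 \<Omega>" "is_weak_partial \<Omega> i v (D i v)" "AE x in lebesgue_on \<Omega>. D i v x = g x"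
proof -
  have "D i v \<in> L2 \<Omega> \<and> is_weak_partial \<Omega> i v (D i v)"
    unfolding weak_partial_def by (rule someI[of _ g]) (use assms in simp)
  then show "D i v \<in> L2 \<Omega>" "is_weak_partial \<Omega> i v (D i v)" by auto
  with assms show "AE x in lebesgue_on \<Omega>. D i v x = g x" by (intro is_weak_partial_unique)
qed

lemma H1D:
  assumes "v \<in> H1 \<Omega>" shows "v \<in> L2 \<Omega>" "D i v \<in> L2 \<Omega>" "is_weak_partial \<Omega> i v (D i v)"
  using assms weak_partial(1,2)[of _ i v] unfolding H1_def by blast+

lemma H1I: "v \<in> L2 \<Omega> \<Longrightarrow> (\<And>i. g i \<in> L2 \<Omega>) \<Longrightarrow> (\<And>i. is_weak_partial \<Omega> i v (g i)) \<Longrightarrow> v \<in> H1 \<Omega>"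
  unfolding H1_def by blast

lemma is_weak_partial_cong:
  assumes "v \<in> L2 \<Omega>" "v' \<in> L2 \<Omega>" "AE x in lebesgue_on \<Omega>. v x = v' x" "is_weak_partial \<Omega> i v g"
  shows "is_weak_partial \<Omega> i v' g"
  unfolding is_weak_partial_def
proof
  fix \<phi> assume "\<phi> \<in> test_functions \<Omega>"
  then have "ip v' (partial i \<phi>) = ip v (partial i \<phi>)"
    using assms by (intro L2_inner_cong_AE) (auto intro: test_in_L2 test_partial)
  then show "ip v' (partial i \<phi>) = - ip g \<phi>"
    using assms(4) \<open>\<phi> \<in> test_functions \<Omega>\<close> by (simp add: is_weak_partial_def)
qed

lemma is_weak_partial_add:
  assumes "u \<in> L2 \<Omega>" "v \<in> L2 \<Omega>" "g \<in> L2 \<Omega>" "h \<in> L2 \<Omega>" "is_weak_partial \<Omega> i u g" "is_weak_partial \<Omega> i v h"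
  shows "is_weak_partial \<Omega> i (\<lambda>x. u x + v x) (\<lambda>x. g x + h x)"
  using assms by (auto simp: is_weak_partial_def L2.ip_add_left test_in_L2 test_partial[THEN test_in_L2])

lemma is_weak_partial_scale:
  assumes "u \<in> L2 \<Omega>" "g \<in> L2 \<Omega>" "is_weak_partial \<Omega> i u g"
  shows "is_weak_partial \<Omega> i (\<lambda>x. c * u x) (\<lambda>x. c * g x)"
  using assms by (auto simp: is_weak_partial_def L2.ip_scale_left test_in_L2 test_partial[THEN test_in_L2])

lemma is_weak_partial_test:
  assumes "\<phi> \<in> test_functions \<Omega>" shows "is_weak_partial \<Omega> i \<phi> (partial i \<phi>)"
  unfolding is_weak_partial_def
  using integration_by_parts[OF domain_lebesgue test_functionsD[OF assms], of _ i] by simp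

lemma is_weak_partial_limit:
  assumes "\<And>n. X n \<in> L2 \<Omega>" "\<And>n. Y n \<in> L2 \<Omega>" "v \<in> L2 \<Omega>" "g \<in> L2 \<Omega>"
    and "\<And>n. is_weak_partial \<Omega> i (X n) (Y n)"
    and "strong_conv nm X v" "strong_conv nm Y g"
  shows "is_weak_partial \<Omega> i v g"
  unfolding is_weak_partial_def
proof
  fix \<phi> assume \<phi>: "\<phi> \<in> test_functions \<Omega>"
  have "(\<lambda>n. ip (X n) (partial i \<phi>)) \<longlonglongrightarrow> ip v (partial i \<phi>)"
    by (rule L2.strong_conv_ip[OF assms(1,3,6) test_in_L2[OF test_partial[OF \<phi>]]])
  moreover have "(\<lambda>n. ip (X n) (partial i \<phi>)) \<longlonglongrightarrow> - ip g \<phi>"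
    using tendsto_minus[OF L2.strong_conv_ip[OF assms(2,4,7) test_in_L2[OF \<phi>]]] assms(5) \<phi>
    by (simp add: is_weak_partial_def)
  ultimately show "ip v (partial i \<phi>) = - ip g \<phi>" by (rule LIMSEQ_unique)
qed

lemma test_H1:
  assumes "\<phi> \<in> test_functions \<Omega>"
  shows "\<phi> \<in> H1 \<Omega>" "AE x in lebesgue_on \<Omega>. D i \<phi> x = partial i \<phi> x"
  using assms weak_partial(3)[OF test_in_L2[OF test_partial[OF assms]] is_weak_partial_test[OF assms]]
  by (auto intro!: H1I[where g = "\<lambda>i. partial i \<phi>"] test_in_L2 test_partial is_weak_partial_test)

lemma H1_add:
  assumes u: "u \<in> H1 \<Omega>" and v: "v \<in> H1 \<Omega>"
  shows "(\<lambda>x. u x + v x) \<in> H1 \<Omega>" "AE x in lebesgue_on \<Omega>. D i (\<lambda>x. u x + v x) x = D i u x + D i v x"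
proof -
  have w: "is_weak_partial \<Omega> i (\<lambda>x. u x + v x) (\<lambda>x. D i u x + D i v x)" for i
    by (intro is_weak_partial_add H1D u v)
  show "(\<lambda>x. u x + v x) \<in> H1 \<Omega>"
    by (rule H1I[OF _ _ w]) (intro L2_add H1D u v)+
  show "AE x in lebesgue_on \<Omega>. D i (\<lambda>x. u x + v x) x = D i u x + D i v x"
    by (rule weak_partial(3)[OF _ w]) (intro L2_add H1D u v)
qed

lemma H1_scale:
  assumes u: "u \<in> H1 \<Omega>"
  shows "(\<lambda>x. c * u x) \<in> H1 \<Omega>" "AE x in lebesgue_on \<Omega>. D i (\<lambda>x. c * u x) x = c * D i u x"
proof -
  have w: "is_weak_partial \<Omega> i (\<lambda>x. c * u x) (\<lambda>x. c * D i u x)" for i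
    by (intro is_weak_partial_scale H1D u)
  show "(\<lambda>x. c * u x) \<in> H1 \<Omega>"
    by (rule H1I[OF _ _ w]) (intro L2_scale H1D u)+
  show "AE x in lebesgue_on \<Omega>. D i (\<lambda>x. c * u x) x = c * D i u x"
    by (rule weak_partial(3)[OF _ w]) (intro L2_scale H1D u)
qed

lemma H1_diff:
  assumes u: "u \<in> H1 \<Omega>" and v: "v \<in> H1 \<Omega>"
  shows "(\<lambda>x. u x - v x) \<in> H1 \<Omega>" "AE x in lebesgue_on \<Omega>. D i (\<lambda>x. u x - v x) x = D i u x - D i v x"
proof -
  have eq: "(\<lambda>x. u x - v x) = (\<lambda>x. u x + (-1) * v x)" by simp
  show "(\<lambda>x. u x - v x) \<in> H1 \<Omega>" unfolding eq by (intro H1_add H1_scale u v)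
  show "AE x in lebesgue_on \<Omega>. D i (\<lambda>x. u x - v x) x = D i u x - D i v x"
    unfolding eq using H1_add(2)[OF u H1_scale(1)[OF v], of i "-1"] H1_scale(2)[OF v, of i "-1"]
    by eventually_elim simp
qed

text \<open>Needed for nested derivatives: \<open>D i\<close> is applied to representatives such as
  \<open>D j\<close> of a sum, which agree with the expected function only almost
  everywhere.\<close>

lemma H1_cong:
  assumes u: "u \<in> H1 \<Omega>" and v: "v \<in> L2 \<Omega>" and ae: "AE x in lebesgue_on \<Omega>. u x = v x"
  shows "v \<in> H1 \<Omega>" "AE x in lebesgue_on \<Omega>. D i v x = D i u x"
proof -
  have w: "is_weak_partial \<Omega> i v (D i u)" for i
    by (rule is_weak_partial_cong[OF H1D(1)[OF u] v ae H1D(3)[OF u]])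
  show "v \<in> H1 \<Omega>" by (rule H1I[OF v H1D(2)[OF u] w])
  show "AE x in lebesgue_on \<Omega>. D i v x = D i u x" by (rule weak_partial(3)[OF H1D(2)[OF u] w])
qed

lemma H1_norm_le: "H1_norm \<Omega> v \<le> \<bar>nm v\<bar> + (\<Sum>i\<in>UNIV. \<bar>nm (D i v)\<bar>)"
proof -
  have "sqrt ((nm v)\<^sup>2 + (\<Sum>i\<in>UNIV. (nm (D i v))\<^sup>2)) \<le> sqrt ((nm v)\<^sup>2) + sqrt (\<Sum>i\<in>UNIV. (nm (D i v))\<^sup>2)"
    by (intro sqrt_add_le_add_sqrt sum_nonneg) auto
  also have "sqrt (\<Sum>i\<in>UNIV. (nm (D i v))\<^sup>2) \<le> (\<Sum>i\<in>UNIV. \<bar>nm (D i v)\<bar>)"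
    using L2_set_le_sum_abs[of "\<lambda>i. nm (D i v)" UNIV] by (simp add: L2_set_def)
  finally show ?thesis by (simp add: H1_norm_def)
qed

lemma H1_norm_ge: "\<bar>nm v\<bar> \<le> H1_norm \<Omega> v" "\<bar>nm (D i v)\<bar> \<le> H1_norm \<Omega> v"
proof -
  show "\<bar>nm v\<bar> \<le> H1_norm \<Omega> v"
    unfolding H1_norm_def real_sqrt_abs[symmetric] by (intro real_sqrt_le_mono) (simp add: sum_nonneg)
  have "(nm (D i v))\<^sup>2 \<le> (\<Sum>i\<in>UNIV. (nm (D i v))\<^sup>2)" by (rule member_le_sum) auto
  then show "\<bar>nm (D i v)\<bar> \<le> H1_norm \<Omega> v"
    unfolding H1_norm_def real_sqrt_abs[symmetric] by (intro real_sqrt_le_mono) (simp add: add_increasing)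
qed

lemma test_diff_norm:
  assumes \<phi>: "\<phi> \<in> test_functions \<Omega>" and v: "v \<in> H1 \<Omega>"
  shows "nm (D i (\<lambda>x. \<phi> x - v x)) = nm (\<lambda>x. partial i \<phi> x - D i v x)"
proof (rule L2_norm_cong_AE)
  show "AE x in lebesgue_on \<Omega>. D i (\<lambda>x. \<phi> x - v x) x = partial i \<phi> x - D i v x"
    using H1_diff(2)[OF test_H1(1)[OF \<phi>] v, of i] test_H1(2)[OF \<phi>, of i] by eventually_elim simp
qed (auto intro: H1D H1_diff test_H1 \<phi> v L2.diff_mem test_in_L2 test_partial)

text \<open>The gradient limits \<open>g\<close> need not be the chosen representatives
  \<open>D i v\<close>; that they are weak derivatives is shown along the way, by closedness of the
  weak derivative under strong limits.\<close>

lemma H10I: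
  assumes v: "v \<in> L2 \<Omega>" and g: "\<And>i. g i \<in> L2 \<Omega>" and \<phi>: "\<And>k. \<phi> k \<in> test_functions \<Omega>"
    and conv: "strong_conv nm \<phi> v" "\<And>i. strong_conv nm (\<lambda>k. partial i (\<phi> k)) (g i)"
  shows "v \<in> H10 \<Omega>" "\<And>i. is_weak_partial \<Omega> i v (g i)"
proof -
  show w: "is_weak_partial \<Omega> i v (g i)" for i
    by (rule is_weak_partial_limit[OF _ _ v g is_weak_partial_test[OF \<phi>] conv])
       (auto intro: test_in_L2 test_partial \<phi>)
  then have H1: "v \<in> H1 \<Omega>" using v g by (intro H1I)
  have "(\<lambda>k. H1_norm \<Omega> (\<lambda>x. \<phi> k x - v x)) \<longlonglongrightarrow> 0"
  proof (rule tendsto_sandwich[OF _ _ tendsto_const])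
    show "(\<lambda>k. \<bar>nm (\<lambda>x. \<phi> k x - v x)\<bar> + (\<Sum>i\<in>UNIV. \<bar>nm (\<lambda>x. partial i (\<phi> k) x - g i x)\<bar>)) \<longlonglongrightarrow> 0"
      using conv unfolding strong_conv_def by (auto intro!: tendsto_eq_intros tendsto_null_sum tendsto_rabs_zero)
    have "nm (D i (\<lambda>x. \<phi> k x - v x)) = nm (\<lambda>x. partial i (\<phi> k) x - g i x)" for i k
      unfolding test_diff_norm[OF \<phi> H1]
    proof (rule L2_norm_cong_AE)
      show "AE x in lebesgue_on \<Omega>. partial i (\<phi> k) x - D i v x = partial i (\<phi> k) x - g i x"
        using weak_partial(3)[OF g w, of i] by eventually_elim simp
    qed (auto intro: L2.diff_mem test_in_L2 test_partial \<phi> H1D H1 g)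
    then show "\<forall>\<^sub>F k in sequentially. H1_norm \<Omega> (\<lambda>x. \<phi> k x - v x) \<le>
        \<bar>nm (\<lambda>x. \<phi> k x - v x)\<bar> + (\<Sum>i\<in>UNIV. \<bar>nm (\<lambda>x. partial i (\<phi> k) x - g i x)\<bar>)"
      using H1_norm_le[of "\<lambda>x. \<phi> _ x - v x"] by (auto intro!: always_eventually)
    show "\<forall>\<^sub>F k in sequentially. 0 \<le> H1_norm \<Omega> (\<lambda>x. \<phi> k x - v x)"
      by (simp add: H1_norm_def sum_nonneg)
  qed
  then show "v \<in> H10 \<Omega>" using H1 \<phi> unfolding H10_def strong_conv_def by blast
qed

lemma H10E:
  assumes v: "v \<in> H10 \<Omega>"
  obtains \<phi> where "\<And>k. \<phi> k \<in> test_functions \<Omega>" "strong_conv nm \<phi> v"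
    "\<And>i. strong_conv nm (\<lambda>k. partial i (\<phi> k)) (D i v)"
proof -
  have H1: "v \<in> H1 \<Omega>" using v by (simp add: H10_def)
  obtain \<phi> where \<phi>: "\<And>k. \<phi> k \<in> test_functions \<Omega>" and conv: "(\<lambda>k. H1_norm \<Omega> (\<lambda>x. \<phi> k x - v x)) \<longlonglongrightarrow> 0"
    using v unfolding H10_def strong_conv_def by blast
  show ?thesis
  proof (rule that[OF \<phi>])
    show "strong_conv nm \<phi> v"
      by (rule L2_strong_convI_le[OF order_trans[OF abs_ge_self H1_norm_ge(1)] conv])
         (auto intro: test_in_L2 \<phi> H1D H1)
    have "nm (\<lambda>x. partial i (\<phi> k) x - D i v x) \<le> H1_norm \<Omega> (\<lambda>x. \<phi> k x - v x)" for i k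
      using H1_norm_ge(2)[of i "\<lambda>x. \<phi> k x - v x"] test_diff_norm[OF \<phi> H1, of i k] by simp
    then show "strong_conv nm (\<lambda>k. partial i (\<phi> k)) (D i v)" for i
      by (rule L2_strong_convI_le[OF _ conv]) (auto intro: test_in_L2 test_partial \<phi> H1D H1)
  qed
qed

lemma H10_H1: "v \<in> H10 \<Omega> \<Longrightarrow> v \<in> H1 \<Omega>"
  by (simp add: H10_def)

lemma strong_conv_add:
  assumes "\<And>n. X n \<in> L2 S" "\<And>n. Y n \<in> L2 S" "a \<in> L2 S" "b \<in> L2 S"
    "strong_conv (L2_norm S) X a" "strong_conv (L2_norm S) Y b"
  shows "strong_conv (L2_norm S) (\<lambda>n x. X n x + Y n x) (\<lambda>x. a x + b x)"
proof (rule L2_strong_convI_le)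
  show "L2_norm S (\<lambda>x. (X n x + Y n x) - (a x + b x)) \<le> L2_norm S (\<lambda>x. X n x - a x) + L2_norm S (\<lambda>x. Y n x - b x)" for n
    using L2.nrm_triangle[OF L2.diff_mem[OF assms(1,3)] L2.diff_mem[OF assms(2,4)], of n n]
    by (simp add: algebra_simps)
  show "(\<lambda>n. L2_norm S (\<lambda>x. X n x - a x) + L2_norm S (\<lambda>x. Y n x - b x)) \<longlonglongrightarrow> 0"
    using tendsto_add[OF assms(5,6)[unfolded strong_conv_def]] by simp
qed (use assms in \<open>auto intro: L2_add\<close>)

lemma strong_conv_scale:
  assumes "\<And>n. X n \<in> L2 S" "a \<in> L2 S" "strong_conv (L2_norm S) X a"
  shows "strong_conv (L2_norm S) (\<lambda>n x. c * X n x) (\<lambda>x. c * a x)"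
proof (rule L2_strong_convI_le)
  show "L2_norm S (\<lambda>x. c * X n x - c * a x) \<le> \<bar>c\<bar> * L2_norm S (\<lambda>x. X n x - a x)" for n
    using L2.nrm_scale[OF L2.diff_mem[OF assms(1,2)], of c n] by (simp add: algebra_simps)
  show "(\<lambda>n. \<bar>c\<bar> * L2_norm S (\<lambda>x. X n x - a x)) \<longlonglongrightarrow> 0"
    using assms(3) unfolding strong_conv_def by (rule tendsto_mult_right_zero)
qed (use assms in \<open>auto intro: L2_scale\<close>)

lemma H10_add:
  assumes "u \<in> H10 \<Omega>" "v \<in> H10 \<Omega>" shows "(\<lambda>x. u x + v x) \<in> H10 \<Omega>"
proof -
  obtain \<phi> where \<phi>: "\<And>k. \<phi> k \<in> test_functions \<Omega>" "strong_conv nm \<phi> u" "\<And>i. strong_conv nm (\<lambda>k. partial i (\<phi> k)) (D i u)"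
    using H10E[OF assms(1)] by blast
  obtain \<psi> where \<psi>: "\<And>k. \<psi> k \<in> test_functions \<Omega>" "strong_conv nm \<psi> v" "\<And>i. strong_conv nm (\<lambda>k. partial i (\<psi> k)) (D i v)"
    using H10E[OF assms(2)] by blast
  note H = H10_H1[OF assms(1)] H10_H1[OF assms(2)]
  have eq: "partial i (\<lambda>x. \<phi> k x + \<psi> k x) = (\<lambda>x. partial i (\<phi> k) x + partial i (\<psi> k) x)" for i k
    by (intro smooth_partial_rules(1) test_functionsD[OF \<phi>(1)] test_functionsD[OF \<psi>(1)])
  show ?thesis
  proof (rule H10I(1)[where g = "\<lambda>i x. D i u x + D i v x" and \<phi> = "\<lambda>k x. \<phi> k x + \<psi> k x"])
    show "strong_conv nm (\<lambda>k x. \<phi> k x + \<psi> k x) (\<lambda>x. u x + v x)"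
      by (intro strong_conv_add \<phi> \<psi> test_in_L2[OF \<phi>(1)] test_in_L2[OF \<psi>(1)] H1D H)
    show "strong_conv nm (\<lambda>k. partial i (\<lambda>x. \<phi> k x + \<psi> k x)) (\<lambda>x. D i u x + D i v x)" for i
      unfolding eq
      by (intro strong_conv_add \<phi> \<psi> test_in_L2[OF test_partial[OF \<phi>(1)]] test_in_L2[OF test_partial[OF \<psi>(1)]] H1D H)
  qed (auto intro: L2_add H1D H test_add \<phi> \<psi>)
qed

lemma H10_scale:
  assumes "u \<in> H10 \<Omega>" shows "(\<lambda>x. c * u x) \<in> H10 \<Omega>"
proof -
  obtain \<phi> where \<phi>: "\<And>k. \<phi> k \<in> test_functions \<Omega>" "strong_conv nm \<phi> u" "\<And>i. strong_conv nm (\<lambda>k. partial i (\<phi> k)) (D i u)"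
    using H10E[OF assms(1)] by blast
  note H = H10_H1[OF assms(1)]
  have eq: "partial i (\<lambda>x. c * \<phi> k x) = (\<lambda>x. c * partial i (\<phi> k) x)" for i k
    by (intro smooth_partial_rules(3)[of _ "\<phi> k"] test_functionsD[OF \<phi>(1)])
  show ?thesis
  proof (rule H10I(1)[where g = "\<lambda>i x. c * D i u x" and \<phi> = "\<lambda>k x. c * \<phi> k x"])
    show "strong_conv nm (\<lambda>k x. c * \<phi> k x) (\<lambda>x. c * u x)"
      by (intro strong_conv_scale \<phi> test_in_L2[OF \<phi>(1)] H1D H)
    show "strong_conv nm (\<lambda>k. partial i (\<lambda>x. c * \<phi> k x)) (\<lambda>x. c * D i u x)" for i
      unfolding eq by (intro strong_conv_scale \<phi> test_in_L2[OF test_partial[OF \<phi>(1)]] H1D H)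
  qed (auto intro: L2_scale H1D H test_scale \<phi>)
qed

subsection \<open>The space \<open>V\<close>\<close>

lemma V_D:
  assumes "v \<in> V \<Omega>"
  shows "v \<in> H1 \<Omega>" "v \<in> H10 \<Omega>" "D j v \<in> H1 \<Omega>" "v \<in> L2 \<Omega>" "D j v \<in> L2 \<Omega>" "D i (D j v) \<in> L2 \<Omega>"
  using assms H1D by (auto simp: V_def H2_def)

lemma V_I: "v \<in> H10 \<Omega> \<Longrightarrow> (\<And>j. D j v \<in> H1 \<Omega>) \<Longrightarrow> v \<in> V \<Omega>"
  using H10_H1 by (auto simp: V_def H2_def)

lemma V_add:
  assumes u: "u \<in> V \<Omega>" and v: "v \<in> V \<Omega>"
  shows "(\<lambda>x. u x + v x) \<in> V \<Omega>"
    "AE x in lebesgue_on \<Omega>. D j (\<lambda>x. u x + v x) x = D j u x + D j v x"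
    "AE x in lebesgue_on \<Omega>. D i (D j (\<lambda>x. u x + v x)) x = D i (D j u) x + D i (D j v) x"
proof -
  show ae: "AE x in lebesgue_on \<Omega>. D j (\<lambda>x. u x + v x) x = D j u x + D j v x" for j
    by (intro H1_add V_D u v)
  then have ae': "AE x in lebesgue_on \<Omega>. D j u x + D j v x = D j (\<lambda>x. u x + v x) x" for j
    by (simp add: eq_commute)
  have sum: "(\<lambda>x. D j u x + D j v x) \<in> H1 \<Omega>" for j by (intro H1_add V_D u v)
  have L: "D j (\<lambda>x. u x + v x) \<in> L2 \<Omega>" for j by (intro H1D H1_add V_D u v)
  note c = H1_cong[OF sum L ae']
  show "(\<lambda>x. u x + v x) \<in> V \<Omega>" by (intro V_I H10_add V_D[OF u] V_D[OF v] c)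
  show "AE x in lebesgue_on \<Omega>. D i (D j (\<lambda>x. u x + v x)) x = D i (D j u) x + D i (D j v) x"
    using c(2)[of i j] H1_add(2)[OF V_D(3)[OF u] V_D(3)[OF v], of i j j] by eventually_elim simp
qed

lemma V_scale:
  assumes u: "u \<in> V \<Omega>"
  shows "(\<lambda>x. c * u x) \<in> V \<Omega>"
    "AE x in lebesgue_on \<Omega>. D j (\<lambda>x. c * u x) x = c * D j u x"
    "AE x in lebesgue_on \<Omega>. D i (D j (\<lambda>x. c * u x)) x = c * D i (D j u) x"
proof -
  show ae: "AE x in lebesgue_on \<Omega>. D j (\<lambda>x. c * u x) x = c * D j u x" for j
    by (intro H1_scale V_D u)
  then have ae': "AE x in lebesgue_on \<Omega>. c * D j u x = D j (\<lambda>x. c * u x) x" for j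
    by (simp add: eq_commute)
  have sc: "(\<lambda>x. c * D j u x) \<in> H1 \<Omega>" for j by (intro H1_scale V_D u)
  have L: "D j (\<lambda>x. c * u x) \<in> L2 \<Omega>" for j by (intro H1D H1_scale V_D u)
  note c = H1_cong[OF sc L ae']
  show "(\<lambda>x. c * u x) \<in> V \<Omega>" by (intro V_I H10_scale V_D[OF u] c)
  show "AE x in lebesgue_on \<Omega>. D i (D j (\<lambda>x. c * u x)) x = c * D i (D j u) x"
    using c(2)[of i j] H1_scale(2)[OF V_D(3)[OF u], of i c j] by eventually_elim simp
qed

lemma V_diff:
  assumes u: "u \<in> V \<Omega>" and v: "v \<in> V \<Omega>"
  shows "(\<lambda>x. u x - v x) \<in> V \<Omega>"
    "AE x in lebesgue_on \<Omega>. D j (\<lambda>x. u x - v x) x = D j u x - D j v x"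
    "AE x in lebesgue_on \<Omega>. D i (D j (\<lambda>x. u x - v x)) x = D i (D j u) x - D i (D j v) x"
proof -
  have eq: "(\<lambda>x. u x - v x) = (\<lambda>x. u x + (-1) * v x)" by simp
  note v' = V_scale[OF v, where c = "-1"]
  show "(\<lambda>x. u x - v x) \<in> V \<Omega>" unfolding eq by (rule V_add(1)[OF u v'(1)])
  show "AE x in lebesgue_on \<Omega>. D j (\<lambda>x. u x - v x) x = D j u x - D j v x"
    unfolding eq using V_add(2)[OF u v'(1), of j] v'(2)[of j] by eventually_elim simp
  show "AE x in lebesgue_on \<Omega>. D i (D j (\<lambda>x. u x - v x)) x = D i (D j u) x - D i (D j v) x"
    unfolding eq using V_add(3)[OF u v'(1), of i j] v'(3)[of i j] by eventually_elim simp
qed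

definition H2_inner :: "(real^'n \<Rightarrow> real) \<Rightarrow> (real^'n \<Rightarrow> real) \<Rightarrow> real" where
  "H2_inner u v = ip u v + (\<Sum>i\<in>UNIV. ip (D i u) (D i v)) + (\<Sum>i\<in>UNIV. \<Sum>j\<in>UNIV. ip (D i (D j u)) (D i (D j v)))"

lemma V_zero: "(\<lambda>x. 0) \<in> V \<Omega>"
proof -
  have t: "(\<lambda>x. 0) \<in> test_functions \<Omega>" by (rule test_zero)
  have p0: "partial i (\<lambda>x. 0) = (\<lambda>x. 0)" for i by (simp add: fun_eq_iff partial_const)
  have "(\<lambda>x. 0) \<in> H10 \<Omega>"
    by (rule H10I(1)[where g = "\<lambda>i x. 0" and \<phi> = "\<lambda>k x. 0"]) (auto simp: t L2_zero p0 strong_conv_def L2_norm_def L2_inner_def)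
  moreover have "D j (\<lambda>x. 0) \<in> H1 \<Omega>" for j
  proof (rule H1_cong(1)[OF test_H1(1)[OF t]])
    show "D j (\<lambda>x. 0) \<in> L2 \<Omega>" by (rule H1D(2)[OF test_H1(1)[OF t]])
    show "AE x in lebesgue_on \<Omega>. 0 = D j (\<lambda>x. 0) x"
      using test_H1(2)[OF t, of j] by eventually_elim (simp add: p0)
  qed
  ultimately show ?thesis by (rule V_I)
qed

text \<open>Linearity of \<open>D\<close> holds for classes only, since \<open>D\<close> of a sum is
  some representative; each identity is therefore carried through
  \<open>L2_inner_cong_AE\<close>.\<close>

lemma semi_inner_V: "semi_inner (V \<Omega>) H2_inner"
proof
  fix u v w :: "real^'n \<Rightarrow> real" and c :: real
  assume u: "u \<in> V \<Omega>"
  show "(\<lambda>x. c * u x) \<in> V \<Omega>" by (rule V_scale[OF u])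
  have "0 \<le> ip (f :: real^'n \<Rightarrow> real) f" for f by (simp add: L2_inner_def)
  then show "0 \<le> H2_inner u u" unfolding H2_inner_def by (intro add_nonneg_nonneg sum_nonneg)
  { assume w: "w \<in> V \<Omega>"
    have "ip (D j (\<lambda>x. c * u x)) (D j w) = c * ip (D j u) (D j w)" for j
      using L2_inner_cong_AE[of "D j (\<lambda>x. c * u x)" \<Omega> "\<lambda>x. c * D j u x" "D j w" "D j w"] V_scale(1)[OF u, of c] V_scale(2)[OF u, where c = c and j = j] w u
      by (simp add: V_D L2.ip_scale_left L2_scale)
    moreover have "ip (D i (D j (\<lambda>x. c * u x))) (D i (D j w)) = c * ip (D i (D j u)) (D i (D j w))" for i j
      using L2_inner_cong_AE[of "D i (D j (\<lambda>x. c * u x))" \<Omega> "\<lambda>x. c * D i (D j u) x" "D i (D j w)" "D i (D j w)"]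
        V_scale(1)[OF u, of c] V_scale(3)[OF u, where c = c and i = i and j = j] w u
      by (simp add: V_D L2.ip_scale_left L2_scale)
    ultimately show "H2_inner (\<lambda>x. c * u x) w = c * H2_inner u w"
      using u w by (simp add: H2_inner_def L2.ip_scale_left V_D sum_distrib_left distrib_left) }
  assume v: "v \<in> V \<Omega>"
  show "(\<lambda>x. u x + v x) \<in> V \<Omega>" by (rule V_add[OF u v])
  show "H2_inner u v = H2_inner v u"
    unfolding H2_inner_def L2_inner_def by (simp add: mult.commute)
  assume w: "w \<in> V \<Omega>"
  have "ip (D j (\<lambda>x. u x + v x)) (D j w) = ip (D j u) (D j w) + ip (D j v) (D j w)" for j
    using L2_inner_cong_AE[of "D j (\<lambda>x. u x + v x)" \<Omega> "\<lambda>x. D j u x + D j v x" "D j w" "D j w"] V_add(1)[OF u v] V_add(2)[OF u v, where j = j] w u v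
    by (simp add: V_D L2.ip_add_left L2_add)
  moreover have "ip (D i (D j (\<lambda>x. u x + v x))) (D i (D j w)) = ip (D i (D j u)) (D i (D j w)) + ip (D i (D j v)) (D i (D j w))" for i j
    using L2_inner_cong_AE[of "D i (D j (\<lambda>x. u x + v x))" \<Omega> "\<lambda>x. D i (D j u) x + D i (D j v) x" "D i (D j w)" "D i (D j w)"]
      V_add(1)[OF u v] V_add(3)[OF u v, where i = i and j = j] w u v
    by (simp add: V_D L2.ip_add_left L2_add)
  ultimately show "H2_inner (\<lambda>x. u x + v x) w = H2_inner u w + H2_inner v w"
    using u v w by (simp add: H2_inner_def L2.ip_add_left V_D sum.distrib)
qed (rule V_zero)

lemma H2_norm_square: "(H2_norm \<Omega> v)\<^sup>2 = (nm v)\<^sup>2 + (\<Sum>i\<in>UNIV. (nm (D i v))\<^sup>2) + (\<Sum>i\<in>UNIV. \<Sum>j\<in>UNIV. (nm (D i (D j v)))\<^sup>2)"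
  unfolding H2_norm_def by (intro real_sqrt_pow2 add_nonneg_nonneg sum_nonneg) auto

lemma nrm_V: "semi_inner.nrm H2_inner = H2_norm \<Omega>"
proof
  fix v :: "real^'n \<Rightarrow> real"
  have "(nm f)\<^sup>2 = ip f f" for f :: "real^'n \<Rightarrow> real"
    unfolding L2_norm_def by (rule real_sqrt_pow2) (simp add: L2_inner_def)
  then show "semi_inner.nrm H2_inner v = H2_norm \<Omega> v"
    by (simp add: semi_inner.nrm_def[OF semi_inner_V] H2_inner_def H2_norm_def)
qed

lemma H2_norm_ge: "\<bar>nm v\<bar> \<le> H2_norm \<Omega> v" "\<bar>nm (D i v)\<bar> \<le> H2_norm \<Omega> v" "\<bar>nm (D i (D j v))\<bar> \<le> H2_norm \<Omega> v"
proof -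
  have s1: "(nm (D i v))\<^sup>2 \<le> (\<Sum>i\<in>UNIV. (nm (D i v))\<^sup>2)" by (rule member_le_sum) auto
  have "(nm (D i (D j v)))\<^sup>2 \<le> (\<Sum>j\<in>UNIV. (nm (D i (D j v)))\<^sup>2)" by (rule member_le_sum) auto
  also have "\<dots> \<le> (\<Sum>i\<in>UNIV. \<Sum>j\<in>UNIV. (nm (D i (D j v)))\<^sup>2)"
    by (rule member_le_sum[of i UNIV "\<lambda>i. \<Sum>j\<in>UNIV. (nm (D i (D j v)))\<^sup>2"]) (auto intro: sum_nonneg)
  finally have s2: "(nm (D i (D j v)))\<^sup>2 \<le> (\<Sum>i\<in>UNIV. \<Sum>j\<in>UNIV. (nm (D i (D j v)))\<^sup>2)" .
  have nn: "0 \<le> (\<Sum>i\<in>UNIV. (nm (D i v))\<^sup>2)" "0 \<le> (\<Sum>i\<in>UNIV. \<Sum>j\<in>UNIV. (nm (D i (D j v)))\<^sup>2)"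
    by (auto intro!: sum_nonneg)
  have abs: "\<bar>a\<bar> \<le> H2_norm \<Omega> v" if "a\<^sup>2 \<le> (H2_norm \<Omega> v)\<^sup>2" for a
    using that by (simp add: abs_le_square_iff[symmetric]) (simp add: H2_norm_def sum_nonneg)
  show "\<bar>nm v\<bar> \<le> H2_norm \<Omega> v" "\<bar>nm (D i v)\<bar> \<le> H2_norm \<Omega> v" "\<bar>nm (D i (D j v))\<bar> \<le> H2_norm \<Omega> v"
    by (rule abs, unfold H2_norm_square, use s1 s2 nn zero_le_power2[of "nm v"] in linarith)+
qed

lemma H2_norm_le:
  "H2_norm \<Omega> v \<le> \<bar>nm v\<bar> + (\<Sum>i\<in>UNIV. \<bar>nm (D i v)\<bar>) + (\<Sum>i\<in>UNIV. \<Sum>j\<in>UNIV. \<bar>nm (D i (D j v))\<bar>)"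
proof -
  have sq: "sqrt (\<Sum>i\<in>UNIV. (f i)\<^sup>2) \<le> (\<Sum>i\<in>UNIV. \<bar>f i\<bar>)" for f :: "'a::finite \<Rightarrow> real"
    using L2_set_le_sum_abs[of f UNIV] by (simp add: L2_set_def)
  have "H2_norm \<Omega> v \<le> sqrt ((nm v)\<^sup>2 + (\<Sum>i\<in>UNIV. (nm (D i v))\<^sup>2)) + sqrt (\<Sum>i\<in>UNIV. \<Sum>j\<in>UNIV. (nm (D i (D j v)))\<^sup>2)"
    unfolding H2_norm_def by (intro sqrt_add_le_add_sqrt add_nonneg_nonneg sum_nonneg) auto
  also have "sqrt ((nm v)\<^sup>2 + (\<Sum>i\<in>UNIV. (nm (D i v))\<^sup>2)) \<le> \<bar>nm v\<bar> + (\<Sum>i\<in>UNIV. \<bar>nm (D i v)\<bar>)"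
    using H1_norm_le[of v] by (simp add: H1_norm_def)
  also have "sqrt (\<Sum>i\<in>UNIV. \<Sum>j\<in>UNIV. (nm (D i (D j v)))\<^sup>2) \<le> (\<Sum>i\<in>UNIV. \<Sum>j\<in>UNIV. \<bar>nm (D i (D j v))\<bar>)"
    using sq[of "\<lambda>(i, j). nm (D i (D j v))"]
    by (simp add: sum.cartesian_product case_prod_unfold)
  finally show ?thesis by simp
qed

text \<open>Closedness of the weak derivatives settles all but membership in \<open>H10\<close>. The
  \<open>X n\<close> are themselves only limits of test functions, so for each \<open>n\<close> a
  test function within \<open>inverse (real (Suc n))\<close> of \<open>X n\<close>, gradients
  included, is picked.\<close>

lemma V_limit:
  assumes X: "\<And>n. X n \<in> V \<Omega>" and v: "v \<in> L2 \<Omega>" and g: "\<And>i. g i \<in> L2 \<Omega>" and h: "\<And>i j. h i j \<in> L2 \<Omega>"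
    and conv: "strong_conv nm X v" "\<And>i. strong_conv nm (\<lambda>n. D i (X n)) (g i)"
      "\<And>i j. strong_conv nm (\<lambda>n. D i (D j (X n))) (h i j)"
  shows "v \<in> V \<Omega>" "strong_conv (H2_norm \<Omega>) X v"
proof -
  have w1: "is_weak_partial \<Omega> i v (g i)" for i
    by (rule is_weak_partial_limit[OF _ _ v g _ conv(1,2)]) (auto intro: V_D X H1D)
  have w2: "is_weak_partial \<Omega> i (g j) (h i j)" for i j
    by (rule is_weak_partial_limit[OF _ _ g h _ conv(2,3)]) (auto intro: V_D X H1D)
  have gH1: "g j \<in> H1 \<Omega>" for j by (rule H1I[OF g h w2])
  have Dv: "AE x in lebesgue_on \<Omega>. D j v x = g j x" for j by (rule weak_partial(3)[OF g w1])
  then have Dv': "AE x in lebesgue_on \<Omega>. g j x = D j v x" for j by (simp add: eq_commute)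
  note c = H1_cong[OF gH1 weak_partial(1)[OF g w1] Dv']
  have DDv: "AE x in lebesgue_on \<Omega>. D i (D j v) x = h i j x" for i j
    using c(2)[of i j] weak_partial(3)[OF h w2, of i j] by eventually_elim simp
  have "\<exists>\<phi>\<in>test_functions \<Omega>. nm (\<lambda>x. \<phi> x - X n x) + (\<Sum>i\<in>UNIV. nm (\<lambda>x. partial i \<phi> x - D i (X n) x)) < inverse (real (Suc n))" for n
  proof -
    obtain \<phi> where \<phi>: "\<And>k. \<phi> k \<in> test_functions \<Omega>" "strong_conv nm \<phi> (X n)"
      "\<And>i. strong_conv nm (\<lambda>k. partial i (\<phi> k)) (D i (X n))"
      using H10E[OF V_D(2)[OF X]] by blast
    have "(\<lambda>k. nm (\<lambda>x. \<phi> k x - X n x) + (\<Sum>i\<in>UNIV. nm (\<lambda>x. partial i (\<phi> k) x - D i (X n) x))) \<longlonglongrightarrow> 0"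
      using \<phi>(2,3) unfolding strong_conv_def by (auto intro!: tendsto_eq_intros tendsto_null_sum)
    then have "eventually (\<lambda>k. nm (\<lambda>x. \<phi> k x - X n x) + (\<Sum>i\<in>UNIV. nm (\<lambda>x. partial i (\<phi> k) x - D i (X n) x)) < inverse (real (Suc n))) sequentially"
      by (rule order_tendstoD) simp
    then show ?thesis using \<phi>(1) by (auto simp: eventually_sequentially)
  qed
  then have "\<forall>n. \<exists>\<phi>. \<phi> \<in> test_functions \<Omega> \<and> nm (\<lambda>x. \<phi> x - X n x) + (\<Sum>i\<in>UNIV. nm (\<lambda>x. partial i \<phi> x - D i (X n) x)) < inverse (real (Suc n))"
    by blast
  from choice[OF this] obtain \<phi> where \<phi>: "\<And>n. \<phi> n \<in> test_functions \<Omega>"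
    and \<phi>_near: "\<And>n. nm (\<lambda>x. \<phi> n x - X n x) + (\<Sum>i\<in>UNIV. nm (\<lambda>x. partial i (\<phi> n) x - D i (X n) x)) < inverse (real (Suc n))"
    by blast
  have L: "\<phi> n \<in> L2 \<Omega>" "partial i (\<phi> n) \<in> L2 \<Omega>" "X n \<in> L2 \<Omega>" "D i (X n) \<in> L2 \<Omega>" for n i
    by (auto intro: test_in_L2 test_partial \<phi> V_D X)
  have nn: "0 \<le> nm (\<lambda>x. \<phi> n x - X n x)" "0 \<le> nm (\<lambda>x. partial i (\<phi> n) x - D i (X n) x)" for n i
    by (intro L2.nrm_nonneg L2.diff_mem L)+
  have near1: "nm (\<lambda>x. \<phi> n x - X n x) \<le> inverse (real (Suc n))" for n
    using \<phi>_near[of n] sum_nonneg[of UNIV "\<lambda>i. nm (\<lambda>x. partial i (\<phi> n) x - D i (X n) x)"] nn by force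
  have near2: "nm (\<lambda>x. partial i (\<phi> n) x - D i (X n) x) \<le> inverse (real (Suc n))" for n i
  proof -
    have "nm (\<lambda>x. partial i (\<phi> n) x - D i (X n) x) \<le> (\<Sum>i\<in>UNIV. nm (\<lambda>x. partial i (\<phi> n) x - D i (X n) x))"
      by (rule member_le_sum) (use nn in auto)
    with \<phi>_near[of n] nn(1)[of n] show ?thesis by linarith
  qed
  have "v \<in> H10 \<Omega>"
  proof (rule H10I(1)[OF v g \<phi>])
    show "strong_conv nm \<phi> v"
    proof (rule L2_strong_convI_le)
      show "nm (\<lambda>x. \<phi> n x - v x) \<le> inverse (real (Suc n)) + nm (\<lambda>x. X n x - v x)" for n
        using L2.nrm_triangle_diff[OF L(1)[where n = n] L(3)[where n = n] v] near1[of n] by simp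
      show "(\<lambda>n. inverse (real (Suc n)) + nm (\<lambda>x. X n x - v x)) \<longlonglongrightarrow> 0"
        using tendsto_add[OF LIMSEQ_inverse_real_of_nat conv(1)[unfolded strong_conv_def]] by simp
    qed (intro L v)+
    show "strong_conv nm (\<lambda>n. partial i (\<phi> n)) (g i)" for i
    proof (rule L2_strong_convI_le)
      show "nm (\<lambda>x. partial i (\<phi> n) x - g i x) \<le> inverse (real (Suc n)) + nm (\<lambda>x. D i (X n) x - g i x)" for n
        using L2.nrm_triangle_diff[OF L(2)[where n = n and i = i] L(4)[where n = n and i = i] g[where i = i]] near2[of i n] by simp
      show "(\<lambda>n. inverse (real (Suc n)) + nm (\<lambda>x. D i (X n) x - g i x)) \<longlonglongrightarrow> 0"
        using tendsto_add[OF LIMSEQ_inverse_real_of_nat conv(2)[of i, unfolded strong_conv_def]] by simp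
    qed (intro L g)+
  qed
  then show V: "v \<in> V \<Omega>" by (intro V_I c)
  have e1: "nm (D i (\<lambda>x. X n x - v x)) = nm (\<lambda>x. D i (X n) x - g i x)" for i n
  proof (rule L2_norm_cong_AE)
    show "AE x in lebesgue_on \<Omega>. D i (\<lambda>x. X n x - v x) x = D i (X n) x - g i x"
      using V_diff(2)[OF X[of n] V, where j = i] Dv[of i] by eventually_elim simp
  qed (auto intro: V_D V_diff X V L2.diff_mem g)
  have e2: "nm (D i (D j (\<lambda>x. X n x - v x))) = nm (\<lambda>x. D i (D j (X n)) x - h i j x)" for i j n
  proof (rule L2_norm_cong_AE)
    show "AE x in lebesgue_on \<Omega>. D i (D j (\<lambda>x. X n x - v x)) x = D i (D j (X n)) x - h i j x"
      using V_diff(3)[OF X[of n] V, where i = i and j = j] DDv[of i j] by eventually_elim simp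
  qed (auto intro: V_D V_diff X V L2.diff_mem h)
  show "strong_conv (H2_norm \<Omega>) X v" unfolding strong_conv_def
  proof (rule tendsto_sandwich[OF _ _ tendsto_const])
    show "(\<lambda>n. \<bar>nm (\<lambda>x. X n x - v x)\<bar> + (\<Sum>i\<in>UNIV. \<bar>nm (\<lambda>x. D i (X n) x - g i x)\<bar>) +
        (\<Sum>i\<in>UNIV. \<Sum>j\<in>UNIV. \<bar>nm (\<lambda>x. D i (D j (X n)) x - h i j x)\<bar>)) \<longlonglongrightarrow> 0"
      using conv unfolding strong_conv_def by (auto intro!: tendsto_eq_intros tendsto_null_sum tendsto_rabs_zero)
    show "\<forall>\<^sub>F n in sequentially. H2_norm \<Omega> (\<lambda>x. X n x - v x) \<le> \<bar>nm (\<lambda>x. X n x - v x)\<bar> +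
        (\<Sum>i\<in>UNIV. \<bar>nm (\<lambda>x. D i (X n) x - g i x)\<bar>) + (\<Sum>i\<in>UNIV. \<Sum>j\<in>UNIV. \<bar>nm (\<lambda>x. D i (D j (X n)) x - h i j x)\<bar>)"
      using H2_norm_le[of "\<lambda>x. X _ x - v x"] by (intro always_eventually allI) (simp add: e1 e2)
    show "\<forall>\<^sub>F n in sequentially. 0 \<le> H2_norm \<Omega> (\<lambda>x. X n x - v x)"
      by (simp add: H2_norm_def sum_nonneg)
  qed
qed

lemma V_complete:
  assumes X: "\<And>n. X n \<in> V \<Omega>"
    and cauchy: "\<And>e. 0 < e \<Longrightarrow> \<exists>N. \<forall>m\<ge>N. \<forall>n\<ge>N. H2_norm \<Omega> (\<lambda>x. X m x - X n x) < e"
  shows "\<exists>l\<in>V \<Omega>. strong_conv (H2_norm \<Omega>) X l"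
proof -
  have e1: "nm (D i (\<lambda>x. X m x - X n x)) = nm (\<lambda>x. D i (X m) x - D i (X n) x)" for i m n
    by (rule L2_norm_cong_AE[OF _ _ V_diff(2)[OF X X]]) (auto intro: V_D V_diff X L2.diff_mem)
  have e2: "nm (D i (D j (\<lambda>x. X m x - X n x))) = nm (\<lambda>x. D i (D j (X m)) x - D i (D j (X n)) x)" for i j m n
    by (rule L2_norm_cong_AE[OF _ _ V_diff(3)[OF X X]]) (auto intro: V_D V_diff X L2.diff_mem)
  have "\<exists>l\<in>L2 \<Omega>. strong_conv nm X l"
  proof (rule L2_complete)
    fix e :: real assume "0 < e"
    from cauchy[OF this] show "\<exists>N. \<forall>m\<ge>N. \<forall>n\<ge>N. nm (\<lambda>x. X m x - X n x) < e"
      using H2_norm_ge(1) by (meson abs_ge_self le_less_trans)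
  qed (intro V_D X)
  then obtain v where v: "v \<in> L2 \<Omega>" "strong_conv nm X v" by blast
  have "\<exists>l\<in>L2 \<Omega>. strong_conv nm (\<lambda>n. D i (X n)) l" for i
  proof (rule L2_complete)
    fix e :: real assume "0 < e"
    from cauchy[OF this] show "\<exists>N. \<forall>m\<ge>N. \<forall>n\<ge>N. nm (\<lambda>x. D i (X m) x - D i (X n) x) < e"
      using H2_norm_ge(2)[of i] unfolding e1[symmetric] by (meson abs_ge_self le_less_trans)
  qed (intro V_D X)
  then obtain g where g: "\<And>i. g i \<in> L2 \<Omega>" "\<And>i. strong_conv nm (\<lambda>n. D i (X n)) (g i)" by metis
  have "\<exists>l\<in>L2 \<Omega>. strong_conv nm (\<lambda>n. D i (D j (X n))) l" for i j
  proof (rule L2_complete)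
    fix e :: real assume "0 < e"
    from cauchy[OF this] show "\<exists>N. \<forall>m\<ge>N. \<forall>n\<ge>N. nm (\<lambda>x. D i (D j (X m)) x - D i (D j (X n)) x) < e"
      using H2_norm_ge(3)[of i j] unfolding e2[symmetric] by (meson abs_ge_self le_less_trans)
  qed (intro V_D X)
  then obtain h where h: "\<And>i j. h i j \<in> L2 \<Omega>" "\<And>i j. strong_conv nm (\<lambda>n. D i (D j (X n))) (h i j)" by metis
  show ?thesis using V_limit[OF X v(1) g(1) h(1) v(2) g(2) h(2)] by blast
qed

lemma semi_hilbert_V: "semi_hilbert (V \<Omega>) H2_inner"
  by (intro semi_hilbert.intro semi_hilbert_axioms.intro semi_inner_V, unfold nrm_V) (rule V_complete)

end

sublocale open_domain \<subseteq> V: semi_hilbert "V \<Omega>" H2_inner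
  rewrites "semi_inner.nrm H2_inner = H2_norm \<Omega>"
  by (rule semi_hilbert_V, rule nrm_V)

section \<open>The weak Laplacian, Green's formula and the Poincare inequality\<close>

context open_domain
begin

definition wlap :: "(real^'n \<Rightarrow> real) \<Rightarrow> real^'n \<Rightarrow> real" where
  "wlap u x = (\<Sum>i\<in>UNIV. D i (D i u) x)"

lemma wlap_L2: "u \<in> V \<Omega> \<Longrightarrow> wlap u \<in> L2 \<Omega>"
  unfolding wlap_def[abs_def] by (intro L2_sum V_D) simp_all

lemma wlap_diff:
  assumes "u \<in> V \<Omega>" "v \<in> V \<Omega>"
  shows "AE x in lebesgue_on \<Omega>. wlap (\<lambda>x. u x - v x) x = wlap u x - wlap v x"
proof -
  have "AE x in lebesgue_on \<Omega>. \<forall>i\<in>UNIV. D i (D i (\<lambda>x. u x - v x)) x = D i (D i u) x - D i (D i v) x"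
    by (intro AE_finite_allI V_diff(3) assms) simp
  then show ?thesis by eventually_elim (simp add: wlap_def sum_subtractf)
qed

lemma wlap_add:
  assumes "u \<in> V \<Omega>" "v \<in> V \<Omega>"
  shows "AE x in lebesgue_on \<Omega>. wlap (\<lambda>x. u x + v x) x = wlap u x + wlap v x"
proof -
  have "AE x in lebesgue_on \<Omega>. \<forall>i\<in>UNIV. D i (D i (\<lambda>x. u x + v x)) x = D i (D i u) x + D i (D i v) x"
    by (intro AE_finite_allI V_add(3) assms) simp
  then show ?thesis by eventually_elim (simp add: wlap_def sum.distrib)
qed

text \<open>Test functions approximate \<open>w\<close>, and \<open>u\<close> already has weak
  second derivatives in \<open>L2\<close>; the boundary enters only through
  \<open>w \<in> H10 \<Omega>\<close>.\<close>

lemma Green: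
  assumes u: "u \<in> V \<Omega>" and w: "w \<in> H10 \<Omega>"
  shows "ip w (wlap u) = - (\<Sum>i\<in>UNIV. ip (D i w) (D i u))"
proof -
  obtain \<phi> where \<phi>: "\<And>k. \<phi> k \<in> test_functions \<Omega>" "strong_conv nm \<phi> w" "\<And>i. strong_conv nm (\<lambda>k. partial i (\<phi> k)) (D i w)"
    using H10E[OF w] by blast
  note H = H10_H1[OF w]
  have "(\<lambda>k. ip (\<phi> k) (wlap u)) \<longlonglongrightarrow> ip w (wlap u)"
    by (rule L2.strong_conv_ip[OF test_in_L2[OF \<phi>(1)] H1D(1)[OF H] \<phi>(2) wlap_L2[OF u]])
  moreover have "ip (\<phi> k) (wlap u) = - (\<Sum>i\<in>UNIV. ip (partial i (\<phi> k)) (D i u))" for k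
  proof -
    have "ip (\<phi> k) (wlap u) = ip (wlap u) (\<phi> k)"
      by (intro L2.ip_commute test_in_L2[OF \<phi>(1)] wlap_L2 u)
    also have "\<dots> = (\<Sum>i\<in>UNIV. ip (D i (D i u)) (\<phi> k))"
      unfolding wlap_def[abs_def] by (intro L2_inner_sum_left V_D u test_in_L2[OF \<phi>(1)]) simp
    also have "\<dots> = (\<Sum>i\<in>UNIV. - ip (partial i (\<phi> k)) (D i u))"
    proof (intro sum.cong refl)
      fix i
      have "ip (D i u) (partial i (\<phi> k)) = - ip (D i (D i u)) (\<phi> k)"
        using H1D(3)[OF V_D(3)[OF u]] \<phi>(1) by (simp add: is_weak_partial_def)
      moreover have "ip (D i u) (partial i (\<phi> k)) = ip (partial i (\<phi> k)) (D i u)"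
        by (intro L2.ip_commute V_D u test_in_L2[OF test_partial[OF \<phi>(1)]])
      ultimately show "ip (D i (D i u)) (\<phi> k) = - ip (partial i (\<phi> k)) (D i u)" by simp
    qed
    finally show ?thesis by (simp add: sum_negf)
  qed
  moreover have "(\<lambda>k. - (\<Sum>i\<in>UNIV. ip (partial i (\<phi> k)) (D i u))) \<longlonglongrightarrow> - (\<Sum>i\<in>UNIV. ip (D i w) (D i u))"
    by (intro tendsto_minus tendsto_sum L2.strong_conv_ip \<phi>(3) test_in_L2[OF test_partial[OF \<phi>(1)]] H1D H V_D u)
  ultimately show ?thesis by (simp add: LIMSEQ_unique)
qed

lemma Green_energy: "u \<in> V \<Omega> \<Longrightarrow> (\<Sum>i\<in>UNIV. (nm (D i u))\<^sup>2) = - ip u (wlap u)"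
  by (simp add: Green V_D L2.nrm_square)

text \<open>In the expanded square the cross term is \<open>2 * \<nu>\<close> times the gradient
  energy by Green's formula, hence nonnegative.\<close>

lemma shifted_laplacian_norm:
  assumes u: "u \<in> V \<Omega>" and \<nu>: "0 \<le> \<nu>"
  shows "nm (wlap u) \<le> nm (\<lambda>x. \<nu> * u x - wlap u x)"
proof -
  have "(nm (\<lambda>x. \<nu> * u x - wlap u x))\<^sup>2 = \<nu>\<^sup>2 * (nm u)\<^sup>2 + 2 * \<nu> * (\<Sum>i\<in>UNIV. (nm (D i u))\<^sup>2) + (nm (wlap u))\<^sup>2"
    using V_D(4)[OF u] wlap_L2[OF u] \<nu>
    by (simp add: L2.square_diff L2_scale L2.nrm_scale L2.ip_scale_left Green_energy[OF u] power_mult_distrib)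
  moreover have "0 \<le> \<nu>\<^sup>2 * (nm u)\<^sup>2 + 2 * \<nu> * (\<Sum>i\<in>UNIV. (nm (D i u))\<^sup>2)"
    using \<nu> by (intro add_nonneg_nonneg mult_nonneg_nonneg sum_nonneg) auto
  ultimately have "(nm (wlap u))\<^sup>2 \<le> (nm (\<lambda>x. \<nu> * u x - wlap u x))\<^sup>2" by linarith
  then show ?thesis
    by (rule power2_le_imp_le) (intro L2.nrm_nonneg L2.mem_intros V_D[OF u] wlap_L2 u)
qed

text \<open>Serves to transfer estimates: what is proved for one constructed solution holds for
  every element of \<open>V\<close> with the same right-hand side. The difference has nonpositive
  squared norm by the energy identity.\<close>

lemma resolvent_unique:
  assumes u: "u \<in> V \<Omega>" and v: "v \<in> V \<Omega>" and \<nu>: "0 < \<nu>"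
    and eq: "AE x in lebesgue_on \<Omega>. \<nu> * u x - wlap u x = \<nu> * v x - wlap v x"
  shows "AE x in lebesgue_on \<Omega>. u x = v x"
    "AE x in lebesgue_on \<Omega>. D i (D j u) x = D i (D j v) x"
proof -
  define w where "w = (\<lambda>x. u x - v x)"
  have w: "w \<in> V \<Omega>" unfolding w_def by (intro V_diff u v)
  have "AE x in lebesgue_on \<Omega>. wlap w x = \<nu> * w x"
    using eq wlap_diff[OF u v] by eventually_elim (simp add: w_def algebra_simps)
  then have "ip w (wlap w) = ip w (\<lambda>x. \<nu> * w x)"
    by (intro L2_inner_cong_AE) (auto intro: V_D w wlap_L2 L2_scale)
  also have "\<dots> = \<nu> * (nm w)\<^sup>2" using V_D(4)[OF w] by (simp add: L2.ip_scale_right L2.nrm_square)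
  finally have "\<nu> * (nm w)\<^sup>2 = - (\<Sum>i\<in>UNIV. (nm (D i w))\<^sup>2)" using Green_energy[OF w] by simp
  moreover have "0 \<le> (\<Sum>i\<in>UNIV. (nm (D i w))\<^sup>2)" by (intro sum_nonneg) simp
  ultimately have "\<nu> * (nm w)\<^sup>2 \<le> 0" by simp
  then have "nm w = 0" using \<nu> by (simp add: mult_le_0_iff)
  then have w0: "AE x in lebesgue_on \<Omega>. w x = 0" using L2_norm_eq_0_iff[OF V_D(4)[OF w]] by simp
  then show "AE x in lebesgue_on \<Omega>. u x = v x" by eventually_elim (simp add: w_def)
  then have uv: "AE x in lebesgue_on \<Omega>. D j u x = D j v x" for j
    using H1_cong(2)[OF V_D(1)[OF v] V_D(4)[OF u], of j] by (simp add: eq_commute)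
  show "AE x in lebesgue_on \<Omega>. D i (D j u) x = D i (D j v) x"
    by (rule H1_cong(2)[OF V_D(3)[OF v] V_D(5)[OF u]]) (use uv[of j] in \<open>simp add: eq_commute\<close>)
qed

text \<open>Integrating the square of \<open>\<phi>\<close> by parts against the coordinate
  \<open>x $ i\<close> leaves, up to sign, twice the pairing of \<open>x $ i * \<phi> x\<close> with
  \<open>partial i \<phi>\<close>, and the coordinate is at most \<open>R\<close> in absolute
  value.\<close>

lemma Poincare_test:
  assumes R: "\<And>x. x \<in> \<Omega> \<Longrightarrow> norm x \<le> R" "0 \<le> R" and \<phi>: "\<phi> \<in> test_functions \<Omega>"
  shows "nm \<phi> \<le> 2 * R * nm (partial i \<phi>)"
proof -
  define \<psi> where "\<psi> x = x $ i * \<phi> x" for x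
  have \<psi>_eq: "\<psi> = (\<lambda>x. (axis i 1 \<bullet> x - 0) * \<phi> x)" by (simp add: \<psi>_def fun_eq_iff inner_axis')
  have sm: "smooth \<phi>" using \<phi> by (rule test_functionsD)
  have \<psi>: "\<psi> \<in> test_functions \<Omega>" unfolding \<psi>_eq by (rule test_mult_smooth[OF smooth_affine \<phi>])
  have "partial i \<psi> = (\<lambda>x. \<phi> x + x $ i * partial i \<phi> x)"
    unfolding \<psi>_eq smooth_partial_rules(4)[OF smooth_affine sm]
    using partial_affine[of i "axis i 1" 0] by (simp add: fun_eq_iff inner_axis')
  moreover have xp: "(\<lambda>x. x $ i * partial i \<phi> x) \<in> L2 \<Omega>"
    using test_in_L2[OF test_mult_smooth[OF smooth_affine[of "axis i 1" 0] test_partial[OF \<phi>, of i]]]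
    by (simp add: inner_axis')
  moreover have "ip (partial i \<phi>) \<psi> = - ip \<phi> (partial i \<psi>)"
    by (rule integration_by_parts[OF domain_lebesgue sm \<psi>])
  ultimately have "ip (partial i \<phi>) \<psi> = - (ip \<phi> \<phi> + ip \<phi> (\<lambda>x. x $ i * partial i \<phi> x))"
    by (simp add: L2.ip_add_right test_in_L2[OF \<phi>])
  moreover have "ip \<phi> (\<lambda>x. x $ i * partial i \<phi> x) = ip (partial i \<phi>) \<psi>"
    by (simp add: L2_inner_def \<psi>_def mult_ac)
  ultimately have "(nm \<phi>)\<^sup>2 = 2 * - ip (partial i \<phi>) \<psi>"
    by (simp add: L2.nrm_square test_in_L2[OF \<phi>])
  also have "\<dots> \<le> 2 * (nm (partial i \<phi>) * nm \<psi>)"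
    using L2.Cauchy_Schwarz[OF test_in_L2[OF test_partial[OF \<phi>, of i]] test_in_L2[OF \<psi>]] by linarith
  also have "\<dots> \<le> 2 * (nm (partial i \<phi>) * (R * nm \<phi>))"
  proof -
    have "nm \<psi> \<le> nm (\<lambda>x. R * \<phi> x)"
  proof (rule L2_norm_mono_AE)
    show "AE x in lebesgue_on \<Omega>. \<bar>\<psi> x\<bar> \<le> \<bar>R * \<phi> x\<bar>"
    proof (rule AE_I2)
      fix x assume "x \<in> space (lebesgue_on \<Omega>)"
      then have "\<bar>x $ i\<bar> \<le> R" using R(1)[of x] component_le_norm_cart[of x i] by simp
      then show "\<bar>\<psi> x\<bar> \<le> \<bar>R * \<phi> x\<bar>" unfolding \<psi>_def abs_mult by (intro mult_right_mono) auto
    qed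
  qed (intro test_in_L2[OF \<psi>] L2_scale test_in_L2[OF \<phi>])+
    also have "nm (\<lambda>x. R * \<phi> x) = R * nm \<phi>" using R(2) by (simp add: L2.nrm_scale test_in_L2[OF \<phi>])
    finally show ?thesis
      using L2.nrm_nonneg[OF test_in_L2[OF test_partial[OF \<phi>, of i]]] by (intro mult_left_mono) auto
  qed
  finally have *: "nm \<phi> * nm \<phi> \<le> (2 * R * nm (partial i \<phi>)) * nm \<phi>"
    by (simp add: power2_eq_square mult_ac)
  show ?thesis
  proof (cases "nm \<phi> = 0")
    case True
    then show ?thesis using R(2) L2.nrm_nonneg[OF test_in_L2[OF test_partial[OF \<phi>, of i]]] by simp
  next
    case False
    then have "0 < nm \<phi>" using L2.nrm_nonneg[OF test_in_L2[OF \<phi>]] by simp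
    then show ?thesis using * by (simp only: mult_le_cancel_right_pos)
  qed
qed

lemma Poincare:
  assumes R: "\<And>x. x \<in> \<Omega> \<Longrightarrow> norm x \<le> R" "0 \<le> R" and v: "v \<in> H10 \<Omega>"
  shows "nm v \<le> 2 * R * nm (D i v)"
proof -
  obtain \<phi> where \<phi>: "\<And>k. \<phi> k \<in> test_functions \<Omega>" "strong_conv nm \<phi> v" "\<And>i. strong_conv nm (\<lambda>k. partial i (\<phi> k)) (D i v)"
    using H10E[OF v] by blast
  note H = H10_H1[OF v]
  show ?thesis
  proof (rule LIMSEQ_le)
    show "(\<lambda>k. nm (\<phi> k)) \<longlonglongrightarrow> nm v"
      by (intro L2.strong_conv_nrm test_in_L2[OF \<phi>(1)] H1D H \<phi>)
    show "(\<lambda>k. 2 * R * nm (partial i (\<phi> k))) \<longlonglongrightarrow> 2 * R * nm (D i v)"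
      by (intro tendsto_mult_left L2.strong_conv_nrm test_in_L2[OF test_partial[OF \<phi>(1)]] H1D H \<phi>)
    show "\<exists>N. \<forall>n\<ge>N. nm (\<phi> n) \<le> 2 * R * nm (partial i (\<phi> n))"
      using Poincare_test[OF R \<phi>(1)] by blast
  qed
qed

end

section \<open>Convex domains: solvability in \<open>V\<close> and the Miranda-Talenti
  inequality\<close>

locale convex_domain = open_domain \<Omega> for \<Omega> :: "(real^'n) set" +
  assumes bounded_domain: "bounded \<Omega>" and convex_domain: "convex \<Omega>"
begin

text \<open>Weak limit of the approximate solutions along an exhaustion by compact convex sets.
  Their Hessians are controlled only on \<open>C n\<close>, but every test function is supported in
  \<open>C n\<close> for large \<open>n\<close>, so the limit equation and the limit derivatives
  hold in all of \<Omega>.\<close>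

lemma resolvent:
  assumes g: "g \<in> L2 \<Omega>" and \<nu>: "0 < \<nu>"
  obtains u where "u \<in> V \<Omega>" "AE x in lebesgue_on \<Omega>. \<nu> * u x - wlap u x = g x"
    "(\<Sum>i\<in>UNIV. \<Sum>j\<in>UNIV. (nm (D i (D j u)))\<^sup>2) \<le> (nm g)\<^sup>2"
proof -
  obtain C' :: "nat \<Rightarrow> (real^'n) set" where C': "\<And>n. compact (C' n)" "\<And>n. C' n \<subseteq> \<Omega>" "\<And>K. compact K \<Longrightarrow> K \<subseteq> \<Omega> \<Longrightarrow> \<exists>N. \<forall>n\<ge>N. K \<subseteq> C' n"
    by (rule open_Union_compact_subsets[OF open_domain]) (rule that)
  \<comment> \<open>The approximate solver needs convex sets; convexity of \<Omega> keeps the hulls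
    of an exhaustion inside \<Omega>.\<close>
  define C where "C n = convex hull (C' n)" for n :: nat
  have C: "compact (C n)" "convex (C n)" "C n \<subseteq> \<Omega>" for n
    unfolding C_def by (intro compact_convex_hull C' convex_convex_hull hull_minimal convex_domain)+
  have C_exh: "\<exists>N. \<forall>n\<ge>N. K \<subseteq> C n" if "compact K" "K \<subseteq> \<Omega>" for K
    using C'(3)[OF that] hull_subset[of "C' _" convex] unfolding C_def by (meson order_trans)
  have C_leb: "C n \<in> sets lebesgue" for n using compact_imp_closed[OF C(1)[of n]] by simp
  define \<delta> where "\<delta> n = inverse (real (Suc n))" for n
  have \<delta>: "0 < \<delta> n" "\<delta> n \<le> 1" for n by (auto simp: \<delta>_def field_simps)
  have \<delta>_lim: "\<delta> \<longlonglongrightarrow> 0" unfolding \<delta>_def[abs_def] by (rule LIMSEQ_inverse_real_of_nat)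
  define good where "good n w \<longleftrightarrow> w \<in> test_functions \<Omega> \<and>
    (\<Sum>i\<in>UNIV. \<Sum>j\<in>UNIV. (nm (\<lambda>x. indicator (C n) x * partial j (partial i w) x))\<^sup>2) \<le> (nm g + \<delta> n)\<^sup>2 \<and>
    nm w \<le> (nm g + \<delta> n) / \<nu> \<and> (\<forall>i. (nm (partial i w))\<^sup>2 \<le> (nm g + \<delta> n)\<^sup>2 / \<nu> + \<delta> n) \<and>
    nm (\<lambda>x. indicator (C n) x * (\<nu> * w x - laplacian w x - g x)) \<le> \<delta> n" for n w
  have "\<exists>w. good n w" for n
    by (rule approximate_solution[OF open_domain bounded_domain C(1)[of n] C(2)[of n] C(3)[of n] g \<nu> \<delta>(1)[of n]])
       (auto simp: good_def)
  then obtain w where w: "\<And>n. good n (w n)" by metis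
  have wt: "w n \<in> test_functions \<Omega>" for n using w[of n] by (simp add: good_def)
  have ng: "0 \<le> nm g" using L2.nrm_nonneg[OF g] .
  define B where "B = nm g + 1"
  have B: "nm g + \<delta> n \<le> B" "0 \<le> nm g + \<delta> n" for n using \<delta>[of n] ng by (auto simp: B_def)
  have B2: "(nm g + \<delta> n)\<^sup>2 \<le> B\<^sup>2" for n using B by (intro power_mono)
  define H where "H n i j x = indicator (C n) x * partial j (partial i (w n)) x" for n i j x
  have H_L2: "H n i j \<in> L2 \<Omega>" for n i j
    unfolding H_def[abs_def] by (intro L2_indicator test_in_L2[OF test_partial[OF test_partial[OF wt]]] C_leb)
  have H_sum: "(\<Sum>i\<in>UNIV. \<Sum>j\<in>UNIV. (nm (H n i j))\<^sup>2) \<le> (nm g + \<delta> n)\<^sup>2" for n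
    using w[of n] by (simp add: good_def H_def[abs_def])
  \<comment> \<open>The index type bundles the function, its gradient and the truncated Hessian, so
    that one subsequence works for all of them.\<close>
  define X where "X n k = (case k of Inl None \<Rightarrow> w n | Inl (Some i) \<Rightarrow> partial i (w n) | Inr (i, j) \<Rightarrow> H n i j)"
    for n and k :: "'n option + 'n \<times> 'n"
  define M where "M = B / \<nu> + sqrt (B\<^sup>2 / \<nu> + 1) + B"
  have X_L2: "X n k \<in> L2 \<Omega>" for n k
    unfolding X_def by (auto split: sum.split option.split intro: test_in_L2[OF wt] test_in_L2[OF test_partial[OF wt]] H_L2)
  have X_bound: "nm (X n k) \<le> M" for n k
  proof -
    have s0: "0 \<le> B / \<nu>" "0 \<le> sqrt (B\<^sup>2 / \<nu> + 1)" "0 \<le> B" using ng \<nu> by (auto simp: B_def)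
    have b1: "nm (w n) \<le> B / \<nu>"
      using w[of n] divide_right_mono[OF B(1)[of n], of \<nu>] \<nu> by (simp add: good_def)
    have b2: "nm (partial i (w n)) \<le> sqrt (B\<^sup>2 / \<nu> + 1)" for i
    proof (rule real_le_rsqrt)
      have "(nm (partial i (w n)))\<^sup>2 \<le> (nm g + \<delta> n)\<^sup>2 / \<nu> + \<delta> n" using w[of n] by (simp add: good_def)
      also have "\<dots> \<le> B\<^sup>2 / \<nu> + 1" using B2[of n] \<delta>[of n] \<nu> by (intro add_mono divide_right_mono) auto
      finally show "(nm (partial i (w n)))\<^sup>2 \<le> B\<^sup>2 / \<nu> + 1" .
    qed
    have b3: "nm (H n i j) \<le> B" for i j
    proof (rule power2_le_imp_le[OF _ s0(3)])
      have "(nm (H n i j))\<^sup>2 \<le> (\<Sum>j\<in>UNIV. (nm (H n i j))\<^sup>2)" by (rule member_le_sum) auto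
      also have "\<dots> \<le> (\<Sum>i\<in>UNIV. \<Sum>j\<in>UNIV. (nm (H n i j))\<^sup>2)"
        by (rule member_le_sum[of i UNIV "\<lambda>i. \<Sum>j\<in>UNIV. (nm (H n i j))\<^sup>2"]) (auto intro: sum_nonneg)
      finally show "(nm (H n i j))\<^sup>2 \<le> B\<^sup>2" using H_sum[of n] B2[of n] by linarith
    qed
    consider "k = Inl None" | i where "k = Inl (Some i)" | i j where "k = Inr (i, j)"
      by (cases k; (cases "projl k")?) auto
    then show ?thesis
    proof cases
      case 1
      then have "nm (X n k) = nm (w n)" by (simp add: X_def)
      with b1 s0 show ?thesis unfolding M_def by linarith
    next
      case (2 i)
      then have "nm (X n k) = nm (partial i (w n))" by (simp add: X_def)
      with b2[of i] s0 show ?thesis unfolding M_def by linarith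
    next
      case (3 i j)
      then have "nm (X n k) = nm (H n i j)" by (simp add: X_def)
      with b3[of i j] s0 show ?thesis unfolding M_def by linarith
    qed
  qed
  obtain r l where r: "strict_mono r" and l: "\<And>k. l k \<in> L2 \<Omega>"
    and weak: "\<And>k y. y \<in> L2 \<Omega> \<Longrightarrow> (\<lambda>n. ip (X (r n) k) y) \<longlonglongrightarrow> ip (l k) y"
    using L2_family_weak_compactness[of X \<Omega> M, OF X_L2 X_bound] by blast
  define u where "u = l (Inl None)"
  define p where "p i = l (Inl (Some i))" for i
  define h where "h i j = l (Inr (i, j))" for i j
  have uph: "u \<in> L2 \<Omega>" "p i \<in> L2 \<Omega>" "h i j \<in> L2 \<Omega>" for i j using l by (auto simp: u_def p_def h_def)
  have weak_u: "(\<lambda>n. ip (w (r n)) y) \<longlonglongrightarrow> ip u y"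
    and weak_p: "(\<lambda>n. ip (partial i (w (r n))) y) \<longlonglongrightarrow> ip (p i) y"
    and weak_h: "(\<lambda>n. ip (H (r n) i j) y) \<longlonglongrightarrow> ip (h i j) y" if "y \<in> L2 \<Omega>" for y i j
    using weak[OF that, of "Inl None"] weak[OF that, of "Inl (Some i)"] weak[OF that, of "Inr (i, j)"]
    by (auto simp: X_def u_def p_def h_def)
  have r_ge: "n \<le> r n" for n by (rule strict_mono_imp_increasing[OF r])
  have u_H10: "u \<in> H10 \<Omega>" and u_p: "\<And>i. is_weak_partial \<Omega> i u (p i)"
  proof -
    \<comment> \<open>The first-order jets of test functions form a subspace. By Mazur the weak
      limit of jets is a strong limit of jets of possibly different test functions, which is what
      \<open>H10\<close> asks for.\<close>
    define J where "J \<phi> k = (case k of None \<Rightarrow> \<phi> | Some i \<Rightarrow> partial i \<phi>)" for \<phi> :: "real^'n \<Rightarrow> real" and k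
    obtain Y where Y: "\<And>n. Y n \<in> J ` test_functions \<Omega>"
      "\<And>k. strong_conv nm (\<lambda>n. Y n k) (case k of None \<Rightarrow> u | Some i \<Rightarrow> p i)"
    proof (rule L2_family_Mazur[of "J ` test_functions \<Omega>" \<Omega> "\<lambda>n. J (w (r n))" "\<lambda>k. case k of None \<Rightarrow> u | Some i \<Rightarrow> p i"])
      show "f k \<in> L2 \<Omega>" if f: "f \<in> J ` test_functions \<Omega>" for f k
      proof -
        obtain \<phi> where \<phi>: "f = J \<phi>" "\<phi> \<in> test_functions \<Omega>" using f by auto
        show ?thesis unfolding \<phi>(1) J_def
          by (cases k) (simp_all add: test_in_L2[OF \<phi>(2)] test_in_L2[OF test_partial[OF \<phi>(2)]])
      qed
      show "(\<lambda>k x. 0) \<in> J ` test_functions \<Omega>"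
        by (rule image_eqI[OF _ test_zero]) (auto simp: J_def fun_eq_iff partial_const split: option.split)
      show "(\<lambda>k x. f k x + g k x) \<in> J ` test_functions \<Omega>" if fg: "f \<in> J ` test_functions \<Omega>" "g \<in> J ` test_functions \<Omega>" for f g
      proof -
        obtain \<phi> \<psi> where "f = J \<phi>" "g = J \<psi>" "\<phi> \<in> test_functions \<Omega>" "\<psi> \<in> test_functions \<Omega>" using fg by auto
        then show ?thesis
          by (intro image_eqI[of _ J "\<lambda>x. \<phi> x + \<psi> x"])
             (auto simp: J_def fun_eq_iff smooth_partial_rules(1) test_functionsD test_add split: option.split)
      qed
      show "(\<lambda>k x. c * f k x) \<in> J ` test_functions \<Omega>" if f: "f \<in> J ` test_functions \<Omega>" for c f
      proof -
        obtain \<phi> where \<phi>: "f = J \<phi>" "\<phi> \<in> test_functions \<Omega>" using f by auto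
        have "partial i (\<lambda>x. c * \<phi> x) x = c * partial i \<phi> x" for i x
          by (rule partial_scale[OF smooth_differentiable[OF test_functionsD[OF \<phi>(2)]]])
        then show ?thesis using \<phi>
          by (intro image_eqI[of _ J "\<lambda>x. c * \<phi> x"])
             (auto simp: J_def fun_eq_iff test_scale split: option.split)
      qed
      show "J (w (r n)) \<in> J ` test_functions \<Omega>" for n using wt by simp
      show "(case k of None \<Rightarrow> u | Some i \<Rightarrow> p i) \<in> L2 \<Omega>" for k using uph by (simp split: option.split)
      show "(\<lambda>n. ip (J (w (r n)) k) y) \<longlonglongrightarrow> ip (case k of None \<Rightarrow> u | Some i \<Rightarrow> p i) y" if "y \<in> L2 \<Omega>" for k y
        using weak_u[OF that] weak_p[OF that] by (simp add: J_def split: option.split)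
    qed blast
    have "\<exists>\<phi>. \<phi> \<in> test_functions \<Omega> \<and> Y n = J \<phi>" for n using Y(1)[of n] by auto
    then obtain \<phi> where \<phi>: "\<And>n. \<phi> n \<in> test_functions \<Omega>" "\<And>n. Y n = J (\<phi> n)" by metis
    have "strong_conv nm \<phi> u" "strong_conv nm (\<lambda>n. partial i (\<phi> n)) (p i)" for i
      using Y(2)[of None] Y(2)[of "Some i"] by (simp_all add: \<phi>(2) J_def)
    note HI = H10I[of u p \<phi>, OF uph(1,2) \<phi>(1) this]
    show "u \<in> H10 \<Omega>" "\<And>i. is_weak_partial \<Omega> i u (p i)" by (fact HI)+
  qed
  have ev_C: "\<exists>N. \<forall>n\<ge>N. \<forall>x. \<psi> x \<noteq> 0 \<longrightarrow> x \<in> C (r n)" if \<psi>: "\<psi> \<in> test_functions \<Omega>" for \<psi>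
  proof -
    obtain K where K: "compact K" "K \<subseteq> \<Omega>" "\<And>x. x \<notin> K \<Longrightarrow> \<psi> x = 0" using \<psi> by (rule test_functionsE) blast
    obtain N where "\<forall>n\<ge>N. K \<subseteq> C n" using C_exh[OF K(1,2)] by blast
    then have "\<forall>n\<ge>N. K \<subseteq> C (r n)" using r_ge order_trans by blast
    then show ?thesis using K(3) by blast
  qed
  \<comment> \<open>For a fixed \<open>\<psi>\<close> the truncation to \<open>C (r n)\<close> is
    eventually invisible, so integration by parts for the smooth \<open>w (r n)\<close> survives in
    the limit.\<close>
  have p_h: "is_weak_partial \<Omega> j (p i) (h i j)" for i j
    unfolding is_weak_partial_def
  proof
    fix \<psi> assume \<psi>: "\<psi> \<in> test_functions \<Omega>"
    obtain N where N: "\<And>n x. n \<ge> N \<Longrightarrow> \<psi> x \<noteq> 0 \<Longrightarrow> x \<in> C (r n)" using ev_C[OF \<psi>] by blast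
    have "(\<lambda>n. ip (partial i (w (r n))) (partial j \<psi>)) \<longlonglongrightarrow> ip (p i) (partial j \<psi>)"
      by (intro weak_p test_in_L2[OF test_partial[OF \<psi>]])
    moreover have "(\<lambda>n. ip (partial i (w (r n))) (partial j \<psi>)) \<longlonglongrightarrow> - ip (h i j) \<psi>"
    proof (rule Lim_transform_eventually[OF tendsto_minus[OF weak_h[OF test_in_L2[OF \<psi>]]]])
      show "\<forall>\<^sub>F n in sequentially. - ip (H (r n) i j) \<psi> = ip (partial i (w (r n))) (partial j \<psi>)"
      proof (rule eventually_sequentiallyI[of N])
        fix n assume "N \<le> n"
        then have "H (r n) i j x * \<psi> x = partial j (partial i (w (r n))) x * \<psi> x" for x
          using N[of n x] by (cases "\<psi> x = 0") (auto simp: H_def)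
        then have "ip (H (r n) i j) \<psi> = ip (partial j (partial i (w (r n)))) \<psi>" by (simp only: L2_inner_def)
        also have "\<dots> = - ip (partial i (w (r n))) (partial j \<psi>)"
          by (rule integration_by_parts[OF domain_lebesgue smooth_partial[OF test_functionsD[OF wt]] \<psi>])
        finally show "- ip (H (r n) i j) \<psi> = ip (partial i (w (r n))) (partial j \<psi>)" by simp
      qed
    qed
    ultimately show "ip (p i) (partial j \<psi>) = - ip (h i j) \<psi>" by (rule LIMSEQ_unique)
  qed
  have "AE x in lebesgue_on \<Omega>. (\<nu> * u x - (\<Sum>i\<in>UNIV. h i i x)) - g x = 0"
  proof (rule fundamental_lemma[OF open_domain])
    have hs: "(\<lambda>x. \<Sum>i\<in>UNIV. h i i x) \<in> L2 \<Omega>" by (intro L2_sum uph) simp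
    show "(\<lambda>x. (\<nu> * u x - (\<Sum>i\<in>UNIV. h i i x)) - g x) \<in> L2 \<Omega>" by (intro L2.mem_intros uph hs g)
    fix \<psi> assume \<psi>: "\<psi> \<in> test_functions \<Omega>"
    note \<psi>' = test_in_L2[OF \<psi>]
    obtain N where N: "\<And>n x. n \<ge> N \<Longrightarrow> \<psi> x \<noteq> 0 \<Longrightarrow> x \<in> C (r n)" using ev_C[OF \<psi>] by blast
    define E where "E n x = indicator (C n) x * (\<nu> * w n x - laplacian (w n) x - g x)" for n x
    have E_L2: "E n \<in> L2 \<Omega>" for n
      unfolding E_def[abs_def]
      by (intro L2_indicator C_leb L2.mem_intros test_in_L2[OF wt] test_in_L2[OF test_laplacian[OF wt]] g)
    \<comment> \<open>Two limits of one sequence: zero by the approximate equation, and a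
      combination of weak limits once \<open>\<psi>\<close> is supported in
      \<open>C (r n)\<close>.\<close>
    have "(\<lambda>n. ip (E (r n)) \<psi>) \<longlonglongrightarrow> 0"
    proof (rule Lim_null_comparison)
      show "\<forall>\<^sub>F n in sequentially. norm (ip (E (r n)) \<psi>) \<le> \<delta> (r n) * nm \<psi>"
      proof (intro always_eventually allI)
        fix n
        have "\<bar>ip (E (r n)) \<psi>\<bar> \<le> nm (E (r n)) * nm \<psi>" by (intro L2.Cauchy_Schwarz E_L2 \<psi>')
        also have "\<dots> \<le> \<delta> (r n) * nm \<psi>"
          using w[of "r n"] by (intro mult_right_mono L2.nrm_nonneg \<psi>') (simp add: good_def E_def[abs_def])
        finally show "norm (ip (E (r n)) \<psi>) \<le> \<delta> (r n) * nm \<psi>" by simp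
      qed
      show "(\<lambda>n. \<delta> (r n) * nm \<psi>) \<longlonglongrightarrow> 0"
        by (intro tendsto_mult_left_zero LIMSEQ_subseq_LIMSEQ[OF \<delta>_lim r, unfolded o_def])
    qed
    moreover have "(\<lambda>n. ip (E (r n)) \<psi>) \<longlonglongrightarrow> \<nu> * ip u \<psi> - (\<Sum>i\<in>UNIV. ip (h i i) \<psi>) - ip g \<psi>"
    proof (rule Lim_transform_eventually)
      show "(\<lambda>n. \<nu> * ip (w (r n)) \<psi> - (\<Sum>i\<in>UNIV. ip (H (r n) i i) \<psi>) - ip g \<psi>) \<longlonglongrightarrow>
          \<nu> * ip u \<psi> - (\<Sum>i\<in>UNIV. ip (h i i) \<psi>) - ip g \<psi>"
        by (intro tendsto_intros weak_u weak_h \<psi>')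
      show "\<forall>\<^sub>F n in sequentially. \<nu> * ip (w (r n)) \<psi> - (\<Sum>i\<in>UNIV. ip (H (r n) i i) \<psi>) - ip g \<psi> = ip (E (r n)) \<psi>"
      proof (rule eventually_sequentiallyI[of N])
        fix n assume "N \<le> n"
        have Hs: "(\<lambda>x. \<Sum>i\<in>UNIV. H (r n) i i x) \<in> L2 \<Omega>" by (intro L2_sum H_L2) simp
        have "E (r n) x * \<psi> x = (\<nu> * w (r n) x - (\<Sum>i\<in>UNIV. H (r n) i i x) - g x) * \<psi> x" for x
          using N[OF \<open>N \<le> n\<close>, of x] by (cases "\<psi> x = 0") (auto simp: E_def H_def laplacian_def)
        then have "ip (E (r n)) \<psi> = ip (\<lambda>x. \<nu> * w (r n) x - (\<Sum>i\<in>UNIV. H (r n) i i x) - g x) \<psi>"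
          by (simp only: L2_inner_def)
        also have "\<dots> = \<nu> * ip (w (r n)) \<psi> - ip (\<lambda>x. \<Sum>i\<in>UNIV. H (r n) i i x) \<psi> - ip g \<psi>"
          using test_in_L2[OF wt] Hs g \<psi>' by (simp add: L2.ip_diff_left L2.ip_scale_left L2.mem_intros)
        also have "ip (\<lambda>x. \<Sum>i\<in>UNIV. H (r n) i i x) \<psi> = (\<Sum>i\<in>UNIV. ip (H (r n) i i) \<psi>)"
          by (intro L2_inner_sum_left H_L2 \<psi>') simp
        finally show "\<nu> * ip (w (r n)) \<psi> - (\<Sum>i\<in>UNIV. ip (H (r n) i i) \<psi>) - ip g \<psi> = ip (E (r n)) \<psi>" by simp
      qed
    qed
    ultimately have "0 = \<nu> * ip u \<psi> - (\<Sum>i\<in>UNIV. ip (h i i) \<psi>) - ip g \<psi>" by (rule LIMSEQ_unique)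
    moreover have "ip (\<lambda>x. \<Sum>i\<in>UNIV. h i i x) \<psi> = (\<Sum>i\<in>UNIV. ip (h i i) \<psi>)"
      by (intro L2_inner_sum_left uph \<psi>') simp
    ultimately show "ip (\<lambda>x. (\<nu> * u x - (\<Sum>i\<in>UNIV. h i i x)) - g x) \<psi> = 0"
      using uph hs g \<psi>' by (simp add: L2.ip_diff_left L2.ip_scale_left L2.mem_intros)
  qed
  then have eq: "AE x in lebesgue_on \<Omega>. \<nu> * u x - (\<Sum>i\<in>UNIV. h i i x) = g x" by eventually_elim simp
  have pH1: "p i \<in> H1 \<Omega>" for i by (rule H1I[OF uph(2) uph(3) p_h])
  have Du: "AE x in lebesgue_on \<Omega>. p i x = D i u x" for i
    using weak_partial(3)[OF uph(2) u_p, of i] by (simp add: eq_commute)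
  note c = H1_cong[OF pH1 weak_partial(1)[OF uph(2) u_p] Du]
  have DDu: "AE x in lebesgue_on \<Omega>. D j (D i u) x = h i j x" for i j
    using c(2)[of j i] weak_partial(3)[OF uph(3) p_h, of j i] by eventually_elim simp
  have uV: "u \<in> V \<Omega>" by (intro V_I u_H10 c)
  have DDn: "nm (D j (D i u)) = nm (h i j)" for i j
    by (rule L2_norm_cong_AE[OF _ _ DDu]) (intro V_D uV uph)+
  show ?thesis
  proof (rule that[OF uV])
    have "AE x in lebesgue_on \<Omega>. \<forall>i\<in>UNIV. D i (D i u) x = h i i x" by (intro AE_finite_allI DDu) simp
    with eq show "AE x in lebesgue_on \<Omega>. \<nu> * u x - wlap u x = g x"
      by eventually_elim (simp add: wlap_def)
    interpret F: semi_hilbert "L2_family \<Omega> :: (('n \<times> 'n) \<times> (real^'n) \<Rightarrow> real) set" "L2_family_inner \<Omega>"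
      by (rule semi_hilbert_L2_family)
    define hF where "hF = (\<lambda>((i, j), x). h i j x)"
    define HF where "HF n = (\<lambda>((i, j), x). H n i j x)" for n
    have mem: "hF \<in> L2_family \<Omega>" "HF n \<in> L2_family \<Omega>" for n
      unfolding hF_def HF_def L2_family_def using uph H_L2 by auto
    \<comment> \<open>Lower semicontinuity is applied to the Hessian as one vector, not entry by
      entry; this keeps the constant at exactly one.\<close>
    have "F.nrm hF \<le> nm g + 0"
    proof (rule F.weak_limit_nrm_le[OF mem(2) mem(1)])
      show "(\<lambda>n. L2_family_inner \<Omega> (HF (r n)) hF) \<longlonglongrightarrow> L2_family_inner \<Omega> hF hF"
        unfolding L2_family_inner_def hF_def HF_def by (intro tendsto_sum) (auto intro!: weak_h uph)
      show "(\<lambda>n. nm g + \<delta> (r n)) \<longlonglongrightarrow> nm g + 0"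
        by (intro tendsto_intros LIMSEQ_subseq_LIMSEQ[OF \<delta>_lim r, unfolded o_def])
      show "F.nrm (HF (r n)) \<le> nm g + \<delta> (r n)" for n
      proof (rule power2_le_imp_le[OF _ B(2)])
        show "(F.nrm (HF (r n)))\<^sup>2 \<le> (nm g + \<delta> (r n))\<^sup>2"
          using H_sum[of "r n"] unfolding L2_family_nrm_square[OF mem(2)]
          by (simp add: HF_def sum.cartesian_product case_prod_unfold UNIV_Times_UNIV[symmetric] del: UNIV_Times_UNIV)
      qed
    qed
    then have "(F.nrm hF)\<^sup>2 \<le> (nm g)\<^sup>2" using F.nrm_nonneg[OF mem(1)] by (simp add: power_mono)
    then have "(\<Sum>i\<in>UNIV. \<Sum>j\<in>UNIV. (nm (h i j))\<^sup>2) \<le> (nm g)\<^sup>2"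
      unfolding L2_family_nrm_square[OF mem(1)]
      by (simp add: hF_def sum.cartesian_product case_prod_unfold UNIV_Times_UNIV[symmetric] del: UNIV_Times_UNIV)
    then show "(\<Sum>i\<in>UNIV. \<Sum>j\<in>UNIV. (nm (D i (D j u)))\<^sup>2) \<le> (nm g)\<^sup>2"
      unfolding DDn by (subst sum.swap)
  qed
qed

text \<open>Every \<open>u\<close> in \<open>V\<close> solves a resolvent equation with its own
  right-hand side, and by uniqueness inherits the Hessian bound of the constructed solution. Letting
  \<open>\<nu>\<close> tend to zero leaves the Laplacian alone, with constant one.\<close>

lemma Miranda_Talenti:
  assumes u: "u \<in> V \<Omega>"
  shows "(\<Sum>i\<in>UNIV. \<Sum>j\<in>UNIV. (nm (D i (D j u)))\<^sup>2) \<le> (nm (wlap u))\<^sup>2"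
proof -
  define S where "S = (\<Sum>i\<in>UNIV. \<Sum>j\<in>UNIV. (nm (D i (D j u)))\<^sup>2)"
  have L: "u \<in> L2 \<Omega>" "wlap u \<in> L2 \<Omega>" by (intro V_D u wlap_L2)+
  have *: "S \<le> (\<nu> * nm u + nm (wlap u))\<^sup>2" if \<nu>: "0 < \<nu>" for \<nu>
  proof -
    have g: "(\<lambda>x. \<nu> * u x - wlap u x) \<in> L2 \<Omega>" by (intro L2.mem_intros L)
    obtain v where v: "v \<in> V \<Omega>" "AE x in lebesgue_on \<Omega>. \<nu> * v x - wlap v x = \<nu> * u x - wlap u x"
      "(\<Sum>i\<in>UNIV. \<Sum>j\<in>UNIV. (nm (D i (D j v)))\<^sup>2) \<le> (nm (\<lambda>x. \<nu> * u x - wlap u x))\<^sup>2"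
      using resolvent[OF g \<nu>] by blast
    have "nm (D i (D j v)) = nm (D i (D j u))" for i j
      by (rule L2_norm_cong_AE[OF _ _ resolvent_unique(2)[OF v(1) u \<nu> v(2)]]) (intro V_D u v)+
    then have "S \<le> (nm (\<lambda>x. \<nu> * u x - wlap u x))\<^sup>2" using v(3) by (simp add: S_def)
    also have "\<dots> \<le> (\<nu> * nm u + nm (wlap u))\<^sup>2"
    proof (rule power_mono[OF _ L2.nrm_nonneg[OF g]])
      show "nm (\<lambda>x. \<nu> * u x - wlap u x) \<le> \<nu> * nm u + nm (wlap u)"
        using L2.nrm_triangle[OF L2_scale[OF L(1), of \<nu>] L2_scale[OF L(2), of "-1"]]
          L2.nrm_scale[OF L(1), of \<nu>] L2.nrm_scale[OF L(2), of "-1"] \<nu> by simp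
    qed
    finally show ?thesis .
  qed
  have "S \<le> (0 * nm u + nm (wlap u))\<^sup>2"
  proof (rule LIMSEQ_le_const)
    show "(\<lambda>n. (inverse (real (Suc n)) * nm u + nm (wlap u))\<^sup>2) \<longlonglongrightarrow> (0 * nm u + nm (wlap u))\<^sup>2"
      by (intro tendsto_intros LIMSEQ_inverse_real_of_nat)
    show "\<exists>N. \<forall>n\<ge>N. S \<le> (inverse (real (Suc n)) * nm u + nm (wlap u))\<^sup>2"
      by (intro exI allI impI *) simp
  qed
  then show ?thesis by (simp add: S_def)
qed

text \<open>By Green the gradient energy is at most \<open>nm u * nm (wlap u)\<close>, and by
  Poincare \<open>nm u\<close> is at most \<open>2 * R\<close> times the norm of one derivative,
  which then cancels. Second derivatives come from Miranda-Talenti.\<close>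

lemma V_norm_bounds:
  obtains c where "0 < c" "\<And>u. u \<in> V \<Omega> \<Longrightarrow> nm u \<le> c * nm (wlap u)"
    "\<And>u. u \<in> V \<Omega> \<Longrightarrow> H2_norm \<Omega> u \<le> c * nm (wlap u)"
proof -
  obtain R where R: "\<And>x. x \<in> \<Omega> \<Longrightarrow> norm x \<le> R" "0 < R"
    using bounded_domain by (auto simp: bounded_pos)
  define d where "d = real CARD('n)"
  \<comment> \<open>The three summands account for the function, the \<open>d\<close> first and the
    \<open>d * d\<close> second derivatives.\<close>
  define c where "c = 4 * R\<^sup>2 + d * (2 * R) + d * d"
  have d: "0 < d" by (simp add: d_def card_gt_0_iff)
  have c0: "0 < c" "4 * R\<^sup>2 \<le> c" using R d by (auto simp: c_def intro!: add_nonneg_pos add_nonneg_nonneg mult_nonneg_nonneg)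
  have bounds: "nm u \<le> 4 * R\<^sup>2 * nm (wlap u) \<and> H2_norm \<Omega> u \<le> c * nm (wlap u)" if u: "u \<in> V \<Omega>" for u
  proof -
    define L where "L = nm (wlap u)"
    have L0: "0 \<le> L" unfolding L_def by (intro L2.nrm_nonneg wlap_L2 u)
    have nn: "0 \<le> nm u" "0 \<le> nm (D i u)" "0 \<le> nm (D i (D j u))" for i j by (intro L2.nrm_nonneg V_D u)+
    have P: "nm u \<le> 2 * R * nm (D i u)" for i using R V_D(2)[OF u] by (intro Poincare) auto
    have E: "(\<Sum>i\<in>UNIV. (nm (D i u))\<^sup>2) \<le> nm u * L"
      using L2.Cauchy_Schwarz[OF V_D(4)[OF u] wlap_L2[OF u]] Green_energy[OF u] by (simp add: L_def)
    have Ei: "(nm (D i u))\<^sup>2 \<le> nm u * L" for i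
      using E member_le_sum[of i UNIV "\<lambda>i. (nm (D i u))\<^sup>2"] by force
    have DL: "nm (D i u) \<le> 2 * R * L" for i
    proof (cases "nm (D i u) = 0")
      case True then show ?thesis using R L0 by simp
    next
      case False
      then have pos: "0 < nm (D i u)" using nn(2)[of i] by simp
      have "nm (D i u) * nm (D i u) \<le> (2 * R * nm (D i u)) * L"
        using order_trans[OF Ei[of i] mult_right_mono[OF P[of i] L0]] by (simp add: power2_eq_square)
      then have "nm (D i u) * nm (D i u) \<le> (2 * R * L) * nm (D i u)" by (simp add: mult_ac)
      then show ?thesis using pos by (simp only: mult_le_cancel_right_pos)
    qed
    have uL: "nm u \<le> 4 * R\<^sup>2 * L"
      using order_trans[OF P[of undefined] mult_left_mono[OF DL[of undefined], of "2 * R"]] R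
      by (simp add: power2_eq_square mult_ac)
    have DDL: "nm (D i (D j u)) \<le> L" for i j
    proof (rule power2_le_imp_le[OF _ L0])
      have "(nm (D i (D j u)))\<^sup>2 \<le> (\<Sum>j\<in>UNIV. (nm (D i (D j u)))\<^sup>2)" by (rule member_le_sum) auto
      also have "\<dots> \<le> (\<Sum>i\<in>UNIV. \<Sum>j\<in>UNIV. (nm (D i (D j u)))\<^sup>2)"
        by (rule member_le_sum[of i UNIV "\<lambda>i. \<Sum>j\<in>UNIV. (nm (D i (D j u)))\<^sup>2"]) (auto intro: sum_nonneg)
      finally show "(nm (D i (D j u)))\<^sup>2 \<le> L\<^sup>2" using Miranda_Talenti[OF u] by (simp add: L_def)
    qed
    have "H2_norm \<Omega> u \<le> nm u + (\<Sum>i\<in>UNIV. nm (D i u)) + (\<Sum>i\<in>UNIV. \<Sum>j\<in>UNIV. nm (D i (D j u)))"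
      using H2_norm_le[of u] nn by simp
    also have "\<dots> \<le> 4 * R\<^sup>2 * L + (\<Sum>i\<in>(UNIV::'n set). 2 * R * L) + (\<Sum>i\<in>(UNIV::'n set). \<Sum>j\<in>(UNIV::'n set). L)"
      by (intro add_mono uL sum_mono DL DDL)
    also have "\<dots> = c * L" by (simp add: c_def d_def algebra_simps)
    finally show ?thesis using uL by (simp add: L_def)
  qed
  show ?thesis
  proof (rule that[OF c0(1)])
    fix u assume u: "u \<in> V \<Omega>"
    have "0 \<le> nm (wlap u)" by (intro L2.nrm_nonneg wlap_L2 u)
    then have "4 * R\<^sup>2 * nm (wlap u) \<le> c * nm (wlap u)" by (intro mult_right_mono c0)
    then show "nm u \<le> c * nm (wlap u)" using bounds[OF u] by linarith
    show "H2_norm \<Omega> u \<le> c * nm (wlap u)" using bounds[OF u] by simp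
  qed
qed

end

section \<open>The Cordes condition\<close>

lemma norm_matrix_square: "(norm (M::real^'n^'m))\<^sup>2 = (\<Sum>i\<in>UNIV. \<Sum>j\<in>UNIV. (M $ i $ j)\<^sup>2)"
  unfolding power2_norm_eq_inner by (simp add: inner_vec_def power2_eq_square)

lemma trace_eq_inner: "trace (M::real^'n^'n) = mat 1 \<bullet> M"
  by (simp add: trace_def inner_vec_def mat_def if_distrib[of "\<lambda>x. x * _"] cong: if_cong)

lemma norm_mat_1: "(norm (mat 1 :: real^'n^'n))\<^sup>2 = real CARD('n)"
  unfolding power2_norm_eq_inner trace_eq_inner[symmetric] by (simp add: trace_def mat_def)

text \<open>For nonzero \<open>M\<close>, the factor that brings a multiple of \<open>M\<close>
  closest to the identity matrix in the Frobenius norm.\<close>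

definition cordes_scale :: "real^'n^'n \<Rightarrow> real" where
  "cordes_scale M = trace M / (norm M)\<^sup>2"

text \<open>The minimal squared distance of multiples of \<open>M\<close> to the identity is
  \<open>d - (trace M)^2 / (norm M)^2\<close>, and by the Cordes condition it is at most
  \<open>1 - \<epsilon>\<close>. The upper bound on the scale comes from Cauchy-Schwarz against the
  identity, the lower one from the Cordes condition and the trace bound.\<close>

lemma cordes_class_bounds:
  fixes M :: "real^'n^'n"
  assumes M: "M \<in> cordes_class \<nu>l \<nu>u \<epsilon>" and \<nu>: "0 < \<nu>l" and \<epsilon>: "0 < \<epsilon>" "\<epsilon> \<le> 1"
  shows "0 < cordes_scale M" "cordes_scale M \<le> 1 / \<nu>l" "\<epsilon> / (real CARD('n) * \<nu>u) \<le> cordes_scale M"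
    "norm M \<le> real CARD('n) * \<nu>u / sqrt \<epsilon>"
    "\<bar>cordes_scale M * (M \<bullet> N) - trace N\<bar> \<le> sqrt (1 - \<epsilon>) * norm N"
proof -
  define d where "d = real CARD('n)"
  have d: "1 \<le> d" using zero_less_card_finite[where 'a = 'n] by (simp add: d_def Suc_le_eq)
  have diag: "\<nu>l \<le> M $ i $ i" "M $ i $ i \<le> \<nu>u" for i
  proof -
    have "axis i 1 \<bullet> (M *v axis i 1) = M $ i $ i"
      by (simp add: inner_axis' matrix_vector_mul_component inner_axis)
    moreover have "\<nu>l * (norm (axis i (1::real)))\<^sup>2 \<le> axis i 1 \<bullet> (M *v axis i 1) \<and>
        axis i 1 \<bullet> (M *v axis i 1) \<le> \<nu>u * (norm (axis i (1::real)))\<^sup>2"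
      using M unfolding cordes_class_def by blast
    ultimately show "\<nu>l \<le> M $ i $ i" "M $ i $ i \<le> \<nu>u" by auto
  qed
  have tr_l: "d * \<nu>l \<le> trace M" and tr_u: "trace M \<le> d * \<nu>u"
    using sum_mono[of UNIV "\<lambda>i. \<nu>l" "\<lambda>i. M $ i $ i"] sum_mono[of UNIV "\<lambda>i. M $ i $ i" "\<lambda>i. \<nu>u"] diag
    by (simp_all add: trace_def d_def)
  have dl: "0 < d * \<nu>l" using d \<nu> by simp
  have tr: "0 < trace M" using tr_l dl by linarith
  have nM: "0 < norm M" using tr by (auto simp: trace_eq_inner)
  have CS: "(trace M)\<^sup>2 \<le> d * (norm M)\<^sup>2"
  proof -
    have "(trace M)\<^sup>2 \<le> (norm (mat 1 :: real^'n^'n) * norm M)\<^sup>2"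
      unfolding trace_eq_inner by (rule power2_le_iff_abs_le[THEN iffD2]) (auto intro: Cauchy_Schwarz_ineq2)
    then show ?thesis by (simp add: power_mult_distrib norm_mat_1 d_def)
  qed
  have de: "0 < d - 1 + \<epsilon>" using d \<epsilon> by simp
  have "norm M / trace M \<le> 1 / sqrt (d - 1 + \<epsilon>)"
    using M by (simp add: cordes_class_def d_def)
  then have nt: "norm M * sqrt (d - 1 + \<epsilon>) \<le> trace M" using tr de by (simp add: field_simps)
  have "(norm M * sqrt (d - 1 + \<epsilon>))\<^sup>2 \<le> (trace M)\<^sup>2"
    using nt de by (intro power_mono) auto
  then have cord: "(norm M)\<^sup>2 * (d - 1 + \<epsilon>) \<le> (trace M)\<^sup>2" using de by (simp add: power_mult_distrib)
  show pos: "0 < cordes_scale M" using tr nM by (simp add: cordes_scale_def)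
  show "cordes_scale M \<le> 1 / \<nu>l"
  proof -
    have "trace M * (d * \<nu>l) \<le> trace M * trace M" using tr_l tr by (intro mult_left_mono) auto
    also have "\<dots> \<le> d * (norm M)\<^sup>2" using CS by (simp add: power2_eq_square)
    finally have "d * (trace M * \<nu>l) \<le> d * (norm M)\<^sup>2" by (simp add: mult_ac)
    then have "trace M * \<nu>l \<le> (norm M)\<^sup>2" using d by simp
    then show ?thesis using nM \<nu> by (simp add: cordes_scale_def field_simps)
  qed
  show "\<epsilon> / (real CARD('n) * \<nu>u) \<le> cordes_scale M"
  proof -
    have "0 < d * \<nu>u" using tr tr_u by linarith
    have "\<epsilon> * (norm M)\<^sup>2 \<le> (d - 1 + \<epsilon>) * (norm M)\<^sup>2" using d by (intro mult_right_mono) auto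
    also have "\<dots> \<le> trace M * trace M" using cord by (simp add: power2_eq_square mult_ac)
    also have "\<dots> \<le> trace M * (d * \<nu>u)" using tr tr_u by (intro mult_left_mono) auto
    finally show ?thesis using \<open>0 < d * \<nu>u\<close> nM by (simp add: cordes_scale_def d_def[symmetric] field_simps)
  qed
  show "norm M \<le> real CARD('n) * \<nu>u / sqrt \<epsilon>"
  proof -
    have "norm M * sqrt \<epsilon> \<le> norm M * sqrt (d - 1 + \<epsilon>)" using d by (intro mult_left_mono real_sqrt_le_mono) auto
    then have "norm M * sqrt \<epsilon> \<le> d * \<nu>u" using nt tr_u by linarith
    then show ?thesis using \<epsilon> by (simp add: d_def[symmetric] field_simps)
  qed
  have "(norm (cordes_scale M *\<^sub>R M - mat 1))\<^sup>2 = (cordes_scale M)\<^sup>2 * (norm M)\<^sup>2 - 2 * cordes_scale M * trace M + d"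
    using norm_mat_1[where 'n = 'n] unfolding power2_norm_eq_inner
    by (simp add: inner_diff_left inner_diff_right trace_eq_inner inner_commute[of M "mat 1"] d_def power2_eq_square[of "cordes_scale M"] right_diff_distrib)
  also have "\<dots> = d - (trace M)\<^sup>2 / (norm M)\<^sup>2"
    using nM by (simp add: cordes_scale_def field_simps power2_eq_square)
  also have "\<dots> \<le> 1 - \<epsilon>" using cord nM by (simp add: field_simps)
  finally have "norm (cordes_scale M *\<^sub>R M - mat 1) \<le> sqrt (1 - \<epsilon>)" by (rule real_le_rsqrt)
  then have "norm (cordes_scale M *\<^sub>R M - mat 1) * norm N \<le> sqrt (1 - \<epsilon>) * norm N" by (rule mult_right_mono) simp
  moreover have "cordes_scale M * (M \<bullet> N) - trace N = (cordes_scale M *\<^sub>R M - mat 1) \<bullet> N"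
    by (simp add: inner_diff_left trace_eq_inner)
  ultimately show "\<bar>cordes_scale M * (M \<bullet> N) - trace N\<bar> \<le> sqrt (1 - \<epsilon>) * norm N"
    using Cauchy_Schwarz_ineq2[of "cordes_scale M *\<^sub>R M - mat 1" N] by linarith
qed

section \<open>The Hamilton--Jacobi--Bellman operator\<close>

text \<open>Used for measurability: it lets the supremum over the controls run over a countable
  set.\<close>

lemma compact_countable_dense:
  fixes A :: "'a::metric_space set"
  assumes "compact A"
  obtains B where "countable B" "B \<subseteq> A" "A \<subseteq> closure B"
proof -
  have "\<exists>B\<subseteq>A. finite B \<and> A \<subseteq> (\<Union>b\<in>B. ball b (inverse (real (Suc n))))" for n
  proof -
    obtain B where "B \<subseteq> A" "finite B" "A \<subseteq> (\<Union>b\<in>B. ball b (inverse (real (Suc n))))"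
    proof (rule compactE_image[OF assms])
      show "open (ball b (inverse (real (Suc n))))" for b :: 'a by simp
      show "A \<subseteq> (\<Union>b\<in>A. ball b (inverse (real (Suc n))))" by force
    qed blast
    then show ?thesis by blast
  qed
  then obtain B where B: "\<And>n. B n \<subseteq> A" "\<And>n. finite (B n)" "\<And>n. A \<subseteq> (\<Union>b\<in>B n. ball b (inverse (real (Suc n))))"
    by metis
  show ?thesis
  proof (rule that[of "\<Union>n. B n"])
    show "countable (\<Union>n. B n)" using B(2) by (simp add: countable_finite)
    show "(\<Union>n. B n) \<subseteq> A" using B(1) by blast
    show "A \<subseteq> closure (\<Union>n. B n)"
    proof
      fix x assume "x \<in> A"
      show "x \<in> closure (\<Union>n. B n)"
      proof (unfold closure_approachable, intro allI impI)
        fix e :: real assume "0 < e"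
        then obtain n where n: "inverse (real (Suc n)) < e" using reals_Archimedean by blast
        obtain b where "b \<in> B n" "dist b x < inverse (real (Suc n))" using B(3)[of n] \<open>x \<in> A\<close> by auto
        then show "\<exists>y\<in>\<Union>n. B n. dist y x < e" using n by (intro bexI[of _ b]) auto
      qed
    qed
  qed
qed

context open_domain
begin

lemma weak_hessian_nth: "weak_hessian \<Omega> v x $ i $ j = D i (D j v) x"
  by (simp add: weak_hessian_def)

lemma trace_weak_hessian: "trace (weak_hessian \<Omega> v x) = wlap v x"
  by (simp add: trace_def weak_hessian_nth wlap_def)

lemma weak_hessian_add:
  assumes "u \<in> V \<Omega>" "v \<in> V \<Omega>"
  shows "AE x in lebesgue_on \<Omega>. weak_hessian \<Omega> (\<lambda>x. u x + v x) x = weak_hessian \<Omega> u x + weak_hessian \<Omega> v x"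
proof -
  have "AE x in lebesgue_on \<Omega>. \<forall>i\<in>UNIV. \<forall>j\<in>UNIV. D i (D j (\<lambda>x. u x + v x)) x = D i (D j u) x + D i (D j v) x"
    by (intro AE_finite_allI V_add(3) assms) simp_all
  then show ?thesis by eventually_elim (simp add: vec_eq_iff weak_hessian_nth)
qed

lemma weak_hessian_diff:
  assumes "u \<in> V \<Omega>" "v \<in> V \<Omega>"
  shows "AE x in lebesgue_on \<Omega>. weak_hessian \<Omega> (\<lambda>x. u x - v x) x = weak_hessian \<Omega> u x - weak_hessian \<Omega> v x"
proof -
  have "AE x in lebesgue_on \<Omega>. \<forall>i\<in>UNIV. \<forall>j\<in>UNIV. D i (D j (\<lambda>x. u x - v x)) x = D i (D j u) x - D i (D j v) x"
    by (intro AE_finite_allI V_diff(3) assms) simp_all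
  then show ?thesis by eventually_elim (simp add: vec_eq_iff weak_hessian_nth)
qed

lemma norm_weak_hessian:
  assumes v: "v \<in> V \<Omega>"
  shows "(\<lambda>x. norm (weak_hessian \<Omega> v x)) \<in> L2 \<Omega>"
    "(nm (\<lambda>x. norm (weak_hessian \<Omega> v x)))\<^sup>2 = (\<Sum>i\<in>UNIV. \<Sum>j\<in>UNIV. (nm (D i (D j v)))\<^sup>2)"
proof -
  have L: "D i (D j v) \<in> L2 \<Omega>" for i j by (intro V_D v)
  have int: "integrable (lebesgue_on \<Omega>) (\<lambda>x. (D i (D j v) x)\<^sup>2)" for i j by (rule L2_square_integrable[OF L])
  have eq: "(norm (weak_hessian \<Omega> v x))\<^sup>2 = (\<Sum>i\<in>UNIV. \<Sum>j\<in>UNIV. (D i (D j v) x)\<^sup>2)" for x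
    by (simp add: norm_matrix_square weak_hessian_nth)
  have "(\<lambda>x. sqrt (\<Sum>i\<in>UNIV. \<Sum>j\<in>UNIV. (D i (D j v) x)\<^sup>2)) \<in> borel_measurable (lebesgue_on \<Omega>)"
    using L2_measurable[OF L] by measurable
  then have "(\<lambda>x. norm (weak_hessian \<Omega> v x)) \<in> borel_measurable (lebesgue_on \<Omega>)"
    by (simp add: eq[symmetric])
  then show "(\<lambda>x. norm (weak_hessian \<Omega> v x)) \<in> L2 \<Omega>"
    using int by (simp add: L2_def eq)
  from L2.nrm_square[OF this]
  have "(nm (\<lambda>x. norm (weak_hessian \<Omega> v x)))\<^sup>2 = (LINT x|lebesgue_on \<Omega>. (norm (weak_hessian \<Omega> v x))\<^sup>2)"
    unfolding L2_inner_def power2_eq_square .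
  also have "\<dots> = (\<Sum>i\<in>UNIV. \<Sum>j\<in>UNIV. (LINT x|lebesgue_on \<Omega>. (D i (D j v) x)\<^sup>2))"
    unfolding eq using int by (simp add: Bochner_Integration.integral_sum)
  also have "\<dots> = (\<Sum>i\<in>UNIV. \<Sum>j\<in>UNIV. (nm (D i (D j v)))\<^sup>2)"
    by (intro sum.cong refl) (simp only: L2.nrm_square[OF L], simp only: L2_inner_def power2_eq_square)
  finally show "(nm (\<lambda>x. norm (weak_hessian \<Omega> v x)))\<^sup>2 = (\<Sum>i\<in>UNIV. \<Sum>j\<in>UNIV. (nm (D i (D j v)))\<^sup>2)" .
qed

end

section \<open>The Hamiltonian and the operator that it induces on \<open>V\<close>\<close>

locale hjb_domain = convex_domain \<Omega> for \<Omega> :: "(real^'n) set" +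
  fixes A :: "'a::metric_space set" and a :: "real^'n \<Rightarrow> 'a \<Rightarrow> real^'n^'n" and f :: "real^'n \<Rightarrow> 'a \<Rightarrow> real"
    and \<nu>l \<nu>u \<epsilon> :: real
  assumes A: "compact A" "A \<noteq> {}"
    and a_cont: "continuous_on (closure \<Omega> \<times> A) (\<lambda>(x, \<alpha>). a x \<alpha>)"
    and ellipticity: "0 < \<nu>l" "0 < \<epsilon>" "\<epsilon> \<le> 1"
    and cordes: "\<And>x \<alpha>. x \<in> closure \<Omega> \<Longrightarrow> \<alpha> \<in> A \<Longrightarrow> a x \<alpha> \<in> cordes_class \<nu>l \<nu>u \<epsilon>"
    and f_cont: "continuous_on (closure \<Omega> \<times> A) (\<lambda>(x, \<alpha>). f x \<alpha>)"
begin

text \<open>\<open>\<kappa>\<close> is the relative distance of the rescaled operators from the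
  Laplacian, \<open>\<gamma>\<close> an upper bound for the Cordes scales, \<open>Ka\<close> one for
  the norms of the coefficients and hence the Lipschitz constant of \<open>ham\<close>, and
  \<open>Kf\<close> one for \<open>f\<close>.\<close>

definition \<kappa> :: real where "\<kappa> = sqrt (1 - \<epsilon>)"
definition \<gamma> :: real where "\<gamma> = 1 / \<nu>l"
definition Ka :: real where "Ka = real CARD('n) * \<nu>u / sqrt \<epsilon>"
definition Kf :: real where "Kf = (SUP p\<in>closure \<Omega> \<times> A. \<bar>f (fst p) (snd p)\<bar>)"

abbreviation ham where "ham x M \<equiv> hamiltonian A a f x M"
abbreviation F where "F v \<equiv> HJB \<Omega> A a f v"

lemma \<kappa>: "0 \<le> \<kappa>" "\<kappa> < 1"
  using ellipticity by (auto simp: \<kappa>_def)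

lemma \<gamma>: "0 < \<gamma>" using ellipticity by (simp add: \<gamma>_def)

lemma mem_closure: "x \<in> \<Omega> \<Longrightarrow> x \<in> closure \<Omega>" using closure_subset by blast

lemma norm_a: "x \<in> \<Omega> \<Longrightarrow> \<alpha> \<in> A \<Longrightarrow> norm (a x \<alpha>) \<le> Ka"
  unfolding Ka_def by (rule cordes_class_bounds(4)[OF cordes ellipticity]) (auto intro: mem_closure)

lemma abs_f: "x \<in> \<Omega> \<Longrightarrow> \<alpha> \<in> A \<Longrightarrow> \<bar>f x \<alpha>\<bar> \<le> Kf"
proof -
  assume x: "x \<in> \<Omega>" "\<alpha> \<in> A"
  have "compact (closure \<Omega> \<times> A)" using bounded_domain A by (intro compact_Times) (simp_all add: compact_closure)
  moreover have "continuous_on (closure \<Omega> \<times> A) (\<lambda>p. \<bar>f (fst p) (snd p)\<bar>)"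
    using continuous_on_rabs[OF f_cont] by (simp add: case_prod_unfold)
  ultimately have "compact ((\<lambda>p. \<bar>f (fst p) (snd p)\<bar>) ` (closure \<Omega> \<times> A))" by (intro compact_continuous_image)
  then have "bdd_above ((\<lambda>p. \<bar>f (fst p) (snd p)\<bar>) ` (closure \<Omega> \<times> A))"
    by (intro bounded_imp_bdd_above compact_imp_bounded)
  then show "\<bar>f x \<alpha>\<bar> \<le> Kf"
    unfolding Kf_def using x mem_closure cSUP_upper[of "(x, \<alpha>)" "closure \<Omega> \<times> A" "\<lambda>p. \<bar>f (fst p) (snd p)\<bar>"] by auto
qed

lemma a_inner_bound: "x \<in> \<Omega> \<Longrightarrow> \<alpha> \<in> A \<Longrightarrow> \<bar>a x \<alpha> \<bullet> M\<bar> \<le> Ka * norm M"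
  using Cauchy_Schwarz_ineq2[of "a x \<alpha>" M] mult_right_mono[OF norm_a[of x \<alpha>], of "norm M"] by simp

lemma ham_bdd: "x \<in> \<Omega> \<Longrightarrow> B \<subseteq> A \<Longrightarrow> bdd_above ((\<lambda>\<alpha>. - (a x \<alpha> \<bullet> M) - f x \<alpha>) ` B)"
proof (rule bdd_aboveI2)
  fix \<alpha> assume "x \<in> \<Omega>" "B \<subseteq> A" "\<alpha> \<in> B"
  then have "x \<in> \<Omega>" "\<alpha> \<in> A" by auto
  from a_inner_bound[OF this, of M] abs_f[OF this] show "- (a x \<alpha> \<bullet> M) - f x \<alpha> \<le> Ka * norm M + Kf" by linarith
qed

lemma ham_upper: "x \<in> \<Omega> \<Longrightarrow> \<alpha> \<in> A \<Longrightarrow> - (a x \<alpha> \<bullet> M) - f x \<alpha> \<le> ham x M"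
  unfolding hamiltonian_def by (rule cSUP_upper) (auto intro: ham_bdd)

lemma ham_least: "(\<And>\<alpha>. \<alpha> \<in> A \<Longrightarrow> - (a x \<alpha> \<bullet> M) - f x \<alpha> \<le> s) \<Longrightarrow> ham x M \<le> s"
  unfolding hamiltonian_def by (rule cSUP_least) (use A in auto)

text \<open>A common lower bound for all linear operators on an increment lowers the supremum by as
  much. With a norm bound this gives the Lipschitz estimate, with a supersolution the bound on the
  densities.\<close>

lemma ham_add_le:
  assumes x: "x \<in> \<Omega>" and s: "\<And>\<alpha>. \<alpha> \<in> A \<Longrightarrow> s \<le> a x \<alpha> \<bullet> N"
  shows "ham x (M + N) \<le> ham x M - s"
proof (rule ham_least)
  fix \<alpha> assume "\<alpha> \<in> A"
  with ham_upper[OF x this, of M] s[OF this] show "- (a x \<alpha> \<bullet> (M + N)) - f x \<alpha> \<le> ham x M - s"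
    by (simp add: inner_add_right)
qed

lemma ham_lipschitz:
  assumes x: "x \<in> \<Omega>" shows "\<bar>ham x M - ham x N\<bar> \<le> Ka * norm (M - N)"
proof -
  have "ham x M \<le> ham x N + Ka * norm (M - N)" for M N
  proof -
    have "ham x (N + (M - N)) \<le> ham x N - (- (Ka * norm (M - N)))"
    proof (rule ham_add_le[OF x])
      fix \<alpha> assume "\<alpha> \<in> A"
      from a_inner_bound[OF x this, of "M - N"] show "- (Ka * norm (M - N)) \<le> a x \<alpha> \<bullet> (M - N)" by linarith
    qed
    then show ?thesis by simp
  qed
  from this[of M N] this[of N M] show ?thesis by (simp add: norm_minus_commute abs_le_iff)
qed

lemma ham_zero_bound: "x \<in> \<Omega> \<Longrightarrow> \<bar>ham x 0\<bar> \<le> Kf"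
proof -
  assume x: "x \<in> \<Omega>"
  obtain \<alpha> where \<alpha>: "\<alpha> \<in> A" using A by blast
  have "- f x \<alpha> \<le> ham x 0" using ham_upper[OF x \<alpha>, of 0] by simp
  moreover have "ham x 0 \<le> Kf" by (rule ham_least) (use abs_f[OF x] in \<open>force simp: abs_le_iff\<close>)
  ultimately show "\<bar>ham x 0\<bar> \<le> Kf" using abs_f[OF x \<alpha>] by linarith
qed

text \<open>Multiplying each linear operator by its own Cordes scale does not change the zero set of the
  supremum but brings every operator within relative distance \<open>\<kappa> < 1\<close> of the Laplacian.\<close>
lemma ham_cordes:
  assumes x: "x \<in> \<Omega>" shows "\<bar>trace (M - N)\<bar> \<le> \<kappa> * norm (M - N) + \<gamma> * \<bar>ham x M - ham x N\<bar>"
proof -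
  have one: "trace (M - N) \<le> \<kappa> * norm (M - N) + \<gamma> * \<bar>ham x M - ham x N\<bar>" for M N
  proof (rule field_le_epsilon)
    fix e :: real assume e: "0 < e"
    define \<eta> where "\<eta> = e / \<gamma>"
    have \<eta>: "0 < \<eta>" using e \<gamma> by (simp add: \<eta>_def)
    have "ham x M - \<eta> < (SUP \<alpha>\<in>A. - (a x \<alpha> \<bullet> M) - f x \<alpha>)" using \<eta> by (simp add: hamiltonian_def)
    \<comment> \<open>An almost optimal control for \<open>M\<close> bounds the linear operator on
      \<open>M - N\<close> by the difference of the Hamiltonians plus \<open>\<eta>\<close>; the
      opposite bound on the trace follows by exchanging \<open>M\<close> and
      \<open>N\<close>.\<close>
    then obtain \<alpha> where \<alpha>: "\<alpha> \<in> A" "ham x M - \<eta> < - (a x \<alpha> \<bullet> M) - f x \<alpha>"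
      using A(2) ham_bdd[OF x order_refl] by (subst (asm) less_cSUP_iff) auto
    note c = cordes_class_bounds[OF cordes[OF mem_closure[OF x] \<alpha>(1)] ellipticity]
    have "a x \<alpha> \<bullet> (M - N) \<le> \<bar>ham x M - ham x N\<bar> + \<eta>"
      using \<alpha>(2) ham_upper[OF x \<alpha>(1), of N] by (simp add: inner_diff_right)
    then have "cordes_scale (a x \<alpha>) * (a x \<alpha> \<bullet> (M - N)) \<le> cordes_scale (a x \<alpha>) * (\<bar>ham x M - ham x N\<bar> + \<eta>)"
      using c(1) by (intro mult_left_mono) auto
    also have "\<dots> \<le> \<gamma> * (\<bar>ham x M - ham x N\<bar> + \<eta>)"
      using c(2) \<eta> by (intro mult_right_mono) (auto simp: \<gamma>_def)
    also have "\<dots> = \<gamma> * \<bar>ham x M - ham x N\<bar> + e" using \<gamma> by (simp add: \<eta>_def distrib_left)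
    finally show "trace (M - N) \<le> \<kappa> * norm (M - N) + \<gamma> * \<bar>ham x M - ham x N\<bar> + e"
      using c(5)[of "M - N"] by (simp add: \<kappa>_def abs_le_iff)
  qed
  have "trace (N - M) = - trace (M - N)" by (simp add: trace_def sum_negf[symmetric])
  then show ?thesis using one[of M N] one[of N M] by (simp add: norm_minus_commute abs_minus_commute abs_le_iff)
qed

text \<open>Continuity in the control reduces the supremum to a countable dense set of controls; for
  each of them continuity of the coefficients in \<open>x\<close> suffices.\<close>

lemma F_measurable:
  assumes v: "v \<in> V \<Omega>" shows "F v \<in> borel_measurable (lebesgue_on \<Omega>)"
proof -
  obtain B where B: "countable B" "B \<subseteq> A" "A \<subseteq> closure B" using compact_countable_dense[OF A(1)] by blast
  have B_ne: "B \<noteq> {}" using B(3) A(2) by auto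
  have ac: "continuous_on A (\<lambda>\<alpha>. a x \<alpha>)" "continuous_on A (\<lambda>\<alpha>. f x \<alpha>)" if "x \<in> \<Omega>" for x
  proof -
    have "continuous_on A (\<lambda>\<alpha>. (x, \<alpha>))" "(\<lambda>\<alpha>. (x, \<alpha>)) ` A \<subseteq> closure \<Omega> \<times> A"
      using mem_closure[OF that] by (auto intro: continuous_on_Pair continuous_on_const continuous_on_id)
    from continuous_on_compose2[OF a_cont this] continuous_on_compose2[OF f_cont this]
    show "continuous_on A (\<lambda>\<alpha>. a x \<alpha>)" "continuous_on A (\<lambda>\<alpha>. f x \<alpha>)" by simp_all
  qed
  have xc: "continuous_on \<Omega> (\<lambda>x. a x \<alpha>)" "continuous_on \<Omega> (\<lambda>x. f x \<alpha>)" if "\<alpha> \<in> A" for \<alpha>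
  proof -
    have "continuous_on \<Omega> (\<lambda>x. (x, \<alpha>))" "(\<lambda>x. (x, \<alpha>)) ` \<Omega> \<subseteq> closure \<Omega> \<times> A"
      using that mem_closure by (auto intro: continuous_on_Pair continuous_on_const continuous_on_id)
    from continuous_on_compose2[OF a_cont this] continuous_on_compose2[OF f_cont this]
    show "continuous_on \<Omega> (\<lambda>x. a x \<alpha>)" "continuous_on \<Omega> (\<lambda>x. f x \<alpha>)" by simp_all
  qed
  have eq: "F v x = (SUP \<alpha>\<in>B. - (a x \<alpha> \<bullet> weak_hessian \<Omega> v x) - f x \<alpha>)" if x: "x \<in> \<Omega>" for x
  proof -
    let ?g = "\<lambda>\<alpha>. - (a x \<alpha> \<bullet> weak_hessian \<Omega> v x) - f x \<alpha>"
    have g_cont: "continuous_on A ?g" by (intro continuous_intros ac x)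
    have "?g \<alpha> \<le> (SUP \<alpha>\<in>B. ?g \<alpha>)" if \<alpha>: "\<alpha> \<in> A" for \<alpha>
    proof (rule field_le_epsilon)
      fix e :: real assume "0 < e"
      then obtain d where d: "0 < d" "\<And>\<beta>. \<beta> \<in> A \<Longrightarrow> dist \<beta> \<alpha> < d \<Longrightarrow> dist (?g \<beta>) (?g \<alpha>) < e"
        using g_cont \<alpha> unfolding continuous_on_iff by blast
      obtain \<beta> where \<beta>: "\<beta> \<in> B" "dist \<beta> \<alpha> < d" using B(3) \<alpha> d(1) by (meson closure_approachable subsetD)
      have "?g \<alpha> \<le> ?g \<beta> + e" using d(2)[of \<beta>] \<beta> B(2) by (auto simp: dist_real_def)
      also have "?g \<beta> \<le> (SUP \<alpha>\<in>B. ?g \<alpha>)" by (rule cSUP_upper[OF \<beta>(1) ham_bdd[OF x B(2)]])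
      finally show "?g \<alpha> \<le> (SUP \<alpha>\<in>B. ?g \<alpha>) + e" by simp
    qed
    then have "F v x \<le> (SUP \<alpha>\<in>B. ?g \<alpha>)" unfolding HJB_def by (rule ham_least)
    moreover have "(SUP \<alpha>\<in>B. ?g \<alpha>) \<le> F v x"
      unfolding HJB_def using B(2) by (intro cSUP_least B_ne ham_upper x) auto
    ultimately show ?thesis by simp
  qed
  have "(\<lambda>x. SUP \<alpha>\<in>B. - (a x \<alpha> \<bullet> weak_hessian \<Omega> v x) - f x \<alpha>) \<in> borel_measurable (lebesgue_on \<Omega>)"
  proof (rule borel_measurable_cSUP[OF B(1)])
    fix \<alpha> assume \<alpha>: "\<alpha> \<in> B"
    then have \<alpha>A: "\<alpha> \<in> A" using B by blast
    have m1: "(\<lambda>x. a x \<alpha> $ i $ j) \<in> borel_measurable (lebesgue_on \<Omega>)" for i j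
      by (intro continuous_imp_measurable_on_sets_lebesgue domain_lebesgue continuous_intros xc \<alpha>A)
    have m2: "(\<lambda>x. f x \<alpha>) \<in> borel_measurable (lebesgue_on \<Omega>)"
      by (intro continuous_imp_measurable_on_sets_lebesgue domain_lebesgue xc \<alpha>A)
    have m3: "D i (D j v) \<in> borel_measurable (lebesgue_on \<Omega>)" for i j by (intro L2_measurable V_D v)
    have "(\<lambda>x. - (\<Sum>i\<in>UNIV. \<Sum>j\<in>UNIV. a x \<alpha> $ i $ j * D i (D j v) x) - f x \<alpha>) \<in> borel_measurable (lebesgue_on \<Omega>)"
      using m1 m2 m3 by measurable
    then show "(\<lambda>x. - (a x \<alpha> \<bullet> weak_hessian \<Omega> v x) - f x \<alpha>) \<in> borel_measurable (lebesgue_on \<Omega>)"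
      by (simp add: inner_vec_def weak_hessian_nth)
  next
    fix x assume "x \<in> space (lebesgue_on \<Omega>)"
    then have "x \<in> \<Omega>" by simp
    then show "bdd_above ((\<lambda>\<alpha>. - (a x \<alpha> \<bullet> weak_hessian \<Omega> v x) - f x \<alpha>) ` B)" by (rule ham_bdd[OF _ B(2)])
  qed
  moreover have "F v \<in> borel_measurable (lebesgue_on \<Omega>) \<longleftrightarrow>
      (\<lambda>x. SUP \<alpha>\<in>B. - (a x \<alpha> \<bullet> weak_hessian \<Omega> v x) - f x \<alpha>) \<in> borel_measurable (lebesgue_on \<Omega>)"
    by (rule measurable_cong) (simp add: eq)
  ultimately show ?thesis by simp
qed

lemma const_L2: "(\<lambda>x. c) \<in> L2 \<Omega>"
proof -
  have "\<Omega> \<in> lmeasurable" using lmeasurable_open bounded_domain open_domain by blast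
  then interpret finite_measure "lebesgue_on \<Omega>" by (rule finite_measure_lebesgue_on)
  show ?thesis by (simp add: L2_def)
qed

lemma hess_MT: "v \<in> V \<Omega> \<Longrightarrow> nm (\<lambda>x. norm (weak_hessian \<Omega> v x)) \<le> nm (wlap v)"
  using Miranda_Talenti[of v] norm_weak_hessian(2)[of v] by (intro power2_le_imp_le[OF _ L2.nrm_nonneg[OF wlap_L2]]) simp_all

lemma F_L2:
  assumes v: "v \<in> V \<Omega>" shows "F v \<in> L2 \<Omega>"
proof (rule L2_bound[OF F_measurable[OF v]])
  show "(\<lambda>x. Ka * norm (weak_hessian \<Omega> v x) + Kf) \<in> L2 \<Omega>"
    by (intro L2_add L2_scale norm_weak_hessian v const_L2)
  show "AE x in lebesgue_on \<Omega>. \<bar>F v x\<bar> \<le> \<bar>Ka * norm (weak_hessian \<Omega> v x) + Kf\<bar>"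
  proof (rule AE_I2)
    fix x assume "x \<in> space (lebesgue_on \<Omega>)"
    then have x: "x \<in> \<Omega>" by simp
    show "\<bar>F v x\<bar> \<le> \<bar>Ka * norm (weak_hessian \<Omega> v x) + Kf\<bar>"
      using ham_lipschitz[OF x, of "weak_hessian \<Omega> v x" 0] ham_zero_bound[OF x] by (simp add: HJB_def)
  qed
qed

lemma F_lipschitz:
  assumes u: "u \<in> V \<Omega>" and v: "v \<in> V \<Omega>"
  shows "nm (\<lambda>x. F u x - F v x) \<le> \<bar>Ka\<bar> * nm (wlap (\<lambda>x. u x - v x))"
proof -
  have uv: "(\<lambda>x. u x - v x) \<in> V \<Omega>" by (intro V_diff u v)
  have "nm (\<lambda>x. F u x - F v x) \<le> nm (\<lambda>x. \<bar>Ka\<bar> * norm (weak_hessian \<Omega> (\<lambda>x. u x - v x) x))"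
  proof (intro L2_norm_mono_AE L2.diff_mem F_L2 u v L2_scale norm_weak_hessian uv)
    have "AE x in lebesgue_on \<Omega>. x \<in> \<Omega>" by (rule AE_I2) simp
    with weak_hessian_diff[OF u v]
    show "AE x in lebesgue_on \<Omega>. \<bar>F u x - F v x\<bar> \<le> \<bar>\<bar>Ka\<bar> * norm (weak_hessian \<Omega> (\<lambda>x. u x - v x) x)\<bar>"
    proof eventually_elim
      case (elim x)
      have "\<bar>F u x - F v x\<bar> \<le> Ka * norm (weak_hessian \<Omega> u x - weak_hessian \<Omega> v x)"
        unfolding HJB_def by (rule ham_lipschitz[OF elim(2)])
      also have "\<dots> \<le> \<bar>Ka\<bar> * norm (weak_hessian \<Omega> u x - weak_hessian \<Omega> v x)" by (intro mult_right_mono) auto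
      finally show ?case using elim(1) by simp
    qed
  qed
  also have "\<dots> = \<bar>Ka\<bar> * nm (\<lambda>x. norm (weak_hessian \<Omega> (\<lambda>x. u x - v x) x))"
    using L2.nrm_scale[OF norm_weak_hessian(1)[OF uv], of "\<bar>Ka\<bar>"] by simp
  also have "\<dots> \<le> \<bar>Ka\<bar> * nm (wlap (\<lambda>x. u x - v x))" by (intro mult_left_mono hess_MT uv) simp
  finally show ?thesis .
qed

text \<open>In \<open>ham_cordes\<close> the Hessian term has the factor
  \<open>\<kappa> < 1\<close>. After taking \<open>L2\<close> norms, Miranda-Talenti with constant
  one turns it into \<open>\<kappa>\<close> times the norm of the Laplacian, which is absorbed on
  the left.\<close>

lemma F_coercive:
  assumes u: "u \<in> V \<Omega>" and v: "v \<in> V \<Omega>"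
  shows "(1 - \<kappa>) * nm (wlap (\<lambda>x. u x - v x)) \<le> \<gamma> * nm (\<lambda>x. F u x - F v x)"
proof -
  have uv: "(\<lambda>x. u x - v x) \<in> V \<Omega>" by (intro V_diff u v)
  let ?h = "\<lambda>x. norm (weak_hessian \<Omega> (\<lambda>x. u x - v x) x)"
  have L: "?h \<in> L2 \<Omega>" "(\<lambda>x. \<bar>F u x - F v x\<bar>) \<in> L2 \<Omega>"
    by (intro norm_weak_hessian uv L2_abs L2.diff_mem F_L2 u v)+
  have "nm (wlap (\<lambda>x. u x - v x)) \<le> nm (\<lambda>x. \<kappa> * ?h x + \<gamma> * \<bar>F u x - F v x\<bar>)"
  proof (intro L2_norm_mono_AE wlap_L2 uv L2_add L2_scale L)
    have "AE x in lebesgue_on \<Omega>. x \<in> \<Omega>" by (rule AE_I2) simp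
    with weak_hessian_diff[OF u v]
    show "AE x in lebesgue_on \<Omega>. \<bar>wlap (\<lambda>x. u x - v x) x\<bar> \<le> \<bar>\<kappa> * ?h x + \<gamma> * \<bar>F u x - F v x\<bar>\<bar>"
    proof eventually_elim
      case (elim x)
      have "\<bar>wlap (\<lambda>x. u x - v x) x\<bar> \<le> \<kappa> * ?h x + \<gamma> * \<bar>F u x - F v x\<bar>"
        unfolding trace_weak_hessian[symmetric] elim(1) HJB_def by (rule ham_cordes[OF elim(2)])
      then show ?case by linarith
    qed
  qed
  also have "\<dots> \<le> nm (\<lambda>x. \<kappa> * ?h x) + nm (\<lambda>x. \<gamma> * \<bar>F u x - F v x\<bar>)"
    by (intro L2.nrm_triangle L2_scale L)
  also have "\<dots> = \<kappa> * nm ?h + \<gamma> * nm (\<lambda>x. F u x - F v x)"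
    using L2.nrm_scale[OF L(1), of \<kappa>] L2.nrm_scale[OF L(2), of \<gamma>] \<kappa> \<gamma> by (simp add: L2_norm_abs)
  also have "\<dots> \<le> \<kappa> * nm (wlap (\<lambda>x. u x - v x)) + \<gamma> * nm (\<lambda>x. F u x - F v x)"
    by (intro add_right_mono mult_left_mono hess_MT uv \<kappa>)
  finally show ?thesis by (simp add: algebra_simps)
qed

subsection \<open>Approximate supersolutions and the bound on the density\<close>

text \<open>Solves \<open>\<Delta>w - \<kappa> |D\<^sup>2w| = \<gamma> m\<close> approximately by a contraction; the Cordes condition then makes \<open>w\<close>
  satisfy \<open>a : D\<^sup>2w \<ge> m\<close> up to a small error for all coefficients at once.\<close>
lemma approximate_supersolution:
  assumes "0 < \<tau>"
  obtains C where "0 < C" "\<And>m. m \<in> L2 \<Omega> \<Longrightarrow> \<exists>w\<in>V \<Omega>. H2_norm \<Omega> w \<le> C * nm m \<and>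
      nm (\<lambda>x. wlap w x - \<kappa> * norm (weak_hessian \<Omega> w x) - \<gamma> * m x) \<le> \<tau> * nm m"
proof -
  obtain c where c: "0 < c" "\<And>u. u \<in> V \<Omega> \<Longrightarrow> nm u \<le> c * nm (wlap u)"
    "\<And>u. u \<in> V \<Omega> \<Longrightarrow> H2_norm \<Omega> u \<le> c * nm (wlap u)" using V_norm_bounds by blast
  \<comment> \<open>\<open>\<theta>\<close> lies halfway between \<open>\<kappa>\<close> and 1, and
    \<open>\<nu>\<close> uses up the gap, since the shift \<open>\<nu> * z x\<close> costs at most
    \<open>\<nu> * c\<close> times the residual.\<close>
  define \<theta> where "\<theta> = (1 + \<kappa>) / 2"
  define \<nu> where "\<nu> = (1 - \<kappa>) / (2 * c)"
  have \<theta>: "0 \<le> \<theta>" "\<theta> < 1" using \<kappa> by (auto simp: \<theta>_def)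
  have \<nu>: "0 < \<nu>" "\<nu> * c + \<kappa> = \<theta>" using \<kappa> c by (auto simp: \<nu>_def \<theta>_def field_simps)
  \<comment> \<open>Number of contraction steps after which the residual, initially of norm
    \<open>\<gamma> * nm m\<close>, is at most \<open>\<tau> * nm m\<close>.\<close>
  obtain k where k: "\<theta> ^ k < \<tau> / \<gamma>" using real_arch_pow_inv[of "\<tau> / \<gamma>" \<theta>] assms \<gamma> \<theta> by auto
  define C where "C = c * ((\<tau> + \<gamma>) / (1 - \<kappa>))"
  have C: "0 < C" using c \<kappa> \<gamma> assms by (simp add: C_def)
  show ?thesis
  proof (rule that[OF C])
    fix m assume m: "m \<in> L2 \<Omega>"
    define B where "B w x = wlap w x - \<kappa> * norm (weak_hessian \<Omega> w x) - \<gamma> * m x" for w x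
    have B_L2: "B w \<in> L2 \<Omega>" if "w \<in> V \<Omega>" for w
      unfolding B_def[abs_def] by (intro L2.diff_mem L2_scale wlap_L2 norm_weak_hessian that m)
    have nm0: "0 \<le> nm m" by (rule L2.nrm_nonneg[OF m])
    have "\<exists>w\<in>V \<Omega>. nm (B w) \<le> \<theta> ^ n * (\<gamma> * nm m)" for n
    proof (induction n)
      case 0
      have "AE x in lebesgue_on \<Omega>. weak_hessian \<Omega> (\<lambda>x. 0) x = 0"
        using weak_hessian_diff[OF V_zero V_zero] by eventually_elim simp
      then have "AE x in lebesgue_on \<Omega>. B (\<lambda>x. 0) x = (-\<gamma>) * m x"
        by eventually_elim (simp add: B_def trace_weak_hessian[symmetric] trace_def)
      then have "nm (B (\<lambda>x. 0)) = nm (\<lambda>x. (-\<gamma>) * m x)"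
        by (intro L2_norm_cong_AE B_L2 V_zero L2_scale m)
      also have "\<dots> = \<gamma> * nm m" using L2.nrm_scale[OF m, of "-\<gamma>"] \<gamma> by simp
      finally show ?case by (intro bexI[OF _ V_zero]) simp
    next
      case (Suc n)
      then obtain w where w: "w \<in> V \<Omega>" "nm (B w) \<le> \<theta> ^ n * (\<gamma> * nm m)" by blast
      \<comment> \<open>The correction solves the shifted linear equation for the residual. Adding
        it cancels \<open>B w\<close> and leaves \<open>\<nu> * z x\<close> and the change of the
        Hessian norm, which together are smaller by the factor \<open>\<theta>\<close>.\<close>
      obtain z where z: "z \<in> V \<Omega>" "AE x in lebesgue_on \<Omega>. \<nu> * z x - wlap z x = B w x"
        "(\<Sum>i\<in>UNIV. \<Sum>j\<in>UNIV. (nm (D i (D j z)))\<^sup>2) \<le> (nm (B w))\<^sup>2"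
        using resolvent[OF B_L2[OF w(1)] \<nu>(1)] by blast
      define w' where "w' = (\<lambda>x. w x + z x)"
      have w': "w' \<in> V \<Omega>" unfolding w'_def by (intro V_add w z)
      note zL = V_D(4)[OF z(1)] norm_weak_hessian(1)[OF z(1)]
      have hz: "nm (\<lambda>x. norm (weak_hessian \<Omega> z x)) \<le> nm (B w)"
        using z(3) norm_weak_hessian(2)[OF z(1)] by (intro power2_le_imp_le[OF _ L2.nrm_nonneg[OF B_L2[OF w(1)]]]) simp
      have "nm (\<lambda>x. \<nu> * z x - wlap z x) = nm (B w)"
        by (intro L2_norm_cong_AE z L2.diff_mem L2_scale zL wlap_L2 B_L2 w)
      then have lz: "nm (wlap z) \<le> nm (B w)" using shifted_laplacian_norm[OF z(1), of \<nu>] \<nu> by simp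
      have "nm (B w') \<le> nm (\<lambda>x. \<nu> * \<bar>z x\<bar> + \<kappa> * norm (weak_hessian \<Omega> z x))"
      proof (intro L2_norm_mono_AE B_L2 w' L2_add L2_scale L2_abs zL)
        show "AE x in lebesgue_on \<Omega>. \<bar>B w' x\<bar> \<le> \<bar>\<nu> * \<bar>z x\<bar> + \<kappa> * norm (weak_hessian \<Omega> z x)\<bar>"
          using z(2) weak_hessian_add[OF w(1) z(1)] wlap_add[OF w(1) z(1)]
        proof eventually_elim
          case (elim x)
          define h where "h = norm (weak_hessian \<Omega> w x + weak_hessian \<Omega> z x) - norm (weak_hessian \<Omega> w x)"
          have "\<bar>h\<bar> \<le> norm (weak_hessian \<Omega> z x)"
            using norm_triangle_ineq3[of "weak_hessian \<Omega> w x + weak_hessian \<Omega> z x" "weak_hessian \<Omega> w x"] by (simp add: h_def)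
          then have "\<bar>\<kappa> * h\<bar> \<le> \<kappa> * norm (weak_hessian \<Omega> z x)" using \<kappa> by (simp add: abs_mult mult_left_mono)
          moreover have "B w' x = \<nu> * z x - \<kappa> * h"
            using elim by (simp add: B_def w'_def h_def algebra_simps)
          moreover have "\<bar>\<nu> * z x\<bar> = \<nu> * \<bar>z x\<bar>" using \<nu> by (simp add: abs_mult)
          ultimately show ?case by linarith
        qed
      qed
      also have "\<dots> \<le> nm (\<lambda>x. \<nu> * \<bar>z x\<bar>) + nm (\<lambda>x. \<kappa> * norm (weak_hessian \<Omega> z x))"
        by (intro L2.nrm_triangle L2_scale L2_abs zL)
      also have "\<dots> = \<nu> * nm z + \<kappa> * nm (\<lambda>x. norm (weak_hessian \<Omega> z x))"
        using L2.nrm_scale[OF L2_abs[OF zL(1)], of \<nu>] L2.nrm_scale[OF zL(2), of \<kappa>] \<nu> \<kappa> by (simp add: L2_norm_abs)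
      also have "\<dots> \<le> \<nu> * (c * nm (B w)) + \<kappa> * nm (B w)"
      proof (intro add_mono mult_left_mono hz)
        show "nm z \<le> c * nm (B w)" using c(2)[OF z(1)] mult_left_mono[OF lz, of c] c(1) by linarith
      qed (use \<nu> \<kappa> in auto)
      also have "\<dots> = \<theta> * nm (B w)" unfolding \<nu>(2)[symmetric] by (simp add: algebra_simps)
      also have "\<dots> \<le> \<theta> * (\<theta> ^ n * (\<gamma> * nm m))" by (intro mult_left_mono w \<theta>)
      finally show ?case using w' by (intro bexI[of _ w']) (simp_all add: mult.assoc)
    qed
    then obtain w where w: "w \<in> V \<Omega>" "nm (B w) \<le> \<theta> ^ k * (\<gamma> * nm m)" by blast
    have "\<theta> ^ k * \<gamma> \<le> \<tau>" using k \<gamma> by (simp add: field_simps)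
    then have Bw: "nm (B w) \<le> \<tau> * nm m" using w(2) mult_right_mono[of "\<theta> ^ k * \<gamma>" \<tau> "nm m"] nm0 by (simp add: mult.assoc)
    note wL = norm_weak_hessian(1)[OF w(1)] B_L2[OF w(1)]
    \<comment> \<open>Read as an equation for the Laplacian of \<open>w\<close>, the residual bounds
      \<open>w\<close> by \<open>m\<close> whatever the number of iterations, because the Hessian
      term is absorbed.\<close>
    have "wlap w = (\<lambda>x. (B w x + \<kappa> * norm (weak_hessian \<Omega> w x)) + \<gamma> * m x)" by (simp add: B_def fun_eq_iff)
    then have "nm (wlap w) \<le> nm (\<lambda>x. B w x + \<kappa> * norm (weak_hessian \<Omega> w x)) + nm (\<lambda>x. \<gamma> * m x)"
      using L2.nrm_triangle[OF L2_add[OF wL(2) L2_scale[OF wL(1), of \<kappa>]] L2_scale[OF m, of \<gamma>]] by simp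
    also have "nm (\<lambda>x. B w x + \<kappa> * norm (weak_hessian \<Omega> w x)) \<le> nm (B w) + nm (\<lambda>x. \<kappa> * norm (weak_hessian \<Omega> w x))"
      by (intro L2.nrm_triangle L2_scale wL)
    also have "nm (\<lambda>x. \<kappa> * norm (weak_hessian \<Omega> w x)) = \<kappa> * nm (\<lambda>x. norm (weak_hessian \<Omega> w x))"
      using L2.nrm_scale[OF wL(1), of \<kappa>] \<kappa> by simp
    also have "nm (\<lambda>x. \<gamma> * m x) = \<gamma> * nm m" using L2.nrm_scale[OF m, of \<gamma>] \<gamma> by simp
    finally have "nm (wlap w) \<le> \<tau> * nm m + \<kappa> * nm (wlap w) + \<gamma> * nm m"
      using Bw mult_left_mono[OF hess_MT[OF w(1)] \<kappa>(1)] by linarith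
    then have "(1 - \<kappa>) * nm (wlap w) \<le> (\<tau> + \<gamma>) * nm m" by (simp add: algebra_simps)
    then have "nm (wlap w) \<le> (\<tau> + \<gamma>) / (1 - \<kappa>) * nm m" using \<kappa> by (simp add: field_simps)
    from mult_left_mono[OF this, of c] have "c * nm (wlap w) \<le> C * nm m" using c(1) by (simp add: C_def mult.assoc)
    with c(3)[OF w(1)] have "H2_norm \<Omega> w \<le> C * nm m" by linarith
    with w(1) Bw show "\<exists>w\<in>V \<Omega>. H2_norm \<Omega> w \<le> C * nm m \<and>
      nm (\<lambda>x. wlap w x - \<kappa> * norm (weak_hessian \<Omega> w x) - \<gamma> * m x) \<le> \<tau> * nm m"
      by (auto simp: B_def[abs_def])
  qed
qed

text \<open>Passing from \<open>u\<close> to \<open>u + w\<close> lowers the Hamiltonian by at least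
  \<open>m - E\<close> with a small error \<open>E\<close>. Multiplied by \<open>m \<ge> 0\<close>
  and inserted into the inequality, this bounds half of the squared norm of \<open>m\<close> by
  \<open>- G w\<close>, and \<open>w\<close> is bounded by \<open>m\<close>. The constant is uniform
  in the datum, the solution and the operator \<open>\<Phi>\<close> of the equation.\<close>

lemma density_bound:
  assumes ne: "\<Omega> \<noteq> {}"
  obtains C where "0 < C" "\<And>G K \<Phi> u m. G \<in> V_dual \<Omega> \<Longrightarrow> (\<And>v. v \<in> V \<Omega> \<Longrightarrow> \<bar>G v\<bar> \<le> K * H2_norm \<Omega> v) \<Longrightarrow> 0 \<le> K \<Longrightarrow>
    VI_solution \<Omega> A a f \<Phi> G u m \<Longrightarrow> nm m \<le> C * K"
proof -
  \<comment> \<open>Lower bound of all Cordes scales. The tolerance \<open>\<mu> / 2\<close> makes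
    the error \<open>E\<close>, the residual divided by \<open>\<mu>\<close>, cost at most half of
    \<open>nm m\<close>.\<close>
  define \<mu> where "\<mu> = \<epsilon> / (real CARD('n) * \<nu>u)"
  obtain x0 \<alpha>0 where x0: "x0 \<in> \<Omega>" "\<alpha>0 \<in> A" using ne A(2) by blast
  \<comment> \<open>Positivity of the upper ellipticity constant is read off from a single
    coefficient matrix; a point of \<Omega> is needed for that.\<close>
  have \<nu>u: "0 < \<nu>u"
  proof -
    have "\<nu>l * (norm (axis (undefined::'n) (1::real)))\<^sup>2 \<le> \<nu>u * (norm (axis (undefined::'n) (1::real)))\<^sup>2"
      using cordes[OF mem_closure[OF x0(1)] x0(2)] unfolding cordes_class_def by (blast intro: order_trans)
    then show ?thesis using ellipticity by simp
  qed
  have \<mu>: "0 < \<mu>" using \<nu>u ellipticity by (simp add: \<mu>_def)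
  have "0 < \<mu> / 2" using \<mu> by simp
  then obtain C where C: "0 < C" and super: "\<And>m. m \<in> L2 \<Omega> \<Longrightarrow> \<exists>w\<in>V \<Omega>. H2_norm \<Omega> w \<le> C * nm m \<and>
      nm (\<lambda>x. wlap w x - \<kappa> * norm (weak_hessian \<Omega> w x) - \<gamma> * m x) \<le> \<mu> / 2 * nm m"
    by (rule approximate_supersolution) blast
  show ?thesis
  proof (rule that[of "2 * C"])
    show "0 < 2 * C" using C by simp
    fix G K \<Phi> u m
    assume G: "G \<in> V_dual \<Omega>" and GK: "\<And>v. v \<in> V \<Omega> \<Longrightarrow> \<bar>G v\<bar> \<le> K * H2_norm \<Omega> v" and K: "0 \<le> K"
      and sol: "VI_solution \<Omega> A a f \<Phi> G u m"
    have u: "u \<in> V \<Omega>" and m: "m \<in> L2 \<Omega>" and m0: "AE x in lebesgue_on \<Omega>. 0 \<le> m x"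
      using sol by (auto simp: VI_solution_def L2_plus_def)
    obtain w where w: "w \<in> V \<Omega>" "H2_norm \<Omega> w \<le> C * nm m"
      "nm (\<lambda>x. wlap w x - \<kappa> * norm (weak_hessian \<Omega> w x) - \<gamma> * m x) \<le> \<mu> / 2 * nm m"
      using super[OF m] by blast
    define B where "B x = wlap w x - \<kappa> * norm (weak_hessian \<Omega> w x) - \<gamma> * m x" for x
    have B: "B \<in> L2 \<Omega>" unfolding B_def[abs_def] by (intro L2.diff_mem L2_scale wlap_L2 norm_weak_hessian w m)
    define E where "E x = (1 / \<mu>) * \<bar>B x\<bar>" for x
    have E: "E \<in> L2 \<Omega>" unfolding E_def[abs_def] by (intro L2_scale L2_abs B)
    have "nm E = (1 / \<mu>) * nm B"
      unfolding E_def[abs_def] using L2.nrm_scale[OF L2_abs[OF B], of "1 / \<mu>"] \<mu> by (simp add: L2_norm_abs)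
    also have "\<dots> \<le> (1 / \<mu>) * (\<mu> / 2 * nm m)" using w(3) \<mu> unfolding B_def[abs_def] by (intro mult_left_mono) auto
    finally have nE: "nm E \<le> nm m / 2" using \<mu> by simp
    define v where "v = (\<lambda>x. u x + w x)"
    have v: "v \<in> V \<Omega>" unfolding v_def by (intro V_add u w)
    have diff_L2: "(\<lambda>x. F v x - F u x) \<in> L2 \<Omega>" by (intro L2.diff_mem F_L2 u v)
    have mE: "(\<lambda>x. E x - m x) \<in> L2 \<Omega>" by (intro L2.diff_mem E m)
    have "AE x in lebesgue_on \<Omega>. x \<in> \<Omega>" by (rule AE_I2) simp
    with m0 weak_hessian_add[OF u w(1)]
    have "AE x in lebesgue_on \<Omega>. m x * (F v x - F u x) \<le> m x * (E x - m x)"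
    proof eventually_elim
      case (elim x)
      have "m x - E x \<le> a x \<alpha> \<bullet> weak_hessian \<Omega> w x" if \<alpha>: "\<alpha> \<in> A" for \<alpha>
      proof -
        note c = cordes_class_bounds[OF cordes[OF mem_closure[OF elim(3)] \<alpha>] ellipticity]
        define s where "s = cordes_scale (a x \<alpha>)"
        have s: "0 < s" "s \<le> \<gamma>" "\<mu> \<le> s" using c(1,2,3) by (auto simp: s_def \<gamma>_def \<mu>_def)
        \<comment> \<open>The rescaled operator exceeds the Laplacian minus \<open>\<kappa>\<close>
          times the Hessian norm, which is \<open>B x + \<gamma> * m x\<close>. The scale
          \<open>s\<close> can be divided out with one constant for all controls, since
          \<open>\<mu> \<le> s \<le> \<gamma>\<close> and \<open>0 \<le> m x\<close>.\<close>
        have "B x + \<gamma> * m x \<le> s * (a x \<alpha> \<bullet> weak_hessian \<Omega> w x)"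
          using c(5)[of "weak_hessian \<Omega> w x"] by (simp add: B_def s_def \<kappa>_def trace_weak_hessian abs_le_iff)
        moreover have "s * m x \<le> \<gamma> * m x" using s elim(1) by (intro mult_right_mono)
        moreover have "- (s * E x) \<le> B x"
        proof -
          have "\<bar>B x\<bar> \<le> s / \<mu> * \<bar>B x\<bar>" using s \<mu> mult_right_mono[of 1 "s / \<mu>" "\<bar>B x\<bar>"] by simp
          then show ?thesis by (simp add: E_def)
        qed
        ultimately have "s * (m x - E x) \<le> s * (a x \<alpha> \<bullet> weak_hessian \<Omega> w x)" by (simp add: right_diff_distrib)
        then show ?thesis using s(1) by simp
      qed
      then have "F v x \<le> F u x - (m x - E x)"
        unfolding HJB_def v_def elim(2) by (rule ham_add_le[OF elim(3)])
      then show ?case using elim(1) by (intro mult_left_mono) auto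
    qed
    then have "ip m (\<lambda>x. F v x - F u x) \<le> ip m (\<lambda>x. E x - m x)"
      unfolding L2_inner_def by (intro integral_mono_AE L2_mult_integrable m diff_L2 mE)
    also have "\<dots> = ip m E - (nm m)\<^sup>2" using m E by (simp add: L2.ip_diff_right L2.nrm_square)
    also have "ip m E \<le> nm m * (nm m / 2)"
    proof -
      have "ip m E \<le> nm m * nm E" using L2.Cauchy_Schwarz[OF m E] by linarith
      also have "\<dots> \<le> nm m * (nm m / 2)" by (intro mult_left_mono nE L2.nrm_nonneg m)
      finally show ?thesis .
    qed
    finally have "ip m (\<lambda>x. F v x - F u x) \<le> - (nm m)\<^sup>2 / 2" by (simp add: power2_eq_square)
    moreover have "G w \<le> ip m (\<lambda>x. F v x - F u x)"
    proof -
      have "G (\<lambda>x. v x - u x) \<le> ip m (\<lambda>x. F v x - F u x)" using sol v by (simp add: VI_solution_def)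
      then show ?thesis by (simp add: v_def)
    qed
    moreover have "- G w \<le> K * (C * nm m)" using GK[OF w(1)] mult_left_mono[OF w(2) K] by linarith
    ultimately have "(nm m)\<^sup>2 / 2 \<le> K * (C * nm m)" by linarith
    then have *: "nm m * nm m \<le> (2 * C * K) * nm m" by (simp add: power2_eq_square mult_ac)
    show "nm m \<le> 2 * C * K"
    proof (cases "nm m = 0")
      case False
      then have "0 < nm m" using L2.nrm_nonneg[OF m] by simp
      with * show ?thesis by (simp only: mult_le_cancel_right_pos)
    qed (use C K in simp)
  qed
qed

end

text \<open>Testing against the negative part of the limit gives minus the square of its norm, while
  every term of the sequence gives something nonnegative.\<close>

lemma L2_weak_limit_nonneg:
  fixes l :: "real^'n \<Rightarrow> real"
  assumes X: "\<And>n::nat. X n \<in> L2 S" and l: "l \<in> L2 S"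
    and weak: "\<And>y. y \<in> L2 S \<Longrightarrow> (\<lambda>n. L2_inner S (X n) y) \<longlonglongrightarrow> L2_inner S l y"
    and nonneg: "\<And>n. AE x in lebesgue_on S. 0 \<le> X n x"
  shows "AE x in lebesgue_on S. 0 \<le> l x"
proof -
  define y where "y x = (1/2) * (\<bar>l x\<bar> - l x)" for x
  have y: "y \<in> L2 S" unfolding y_def[abs_def] by (intro L2_scale L2.diff_mem L2_abs l)
  have y0: "0 \<le> y x" for x by (simp add: y_def)
  have "0 \<le> L2_inner S l y"
  proof (rule LIMSEQ_le_const[OF weak[OF y]])
    have "0 \<le> L2_inner S (X n) y" for n
      unfolding L2_inner_def
    proof (rule integral_nonneg_AE)
      show "AE x in lebesgue_on S. 0 \<le> X n x * y x" using nonneg[of n] by eventually_elim (simp add: y0)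
    qed
    then show "\<exists>N. \<forall>n\<ge>N. 0 \<le> L2_inner S (X n) y" by blast
  qed
  moreover have "l x * y x = - (y x * y x)" for x by (auto simp: y_def abs_if algebra_simps)
  then have "L2_inner S l y = - (L2_norm S y)\<^sup>2" using y by (simp add: L2_inner_def L2.nrm_square)
  ultimately have "L2_norm S y = 0" by simp
  then have "AE x in lebesgue_on S. y x = 0" using L2_norm_eq_0_iff[OF y] by simp
  then show ?thesis by eventually_elim (auto simp: y_def abs_if split: if_splits)
qed

section \<open>Passage to the limit in the variational inequality\<close>

theorem proposition7p3:
  fixes \<Omega> :: "(real^'n) set"
    and A :: "'a::metric_space set"
    and a :: "real^'n \<Rightarrow> 'a \<Rightarrow> real^'n^'n"
    and f :: "real^'n \<Rightarrow> 'a \<Rightarrow> real"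
    and \<nu>l \<nu>u \<epsilon> :: real
    and F :: "(real^'n \<Rightarrow> real) \<Rightarrow> (real^'n \<Rightarrow> real)"
    and G :: "(real^'n \<Rightarrow> real) \<Rightarrow> real"
    and Gs :: "nat \<Rightarrow> (real^'n \<Rightarrow> real) \<Rightarrow> real"
    and us ms :: "nat \<Rightarrow> real^'n \<Rightarrow> real"
  assumes "open \<Omega>" and "bounded \<Omega>" and "convex \<Omega>" and "\<Omega> \<noteq> {}"
    and "compact A" and "A \<noteq> {}"
    and "continuous_on (closure \<Omega> \<times> A) (\<lambda>(x, \<alpha>). a x \<alpha>)"
    and "0 < \<nu>l" and "\<nu>l \<le> \<nu>u" and "0 < \<epsilon>" and "\<epsilon> \<le> 1"
    and "\<And>x \<alpha>. x \<in> closure \<Omega> \<Longrightarrow> \<alpha> \<in> A \<Longrightarrow> a x \<alpha> \<in> cordes_class \<nu>l \<nu>u \<epsilon>"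
    and "continuous_on (closure \<Omega> \<times> A) (\<lambda>(x, \<alpha>). f x \<alpha>)"
    and "L2_operator \<Omega> F" and "completely_continuous \<Omega> F"
    and "G \<in> V_dual \<Omega>" and "nonneg_distr \<Omega> G"
    and "\<And>n. Gs n \<in> V_dual \<Omega>"
    and "weak_star_conv (V \<Omega>) Gs G"
    and "\<And>n. VI_solution \<Omega> A a f F (Gs n) (us n) (ms n)"
  shows "\<exists>u m. VI_solution \<Omega> A a f F G u m \<and>
           (\<exists>r :: nat \<Rightarrow> nat. strict_mono r \<and>
              strong_conv (H2_norm \<Omega>) (\<lambda>j. us (r j)) u \<and>
              weak_conv (L2 \<Omega>) (L2_norm \<Omega>) (\<lambda>j. ms (r j)) m)"
proof -
  interpret hjb_domain \<Omega> A a f \<nu>l \<nu>u \<epsilon>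
    by unfold_locales (fact assms)+
  let ?H = "\<lambda>v. HJB \<Omega> A a f v"
  have us: "us n \<in> V \<Omega>" and ms: "ms n \<in> L2 \<Omega>" and ms0: "AE x in lebesgue_on \<Omega>. 0 \<le> ms n x"
    and Hus: "AE x in lebesgue_on \<Omega>. ?H (us n) x = F (ms n) x"
    and VI: "\<And>v. v \<in> V \<Omega> \<Longrightarrow> Gs n (\<lambda>x. v x - us n x) \<le> ip (ms n) (\<lambda>x. ?H v x - ?H (us n) x)" for n
    using assms(20)[of n] by (auto simp: VI_solution_def L2_plus_def)
  have F_L2: "F m \<in> L2 \<Omega>" if "m \<in> L2 \<Omega>" for m
    using assms(14) that by (auto simp: L2_operator_def)
  have Gs_lim: "(\<lambda>n. Gs n v) \<longlonglongrightarrow> G v" if "v \<in> V \<Omega>" for v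
    using assms(19) that by (simp add: weak_star_conv_def)
  have Gs_dual: "Gs n \<in> dual_space (V \<Omega>) (H2_norm \<Omega>)" for n using assms(18) by (simp add: V_dual_def)
  \<comment> \<open>Weak-star convergence bounds \<open>Gs n v\<close> for each fixed
    \<open>v\<close>. A bound uniform in \<open>v\<close> is needed for the densities, and again
    because the inequality is tested with functions that move with \<open>us n\<close>.\<close>
  obtain K where K: "0 < K" "\<And>n v. v \<in> V \<Omega> \<Longrightarrow> \<bar>Gs n v\<bar> \<le> K * H2_norm \<Omega> v"
  proof (rule V.uniform_boundedness[of Gs])
    show "bdd_above (range (\<lambda>n. \<bar>Gs n v\<bar>))" if v: "v \<in> V \<Omega>" for v
    proof -
      obtain B where "\<And>n. norm (Gs n v) \<le> B"
        using convergent_imp_Bseq[OF convergentI[OF Gs_lim[OF v]]] by (auto simp: Bseq_def)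
      then show ?thesis by (intro bdd_aboveI2[of _ _ B]) simp
    qed
  qed (use Gs_dual in blast)+
  obtain C where C: "0 < C" "\<And>G K \<Phi> u m. G \<in> V_dual \<Omega> \<Longrightarrow> (\<And>v. v \<in> V \<Omega> \<Longrightarrow> \<bar>G v\<bar> \<le> K * H2_norm \<Omega> v) \<Longrightarrow> 0 \<le> K \<Longrightarrow>
    VI_solution \<Omega> A a f \<Phi> G u m \<Longrightarrow> nm m \<le> C * K"
    using density_bound[OF assms(4)] by blast
  have ms_bound: "nm (ms n) \<le> C * K" for n
    by (rule C(2)[OF assms(18) K(2) _ assms(20)]) (use K in auto)
  obtain r m where r: "strict_mono r" and m: "m \<in> L2 \<Omega>"
    and weak: "\<And>y. y \<in> L2 \<Omega> \<Longrightarrow> (\<lambda>n. ip (ms (r n)) y) \<longlonglongrightarrow> ip m y"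
    using L2.weak_compactness[of ms \<Omega> "C * K", OF ms ms_bound] by blast
  have wconv: "weak_conv (L2 \<Omega>) (L2_norm \<Omega>) (\<lambda>j. ms (r j)) m" by (rule L2_weak_convI[OF ms m weak])
  have m0: "AE x in lebesgue_on \<Omega>. 0 \<le> m x" by (rule L2_weak_limit_nonneg[OF ms m weak ms0])
  \<comment> \<open>Complete continuity makes the right-hand sides of the equations converge
    strongly.\<close>
  have F_conv: "strong_conv nm (\<lambda>j. F (ms (r j))) (F m)"
    using assms(15)[unfolded completely_continuous_def, rule_format, of "\<lambda>j. ms (r j)" m] wconv ms m by simp
  obtain c where c: "0 < c" "\<And>u. u \<in> V \<Omega> \<Longrightarrow> H2_norm \<Omega> u \<le> c * nm (wlap u)" by (rule V_norm_bounds) blast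
  define L where "L = c * (\<gamma> / (1 - \<kappa>))"
  have L: "0 < L" using c \<gamma> \<kappa> by (simp add: L_def)
  \<comment> \<open>Coercivity in the norm of \<open>V\<close>. Since the Hamiltonians equal the
    right-hand sides, convergence of the latter makes the solutions a Cauchy sequence.\<close>
  have stab: "H2_norm \<Omega> (\<lambda>x. u x - v x) \<le> L * nm (\<lambda>x. ?H u x - ?H v x)" if "u \<in> V \<Omega>" "v \<in> V \<Omega>" for u v
  proof -
    have "nm (wlap (\<lambda>x. u x - v x)) \<le> \<gamma> / (1 - \<kappa>) * nm (\<lambda>x. ?H u x - ?H v x)"
      using F_coercive[OF that] \<kappa> by (simp add: field_simps)
    from mult_left_mono[OF this, of c] have "c * nm (wlap (\<lambda>x. u x - v x)) \<le> L * nm (\<lambda>x. ?H u x - ?H v x)" using c(1) by (simp add: L_def mult.assoc)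
    then show ?thesis using c(2)[OF V_diff(1)[OF that]] by linarith
  qed
  have HF: "nm (\<lambda>x. ?H (us i) x - ?H (us j) x) = nm (\<lambda>x. F (ms i) x - F (ms j) x)" for i j
  proof (rule L2_norm_cong_AE)
    show "AE x in lebesgue_on \<Omega>. ?H (us i) x - ?H (us j) x = F (ms i) x - F (ms j) x"
      using Hus[of i] Hus[of j] by eventually_elim simp
  qed (intro L2.diff_mem hjb_domain.F_L2[OF hjb_domain_axioms] us F_L2 ms)+
  have "\<exists>u\<in>V \<Omega>. strong_conv (H2_norm \<Omega>) (\<lambda>j. us (r j)) u"
  proof (rule V_complete)
    fix e :: real assume e: "0 < e"
    have "eventually (\<lambda>j. nm (\<lambda>x. F (ms (r j)) x - F m x) < e / (2 * L)) sequentially"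
      using F_conv e L unfolding strong_conv_def by (intro order_tendstoD) auto
    then obtain N where N: "\<And>j. j \<ge> N \<Longrightarrow> nm (\<lambda>x. F (ms (r j)) x - F m x) < e / (2 * L)"
      by (auto simp: eventually_sequentially)
    show "\<exists>N. \<forall>i\<ge>N. \<forall>j\<ge>N. H2_norm \<Omega> (\<lambda>x. us (r i) x - us (r j) x) < e"
    proof (intro exI[of _ N] allI impI)
      fix i j assume ij: "N \<le> i" "N \<le> j"
      have "nm (\<lambda>x. F (ms (r i)) x - F (ms (r j)) x) \<le> nm (\<lambda>x. F (ms (r i)) x - F m x) + nm (\<lambda>x. F m x - F (ms (r j)) x)"
        by (intro L2.nrm_triangle_diff F_L2 ms m)
      moreover have "nm (\<lambda>x. F m x - F (ms (r j)) x) = nm (\<lambda>x. F (ms (r j)) x - F m x)"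
        by (intro L2.nrm_minus_commute F_L2 ms m)
      moreover have "e / (2 * L) + e / (2 * L) = e / L" using L by (simp add: field_simps)
      ultimately have "nm (\<lambda>x. F (ms (r i)) x - F (ms (r j)) x) < e / L" using N[OF ij(1)] N[OF ij(2)] by linarith
      then have "L * nm (\<lambda>x. F (ms (r i)) x - F (ms (r j)) x) < e" using L by (simp add: field_simps)
      then show "H2_norm \<Omega> (\<lambda>x. us (r i) x - us (r j) x) < e"
        using stab[OF us us, of "r i" "r j"] HF[of "r i" "r j"] by simp
    qed
  qed (rule us)
  then obtain u where u: "u \<in> V \<Omega>" "strong_conv (H2_norm \<Omega>) (\<lambda>j. us (r j)) u" by blast
  note HL = hjb_domain.F_L2[OF hjb_domain_axioms]
  have wlap_le: "nm (wlap v) \<le> real CARD('n) * H2_norm \<Omega> v" if v: "v \<in> V \<Omega>" for v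
  proof -
    have "nm (wlap v) \<le> (\<Sum>i\<in>UNIV. nm (D i (D i v)))"
      unfolding wlap_def[abs_def] by (intro L2_norm_sum V_D v) simp
    also have "\<dots> \<le> (\<Sum>i\<in>(UNIV::'n set). H2_norm \<Omega> v)"
      by (intro sum_mono order_trans[OF abs_ge_self H2_norm_ge(3)])
    finally show ?thesis by simp
  qed
  \<comment> \<open>Lipschitz continuity of the operator on \<open>V\<close> identifies the limit of
    the Hamiltonians; uniqueness of strong limits then gives the equation for \<open>u\<close> and
    \<open>m\<close>.\<close>
  have H_conv: "strong_conv nm (\<lambda>j. ?H (us (r j))) (?H u)"
  proof (rule L2_strong_convI_le)
    show "nm (\<lambda>x. ?H (us (r j)) x - ?H u x) \<le> \<bar>Ka\<bar> * (real CARD('n) * H2_norm \<Omega> (\<lambda>x. us (r j) x - u x))" for j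
      using F_lipschitz[OF us u(1), of "r j"] mult_left_mono[OF wlap_le[OF V_diff(1)[OF us u(1)]], of "\<bar>Ka\<bar>" "r j"] by simp
    show "(\<lambda>j. \<bar>Ka\<bar> * (real CARD('n) * H2_norm \<Omega> (\<lambda>x. us (r j) x - u x))) \<longlonglongrightarrow> 0"
      using u(2) unfolding strong_conv_def by (intro tendsto_mult_right_zero)
  qed (intro HL us u)+
  have Hu: "AE x in lebesgue_on \<Omega>. ?H u x = F m x"
  proof (rule L2_strong_limit_unique[OF _ HL[OF u(1)] F_L2[OF m] H_conv])
    have "nm (\<lambda>x. ?H (us (r j)) x - F m x) = nm (\<lambda>x. F (ms (r j)) x - F m x)" for j
    proof (rule L2_norm_cong_AE)
      show "AE x in lebesgue_on \<Omega>. ?H (us (r j)) x - F m x = F (ms (r j)) x - F m x"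
        using Hus[of "r j"] by eventually_elim simp
    qed (intro L2.diff_mem HL us F_L2 ms m)+
    then show "strong_conv nm (\<lambda>j. ?H (us (r j))) (F m)" using F_conv by (simp add: strong_conv_def)
  qed (intro HL us)
  have "G (\<lambda>x. v x - u x) \<le> ip m (\<lambda>x. ?H v x - ?H u x)" if v: "v \<in> V \<Omega>" for v
  proof (rule LIMSEQ_le)
    have vu: "(\<lambda>x. v x - u x) \<in> V \<Omega>" and uu: "\<And>j. (\<lambda>x. u x - us (r j) x) \<in> V \<Omega>" by (intro V_diff v u us)+
    \<comment> \<open>The fixed function \<open>v - u\<close> is handled by weak-star convergence,
      the moving difference \<open>u - us (r j)\<close> by the uniform bound
      \<open>K\<close>.\<close>
    have split: "Gs n (\<lambda>x. v x - us (r j) x) = Gs n (\<lambda>x. v x - u x) + Gs n (\<lambda>x. u x - us (r j) x)" for n j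
    proof -
      have "\<forall>p\<in>V \<Omega>. \<forall>q\<in>V \<Omega>. Gs n (\<lambda>x. p x + q x) = Gs n p + Gs n q"
        using Gs_dual[of n] by (simp add: dual_space_def)
      from this[rule_format, OF vu uu[of j]] show ?thesis by simp
    qed
    have "(\<lambda>j. Gs (r j) (\<lambda>x. u x - us (r j) x)) \<longlonglongrightarrow> 0"
    proof (rule Lim_null_comparison)
      show "\<forall>\<^sub>F j in sequentially. norm (Gs (r j) (\<lambda>x. u x - us (r j) x)) \<le> K * H2_norm \<Omega> (\<lambda>x. us (r j) x - u x)"
        using K(2)[OF uu] V.nrm_minus_commute[OF u(1) us] by (intro always_eventually allI) simp
      show "(\<lambda>j. K * H2_norm \<Omega> (\<lambda>x. us (r j) x - u x)) \<longlonglongrightarrow> 0"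
        using u(2) unfolding strong_conv_def by (rule tendsto_mult_right_zero)
    qed
    moreover have "(\<lambda>j. Gs (r j) (\<lambda>x. v x - u x)) \<longlonglongrightarrow> G (\<lambda>x. v x - u x)"
      using LIMSEQ_subseq_LIMSEQ[OF Gs_lim[OF vu] r] by (simp add: o_def)
    ultimately show "(\<lambda>j. Gs (r j) (\<lambda>x. v x - us (r j) x)) \<longlonglongrightarrow> G (\<lambda>x. v x - u x)"
      unfolding split using tendsto_add by fastforce
    \<comment> \<open>The densities converge only weakly, but the Hamiltonians converge strongly, so
      the pairing passes to the limit.\<close>
    show "(\<lambda>j. ip (ms (r j)) (\<lambda>x. ?H v x - ?H (us (r j)) x)) \<longlonglongrightarrow> ip m (\<lambda>x. ?H v x - ?H u x)"
    proof (rule L2.weak_strong_ip[OF ms m _ _ weak _ ms_bound])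
      have "nm (\<lambda>x. (?H v x - ?H (us (r j)) x) - (?H v x - ?H u x)) = nm (\<lambda>x. ?H (us (r j)) x - ?H u x)" for j
        using L2.nrm_minus_commute[OF HL[OF u(1)] HL[OF us], of "r j"] by (simp add: algebra_simps)
      then show "strong_conv nm (\<lambda>j x. ?H v x - ?H (us (r j)) x) (\<lambda>x. ?H v x - ?H u x)"
        using H_conv by (simp add: strong_conv_def)
    qed (intro L2.diff_mem HL v us u)+
    show "\<exists>N. \<forall>j\<ge>N. Gs (r j) (\<lambda>x. v x - us (r j) x) \<le> ip (ms (r j)) (\<lambda>x. ?H v x - ?H (us (r j)) x)"
      using VI[OF v] by blast
  qed
  then have "VI_solution \<Omega> A a f F G u m"
    using u(1) m m0 Hu by (simp add: VI_solution_def L2_plus_def)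
  then show ?thesis using r u(2) wconv by blast
qed

end
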